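(* Let $m \geq 1$ be an integer and, for each $n$, let $Y_i = f_o(t_i) + \epsilon_i$, $i=1,\ldots,n$, where the $t_i = t_{n,i} \in [0,1]$ are non-random design points and $\epsilon_1, \epsilon_2, \ldots$ are independent and identically distributed random variables. Let $\rho:\mathbb{R}\to[0,\infty)$ with $\rho(0)=0$, and assume: (A1) $\rho$ is absolutely continuous and convex, and $\psi$ is any choice of its subgradient. (A2) There exist finite constants $\kappa>0$ and $M_1$ such that $|\psi(x+y)-\psi(x)| \leq M_1$ for all $x\in\mathbb{R}$ and all $|y|<\kappa$. (A3) There exists a finite constant $M_2$ such that $\sup_{|t|\leq h} \mathbb{E}\{|\psi(\epsilon_1+t)-\psi(\epsilon_1)|^2\} \leq M_2 |h|$ as $h\to 0$ (i.e. for all sufficiently small $h>0$). (A4) $\mathbb{E}\{|\psi(\epsilon_1)|^2\} \leq \tau^2 < \infty$, $\mathbb{E}\{\psi(\epsilon_1)\}=0$, and there exists a constant $\xi>0$ such that $\mathbb{E}\{\psi(\epsilon_1+t)\} = \xi t + o(t)$ as $t\to 0$. (A5) There exists a constant $M_3$ such that for all $n\geq 2$ and all $f\in\mathcal{W}^{1,1}([0,1])$, $$\left|\frac1n\sum_{i=1}^n f(t_i) - \int_0^1 f(t)\,dt\right| \leq \frac{M_3}{n}\int_0^1 |f'(t)|\,dt.$$ Let $\lambda=\lambda_n>0$ be a deterministic sequence with $\lambda\to 0$ and $n\lambda^{\frac{3}{2m}-\frac{1}{4m^2}}\to\infty$ as $n\to\infty$. Assume further that $f_o\in\mathcal{W}^{2m,2}([0,1])$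 and $f_o^{(s)}(0) = f_o^{(s)}(1) = 0$ for all $m\leq s\leq 2m-1$. Then there exists a sequence of M-type smoothing splines $\widehat f_n$ satisfying $$\|\widehat f_n - f_o\|_{m,\lambda}^2 = O_P\left(\lambda^2 + (n\lambda^{1/(2m)})^{-1}\right).$$
   Context: For an integer $r\ge 1$, $\mathcal{W}^{r,2}([0,1])$ is the Sobolev space of functions $f:[0,1]\to\mathbb{R}$ such that $f, f^{(1)}, \ldots, f^{(r-1)}$ are absolutely continuous and $\int_0^1 |f^{(r)}(x)|^2\,dx < \infty$; $\mathcal{W}^{1,1}([0,1])$ is the space of absolutely continuous functions on $[0,1]$ (with integrable derivative). With $\langle\cdot,\cdot\rangle_2$ the $\mathcal{L}^2([0,1])$ inner product, set $\langle f,g\rangle_{m,\lambda} = \langle f,g\rangle_2 + \lambda\langle f^{(m)},g^{(m)}\rangle_2$ and $\|f\|_{m,\lambda} = \langle f,f\rangle_{m,\lambda}^{1/2}$. An M-type smoothing spline $\widehat f_n$ (for given $n$, $\lambda$, $\rho$) is any minimizer over $f\in\mathcal{W}^{m,2}([0,1])$ of $$\frac1n\sum_{i=1}^n \rho(Y_i - f(t_i)) + \lambda\int_0^1 |f^{(m)}(x)|^2\,dx.$$ *)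

theory Defs
  imports "HOL-Probability.Probability"
begin

definition abs_cont_on :: "real set \<Rightarrow> (real \<Rightarrow> real) \<Rightarrow> bool" where
  "abs_cont_on S f \<longleftrightarrow>
     (\<forall>e>0. \<exists>d>0. \<forall>D :: (real \<times> real) set.
        finite D \<and> (\<forall>(a, b)\<in>D. a < b \<and> {a..b} \<subseteq> S) \<and>
        disjoint_family_on (\<lambda>(a, b). {a<..<b}) D \<and> (\<Sum>(a, b)\<in>D. b - a) < d
        \<longrightarrow> (\<Sum>(a, b)\<in>D. \<bar>f b - f a\<bar>) < e)"

text \<open>
  A function on the unit interval is represented by a total function on the reals; the Sobolev
  spaces, inner products and spline notions depend only on its restriction to the unit interval.
  Iterated derivatives are taken within the unit interval, hence one-sided at the endpoints.
  At points where a derivative fails to exist its value is unspecified; for the top-order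
  derivative of a Sobolev function these points form a null set.
\<close>

definition nderiv :: "nat \<Rightarrow> (real \<Rightarrow> real) \<Rightarrow> real \<Rightarrow> real" where
  "nderiv k = ((\<lambda>g x. vector_derivative g (at x within {0..1})) ^^ k)"

text \<open>
  The space \<open>W^{r,2}([0,1])\<close> for \<open>r \<ge> 1\<close>. The differentiability clause says that the derivatives
  of order below \<open>r\<close> exist everywhere on the unit interval, so that the values of
  \<^const>\<open>nderiv\<close> in the first clause are genuine derivatives.
\<close>

definition sobolev2 :: "nat \<Rightarrow> (real \<Rightarrow> real) set" where
  "sobolev2 r = {f.
     (\<forall>k<r. abs_cont_on {0..1} (nderiv k f)) \<and>
     (\<forall>k. Suc k < r \<longrightarrow> nderiv k f differentiable_on {0..1}) \<and>
     set_integrable lebesgue {0..1} (\<lambda>x. \<bar>nderiv r f x\<bar>\<^sup>2)}"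

definition sobolev11 :: "(real \<Rightarrow> real) set" where
  "sobolev11 = {f. abs_cont_on {0..1} f \<and> set_integrable lebesgue {0..1} (nderiv 1 f)}"

definition inner2 :: "(real \<Rightarrow> real) \<Rightarrow> (real \<Rightarrow> real) \<Rightarrow> real" where
  "inner2 f g = (LINT x:{0..1}|lebesgue. f x * g x)"

definition sob_inner :: "nat \<Rightarrow> real \<Rightarrow> (real \<Rightarrow> real) \<Rightarrow> (real \<Rightarrow> real) \<Rightarrow> real" where
  "sob_inner m lam f g = inner2 f g + lam * inner2 (nderiv m f) (nderiv m g)"

definition sob_norm :: "nat \<Rightarrow> real \<Rightarrow> (real \<Rightarrow> real) \<Rightarrow> real" where
  "sob_norm m lam f = sqrt (sob_inner m lam f f)"

text \<open>Design points and responses are indexed from \<open>1\<close> to \<open>n\<close>.\<close>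

definition spline_objective ::
  "nat \<Rightarrow> nat \<Rightarrow> real \<Rightarrow> (real \<Rightarrow> real) \<Rightarrow> (nat \<Rightarrow> real) \<Rightarrow> (nat \<Rightarrow> real) \<Rightarrow> (real \<Rightarrow> real) \<Rightarrow> real" where
  "spline_objective m n lam \<rho> t y f =
     1 / real n * (\<Sum>i=1..n. \<rho> (y i - f (t i))) + lam * (LINT x:{0..1}|lebesgue. \<bar>nderiv m f x\<bar>\<^sup>2)"

definition m_smoothing_spline ::
  "nat \<Rightarrow> nat \<Rightarrow> real \<Rightarrow> (real \<Rightarrow> real) \<Rightarrow> (nat \<Rightarrow> real) \<Rightarrow> (nat \<Rightarrow> real) \<Rightarrow> (real \<Rightarrow> real) \<Rightarrow> bool" where
  "m_smoothing_spline m n lam \<rho> t y f \<longleftrightarrow>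
     is_arg_min (spline_objective m n lam \<rho> t y) (\<lambda>g. g \<in> sobolev2 m) f"

text \<open>
  \<open>X n = O_P(r n)\<close> for random variables \<open>X n\<close>. Measurability is part of the definition, because
  \<^const>\<open>measure\<close> assigns \<open>0\<close> to non-measurable sets.
\<close>

definition big_O_prob :: "'a measure \<Rightarrow> (nat \<Rightarrow> 'a \<Rightarrow> real) \<Rightarrow> (nat \<Rightarrow> real) \<Rightarrow> bool" where
  "big_O_prob M X r \<longleftrightarrow>
     (\<forall>n. X n \<in> borel_measurable M) \<and>
     (\<forall>\<delta>>0. \<exists>C>0. \<forall>\<^sub>F n in sequentially.
        measure M {\<omega> \<in> space M. \<bar>X n \<omega>\<bar> > C * \<bar>r n\<bar>} < \<delta>)"

end

theory Submission
  imports Defs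
begin

hide_const (open) Polynomial.content

text \<open>
  Put \<open>b = \<lambda>\<^bsup>1/(2m)\<^esup>\<close> and \<open>r\<^sup>2 = D\<^sup>2 (\<lambda>\<^sup>2 + 1/(n b))\<close>. By convexity of the objective, a spline at distance more
  than \<open>r\<close> from \<open>f\<^sub>o\<close> yields a point \<open>f\<^sub>o + h\<close> with \<open>\<parallel>h\<parallel>\<^sup>2 = r\<^sup>2\<close> whose objective is at most that of \<open>f\<^sub>o\<close>.
  The expected loss grows at least like \<open>\<xi>/8 \<Sum> h(t i)\<^sup>2\<close>, which the design condition compares with \<open>n \<parallel>h\<parallel>\<^sup>2\<close> in \<open>L\<^sup>2\<close>,
  and the boundary conditions turn the penalty cross term into \<open>\<lambda> \<langle>f\<^sub>o\<^bsup>(2m)\<^esup>, h\<rangle>\<close>, of order \<open>\<lambda> r\<close>.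
  So the centred loss must be large somewhere on the ball. As \<open>h(t i)\<close> is an inner product of \<open>(h, b h')\<close>
  with an element of squared norm of order \<open>1/b\<close>, symmetrisation and contraction of one observation at a time
  bound its expected supremum by a multiple of \<open>r (n/b)\<^bsup>1/2\<^esup>\<close>, and Markov's inequality applies.

  A spline exists because the penalised problem reduces to a finite-dimensional space; choosing among the
  minimisers one nearest to \<open>f\<^sub>o\<close> makes the error a measurable function of the data.
\<close>

section \<open>Absolutely continuous functions\<close>

text \<open>The lower bound on the expected loss and the Lipschitz bound hold only for arguments
  near 0, so the ball has to be small in the supremum norm. The square of that norm is of order
  \<open>r^2 / b\<close>, that is, D^2 (\<lambda>^2 / b + 1 / (n b^2)), and here the rate condition
  enters: since 3/(2m) - 1/(4m^2) >= 1/m, it forces n b^2 to infinity. On the sphere, n times the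
  objective gains order n r^2 against noise of order r (n/b)^(1/2) and bias of order n \<lambda> r.
  These balance when r^2 is of order \<lambda>^2 + 1/(n b), and a large \<open>D\<close> lets the
  gain win. Derivatives in the definitions are pointwise vector derivatives, unspecified where they
  fail to exist. Calculus with them needs Lebesgue's theorem: an absolutely continuous function is
  differentiable almost everywhere and is the integral of its derivative. The first part proves it,
  the differentiability by means of Vitali's covering theorem.\<close>

lemma abs_cont_onE:
  assumes "abs_cont_on S f" "e > 0"
  obtains d where "d > 0"
    "\<forall>D. finite D \<longrightarrow> (\<forall>u v. (u, v) \<in> D \<longrightarrow> u < v \<and> {u..v} \<subseteq> S) \<longrightarrow>
        disjoint_family_on (\<lambda>(u, v). {u<..<v}) D \<longrightarrow> (\<Sum>(u, v)\<in>D. v - u) < d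
        \<longrightarrow> (\<Sum>(u, v)\<in>D. \<bar>f v - f u\<bar>) < e"
proof -
  from assms obtain d where "d > 0" and d: "\<forall>D. finite D \<and> (\<forall>(a, b)\<in>D. a < b \<and> {a..b} \<subseteq> S) \<and>
        disjoint_family_on (\<lambda>(a, b). {a<..<b}) D \<and> (\<Sum>(a, b)\<in>D. b - a) < d
        \<longrightarrow> (\<Sum>(a, b)\<in>D. \<bar>f b - f a\<bar>) < e"
    unfolding abs_cont_on_def by (elim allE[of _ e] impE exE conjE) (assumption | rule that)+
  show thesis
    by (rule that[OF \<open>d > 0\<close>], intro allI impI, rule d[THEN spec, THEN mp]) blast
qed

lemma abs_cont_onI:
  assumes "\<And>e. e > 0 \<Longrightarrow> \<exists>d>0. \<forall>D. finite D \<longrightarrow> (\<forall>u v. (u, v) \<in> D \<longrightarrow> u < v \<and> {u..v} \<subseteq> S) \<longrightarrow>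
        disjoint_family_on (\<lambda>(u, v). {u<..<v}) D \<longrightarrow> (\<Sum>(u, v)\<in>D. v - u) < d
        \<longrightarrow> (\<Sum>(u, v)\<in>D. \<bar>f v - f u\<bar>) < e"
  shows "abs_cont_on S f"
  unfolding abs_cont_on_def
proof (intro allI impI)
  fix e :: real assume "e > 0"
  from assms[OF this] obtain d where d: "d > 0" and D: "\<forall>D. finite D \<longrightarrow> (\<forall>u v. (u, v) \<in> D \<longrightarrow> u < v \<and> {u..v} \<subseteq> S) \<longrightarrow>
        disjoint_family_on (\<lambda>(u, v). {u<..<v}) D \<longrightarrow> (\<Sum>(u, v)\<in>D. v - u) < d
        \<longrightarrow> (\<Sum>(u, v)\<in>D. \<bar>f v - f u\<bar>) < e" by (elim exE conjE) (rule that)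
  show "\<exists>d>0. \<forall>D. finite D \<and> (\<forall>(a, b)\<in>D. a < b \<and> {a..b} \<subseteq> S) \<and>
        disjoint_family_on (\<lambda>(a, b). {a<..<b}) D \<and> (\<Sum>(a, b)\<in>D. b - a) < d
        \<longrightarrow> (\<Sum>(a, b)\<in>D. \<bar>f b - f a\<bar>) < e"
    by (rule exI[of _ d], intro conjI d allI impI, elim conjE, rule D[rule_format]) auto
qed

lemma abs_cont_on_divisionD:
  assumes "abs_cont_on {a..b} f" "e > 0"
  obtains d where "d > 0"
    "\<And>p S. p division_of S \<Longrightarrow> S \<subseteq> {a..b} \<Longrightarrow> (\<Sum>K\<in>p. content K) < d \<Longrightarrow>
       (\<Sum>K\<in>p. \<bar>f (Sup K) - f (Inf K)\<bar>) < e"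
proof -
  obtain d where d: "d > 0" and D: "\<forall>D. finite D \<longrightarrow> (\<forall>u v. (u, v) \<in> D \<longrightarrow> u < v \<and> {u..v} \<subseteq> {a..b}) \<longrightarrow>
        disjoint_family_on (\<lambda>(u, v). {u<..<v}) D \<longrightarrow> (\<Sum>(u, v)\<in>D. v - u) < d
        \<longrightarrow> (\<Sum>(u, v)\<in>D. \<bar>f v - f u\<bar>) < e"
    by (rule abs_cont_onE[OF assms]) (rule that)
  show thesis
  proof (rule that[OF d])
    fix p S assume p: "p division_of S" and S: "S \<subseteq> {a..b}" and len: "(\<Sum>K\<in>p. content K) < d"
    define q where "q = {K\<in>p. Inf K < Sup K}"
    define D' where "D' = (\<lambda>K. (Inf K, Sup K)) ` q"
    have fin: "finite p" using p by auto
    have iv: "K = {Inf K..Sup K}" "Inf K \<le> Sup K" "K \<subseteq> {a..b}" if "K \<in> p" for K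
    proof -
      obtain u v where uv: "K = cbox u v" using p \<open>K \<in> p\<close> by blast
      moreover have "K \<noteq> {}" using p \<open>K \<in> p\<close> by blast
      ultimately show "K = {Inf K..Sup K}" "Inf K \<le> Sup K" by auto
      show "K \<subseteq> {a..b}" using p \<open>K \<in> p\<close> S by blast
    qed
    have inj: "inj_on (\<lambda>K. (Inf K, Sup K)) q"
    proof (rule inj_onI)
      fix K L assume "K \<in> q" "L \<in> q" and eq: "(Inf K, Sup K) = (Inf L, Sup L)"
      then have "K \<in> p" "L \<in> p" by (auto simp: q_def)
      then show "K = L" using iv(1)[of K] iv(1)[of L] eq by simp
    qed
    have finq: "finite q" using fin by (simp add: q_def)
    have qp: "K \<in> p" if "K \<in> q" for K using that by (simp add: q_def)
    have "(\<Sum>(u, v)\<in>D'. \<bar>f v - f u\<bar>) < e"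
    proof (rule D[rule_format])
      show "finite D'" using finq by (simp add: D'_def)
      show "u < v \<and> {u..v} \<subseteq> {a..b}" if "(u, v) \<in> D'" for u v
      proof -
        have "Inf K < Sup K \<and> {Inf K..Sup K} \<subseteq> {a..b}" if "K \<in> q" for K
          using iv[OF qp[OF that]] that by (auto simp: q_def)
        then show ?thesis using that by (auto simp: D'_def)
      qed
      show "disjoint_family_on (\<lambda>(u, v). {u<..<v}) D'"
      proof -
        have "{Inf K<..<Sup K} \<inter> {Inf L<..<Sup L} = {}" if "K \<in> q" "L \<in> q" "(Inf K, Sup K) \<noteq> (Inf L, Sup L)" for K L
        proof -
          have "K \<noteq> L" using that by auto
          then have "interior K \<inter> interior L = {}"
            using p qp that by (meson division_ofD(5))
          moreover have "interior K = {Inf K<..<Sup K}" 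
            using iv(1)[OF qp[OF that(1)]] by (metis interior_atLeastAtMost_real)
          moreover have "interior L = {Inf L<..<Sup L}" 
            using iv(1)[OF qp[OF that(2)]] by (metis interior_atLeastAtMost_real)
          ultimately show ?thesis by simp
        qed
        then show ?thesis by (auto simp: D'_def disjoint_family_on_def)
      qed
      have "(\<Sum>(u, v)\<in>D'. v - u) = (\<Sum>K\<in>q. Sup K - Inf K)"
        by (simp add: D'_def sum.reindex[OF inj])
      also have "\<dots> = (\<Sum>K\<in>q. content K)"
      proof (rule sum.cong[OF refl])
        fix K assume "K \<in> q"
        then show "Sup K - Inf K = content K"
          using iv[OF qp] by (metis content_real)
      qed
      also have "\<dots> \<le> (\<Sum>K\<in>p. content K)"
        using fin by (intro sum_mono2) (auto simp: q_def)
      finally show "(\<Sum>(u, v)\<in>D'. v - u) < d" using len by simp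
    qed
    moreover have "(\<Sum>(u, v)\<in>D'. \<bar>f v - f u\<bar>) = (\<Sum>K\<in>q. \<bar>f (Sup K) - f (Inf K)\<bar>)"
      by (simp add: D'_def sum.reindex[OF inj])
    moreover have "\<dots> = (\<Sum>K\<in>p. \<bar>f (Sup K) - f (Inf K)\<bar>)"
    proof (rule sum.mono_neutral_left[OF fin])
      show "\<forall>K\<in>p - q. \<bar>f (Sup K) - f (Inf K)\<bar> = 0"
      proof
        fix K assume "K \<in> p - q"
        then have "Sup K = Inf K" using iv(2)[of K] by (auto simp: q_def)
        then show "\<bar>f (Sup K) - f (Inf K)\<bar> = 0" by simp
      qed
    qed (auto simp: q_def)
    ultimately show "(\<Sum>K\<in>p. \<bar>f (Sup K) - f (Inf K)\<bar>) < e" by simp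
  qed
qed

lemma abs_cont_on_subset:
  assumes f: "abs_cont_on S f" and "T \<subseteq> S"
  shows "abs_cont_on T f"
proof (rule abs_cont_onI)
  fix e :: real assume "e > 0"
  obtain d where d: "d > 0" and D: "\<forall>D. finite D \<longrightarrow> (\<forall>u v. (u, v) \<in> D \<longrightarrow> u < v \<and> {u..v} \<subseteq> S) \<longrightarrow>
        disjoint_family_on (\<lambda>(u, v). {u<..<v}) D \<longrightarrow> (\<Sum>(u, v)\<in>D. v - u) < d
        \<longrightarrow> (\<Sum>(u, v)\<in>D. \<bar>f v - f u\<bar>) < e"
    by (rule abs_cont_onE[OF f \<open>e > 0\<close>]) (rule that)
  show "\<exists>d>0. \<forall>D. finite D \<longrightarrow> (\<forall>u v. (u, v) \<in> D \<longrightarrow> u < v \<and> {u..v} \<subseteq> T) \<longrightarrow>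
        disjoint_family_on (\<lambda>(u, v). {u<..<v}) D \<longrightarrow> (\<Sum>(u, v)\<in>D. v - u) < d
        \<longrightarrow> (\<Sum>(u, v)\<in>D. \<bar>f v - f u\<bar>) < e"
    by (rule exI[of _ d], intro conjI d allI impI, rule D[rule_format]) (use \<open>T \<subseteq> S\<close> in blast)+
qed

lemma abs_cont_on_cong:
  assumes eq: "\<And>x. x \<in> S \<Longrightarrow> f x = g x" and f: "abs_cont_on S f"
  shows "abs_cont_on S g"
proof (rule abs_cont_onI)
  fix e :: real assume "e > 0"
  obtain d where d: "d > 0" and D: "\<forall>D. finite D \<longrightarrow> (\<forall>u v. (u, v) \<in> D \<longrightarrow> u < v \<and> {u..v} \<subseteq> S) \<longrightarrow>
        disjoint_family_on (\<lambda>(u, v). {u<..<v}) D \<longrightarrow> (\<Sum>(u, v)\<in>D. v - u) < d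
        \<longrightarrow> (\<Sum>(u, v)\<in>D. \<bar>f v - f u\<bar>) < e"
    by (rule abs_cont_onE[OF f \<open>e > 0\<close>]) (rule that)
  show "\<exists>d>0. \<forall>D. finite D \<longrightarrow> (\<forall>u v. (u, v) \<in> D \<longrightarrow> u < v \<and> {u..v} \<subseteq> S) \<longrightarrow>
        disjoint_family_on (\<lambda>(u, v). {u<..<v}) D \<longrightarrow> (\<Sum>(u, v)\<in>D. v - u) < d
        \<longrightarrow> (\<Sum>(u, v)\<in>D. \<bar>g v - g u\<bar>) < e"
  proof (rule exI[of _ d], intro conjI d allI impI)
    fix D assume D': "finite D" "\<forall>u v. (u, v) \<in> D \<longrightarrow> u < v \<and> {u..v} \<subseteq> S"
      "disjoint_family_on (\<lambda>(u, v). {u<..<v}) D" "(\<Sum>(u, v)\<in>D. v - u) < d"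
    have "g u = f u \<and> g v = f v" if "(u, v) \<in> D" for u v
    proof -
      have "u \<in> {u..v}" "v \<in> {u..v}" "{u..v} \<subseteq> S" using D'(2) that by fastforce+
      then show ?thesis using eq by (metis subsetD)
    qed
    then have "(\<Sum>(u, v)\<in>D. \<bar>g v - g u\<bar>) = (\<Sum>(u, v)\<in>D. \<bar>f v - f u\<bar>)"
      by (intro sum.cong refl) auto
    with D[rule_format, OF D'(1) D'(2)[rule_format] D'(3,4)] show "(\<Sum>(u, v)\<in>D. \<bar>g v - g u\<bar>) < e" by simp
  qed
qed

lemma abs_cont_on_closeD:
  assumes "abs_cont_on {a..b} f" "e > 0"
  obtains d where "d > 0" "\<And>u v. u \<in> {a..b} \<Longrightarrow> v \<in> {a..b} \<Longrightarrow> \<bar>v - u\<bar> < d \<Longrightarrow> \<bar>f v - f u\<bar> < e"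
proof -
  obtain d where d: "d > 0" and D: "\<And>p S. p division_of S \<Longrightarrow> S \<subseteq> {a..b} \<Longrightarrow> (\<Sum>K\<in>p. content K) < d \<Longrightarrow>
       (\<Sum>K\<in>p. \<bar>f (Sup K) - f (Inf K)\<bar>) < e"
    using abs_cont_on_divisionD[OF assms] by blast
  have le: "\<bar>f v - f u\<bar> < e" if "u \<in> {a..b}" "v \<in> {a..b}" "u \<le> v" "v - u < d" for u v
  proof -
    have "{{u..v}} division_of {u..v}"
      using \<open>u \<le> v\<close> division_of_self[of u v] by simp
    then show ?thesis using D[of "{{u..v}}" "{u..v}"] that by auto
  qed
  show thesis
  proof (rule that[OF d])
    fix u v assume uv: "u \<in> {a..b}" "v \<in> {a..b}" "\<bar>v - u\<bar> < d"
    show "\<bar>f v - f u\<bar> < e"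
    proof (cases "u \<le> v")
      case True then show ?thesis using le uv by auto
    next
      case False then show ?thesis using le[of v u] uv by (auto simp: abs_minus_commute)
    qed
  qed
qed

lemma abs_cont_on_imp_continuous_on:
  assumes "abs_cont_on {a..b} f"
  shows "continuous_on {a..b} f"
  unfolding continuous_on_iff dist_real_def
proof (intro ballI allI impI)
  fix x e :: real assume x: "x \<in> {a..b}" and e: "e > 0"
  show "\<exists>d>0. \<forall>y\<in>{a..b}. \<bar>y - x\<bar> < d \<longrightarrow> \<bar>f y - f x\<bar> < e"
  proof (rule abs_cont_on_closeD[OF assms e])
    fix d assume "d > 0" "\<And>u v. u \<in> {a..b} \<Longrightarrow> v \<in> {a..b} \<Longrightarrow> \<bar>v - u\<bar> < d \<Longrightarrow> \<bar>f v - f u\<bar> < e"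
    with x show ?thesis by (intro exI[of _ d]) simp
  qed
qed


section \<open>The fundamental theorem of calculus for absolutely continuous functions\<close>

lemma sum_content_division:
  fixes S :: "real set"
  assumes p: "p division_of S"
  shows "S \<in> lmeasurable" "(\<Sum>K\<in>p. content K) = measure lebesgue S"
proof -
  have fin: "finite p" and S: "S = \<Union>p" using p by auto
  have box: "\<exists>u v. K = cbox u v" if "K \<in> p" for K using division_ofD(4)[OF p that] .
  have lm: "K \<in> lmeasurable" if "K \<in> p" for K using box[OF that] by auto
  then show "S \<in> lmeasurable" unfolding S using fin by (intro fmeasurable.finite_Union) auto
  have "negligible (K \<inter> L)" if "K \<in> p" "L \<in> p" "K \<noteq> L" for K L
  proof -
    obtain u v where Kuv: "K = cbox u v" using box[OF \<open>K \<in> p\<close>] by blast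
    obtain u' v' where Luv: "L = cbox u' v'" using box[OF \<open>L \<in> p\<close>] by blast
    note K = Kuv Luv
    have "interior K \<inter> interior L = {}" using division_ofD(5)[OF p that] .
    then have emp: "{max u u'<..<min v v'} = {}" using K by (auto simp: interior_atLeastAtMost_real)
    have "K \<inter> L = {max u u'..min v v'}" using K by auto
    then have "K \<inter> L \<subseteq> {max u u'}" using emp by auto
    then show ?thesis by (meson finite.emptyI finite.insertI finite_subset negligible_finite)
  qed
  then have "measure lebesgue S = (\<Sum>K\<in>p. measure lebesgue K)"
    unfolding S using fin lm by (intro measure_negligible_finite_Union) (auto simp: pairwise_def)
  also have "\<dots> = (\<Sum>K\<in>p. content K)"
  proof (intro sum.cong refl)
    fix K assume "K \<in> p"
    then obtain u v where "K = cbox u v" using box by blast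
    then show "measure lebesgue K = content K" by simp
  qed
  finally show "(\<Sum>K\<in>p. content K) = measure lebesgue S" by simp
qed

text \<open>Tags outside \<open>N\<close> are treated by differentiability, as in the usual
  fundamental theorem. Tags in \<open>N\<close> are forced by the gauge into an open set of measure
  below the modulus of absolute continuity, so the increments of \<open>F\<close> over their
  intervals have a small sum. The integrand is set to 0 on \<open>N\<close>, which removes these
  tags from the Riemann sum.\<close>

lemma abs_cont_FTC:
  fixes F :: "real \<Rightarrow> real"
  assumes F: "abs_cont_on {a..b} F" and N: "negligible N" and "a \<le> b"
    and deriv: "\<And>x. x \<in> {a..b} - N \<Longrightarrow> (F has_vector_derivative f x) (at x within {a..b})"
  shows "(f has_integral F b - F a) {a..b}"
proof -
  define g where "g x = (if x \<in> N then 0 else f x)" for x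
  have "(g has_integral F b - F a) (cbox a b)"
    unfolding has_integral
  proof (intro allI impI)
    fix e :: real assume "e > 0"
    \<comment> \<open>The good intervals contribute at most \<open>e' * (b - a)\<close>, which is
      then at most \<open>e / 2\<close>; the summand 1 keeps the denominator positive when
      \<open>a = b\<close>.\<close>
    define e' where "e' = e / (2 * (b - a + 1))"
    have "e' > 0" using \<open>e > 0\<close> \<open>a \<le> b\<close> by (simp add: e'_def)
    obtain \<delta> where \<delta>: "\<delta> > 0" and ac: "\<And>p S. p division_of S \<Longrightarrow> S \<subseteq> {a..b} \<Longrightarrow> (\<Sum>K\<in>p. content K) < \<delta> \<Longrightarrow>
       (\<Sum>K\<in>p. \<bar>F (Sup K) - F (Inf K)\<bar>) < e / 2"
      using abs_cont_on_divisionD[OF F, of "e/2"] \<open>e > 0\<close> by auto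
    obtain U where U: "open U" "N \<subseteq> U" "U \<in> lmeasurable" "measure lebesgue U < \<delta>"
    proof -
      have N': "N \<in> sets lebesgue" "emeasure lebesgue N = 0"
        using N by (auto simp: negligible_iff_null_sets null_sets_def)
      obtain T where T: "open T" "N \<subseteq> T" "T - N \<in> lmeasurable" "emeasure lebesgue (T - N) < ennreal \<delta>"
        using sets_lebesgue_outer_open[OF N'(1) \<delta>] by blast
      have "T \<in> sets lebesgue" using T(1) by simp
      then have "emeasure lebesgue T = emeasure lebesgue (T - N)"
        using N' by (intro emeasure_Diff_null_set[symmetric] null_setsI) auto
      then have "emeasure lebesgue T < ennreal \<delta>" using T by simp
      moreover from this have "T \<in> lmeasurable" using T(1) by (auto intro!: fmeasurableI simp: less_top[symmetric] order_less_trans)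
      ultimately show ?thesis using that[OF T(1,2)] \<delta> by (simp add: emeasure_eq_measure2 ennreal_less_iff)
    qed
    have "\<forall>x\<in>{a..b} - N. \<exists>d. d > 0 \<and> (\<forall>y\<in>{a..b}. norm (y - x) < d \<longrightarrow> norm (F y - F x - (y - x) *\<^sub>R f x) \<le> e' * norm (y - x))"
      using deriv \<open>e' > 0\<close> unfolding has_vector_derivative_def has_derivative_within_alt by blast
    from bchoice[OF this] obtain d where d': "\<forall>x\<in>{a..b} - N. d x > 0 \<and>
        (\<forall>y\<in>{a..b}. norm (y - x) < d x \<longrightarrow> norm (F y - F x - (y - x) *\<^sub>R f x) \<le> e' * norm (y - x))" ..
    have d: "d x > 0" if "x \<in> {a..b} - N" for x using d' that by blast
    have d2: "\<bar>F y - F x - (y - x) * f x\<bar> \<le> e' * \<bar>y - x\<bar>"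
      if "x \<in> {a..b} - N" "y \<in> {a..b}" "\<bar>y - x\<bar> < d x" for x y
      using d'[THEN bspec, OF that(1)] that(2,3) by simp
    define \<gamma> where "\<gamma> x = (if x \<in> N then U else if x \<in> {a..b} then ball x (d x) else ball x 1)" for x
    have "gauge \<gamma>" unfolding gauge_def \<gamma>_def using U d by auto
    moreover have "norm ((\<Sum>(x, K)\<in>p. content K *\<^sub>R g x) - (F b - F a)) < e"
      if p: "p tagged_division_of cbox a b" and fine: "\<gamma> fine p" for p
    proof -
      have finp: "finite p" using p by auto
      define q where "q = {xK \<in> p. fst xK \<in> N}"
      have qp: "q \<subseteq> p" by (auto simp: q_def)
      have tele: "(\<Sum>(x, K)\<in>p. F (Sup K) - F (Inf K)) = F b - F a"
        using additive_tagged_division_1[OF \<open>a \<le> b\<close>, of p F] p by simp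
      have iv: "\<exists>u v. K = {u..v} \<and> u \<le> x \<and> x \<le> v \<and> a \<le> u \<and> v \<le> b" if "(x, K) \<in> p" for x K
      proof -
        have "x \<in> K" "K \<subseteq> cbox a b" "\<exists>u v. K = cbox u v"
          using tagged_division_ofD[OF p] that by blast+
        then show ?thesis by fastforce
      qed
      have good: "\<bar>content K * g x - (F (Sup K) - F (Inf K))\<bar> \<le> e' * content K" if "(x, K) \<in> p - q" for x K
      proof -
        have xK: "(x, K) \<in> p" "x \<notin> N" using that by (auto simp: q_def)
        obtain u v where uv: "K = {u..v}" "u \<le> x" "x \<le> v" "a \<le> u" "v \<le> b" using iv[OF xK(1)] by blast
        note xN = xK(2)
        have x: "x \<in> {a..b} - N" using uv xN by auto
        have sub: "K \<subseteq> ball x (d x)" using fineD[OF fine xK(1)] x by (simp add: \<gamma>_def)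
        have "u \<in> K" "v \<in> K" using uv by auto
        then have "\<bar>u - x\<bar> < d x" "\<bar>v - x\<bar> < d x" using sub by (auto simp: dist_real_def abs_minus_commute)
        then have 1: "\<bar>F u - F x - (u - x) * f x\<bar> \<le> e' * \<bar>u - x\<bar>" "\<bar>F v - F x - (v - x) * f x\<bar> \<le> e' * \<bar>v - x\<bar>"
          using d2[OF x, of u] d2[OF x, of v] uv by simp_all
        have "content K * g x - (F (Sup K) - F (Inf K)) = (F u - F x - (u - x) * f x) - (F v - F x - (v - x) * f x)"
          using uv xN by (simp add: g_def algebra_simps)
        also have "\<bar>\<dots>\<bar> \<le> e' * \<bar>u - x\<bar> + e' * \<bar>v - x\<bar>" using 1 by linarith
        also have "\<dots> = e' * content K" using uv by (simp add: algebra_simps)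
        finally show ?thesis .
      qed
      have bad: "(\<Sum>(x, K)\<in>q. \<bar>F (Sup K) - F (Inf K)\<bar>) < e / 2"
      proof -
        have tq: "q tagged_partial_division_of cbox a b"
          by (rule tagged_partial_division_subset[OF p[unfolded tagged_division_of_def, THEN conjunct1] qp])
        have div: "snd ` q division_of \<Union>(snd ` q)" 
          using partial_division_of_tagged_division[OF tq] .
        have qd: "q tagged_division_of \<Union>(snd ` q)"
          using tagged_partial_division_of_Union_self[OF tq] by simp
        have subab: "\<Union>(snd ` q) \<subseteq> {a..b}"
        proof -
          have "K \<subseteq> {a..b}" if "(x, K) \<in> q" for x K using tagged_division_ofD(3)[OF p] that qp by auto
          then show ?thesis by (intro Sup_least) (metis imageE prod.collapse)
        qed
        have subU: "\<Union>(snd ` q) \<subseteq> U"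
        proof -
          have "K \<subseteq> U" if "(x, K) \<in> q" for x K
            using fineD[OF fine, of x K] that by (simp add: q_def \<gamma>_def)
          then show ?thesis by (intro Sup_least) (metis imageE prod.collapse)
        qed
        have "(\<Sum>K\<in>snd ` q. content K) = measure lebesgue (\<Union>(snd ` q))"
          using sum_content_division(2)[OF div] by simp
        also have "\<dots> \<le> measure lebesgue U"
          using subU U(3) fmeasurableD[OF sum_content_division(1)[OF div]] by (intro measure_mono_fmeasurable)
        also have "\<dots> < \<delta>" by fact
        finally have "(\<Sum>K\<in>snd ` q. \<bar>F (Sup K) - F (Inf K)\<bar>) < e / 2"
          using ac[OF div subab] by simp
        moreover have "(\<Sum>(x, K)\<in>q. \<bar>F (Sup K) - F (Inf K)\<bar>) = (\<Sum>K\<in>snd ` q. \<bar>F (Sup K) - F (Inf K)\<bar>)"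
        proof -
          \<comment> \<open>Passing from tagged intervals to the set of intervals needs a function
            that vanishes on every box without interior. This includes the empty box, where
            \<open>Sup\<close> and \<open>Inf\<close> have no useful value.\<close>
          define h where "h K = (if K = {} then 0 else \<bar>F (Sup K) - F (Inf K)\<bar>)" for K :: "real set"
          have ne: "K \<noteq> {}" if "(x, K) \<in> q" for x K
            using tagged_division_ofD(2)[OF p] that qp by blast
          have "(\<Sum>(x, K)\<in>q. \<bar>F (Sup K) - F (Inf K)\<bar>) = (\<Sum>(x, K)\<in>q. h K)"
            using ne by (intro sum.cong refl) (auto simp: h_def)
          also have "\<dots> = (\<Sum>K\<in>snd ` q. h K)"
          proof (rule sum.over_tagged_division_lemma[OF qd])
            fix u v :: real assume "box u v = {}"
            then have "u = v \<or> cbox u v = {}" by auto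
            then show "h (cbox u v) = 0" by (auto simp: h_def)
          qed
          also have "\<dots> = (\<Sum>K\<in>snd ` q. \<bar>F (Sup K) - F (Inf K)\<bar>)"
            using ne by (intro sum.cong refl) (auto simp: h_def)
          finally show ?thesis .
        qed
        ultimately show ?thesis by simp
      qed
      have "(\<Sum>(x, K)\<in>p. content K *\<^sub>R g x) - (F b - F a) = (\<Sum>(x, K)\<in>p. content K * g x - (F (Sup K) - F (Inf K)))"
        unfolding tele[symmetric] by (simp add: sum_subtractf case_prod_unfold)
      also have "\<dots> = (\<Sum>(x, K)\<in>p - q. content K * g x - (F (Sup K) - F (Inf K))) + (\<Sum>(x, K)\<in>q. content K * g x - (F (Sup K) - F (Inf K)))"
        by (rule sum.subset_diff[OF qp finp])
      also have "\<bar>\<dots>\<bar> \<le> (\<Sum>(x, K)\<in>p - q. e' * content K) + (\<Sum>(x, K)\<in>q. \<bar>F (Sup K) - F (Inf K)\<bar>)"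
      proof (rule order_trans[OF abs_triangle_ineq add_mono])
        show "\<bar>\<Sum>(x, K)\<in>p - q. content K * g x - (F (Sup K) - F (Inf K))\<bar> \<le> (\<Sum>(x, K)\<in>p - q. e' * content K)"
          by (rule order_trans[OF sum_abs sum_mono]) (use good in auto)
        show "\<bar>\<Sum>(x, K)\<in>q. content K * g x - (F (Sup K) - F (Inf K))\<bar> \<le> (\<Sum>(x, K)\<in>q. \<bar>F (Sup K) - F (Inf K)\<bar>)"
          by (rule order_trans[OF sum_abs sum_mono]) (auto simp: g_def q_def)
      qed
      also have "(\<Sum>(x, K)\<in>p - q. e' * content K) \<le> (\<Sum>(x, K)\<in>p. e' * content K)"
        using finp \<open>e' > 0\<close> by (intro sum_mono2) auto
      also have "\<dots> = e' * (b - a)"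
        using additive_content_tagged_division[OF p] \<open>a \<le> b\<close> by (simp add: sum_distrib_left[symmetric] case_prod_unfold)
      also have "\<dots> \<le> e / 2"
        using \<open>a \<le> b\<close> \<open>e > 0\<close> by (simp add: e'_def field_simps)
      finally show ?thesis using bad by simp
    qed
    ultimately show "\<exists>\<gamma>. gauge \<gamma> \<and> (\<forall>p. p tagged_division_of cbox a b \<and> \<gamma> fine p \<longrightarrow>
          norm ((\<Sum>(x, K)\<in>p. content K *\<^sub>R g x) - (F b - F a)) < e)"
      by (intro exI[of _ \<gamma>] conjI allI impI) simp_all
  qed
  then have "(g has_integral F b - F a) {a..b}" by simp
  then show ?thesis
    by (rule has_integral_spike[OF N, rotated]) (auto simp: g_def)
qed

text \<open>Vitali's theorem for balls, with an interval read as the ball around its midpoint,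
  covers \<open>E\<close> up to a null set by countably many disjoint intervals; openness of
  \<open>W\<close> keeps short intervals inside it. The remainders left by finite subfamilies
  decrease to that null set, and continuity from above makes one of them smaller than
  \<open>e\<close>.\<close>

lemma Vitali_finite_intervals:
  fixes E W :: "real set"
  assumes E: "E \<in> lmeasurable" "E \<subseteq> W" "open W" and e: "e > 0"
    and P: "\<And>x d. x \<in> E \<Longrightarrow> d > 0 \<Longrightarrow> \<exists>u v. u < v \<and> u \<le> x \<and> x \<le> v \<and> v - u < d \<and> P u v"
  obtains D where "finite D" "\<And>u v. (u, v) \<in> D \<Longrightarrow> u < v \<and> {u..v} \<subseteq> W \<and> P u v"
    "\<And>u v u' v'. (u, v) \<in> D \<Longrightarrow> (u', v') \<in> D \<Longrightarrow> (u, v) \<noteq> (u', v') \<Longrightarrow> {u..v} \<inter> {u'..v'} = {}"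
    "measure lebesgue (E - (\<Union>(u, v)\<in>D. {u..v})) < e"
proof -
  define K where "K = {(u, v). u < v \<and> {u..v} \<subseteq> W \<and> P u v}"
  define a where "a = (\<lambda>(u, v). (u + v) / (2::real))"
  define r where "r = (\<lambda>(u, v). (v - u) / (2::real))"
  define I where "I = (\<lambda>(u, v). {u..v::real})"
  have cb: "cball (a i) (r i) = I i" for i
    by (cases i) (simp add: a_def r_def I_def cball_eq_atLeastAtMost field_simps)
  have rpos: "0 < r i" if "i \<in> K" for i using that by (auto simp: K_def r_def)
  have fine: "\<exists>i. i \<in> K \<and> x \<in> cball (a i) (r i) \<and> r i < d" if "x \<in> E" "0 < d" for x d
  proof -
    have "x \<in> W" using E that by blast
    then obtain d' where d': "d' > 0" "ball x d' \<subseteq> W" using \<open>open W\<close> openE by blast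
    obtain u v where uv: "u < v" "u \<le> x" "x \<le> v" "v - u < min d d'" "P u v"
      using P[OF \<open>x \<in> E\<close>, of "min d d'"] \<open>0 < d\<close> d' by auto
    have "{u..v} \<subseteq> ball x d'" using uv by (auto simp: dist_real_def)
    then have "(u, v) \<in> K" using uv d' by (auto simp: K_def)
    moreover have "x \<in> cball (a (u, v)) (r (u, v))" unfolding cb using uv by (simp add: I_def)
    moreover have "r (u, v) < d" using uv by (simp add: r_def)
    ultimately show ?thesis by blast
  qed
  obtain C where C: "countable C" "C \<subseteq> K"
     "pairwise (\<lambda>i j. disjnt (cball (a i) (r i)) (cball (a j) (r j))) C"
     "negligible(E - (\<Union>i \<in> C. cball (a i) (r i)))"
    using Vitali_covering_theorem_cballs[of K r E a, OF rpos fine] by blast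
  have I_closed: "I i \<in> sets lebesgue" for i by (cases i) (simp add: I_def)
  have "\<exists>D. finite D \<and> D \<subseteq> C \<and> measure lebesgue (E - (\<Union>i\<in>D. I i)) < e"
  proof (cases "C = {}")
    case True
    then have "negligible E" using C(4) by simp
    then show ?thesis using e by (intro exI[of _ "{}"]) (simp add: negligible_imp_measure0)
  next
    case False
    define A where "A n = E - (\<Union>i\<in>from_nat_into C ` {..n}. I i)" for n :: nat
    have Am: "A n \<in> sets lebesgue" for n
      unfolding A_def using E(1) I_closed by (intro sets.Diff sets.finite_UN) auto
    have AE: "A n \<subseteq> E" for n by (auto simp: A_def)
    have fin: "emeasure lebesgue (A n) \<noteq> \<infinity>" for n
      using fmeasurableD2[OF fmeasurableI2[OF E(1) AE Am]] by simp
    have "(\<lambda>n. measure lebesgue (A n)) \<longlonglongrightarrow> measure lebesgue (\<Inter>n. A n)"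
      by (rule Lim_measure_decseq) (use Am fin in \<open>auto simp: A_def decseq_def\<close>)
    moreover have "(\<Inter>n. A n) = E - (\<Union>i\<in>C. cball (a i) (r i))"
    proof -
      have "(\<Union>n. from_nat_into C ` {..n}) = C"
      proof -
        have "(\<Union>n. from_nat_into C ` {..n}) = range (from_nat_into C)" by auto
        then show ?thesis using range_from_nat_into[OF False C(1)] by simp
      qed
      then show ?thesis unfolding cb A_def by blast
    qed
    ultimately have "(\<lambda>n. measure lebesgue (A n)) \<longlonglongrightarrow> 0"
      using negligible_imp_measure0[OF C(4)] by simp
    then have "\<forall>\<^sub>F n in sequentially. measure lebesgue (A n) < e" using e by (rule order_tendstoD(2))
    then obtain n where "measure lebesgue (A n) < e" by (auto simp: eventually_sequentially)
    then show ?thesis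
      by (intro exI[of _ "from_nat_into C ` {..n}"]) (use from_nat_into[OF False] in \<open>auto simp: A_def\<close>)
  qed
  then obtain D where D: "finite D" "D \<subseteq> C" "measure lebesgue (E - (\<Union>i\<in>D. I i)) < e" by blast
  show thesis
  proof (rule that[OF D(1)])
    show "u < v \<and> {u..v} \<subseteq> W \<and> P u v" if "(u, v) \<in> D" for u v
      using that D(2) C(2) by (auto simp: K_def)
    show "measure lebesgue (E - (\<Union>(u, v)\<in>D. {u..v})) < e"
      using D(3) by (simp add: I_def)
    fix u v u' v' assume "(u, v) \<in> D" "(u', v') \<in> D" "(u, v) \<noteq> (u', v')"
    then have "disjnt (I (u, v)) (I (u', v'))"
      using C(3) D(2) unfolding cb pairwise_def by blast
    then show "{u..v} \<inter> {u'..v'} = {}" by (simp add: I_def disjnt_def)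
  qed
qed

lemma measure_disjoint_intervals:
  fixes D :: "(real \<times> real) set"
  assumes "finite D" "\<And>u v. (u, v) \<in> D \<Longrightarrow> u \<le> v"
    "\<And>u v u' v'. (u, v) \<in> D \<Longrightarrow> (u', v') \<in> D \<Longrightarrow> (u, v) \<noteq> (u', v') \<Longrightarrow> {u..v} \<inter> {u'..v'} = {}"
  shows "measure lebesgue (\<Union>(u, v)\<in>D. {u..v}) = (\<Sum>(u, v)\<in>D. v - u)"
    "(\<Union>(u, v)\<in>D. {u..v}) \<in> lmeasurable"
proof -
  define I where "I = (\<lambda>(u, v). {u..v::real})"
  have disj: "I i \<inter> I j = {}" if "i \<in> D" "j \<in> D" "i \<noteq> j" for i j
    using assms(3)[of "fst i" "snd i" "fst j" "snd j"] that by (simp add: I_def case_prod_unfold)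
  have lm: "I i \<in> lmeasurable" for i by (cases i) (simp add: I_def)
  have "measure lebesgue (\<Union>i\<in>D. I i) = (\<Sum>i\<in>D. measure lebesgue (I i))"
    using assms(1) lm disj by (intro measure_negligible_finite_Union_image) (auto simp: pairwise_def)
  also have "\<dots> = (\<Sum>(u, v)\<in>D. v - u)"
    by (intro sum.cong refl) (use assms(2) in \<open>auto simp: I_def\<close>)
  finally show "measure lebesgue (\<Union>(u, v)\<in>D. {u..v}) = (\<Sum>(u, v)\<in>D. v - u)" by (simp add: I_def)
  show "(\<Union>(u, v)\<in>D. {u..v}) \<in> lmeasurable"
    using fmeasurable.finite_UN[OF assms(1), of I] lm by (simp add: I_def)
qed

lemma sum_division_telescope:
  fixes F :: "real \<Rightarrow> real"
  assumes q: "q division_of cbox u v" and "u \<le> v"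
  shows "(\<Sum>K\<in>q. F (Sup K) - F (Inf K)) = F v - F u"
proof -
  define tq where "tq = (\<lambda>K. (Inf K, K)) ` q"
  have "tq tagged_division_of cbox u v"
  proof (rule tagged_division_ofI)
    show "finite tq" using q by (auto simp: tq_def)
    show "\<Union>{K. \<exists>x. (x, K) \<in> tq} = cbox u v"
    proof -
      have "{K. \<exists>x. (x, K) \<in> tq} = q" by (auto simp: tq_def)
      then show ?thesis using division_ofD(6)[OF q] by simp
    qed
    fix x K assume "(x, K) \<in> tq"
    then have K: "K \<in> q" "x = Inf K" by (auto simp: tq_def)
    obtain a b where ab: "K = cbox a b" using division_ofD(4)[OF q K(1)] by blast
    show "\<exists>a b. K = cbox a b" using ab by blast
    show "K \<subseteq> cbox u v" using division_ofD(2)[OF q K(1)] .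
    have "K \<noteq> {}" using division_ofD(3)[OF q K(1)] .
    then show "x \<in> K" using ab K(2) by simp
  next
    fix x K y L assume "(x, K) \<in> tq" "(y, L) \<in> tq" "(x, K) \<noteq> (y, L)"
    then show "interior K \<inter> interior L = {}"
      using division_ofD(5)[OF q] by (auto simp: tq_def)
  qed
  then have "(\<Sum>(x, K)\<in>tq. F (Sup K) - F (Inf K)) = F v - F u"
    using additive_tagged_division_1[OF \<open>u \<le> v\<close>, of tq F] by simp
  then show ?thesis
    by (simp add: tq_def sum.reindex inj_on_def)
qed

text \<open>\<open>G\<close> consists of the gaps. The intervals of \<open>D\<close> extend to a
  division of \<open>{u..v}\<close>, along which increments telescope and lengths add up.\<close>

lemma complete_intervals:
  fixes F :: "real \<Rightarrow> real"
  assumes D: "finite D" "\<And>a b. (a, b) \<in> D \<Longrightarrow> a < b \<and> {a..b} \<subseteq> {u<..<v}"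
    "\<And>a b a' b'. (a, b) \<in> D \<Longrightarrow> (a', b') \<in> D \<Longrightarrow> (a, b) \<noteq> (a', b') \<Longrightarrow> {a..b} \<inter> {a'..b'} = {}"
    and "u \<le> v"
  obtains G where "G division_of (\<Union>G)" "\<Union>G \<subseteq> {u..v}"
    "F v - F u = (\<Sum>(a, b)\<in>D. F b - F a) + (\<Sum>K\<in>G. F (Sup K) - F (Inf K))"
    "(\<Sum>K\<in>G. content K) = (v - u) - (\<Sum>(a, b)\<in>D. b - a)"
proof -
  define I where "I = (\<lambda>(a, b). {a..b::real})"
  define p where "p = I ` D"
  have disj: "I i \<inter> I j = {}" if "i \<in> D" "j \<in> D" "i \<noteq> j" for i j
    using D(3)[of "fst i" "snd i" "fst j" "snd j"] that by (simp add: I_def case_prod_unfold)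
  have ne: "I i \<noteq> {}" if "i \<in> D" for i
    using D(2)[of "fst i" "snd i"] that by (simp add: I_def case_prod_unfold)
  have sub: "I i \<subseteq> {u<..<v}" if "i \<in> D" for i
    using D(2)[of "fst i" "snd i"] that by (simp add: I_def case_prod_unfold)
  have inj: "inj_on I D"
  proof (rule inj_onI, rule ccontr)
    fix i j assume "i \<in> D" "j \<in> D" "I i = I j" "i \<noteq> j"
    then show False using disj[of i j] ne by auto
  qed
  have p: "p division_of \<Union>p"
  proof (rule division_ofI)
    show "finite p" using D(1) by (simp add: p_def)
    fix K assume "K \<in> p"
    then obtain i where i: "i \<in> D" "K = I i" by (auto simp: p_def)
    then show "K \<noteq> {}" using ne by simp
    show "K \<subseteq> \<Union>p" using \<open>K \<in> p\<close> by blast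
    show "\<exists>a b. K = cbox a b" using i by (cases i) (auto simp: I_def)
    fix L assume "L \<in> p" "K \<noteq> L"
    then obtain j where j: "j \<in> D" "L = I j" by (auto simp: p_def)
    then have "K \<inter> L = {}" using disj[of i j] i \<open>K \<noteq> L\<close> by auto
    then show "interior K \<inter> interior L = {}" using interior_subset by blast
  qed simp
  have pu: "\<Union>p \<subseteq> cbox u v" using sub by (fastforce simp: p_def)
  obtain q where q: "p \<subseteq> q" "q division_of cbox u v"
    using partial_division_extend_interval[OF p pu] by blast
  have finq: "finite q" using q by auto
  define G where "G = q - p"
  have sumq: "(\<Sum>K\<in>q. g K) = (\<Sum>i\<in>D. g (I i)) + (\<Sum>K\<in>G. g K)" for g :: "real set \<Rightarrow> real"
    unfolding G_def using sum.subset_diff[OF q(1) finq, of g] by (simp add: p_def sum.reindex[OF inj])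
  show thesis
  proof (rule that)
    show "G division_of \<Union>G"
      using division_of_subset[OF q(2)[unfolded division_ofD(6)[OF q(2), symmetric]], of G] by (auto simp: G_def)
    show "\<Union>G \<subseteq> {u..v}" using division_ofD(6)[OF q(2)] by (auto simp: G_def)
    have "F v - F u = (\<Sum>i\<in>D. F (Sup (I i)) - F (Inf (I i))) + (\<Sum>K\<in>G. F (Sup K) - F (Inf K))"
      using sum_division_telescope[OF q(2) \<open>u \<le> v\<close>, of F] sumq[of "\<lambda>K. F (Sup K) - F (Inf K)"] by simp
    also have "(\<Sum>i\<in>D. F (Sup (I i)) - F (Inf (I i))) = (\<Sum>(a, b)\<in>D. F b - F a)"
      using D(2) by (intro sum.cong refl) (force simp: I_def)
    finally show "F v - F u = (\<Sum>(a, b)\<in>D. F b - F a) + (\<Sum>K\<in>G. F (Sup K) - F (Inf K))" .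
    have "v - u = (\<Sum>i\<in>D. content (I i)) + (\<Sum>K\<in>G. content K)"
      using additive_content_division[OF q(2)] sumq[of content] \<open>u \<le> v\<close> by simp
    also have "(\<Sum>i\<in>D. content (I i)) = (\<Sum>(a, b)\<in>D. b - a)"
      using D(2) by (intro sum.cong refl) (force simp: I_def)
    finally show "(\<Sum>K\<in>G. content K) = (v - u) - (\<Sum>(a, b)\<in>D. b - a)" by simp
  qed
qed

section \<open>Differentiability almost everywhere\<close>

text \<open>
  For \<open>p < q\<close>, the points where the difference quotients of \<open>F\<close> oscillate across \<open>[p, q]\<close> lie in
  \<open>steep F q \<inter> steep (- F) (- p)\<close>. A second application of Vitali's theorem inside the intervals of a
  first one makes the increment of an absolutely continuous \<open>F\<close> over essentially the same set
  both at least \<open>q\<close> and at most \<open>p\<close> times its measure.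
\<close>

definition steep :: "(real \<Rightarrow> real) \<Rightarrow> real \<Rightarrow> real set" where
  "steep F q = {x\<in>{0<..<1}. \<forall>d>0. \<exists>u v. u < v \<and> (x = u \<or> x = v) \<and> 0 < u \<and> v < 1 \<and> v - u < d \<and> F v - F u > q * (v - u)}"

lemma steep_subset: "steep F q \<subseteq> {0<..<1}" by (auto simp: steep_def)

lemma steepD:
  assumes "x \<in> steep F q" "d > 0"
  shows "\<exists>u v. u < v \<and> u \<le> x \<and> x \<le> v \<and> v - u < d \<and> F v - F u > q * (v - u)"
proof -
  obtain u v where "u < v" "x = u \<or> x = v" "v - u < d" "F v - F u > q * (v - u)"
    using assms unfolding steep_def by blast
  then show ?thesis by (intro exI[of _ u] exI[of _ v]) auto
qed

text \<open>With one endpoint \<open>y\<close> fixed, the other endpoints \<open>x\<close> that give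
  a short interval of slope above \<open>q\<close> form an open set by continuity. Hence for each
  \<open>d\<close> the points with an admissible interval shorter than \<open>d\<close> form an open
  set, and the values d = 1/(n+1) suffice.\<close>

lemma steep_lmeasurable:
  assumes F: "continuous_on {0<..<1} F"
  shows "steep F q \<in> lmeasurable"
proof -
  define A where "A d y = {max 0 (y - d)<..<min y 1} \<inter> (\<lambda>x. F y - F x - q * (y - x)) -` {0<..}" for d y
  define B where "B d y = {max 0 y<..<min (y + d) 1} \<inter> (\<lambda>x. F x - F y - q * (x - y)) -` {0<..}" for d y
  define O' where "O' d = (\<Union>y\<in>{0<..<1}. A d y \<union> B d y)" for d
  have "open (O' d)" for d
    unfolding O'_def A_def B_def
    by (intro open_UN ballI open_Un continuous_open_preimage continuous_intros continuous_on_subset[OF F]) auto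
  then have bor: "O' d \<in> sets borel" for d by simp
  have eq: "(\<exists>u v. u < v \<and> (x = u \<or> x = v) \<and> 0 < u \<and> v < 1 \<and> v - u < d \<and> F v - F u > q * (v - u)) \<longleftrightarrow> x \<in> O' d" for x d
  proof
    assume "\<exists>u v. u < v \<and> (x = u \<or> x = v) \<and> 0 < u \<and> v < 1 \<and> v - u < d \<and> F v - F u > q * (v - u)"
    then obtain u v where uv: "u < v" "x = u \<or> x = v" "0 < u" "v < 1" "v - u < d" "F v - F u > q * (v - u)" by blast
    show "x \<in> O' d"
    proof (cases "x = u")
      case True
      then have "x \<in> A d v" using uv by (auto simp: A_def)
      then show ?thesis using uv by (auto simp: O'_def)
    next
      case False
      then have "x \<in> B d u" using uv by (auto simp: B_def)
      then show ?thesis using uv by (auto simp: O'_def)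
    qed
  next
    assume "x \<in> O' d"
    then obtain y where y: "0 < y" "y < 1" "x \<in> A d y \<or> x \<in> B d y" by (auto simp: O'_def)
    then show "\<exists>u v. u < v \<and> (x = u \<or> x = v) \<and> 0 < u \<and> v < 1 \<and> v - u < d \<and> F v - F u > q * (v - u)"
    proof (elim disjE)
      assume "x \<in> A d y"
      then show ?thesis using y by (intro exI[of _ x] exI[of _ y]) (auto simp: A_def)
    next
      assume "x \<in> B d y"
      then show ?thesis using y by (intro exI[of _ y] exI[of _ x]) (auto simp: B_def)
    qed
  qed
  have "steep F q = {0<..<1} \<inter> (\<Inter>n::nat. O' (1 / real (Suc n)))"
  proof (intro equalityI subsetI)
    fix x assume "x \<in> steep F q"
    then show "x \<in> {0<..<1} \<inter> (\<Inter>n::nat. O' (1 / real (Suc n)))"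
      by (auto simp: steep_def eq)
  next
    fix x assume x: "x \<in> {0<..<1} \<inter> (\<Inter>n::nat. O' (1 / real (Suc n)))"
    have "x \<in> O' d" if "d > 0" for d
    proof -
      obtain n where n: "1 / real (Suc n) < d" using nat_approx_posE[OF \<open>d > 0\<close>] by blast
      have "x \<in> O' (1 / real (Suc n))" using x by blast
      then show ?thesis using n by (fastforce simp: eq[symmetric])
    qed
    then show "x \<in> steep F q" using x by (auto simp: steep_def eq)
  qed
  then have "steep F q \<in> sets lebesgue" using bor by auto
  then show ?thesis
    by (rule fmeasurableI2[of "{0<..<1::real}", rotated 2]) (auto simp: steep_subset)
qed


lemma steep_both_negligible:
  fixes F :: "real \<Rightarrow> real"
  assumes F: "abs_cont_on {0..1} F" and "p < q"
  shows "negligible (steep F q \<inter> steep (\<lambda>x. - F x) (- p))"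
proof -
  have cF: "continuous_on {0<..<1} F"
    by (rule continuous_on_subset[OF abs_cont_on_imp_continuous_on[OF F]]) auto
  define E where "E = steep F q \<inter> steep (\<lambda>x. - F x) (- p)"
  have E: "E \<in> lmeasurable" unfolding E_def
    by (intro fmeasurable.Int steep_lmeasurable continuous_on_minus cF)
  have E01: "E \<subseteq> {0<..<1}" using steep_subset by (auto simp: E_def)
  define \<mu> where "\<mu> = measure lebesgue E"
  have claim: "(q - p) * (\<mu> - e) \<le> e * (1 + 2 * \<bar>q\<bar>)" if "e > 0" for e
  proof -
    obtain \<delta> where \<delta>: "\<delta> > 0" and ac: "\<And>p S. p division_of S \<Longrightarrow> S \<subseteq> {0..1} \<Longrightarrow> (\<Sum>K\<in>p. content K) < \<delta> \<Longrightarrow>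
       (\<Sum>K\<in>p. \<bar>F (Sup K) - F (Inf K)\<bar>) < e"
      using abs_cont_on_divisionD[OF F \<open>e > 0\<close>] by blast
    \<comment> \<open>The gaps between the inner intervals will have total length below
      \<open>2 * \<eta>\<close>: at most the measure of \<open>U - E\<close>, plus \<eta> times the
      total length of the outer intervals, which is at most 1.\<close>
    define \<eta> where "\<eta> = min (\<delta> / 2) e"
    have \<eta>: "\<eta> > 0" "2 * \<eta> \<le> \<delta>" "\<eta> \<le> e" using \<delta> \<open>e > 0\<close> by (auto simp: \<eta>_def)
    obtain T where T: "open T" "E \<subseteq> T" "T - E \<in> lmeasurable" "emeasure lebesgue (T - E) < ennreal \<eta>"
      using sets_lebesgue_outer_open[OF fmeasurableD[OF E] \<eta>(1)] by blast
    define U where "U = T \<inter> {0<..<1}"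
    have U: "open U" "E \<subseteq> U" "U \<subseteq> {0<..<1}" using T E01 by (auto simp: U_def)
    have UE: "U - E \<in> lmeasurable" "measure lebesgue (U - E) < \<eta>"
    proof -
      have "U - E \<in> sets lebesgue" using U(1) E by auto
      then show lm: "U - E \<in> lmeasurable" using T(3) by (rule fmeasurableI2[rotated 2]) (auto simp: U_def)
      have "measure lebesgue (U - E) \<le> measure lebesgue (T - E)"
        by (rule measure_mono_fmeasurable) (use lm T(3) in \<open>auto simp: U_def\<close>)
      also have "\<dots> < \<eta>" using T(3,4) \<eta> by (simp add: emeasure_eq_measure2 ennreal_less_iff)
      finally show "measure lebesgue (U - E) < \<eta>" .
    qed
    have P1: "\<exists>u v. u < v \<and> u \<le> x \<and> x \<le> v \<and> v - u < d \<and> F v - F u < p * (v - u)" if "x \<in> E" "d > 0" for x d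
    proof -
      have "x \<in> steep (\<lambda>x. - F x) (- p)" using that by (simp add: E_def)
      from steepD[OF this \<open>d > 0\<close>] obtain u v where "u < v" "u \<le> x" "x \<le> v" "v - u < d"
        "- F v - - F u > - p * (v - u)" by blast
      then show ?thesis by (intro exI[of _ u] exI[of _ v]) simp
    qed
    have P2: "\<exists>u v. u < v \<and> u \<le> x \<and> x \<le> v \<and> v - u < d \<and> F v - F u > q * (v - u)" if "x \<in> E" "d > 0" for x d
      by (rule steepD) (use that in \<open>auto simp: E_def\<close>)
    obtain D where D: "finite D" "\<And>u v. (u, v) \<in> D \<Longrightarrow> u < v \<and> {u..v} \<subseteq> U \<and> F v - F u < p * (v - u)"
      "\<And>u v u' v'. (u, v) \<in> D \<Longrightarrow> (u', v') \<in> D \<Longrightarrow> (u, v) \<noteq> (u', v') \<Longrightarrow> {u..v} \<inter> {u'..v'} = {}"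
      "measure lebesgue (E - (\<Union>(u, v)\<in>D. {u..v})) < \<eta>"
      using Vitali_finite_intervals[OF E U(2,1) \<eta>(1), of "\<lambda>u v. F v - F u < p * (v - u)", OF P1] by blast
    define L where "L = (\<Union>(u, v)\<in>D. {u..v})"
    have L: "measure lebesgue L = (\<Sum>(u, v)\<in>D. v - u)" "L \<in> lmeasurable"
      unfolding L_def using measure_disjoint_intervals[of D] D(1-3) by (auto simp: less_imp_le)
    have LU: "L \<subseteq> U" using D(2) by (fastforce simp: L_def)
    \<comment> \<open>Inside an interval of the first covering, where the slope of \<open>F\<close>
      is below \<open>p\<close>, the set \<open>E\<close> is covered again by intervals of slope
      above \<open>q\<close>. Here \<open>s\<close> is the total length of these and
      \<open>G\<close> the system of gaps between them.\<close>
    have local: "\<exists>s G. s \<le> v - u \<and> q * s + (\<Sum>K\<in>G. F (Sup K) - F (Inf K)) \<le> F v - F u \<and>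
         G division_of \<Union>G \<and> \<Union>G \<subseteq> {u..v} \<and> (\<Sum>K\<in>G. content K) = v - u - s \<and>
         v - u - s \<le> measure lebesgue ({u..v} - E) + \<eta> * (v - u)"
      if uvD: "(u, v) \<in> D" for u v
    proof -
      have uv: "u < v" "{u..v} \<subseteq> U" using D(2)[OF uvD] by auto
      let ?E = "E \<inter> {u<..<v}"
      have E': "?E \<in> lmeasurable" "?E \<subseteq> {u<..<v}" "open {u<..<v}" using E by (auto intro: fmeasurable.Int)
      have P2': "\<exists>a b. a < b \<and> a \<le> x \<and> x \<le> b \<and> b - a < d \<and> F b - F a > q * (b - a)" if "x \<in> ?E" "d > 0" for x d
        using P2[of x d] that by blast
      have "\<eta> * (v - u) > 0" using \<eta> uv by simp
      then obtain C where C: "finite C" "\<And>a b. (a, b) \<in> C \<Longrightarrow> a < b \<and> {a..b} \<subseteq> {u<..<v} \<and> F b - F a > q * (b - a)"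
        "\<And>a b a' b'. (a, b) \<in> C \<Longrightarrow> (a', b') \<in> C \<Longrightarrow> (a, b) \<noteq> (a', b') \<Longrightarrow> {a..b} \<inter> {a'..b'} = {}"
        "measure lebesgue (?E - (\<Union>(a, b)\<in>C. {a..b})) < \<eta> * (v - u)"
        using Vitali_finite_intervals[OF E', of "\<eta> * (v - u)" "\<lambda>a b. F b - F a > q * (b - a)", OF _ P2'] by blast
      define N where "N = (\<Union>(a, b)\<in>C. {a..b})"
      have N: "measure lebesgue N = (\<Sum>(a, b)\<in>C. b - a)" "N \<in> lmeasurable"
        unfolding N_def using measure_disjoint_intervals[of C] C(1-3) by (auto simp: less_imp_le)
      have Nuv: "N \<subseteq> {u<..<v}" using C(2) by (fastforce simp: N_def)
      define s where "s = (\<Sum>(a, b)\<in>C. b - a)"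
      have C2: "a < b \<and> {a..b} \<subseteq> {u<..<v}" if "(a, b) \<in> C" for a b using C(2)[OF that] by blast
      obtain G where G: "G division_of (\<Union>G)" "\<Union>G \<subseteq> {u..v}"
        "F v - F u = (\<Sum>(a, b)\<in>C. F b - F a) + (\<Sum>K\<in>G. F (Sup K) - F (Inf K))"
        "(\<Sum>K\<in>G. content K) = (v - u) - (\<Sum>(a, b)\<in>C. b - a)"
        using complete_intervals[OF C(1) C2 C(3), of F] uv(1) by auto
      have "s \<le> measure lebesgue {u<..<v}"
        unfolding s_def N(1)[symmetric] by (rule measure_mono_fmeasurable) (use N(2) Nuv in auto)
      then have s1: "s \<le> v - u" using uv by simp
      have "q * s \<le> (\<Sum>(a, b)\<in>C. F b - F a)"
        unfolding s_def sum_distrib_left by (intro sum_mono) (use C(2) in \<open>auto simp: less_imp_le\<close>)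
      then have s2: "q * s + (\<Sum>K\<in>G. F (Sup K) - F (Inf K)) \<le> F v - F u" using G(3) by simp
      have lm: "{u..v} - E \<in> lmeasurable" "?E - N \<in> lmeasurable"
        using E N(2) by (auto intro: fmeasurable.Diff fmeasurable.Int)
      have "v - u = measure lebesgue {u<..<v}" using uv by simp
      also have "\<dots> \<le> measure lebesgue (({u..v} - E) \<union> ((?E - N) \<union> N))"
        by (rule measure_mono_fmeasurable) (use lm N(2) in \<open>auto intro!: fmeasurable.Un simp del: Un_Diff_cancel2\<close>)
      also have "\<dots> \<le> measure lebesgue ({u..v} - E) + measure lebesgue ((?E - N) \<union> N)"
        by (intro measure_Un_le sets.Un fmeasurableD lm N(2))
      also have "measure lebesgue ((?E - N) \<union> N) \<le> measure lebesgue (?E - N) + measure lebesgue N"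
        by (intro measure_Un_le sets.Un fmeasurableD lm N(2))
      finally have "v - u - s \<le> measure lebesgue ({u..v} - E) + \<eta> * (v - u)"
        using C(4) N(1) by (simp add: s_def N_def)
      then show ?thesis using s1 s2 G by (intro exI[of _ s] exI[of _ G]) (simp add: s_def)
    qed
    then have "\<forall>i\<in>D. \<exists>sG. fst sG \<le> snd i - fst i \<and> q * fst sG + (\<Sum>K\<in>snd sG. F (Sup K) - F (Inf K)) \<le> F (snd i) - F (fst i) \<and>
         snd sG division_of \<Union>(snd sG) \<and> \<Union>(snd sG) \<subseteq> {fst i..snd i} \<and> (\<Sum>K\<in>snd sG. content K) = snd i - fst i - fst sG \<and>
         snd i - fst i - fst sG \<le> measure lebesgue ({fst i..snd i} - E) + \<eta> * (snd i - fst i)"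
      by (intro ballI) (metis (no_types, lifting) fst_conv snd_conv prod.collapse)
    from bchoice[OF this] obtain sG where sG: "\<forall>i\<in>D. fst (sG i) \<le> snd i - fst i \<and>
         q * fst (sG i) + (\<Sum>K\<in>snd (sG i). F (Sup K) - F (Inf K)) \<le> F (snd i) - F (fst i) \<and>
         snd (sG i) division_of \<Union>(snd (sG i)) \<and> \<Union>(snd (sG i)) \<subseteq> {fst i..snd i} \<and>
         (\<Sum>K\<in>snd (sG i). content K) = snd i - fst i - fst (sG i) \<and>
         snd i - fst i - fst (sG i) \<le> measure lebesgue ({fst i..snd i} - E) + \<eta> * (snd i - fst i)" ..
    define s where "s i = fst (sG i)" for i
    define G where "G i = snd (sG i)" for i
    have s: "s i \<le> snd i - fst i" and sF: "q * s i + (\<Sum>K\<in>G i. F (Sup K) - F (Inf K)) \<le> F (snd i) - F (fst i)"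
      and Gdiv: "G i division_of \<Union>(G i)" and Gsub: "\<Union>(G i) \<subseteq> {fst i..snd i}"
      and Gc: "(\<Sum>K\<in>G i. content K) = snd i - fst i - s i"
      and sE: "snd i - fst i - s i \<le> measure lebesgue ({fst i..snd i} - E) + \<eta> * (snd i - fst i)"
      if "i \<in> D" for i
      using sG that by (auto simp: s_def G_def)
    have disjD: "{fst i..snd i} \<inter> {fst j..snd j} = {}" if "i \<in> D" "j \<in> D" "i \<noteq> j" for i j
      using D(3)[of "fst i" "snd i" "fst j" "snd j"] that by simp
    have Gij: "K \<inter> L = {}" if "i \<in> D" "j \<in> D" "i \<noteq> j" "K \<in> G i" "L \<in> G j" for i j K L
      using Gsub[OF that(1)] Gsub[OF that(2)] disjD[OF that(1-3)] that(4,5) by blast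
    have GG: "(\<Union>i\<in>D. G i) division_of \<Union>(\<Union>i\<in>D. G i)"
    proof (rule division_ofI)
      show "finite (\<Union>i\<in>D. G i)" using D(1) Gdiv by (auto dest: division_ofD(1))
      fix K assume "K \<in> (\<Union>i\<in>D. G i)"
      then obtain i where i: "i \<in> D" "K \<in> G i" by blast
      show "K \<subseteq> \<Union>(\<Union>i\<in>D. G i)" using i by blast
      show "K \<noteq> {}" using division_ofD(3)[OF Gdiv[OF i(1)] i(2)] .
      show "\<exists>a b. K = cbox a b" using division_ofD(4)[OF Gdiv[OF i(1)] i(2)] .
      fix L assume "L \<in> (\<Union>i\<in>D. G i)" "K \<noteq> L"
      then obtain j where j: "j \<in> D" "L \<in> G j" by blast
      show "interior K \<inter> interior L = {}"
      proof (cases "i = j")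
        case True
        then show ?thesis using division_ofD(5)[OF Gdiv[OF i(1)] i(2)] j \<open>K \<noteq> L\<close> by simp
      next
        case False
        then show ?thesis using Gij[OF i(1) j(1) False i(2) j(2)] interior_subset by blast
      qed
    qed simp
    have sumG: "(\<Sum>K\<in>(\<Union>i\<in>D. G i). g K) = (\<Sum>i\<in>D. \<Sum>K\<in>G i. g K)" for g :: "real set \<Rightarrow> real"
    proof (rule sum.UNION_disjoint[OF D(1)])
      show "\<forall>i\<in>D. finite (G i)" using Gdiv by (auto dest: division_ofD(1))
      show "\<forall>i\<in>D. \<forall>j\<in>D. i \<noteq> j \<longrightarrow> G i \<inter> G j = {}"
        using Gij Gdiv by (metis disjoint_iff division_ofD(3) inf.idem)
    qed
    define l1 where "l1 = (\<Sum>i\<in>D. snd i - fst i)"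
    define l2 where "l2 = (\<Sum>i\<in>D. s i)"
    have Ll1: "measure lebesgue L = l1" using L(1) by (simp add: l1_def case_prod_unfold)
    have l1_le: "l1 \<le> 1"
    proof -
      have "measure lebesgue L \<le> measure lebesgue {0<..<1::real}"
        by (rule measure_mono_fmeasurable) (use L(2) LU U(3) in auto)
      then show ?thesis using Ll1 by simp
    qed
    have l12: "l2 \<le> l1" unfolding l1_def l2_def by (intro sum_mono s)
    have gap: "l1 - l2 < 2 * \<eta>"
    proof -
      have lmi: "{fst i..snd i} - E \<in> lmeasurable" for i using E by (intro fmeasurable.Diff) auto
      have "l1 - l2 = (\<Sum>i\<in>D. snd i - fst i - s i)" by (simp add: l1_def l2_def sum_subtractf)
      also have "\<dots> \<le> (\<Sum>i\<in>D. measure lebesgue ({fst i..snd i} - E) + \<eta> * (snd i - fst i))"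
        by (intro sum_mono sE)
      also have "\<dots> = (\<Sum>i\<in>D. measure lebesgue ({fst i..snd i} - E)) + \<eta> * l1"
        by (simp add: l1_def sum.distrib sum_distrib_left)
      also have "(\<Sum>i\<in>D. measure lebesgue ({fst i..snd i} - E)) = measure lebesgue (\<Union>i\<in>D. {fst i..snd i} - E)"
      proof (rule measure_negligible_finite_Union_image[symmetric, OF D(1)])
        show "pairwise (\<lambda>i j. negligible (({fst i..snd i} - E) \<inter> ({fst j..snd j} - E))) D"
          unfolding pairwise_def
        proof (intro ballI impI)
          fix i j assume "i \<in> D" "j \<in> D" "i \<noteq> j"
          then have "({fst i..snd i} - E) \<inter> ({fst j..snd j} - E) = {}" using disjD[of i j] by blast
          then show "negligible (({fst i..snd i} - E) \<inter> ({fst j..snd j} - E))" by (simp only: negligible_empty)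
        qed
      qed (rule lmi)
      also have "\<dots> \<le> measure lebesgue (U - E)"
      proof (rule measure_mono_fmeasurable)
        show "(\<Union>i\<in>D. {fst i..snd i} - E) \<subseteq> U - E" using LU by (force simp: L_def)
        show "(\<Union>i\<in>D. {fst i..snd i} - E) \<in> sets lebesgue"
          by (intro sets.finite_UN D(1) fmeasurableD lmi)
      qed (rule UE(1))
      also have "\<dots> < \<eta>" by (rule UE(2))
      finally have "l1 - l2 < \<eta> + \<eta> * l1" by linarith
      moreover have "\<eta> * l1 \<le> \<eta> * 1" using l1_le \<eta> by (intro mult_left_mono) auto
      ultimately show ?thesis by simp
    qed
    have "\<Union>(\<Union>i\<in>D. G i) \<subseteq> {0..1}"
    proof
      fix x assume "x \<in> \<Union>(\<Union>i\<in>D. G i)"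
      then obtain i where "i \<in> D" "x \<in> \<Union>(G i)" by blast
      then have "x \<in> {fst i..snd i}" using Gsub by blast
      then have "x \<in> L" using \<open>i \<in> D\<close> by (force simp: L_def)
      then have "x \<in> {0<..<1}" using LU U(3) by blast
      then show "x \<in> {0..1}" by simp
    qed
    moreover have "(\<Sum>K\<in>(\<Union>i\<in>D. G i). content K) < \<delta>"
      unfolding sumG using gap \<eta>(2) by (simp add: Gc l1_def l2_def sum_subtractf)
    ultimately have "(\<Sum>K\<in>(\<Union>i\<in>D. G i). \<bar>F (Sup K) - F (Inf K)\<bar>) < e"
      using ac[OF GG] by blast
    then have small: "\<bar>\<Sum>i\<in>D. \<Sum>K\<in>G i. F (Sup K) - F (Inf K)\<bar> < e"
      unfolding sumG[symmetric] by (rule le_less_trans[OF sum_abs])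
    \<comment> \<open>Two estimates of one increment: from below by the inner intervals of total
      length \<open>l2\<close>, up to the gaps, and from above by the outer intervals of total
      length \<open>l1\<close>. As \<open>l1\<close> and \<open>l2\<close> nearly agree and p < q,
      both must be small.\<close>
    have "q * l2 + (\<Sum>i\<in>D. \<Sum>K\<in>G i. F (Sup K) - F (Inf K)) \<le> (\<Sum>i\<in>D. F (snd i) - F (fst i))"
      unfolding l2_def sum_distrib_left sum.distrib[symmetric] by (intro sum_mono sF)
    also have "\<dots> \<le> (\<Sum>i\<in>D. p * (snd i - fst i))"
      using D(2) by (intro sum_mono) (metis less_imp_le prod.collapse)
    also have "\<dots> = p * l1" by (simp add: l1_def sum_distrib_left)
    finally have main: "q * l2 \<le> p * l1 + e" using small by linarith
    have "q * l1 - q * l2 \<le> \<bar>q\<bar> * (l1 - l2)"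
      using l12 by (simp add: right_diff_distrib[symmetric] mult_right_mono)
    also have "\<dots> \<le> \<bar>q\<bar> * (2 * e)" using gap \<eta>(3) by (intro mult_left_mono) auto
    finally have "(q - p) * l1 \<le> e * (1 + 2 * \<bar>q\<bar>)" using main by (simp add: algebra_simps)
    moreover have "\<mu> - e \<le> l1"
    proof -
      have "\<mu> \<le> measure lebesgue ((E - L) \<union> L)"
        unfolding \<mu>_def by (rule measure_mono_fmeasurable) (use E L(2) in \<open>auto intro: fmeasurable.Un fmeasurable.Diff\<close>)
      also have "\<dots> \<le> measure lebesgue (E - L) + measure lebesgue L"
        by (rule measure_Un_le) (use E L(2) in auto)
      finally show ?thesis using D(4) \<eta>(3) Ll1 by (simp add: L_def)
    qed
    ultimately show ?thesis using \<open>p < q\<close> by (smt (verit) mult_left_mono)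
  qed
  have "\<mu> \<le> 0"
  proof (rule ccontr)
    assume "\<not> \<mu> \<le> 0"
    then have "\<mu> > 0" by simp
    \<comment> \<open>\<open>claim\<close> says (q - p) \<mu> <= e A; the choice of \<open>e\<close>
      below makes the right side half of the left.\<close>
    define A where "A = (q - p) + (1 + 2 * \<bar>q\<bar>)"
    have "A > 0" using \<open>p < q\<close> by (simp add: A_def)
    define e where "e = (q - p) * \<mu> / (2 * A)"
    have "e > 0" using \<open>A > 0\<close> \<open>p < q\<close> \<open>\<mu> > 0\<close> by (simp add: e_def)
    from claim[OF this] have "(q - p) * \<mu> \<le> e * A" by (simp add: A_def algebra_simps)
    also have "\<dots> = (q - p) * \<mu> / 2" using \<open>A > 0\<close> by (simp add: e_def)
    finally show False using \<open>p < q\<close> \<open>\<mu> > 0\<close> by (simp add: mult_le_0_iff zero_less_mult_iff)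
  qed
  then have "measure lebesgue E = 0" unfolding \<mu>_def using measure_nonneg by (metis order.antisym)
  then show ?thesis using E unfolding E_def by (simp add: negligible_iff_measure)
qed


text \<open>If the set had measure \<mu> > 0 within a window of length below \<delta>, then disjoint
  intervals of slope above n > 2/\<mu> and total length above \<mu>/2 would have increments summing
  to more than 1. Absolute continuity forbids this because the window also bounds the total length
  by \<delta>. Countably many windows cover the set.\<close>

lemma steep_unbounded_negligible:
  fixes F :: "real \<Rightarrow> real"
  assumes F: "abs_cont_on {0..1} F"
  shows "negligible (\<Inter>n::nat. steep F (real n))"
proof -
  have cF: "continuous_on {0<..<1} F"
    by (rule continuous_on_subset[OF abs_cont_on_imp_continuous_on[OF F]]) auto
  define E where "E = (\<Inter>n::nat. steep F (real n))"
  obtain \<delta> where \<delta>: "\<delta> > 0" and ac: "\<forall>D. finite D \<longrightarrow> (\<forall>u v. (u, v) \<in> D \<longrightarrow> u < v \<and> {u..v} \<subseteq> {0..1}) \<longrightarrow>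
        disjoint_family_on (\<lambda>(u, v). {u<..<v}) D \<longrightarrow> (\<Sum>(u, v)\<in>D. v - u) < \<delta>
        \<longrightarrow> (\<Sum>(u, v)\<in>D. \<bar>F v - F u\<bar>) < 1"
    by (rule abs_cont_onE[OF F, of 1]) (simp, rule that)
  define h where "h = \<delta> / 4"
  have h: "h > 0" using \<delta> by (simp add: h_def)
  have local: "negligible (E \<inter> {c - h<..<c + h})" for c
  proof (rule ccontr)
    define W where "W = {0<..<1} \<inter> {c - h<..<c + h}"
    define E' where "E' = E \<inter> {c - h<..<c + h}"
    assume neg: "\<not> negligible (E \<inter> {c - h<..<c + h})"
    have Em: "E' \<in> lmeasurable"
    proof -
      have "E \<in> sets lebesgue" unfolding E_def
        using steep_lmeasurable[OF cF] by (intro sets.countable_INT) (auto intro: fmeasurableD)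
      then have "E' \<in> sets lebesgue" unfolding E'_def by (intro sets.Int) auto
      then show ?thesis by (rule fmeasurableI2[of "{c - h<..<c + h}", rotated 2]) (auto simp: E'_def)
    qed
    have "E \<subseteq> steep F (real 0)" unfolding E_def by (rule INT_lower) simp
    then have "E \<subseteq> {0<..<1}" using steep_subset by (rule subset_trans)
    then have EW: "E' \<subseteq> W" by (auto simp: E'_def W_def)
    define \<mu> where "\<mu> = measure lebesgue E'"
    have "\<mu> > 0" using neg Em unfolding \<mu>_def E'_def by (simp add: negligible_iff_measure zero_less_measure_iff)
    obtain n :: nat where n: "real n > 2 / \<mu>" using reals_Archimedean2 by blast
    have P: "\<exists>u v. u < v \<and> u \<le> x \<and> x \<le> v \<and> v - u < d \<and> F v - F u > real n * (v - u)" if "x \<in> E'" "d > 0" for x d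
      by (rule steepD) (use that in \<open>auto simp: E'_def E_def\<close>)
    obtain D where D: "finite D" "\<And>u v. (u, v) \<in> D \<Longrightarrow> u < v \<and> {u..v} \<subseteq> W \<and> F v - F u > real n * (v - u)"
      "\<And>u v u' v'. (u, v) \<in> D \<Longrightarrow> (u', v') \<in> D \<Longrightarrow> (u, v) \<noteq> (u', v') \<Longrightarrow> {u..v} \<inter> {u'..v'} = {}"
      "measure lebesgue (E' - (\<Union>(u, v)\<in>D. {u..v})) < \<mu> / 2"
      using Vitali_finite_intervals[OF Em EW, of "\<mu> / 2" "\<lambda>u v. F v - F u > real n * (v - u)", OF _ _ P] \<open>\<mu> > 0\<close>
      by (auto simp: W_def)
    define L where "L = (\<Union>(u, v)\<in>D. {u..v})"
    have L: "measure lebesgue L = (\<Sum>(u, v)\<in>D. v - u)" "L \<in> lmeasurable"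
      unfolding L_def using measure_disjoint_intervals[of D] D(1-3) by (auto simp: less_imp_le)
    have LW: "L \<subseteq> W" using D(2) by (fastforce simp: L_def)
    have "\<mu> \<le> measure lebesgue ((E' - L) \<union> L)"
      unfolding \<mu>_def by (rule measure_mono_fmeasurable) (use Em L(2) in \<open>auto intro: fmeasurable.Un fmeasurable.Diff\<close>)
    also have "\<dots> \<le> measure lebesgue (E' - L) + measure lebesgue L"
      by (rule measure_Un_le) (use Em L(2) in auto)
    finally have "\<mu> / 2 < (\<Sum>(u, v)\<in>D. v - u)" using D(4) L(1) by (simp add: L_def)
    moreover have "(\<Sum>(u, v)\<in>D. \<bar>F v - F u\<bar>) < 1"
    proof (rule ac[rule_format, OF D(1)])
      show "u < v \<and> {u..v} \<subseteq> {0..1}" if "(u, v) \<in> D" for u v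
      proof -
        have "W \<subseteq> {0..1}" by (auto simp: W_def)
        then show ?thesis using D(2)[OF that] by blast
      qed
      show "disjoint_family_on (\<lambda>(u, v). {u<..<v}) D"
        unfolding disjoint_family_on_def
      proof (intro ballI impI)
        fix i j assume ij: "i \<in> D" "j \<in> D" "i \<noteq> j"
        have "{fst i..snd i} \<inter> {fst j..snd j} = {}"
          using D(3)[of "fst i" "snd i" "fst j" "snd j"] ij by simp
        moreover have "{fst i<..<snd i} \<subseteq> {fst i..snd i}" "{fst j<..<snd j} \<subseteq> {fst j..snd j}" by auto
        ultimately show "(case i of (u, v) \<Rightarrow> {u<..<v}) \<inter> (case j of (u, v) \<Rightarrow> {u<..<v}) = {}"
          unfolding case_prod_unfold by blast
      qed
      have "measure lebesgue L \<le> measure lebesgue {c - h<..<c + h}"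
        by (rule measure_mono_fmeasurable) (use L(2) LW in \<open>auto simp: W_def\<close>)
      also have "\<dots> = 2 * h" using h by simp
      also have "\<dots> < \<delta>" using \<delta> by (simp add: h_def)
      finally show "(\<Sum>(u, v)\<in>D. v - u) < \<delta>" using L(1) by simp
    qed
    moreover have "real n * (\<Sum>(u, v)\<in>D. v - u) \<le> (\<Sum>(u, v)\<in>D. \<bar>F v - F u\<bar>)"
      unfolding sum_distrib_left by (intro sum_mono) (use D(2) in \<open>fastforce\<close>)
    moreover have "2 / \<mu> * (\<mu> / 2) \<le> real n * (\<Sum>(u, v)\<in>D. v - u)"
      using n \<open>\<mu> > 0\<close> calculation(1) by (intro mult_mono) auto
    ultimately show False using \<open>\<mu> > 0\<close> by simp
  qed
  have "E \<subseteq> (\<Union>k::nat. E \<inter> {real k * h - h<..<real k * h + h})"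
  proof
    fix x assume x: "x \<in> E"
    then have "x \<in> steep F (real 0)" unfolding E_def by blast
    then have "x > 0" using steep_subset[of F "real 0"] by auto
    define k where "k = nat \<lfloor>x / h\<rfloor>"
    have "real k = of_int \<lfloor>x / h\<rfloor>" using \<open>x > 0\<close> h by (simp add: k_def)
    then have "real k \<le> x / h" "x / h < real k + 1" by linarith+
    then have "real k * h \<le> x" "x < real k * h + h" using h by (simp_all add: field_simps)
    then have "x \<in> E \<inter> {real k * h - h<..<real k * h + h}" using x h by simp
    then show "x \<in> (\<Union>k::nat. E \<inter> {real k * h - h<..<real k * h + h})" by blast
  qed
  moreover have "negligible (\<Union>k::nat. E \<inter> {real k * h - h<..<real k * h + h})"
    using local by (intro negligible_countable_Union) auto
  ultimately show ?thesis unfolding E_def[symmetric] by (rule negligible_subset[rotated])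
qed

lemma frequently_steep:
  assumes x: "0 < x" "x < 1" and fr: "\<exists>\<^sub>F y in at x. (F y - F x) / (y - x) > q"
  shows "x \<in> steep F q"
  unfolding steep_def
proof (intro CollectI conjI allI impI)
  show "x \<in> {0<..<1}" using x by simp
  fix d :: real assume "d > 0"
  \<comment> \<open>The bound \<open>min x (1 - x)\<close> keeps the interval inside the open unit
    interval, as \<open>steep\<close> demands.\<close>
  define d' where "d' = min d (min x (1 - x))"
  have d': "d' > 0" using x \<open>d > 0\<close> by (simp add: d'_def)
  have "\<forall>\<^sub>F y in at x. y \<noteq> x \<and> dist y x < d'"
    using d' by (auto simp: eventually_at)
  from frequently_eventually_frequently[OF fr this]
  obtain y where y: "(F y - F x) / (y - x) > q" "y \<noteq> x" "\<bar>y - x\<bar> < d'"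
    by (auto simp: dist_real_def dest: frequently_ex)
  show "\<exists>u v. u < v \<and> (x = u \<or> x = v) \<and> 0 < u \<and> v < 1 \<and> v - u < d \<and> F v - F u > q * (v - u)"
  proof (cases "x < y")
    case True
    then show ?thesis using y x
      by (intro exI[of _ x] exI[of _ y]) (auto simp: d'_def field_simps)
  next
    case False
    then have "y < x" using y by simp
    then show ?thesis using y x
      by (intro exI[of _ y] exI[of _ x]) (auto simp: d'_def field_simps)
  qed
qed

text \<open>Outside \<open>N\<close> the difference quotient stays bounded near \<open>x\<close>. If
  its lower and upper limits differed, two rationals p < q between them would place \<open>x\<close>
  in one of countably many null sets; so the quotient has a finite limit.\<close>

lemma abs_cont_differentiable_ae:
  fixes F :: "real \<Rightarrow> real"
  assumes F: "abs_cont_on {0..1} F"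
  obtains N where "negligible N" "\<And>x. x \<in> {0..1} - N \<Longrightarrow> x \<in> {0<..<1} \<and> F differentiable (at x)"
proof -
  have F': "abs_cont_on {0..1} (\<lambda>x. - F x)"
  proof -
    have "\<bar>- F b - - F a\<bar> = \<bar>F b - F a\<bar>" for a b by simp
    then show ?thesis using F unfolding abs_cont_on_def by (simp only:)
  qed
  \<comment> \<open>The endpoints 0 and 1 are discarded too, so that two-sided difference quotients
    make sense at the remaining points.\<close>
  define N where "N = {0, 1} \<union> (\<Inter>n::nat. steep F (real n)) \<union> (\<Inter>n::nat. steep (\<lambda>x. - F x) (real n)) \<union>
     (\<Union>p::rat. \<Union>q::rat. if p < q then steep F (of_rat q) \<inter> steep (\<lambda>x. - F x) (- of_rat p) else {})"
  have "negligible (\<Union>p::rat. \<Union>q::rat. if p < q then steep F (of_rat q) \<inter> steep (\<lambda>x. - F x) (- of_rat p) else {})"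
  proof -
    have 1: "negligible (if p < q then steep F (of_rat q) \<inter> steep (\<lambda>x. - F x) (- of_rat p) else {})" for p q :: rat
      using steep_both_negligible[OF F, of "of_rat p" "of_rat q"] by (simp add: of_rat_less)
    have 2: "negligible (\<Union>q::rat. if p < q then steep F (of_rat q) \<inter> steep (\<lambda>x. - F x) (- of_rat p) else {})" for p
      by (rule negligible_countable_Union) (use 1 in blast)+
    show ?thesis by (rule negligible_countable_Union) (use 2 in blast)+
  qed
  then have N: "negligible N" unfolding N_def
    using steep_unbounded_negligible[OF F] steep_unbounded_negligible[OF F'] by (intro negligible_Un) auto
  show thesis
  proof (rule that[OF N])
    fix x assume xN: "x \<in> {0..1} - N"
    then have x: "0 < x" "x < 1" by (auto simp: N_def order_less_le)
    define s where "s y = (F y - F x) / (y - x)" for y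
    have st: "x \<in> steep F q" if "\<exists>\<^sub>F y in at x. s y > q" for q
      using frequently_steep[OF x] that by (simp add: s_def)
    have st': "x \<in> steep (\<lambda>x. - F x) (- p)" if "\<exists>\<^sub>F y in at x. s y < p" for p
    proof (rule frequently_steep[OF x])
      have "(- F y - - F x) / (y - x) = - s y" for y
        by (simp add: s_def minus_divide_left)
      then show "\<exists>\<^sub>F y in at x. - p < (- F y - - F x) / (y - x)" using that by simp
    qed
    obtain n where "x \<notin> steep F (real n)" using xN by (auto simp: N_def)
    then have "\<not> (\<exists>\<^sub>F y in at x. s y > real n)" using st by blast
    then have up: "\<forall>\<^sub>F y in at x. s y \<le> real n" by (simp add: frequently_def not_less)
    obtain k where "x \<notin> steep (\<lambda>x. - F x) (real k)" using xN by (auto simp: N_def)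
    then have "\<not> (\<exists>\<^sub>F y in at x. s y < - real k)" using st'[of "- real k"] by auto
    then have lo: "\<forall>\<^sub>F y in at x. - real k \<le> s y" by (simp add: frequently_def not_less)
    let ?L = "Liminf (at x) (\<lambda>y. ereal (s y))" and ?U = "Limsup (at x) (\<lambda>y. ereal (s y))"
    have LU: "?L \<le> ?U" by (rule Liminf_le_Limsup) simp
    have "?U \<le> ?L"
    proof (rule ccontr)
      assume "\<not> ?U \<le> ?L"
      then have "?L < ?U" by simp
      then obtain p where p: "?L < ereal (of_rat p)" "ereal (of_rat p) < ?U"
        using ereal_dense3[of ?L ?U] by blast
      then obtain q where q: "ereal (of_rat p) < ereal (of_rat q)" "ereal (of_rat q) < ?U"
        using ereal_dense3[of "ereal (of_rat p)" ?U] by blast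
      have "\<exists>\<^sub>F y in at x. s y > of_rat q"
      proof (rule ccontr)
        assume "\<not> (\<exists>\<^sub>F y in at x. s y > of_rat q)"
        then have "\<forall>\<^sub>F y in at x. ereal (s y) \<le> ereal (of_rat q)" by (simp add: frequently_def not_less)
        then have "?U \<le> ereal (of_rat q)" by (rule Limsup_bounded)
        then show False using q(2) by simp
      qed
      moreover have "\<exists>\<^sub>F y in at x. s y < of_rat p"
      proof (rule ccontr)
        assume "\<not> (\<exists>\<^sub>F y in at x. s y < of_rat p)"
        then have "\<forall>\<^sub>F y in at x. ereal (of_rat p) \<le> ereal (s y)" by (simp add: frequently_def not_less)
        then have "ereal (of_rat p) \<le> ?L" by (rule Liminf_bounded)
        then show False using p(1) by simp
      qed
      moreover have "p < q" using q(1) by (simp add: of_rat_less)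
      ultimately have "x \<in> N" using st st' unfolding N_def
        by (intro UnI2 UN_I[of p] UN_I[of q]) auto
      then show False using xN by blast
    qed
    then have eq: "?L = ?U" using LU by simp
    have "?U \<le> ereal (real n)" using up by (intro Limsup_bounded) simp
    moreover have "ereal (- real k) \<le> ?L" using lo by (intro Liminf_bounded) simp
    ultimately obtain l where l: "?U = ereal l" using eq by (cases ?U) auto
    have "((\<lambda>y. ereal (s y)) \<longlongrightarrow> ereal l) (at x)"
      by (subst tendsto_iff_Liminf_eq_Limsup) (use eq l in auto)
    then have "(s \<longlongrightarrow> l) (at x)" by simp
    then have "(F has_field_derivative l) (at x)"
      unfolding has_field_derivative_iff s_def[abs_def] .
    then show "x \<in> {0<..<1} \<and> F differentiable (at x)"
      using x by (auto simp: real_differentiable_def)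
  qed
qed

section \<open>Derivatives within the unit interval and indefinite integrals\<close>

lemma nderiv_0: "nderiv 0 f = f"
  by (simp add: nderiv_def)

lemma nderiv_Suc: "nderiv (Suc k) f x = vector_derivative (nderiv k f) (at x within {0..1})"
  by (simp add: nderiv_def)

lemma nderiv_1: "nderiv 1 f x = vector_derivative f (at x within {0..1})"
  by (simp add: nderiv_def)

lemma abs_cont_nderivE:
  assumes F: "abs_cont_on {0..1} F"
  obtains N where "negligible N"
    "\<And>x. x \<in> {0..1} - N \<Longrightarrow> x \<in> {0<..<1} \<and> (F has_vector_derivative nderiv 1 F x) (at x within {0..1})"
proof -
  obtain N where N: "negligible N" "\<And>x. x \<in> {0..1} - N \<Longrightarrow> x \<in> {0<..<1} \<and> F differentiable (at x)"
    using abs_cont_differentiable_ae[OF F] by blast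
  show thesis
  proof (rule that[OF N(1)])
    fix x assume x: "x \<in> {0..1} - N"
    then have "F differentiable (at x within {0..1})"
      using N(2) differentiable_at_withinI by blast
    then show "x \<in> {0<..<1} \<and> (F has_vector_derivative nderiv 1 F x) (at x within {0..1})"
      unfolding nderiv_1 vector_derivative_works[symmetric] using N(2)[OF x] by blast
  qed
qed

lemma abs_cont_has_integral:
  assumes F: "abs_cont_on {0..1} F" and ab: "0 \<le> a" "a \<le> b" "b \<le> 1"
  shows "(nderiv 1 F has_integral F b - F a) {a..b}"
proof -
  obtain N where N: "negligible N"
    "\<And>x. x \<in> {0..1} - N \<Longrightarrow> x \<in> {0<..<1} \<and> (F has_vector_derivative nderiv 1 F x) (at x within {0..1})"
    using abs_cont_nderivE[OF F] by blast
  have sub: "{a..b} \<subseteq> {0..1}" using ab by auto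
  show ?thesis
  proof (rule abs_cont_FTC[OF abs_cont_on_subset[OF F sub] N(1) ab(2)])
    fix x assume "x \<in> {a..b} - N"
    then have "(F has_vector_derivative nderiv 1 F x) (at x within {0..1})" using N(2) sub by blast
    then show "(F has_vector_derivative nderiv 1 F x) (at x within {a..b})"
      using has_vector_derivative_within_subset sub by blast
  qed
qed

text \<open>On a piece shorter than the modulus \<open>d\<close> the increments of \<open>F\<close>
  over any division sum to less than 1. These increments are the integrals of the derivative, so its
  indefinite integral has bounded variation there, which gives absolute integrability. Finitely many
  such pieces cover the unit interval.\<close>

lemma abs_cont_nderiv_absolutely_integrable:
  assumes F: "abs_cont_on {0..1} F"
  shows "nderiv 1 F absolutely_integrable_on {0..1}"
proof -
  obtain d where d: "d > 0" and D: "\<And>p S. p division_of S \<Longrightarrow> S \<subseteq> {0..1} \<Longrightarrow> (\<Sum>K\<in>p. content K) < d \<Longrightarrow>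
       (\<Sum>K\<in>p. \<bar>F (Sup K) - F (Inf K)\<bar>) < 1"
    using abs_cont_on_divisionD[OF F, of 1] by auto
  obtain n where n: "1 / real (Suc n) < d" using nat_approx_posE[OF d] by blast
  define N where "N = Suc n"
  have N: "N > 0" "1 / real N < d" using n by (auto simp: N_def)
  have loc: "nderiv 1 F absolutely_integrable_on {real k / real N..real (Suc k) / real N}" if "k < N" for k
  proof -
    let ?a = "real k / real N" and ?b = "real (Suc k) / real N"
    have ab: "0 \<le> ?a" "?a \<le> ?b" "?b \<le> 1" "?b - ?a < d"
      using that N by (auto simp: field_simps)
    have "nderiv 1 F absolutely_integrable_on cbox ?a ?b"
    proof (rule bounded_variation_absolutely_integrable_interval)
      show "nderiv 1 F integrable_on cbox ?a ?b"
        using abs_cont_has_integral[OF F ab(1-3)] by (auto simp: integrable_on_def)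
      fix p assume p: "p division_of cbox ?a ?b"
      have "(\<Sum>K\<in>p. norm (integral K (nderiv 1 F))) = (\<Sum>K\<in>p. \<bar>F (Sup K) - F (Inf K)\<bar>)"
      proof (intro sum.cong refl)
        fix K assume K: "K \<in> p"
        obtain u v where uv: "K = cbox u v" using division_ofD(4)[OF p K] by blast
        have "K \<noteq> {}" "K \<subseteq> cbox ?a ?b" using division_ofD(2,3)[OF p K] by auto
        then have le: "u \<le> v" "?a \<le> u" "v \<le> ?b" using uv by auto
        then have "(nderiv 1 F has_integral F v - F u) K"
          using abs_cont_has_integral[OF F, of u v] ab uv by simp
        then show "norm (integral K (nderiv 1 F)) = \<bar>F (Sup K) - F (Inf K)\<bar>"
          using uv le by (simp add: integral_unique)
      qed
      also have "\<dots> < 1"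
      proof (rule D[OF p])
        show "cbox ?a ?b \<subseteq> {0..1}" using ab by auto
        show "(\<Sum>K\<in>p. content K) < d" using additive_content_division[OF p] ab by simp
      qed
      finally show "(\<Sum>K\<in>p. norm (integral K (nderiv 1 F))) \<le> 1" by simp
    qed
    then show ?thesis by simp
  qed
  have "set_integrable lebesgue (\<Union>k\<in>{..<N}. {real k / real N..real (Suc k) / real N}) (nderiv 1 F)"
    by (rule set_integrable_UN) (use loc in auto)
  moreover have "{0..1} \<subseteq> (\<Union>k\<in>{..<N}. {real k / real N..real (Suc k) / real N})"
  proof
    fix x :: real assume x: "x \<in> {0..1}"
    show "x \<in> (\<Union>k\<in>{..<N}. {real k / real N..real (Suc k) / real N})"
    proof (cases "x = 1")
      case True
      then have "x \<in> {real n / real N..real (Suc n) / real N}" by (simp add: N_def field_simps)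
      then show ?thesis by (auto simp: N_def)
    next
      case False
      define k where "k = nat \<lfloor>x * real N\<rfloor>"
      have k: "real k \<le> x * real N" "x * real N < real k + 1"
        using x by (auto simp: k_def)
      have "x * real N < 1 * real N" using x False N by (intro mult_strict_right_mono) auto
      then have "real k < real N" using k by linarith
      then have "k < N" by simp
      moreover have "x \<in> {real k / real N..real (Suc k) / real N}" using k N by (simp add: field_simps)
      ultimately show ?thesis by blast
    qed
  qed
  ultimately show ?thesis by (intro set_integrable_subset[of lebesgue "\<Union>k\<in>{..<N}. {real k / real N..real (Suc k) / real N}" _ "{0..1}"]) simp_all
qed

text \<open>Truncation: \<bar>g\<bar> is at most \<open>r + n\<close>, where the integral of
  \<open>r\<close> is below \<open>e / 2\<close> by dominated convergence. Over intervals of total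
  length below e / (2 (n + 1)) the constant part contributes at most another
  \<open>e / 2\<close>.\<close>

lemma indefinite_integral_abs_cont:
  fixes g :: "real \<Rightarrow> real"
  assumes g: "g absolutely_integrable_on {0..1}"
  shows "abs_cont_on {0..1} (\<lambda>x. integral {0..x} g)"
proof (rule abs_cont_onI)
  fix e :: real assume "e > 0"
  define h where "h n x = min \<bar>g x\<bar> (real n)" for n x
  have gi: "(\<lambda>x. \<bar>g x\<bar>) absolutely_integrable_on {0..1}"
    using absolutely_integrable_norm[OF g] by (simp add: o_def)
  then have gi': "(\<lambda>x. \<bar>g x\<bar>) integrable_on {0..1}" by (rule set_lebesgue_integral_eq_integral(1))
  have hi: "h n integrable_on {0..1}" for n
  proof -
    have "(\<lambda>x. min \<bar>g x\<bar> (real n)) absolutely_integrable_on {0..1}"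
      by (intro absolutely_integrable_min_1 gi absolutely_integrable_on_const) auto
    then show ?thesis unfolding h_def by (rule set_lebesgue_integral_eq_integral(1))
  qed
  have "(\<lambda>n. integral {0..1} (h n)) \<longlonglongrightarrow> integral {0..1} (\<lambda>x. \<bar>g x\<bar>)"
  proof (rule dominated_convergence(2)[OF hi gi'])
    show "norm (h n x) \<le> \<bar>g x\<bar>" for n x by (simp add: h_def)
    fix x :: real
    obtain m :: nat where m: "\<bar>g x\<bar> \<le> real m" using real_arch_simple by blast
    have "\<forall>\<^sub>F n in sequentially. h n x = \<bar>g x\<bar>"
      unfolding eventually_sequentially h_def using m by (intro exI[of _ m]) auto
    then show "(\<lambda>n. h n x) \<longlonglongrightarrow> \<bar>g x\<bar>" by (rule tendsto_eventually)
  qed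
  then have "\<forall>\<^sub>F n in sequentially. integral {0..1} (\<lambda>x. \<bar>g x\<bar>) - e / 2 < integral {0..1} (h n)"
    by (rule order_tendstoD(1)) (use \<open>e > 0\<close> in simp)
  then obtain n where n: "integral {0..1} (\<lambda>x. \<bar>g x\<bar>) - integral {0..1} (h n) < e / 2"
    unfolding eventually_sequentially by (metis order_refl diff_less_eq less_diff_eq add.commute)
  define r where "r x = \<bar>g x\<bar> - h n x" for x
  have r: "r integrable_on {0..1}" "\<And>x. r x \<ge> 0" "integral {0..1} r < e / 2" "\<And>x. \<bar>g x\<bar> \<le> r x + real n"
  proof -
    show "r integrable_on {0..1}" unfolding r_def by (intro integrable_diff gi' hi)
    show "integral {0..1} r < e / 2" unfolding r_def using n integral_diff[OF gi' hi[of n]] by simp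
  qed (auto simp: r_def h_def)
  define d where "d = e / (2 * real (Suc n))"
  have d: "d > 0" "real n * d \<le> e / 2" using \<open>e > 0\<close> by (auto simp: d_def field_simps)
  show "\<exists>d>0. \<forall>D. finite D \<longrightarrow> (\<forall>u v. (u, v) \<in> D \<longrightarrow> u < v \<and> {u..v} \<subseteq> {0..1}) \<longrightarrow>
        disjoint_family_on (\<lambda>(u, v). {u<..<v}) D \<longrightarrow> (\<Sum>(u, v)\<in>D. v - u) < d
        \<longrightarrow> (\<Sum>(u, v)\<in>D. \<bar>integral {0..v} g - integral {0..u} g\<bar>) < e"
  proof (rule exI[of _ d], intro conjI d(1) allI impI)
    fix D :: "(real \<times> real) set"
    assume D: "finite D" "\<forall>u v. (u, v) \<in> D \<longrightarrow> u < v \<and> {u..v} \<subseteq> {0..1}"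
      "disjoint_family_on (\<lambda>(u, v). {u<..<v}) D" "(\<Sum>(u, v)\<in>D. v - u) < d"
    have iv: "0 \<le> fst i \<and> fst i < snd i \<and> snd i \<le> 1" if "i \<in> D" for i
    proof -
      have "(fst i, snd i) \<in> D" using that by simp
      then have "fst i < snd i \<and> {fst i..snd i} \<subseteq> {0..1}" using D(2) by blast
      then show ?thesis by auto
    qed
    have ri: "(r has_integral integral {fst i..snd i} r) {fst i..snd i}" if "i \<in> D" for i
      using iv[OF that] r(1) by (intro integrable_integral integrable_on_subinterval[OF r(1)]) auto
    have "(r has_integral (\<Sum>i\<in>D. integral {fst i..snd i} r)) (\<Union>i\<in>D. {fst i..snd i})"
    proof (rule has_integral_UN[OF D(1) ri])
      show "pairwise (\<lambda>i j. negligible ({fst i..snd i} \<inter> {fst j..snd j})) D"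
        unfolding pairwise_def
      proof (intro ballI impI)
        fix i j assume ij: "i \<in> D" "j \<in> D" "i \<noteq> j"
        have "{fst i<..<snd i} \<inter> {fst j<..<snd j} = {}"
          using D(3) ij unfolding disjoint_family_on_def case_prod_unfold by blast
        then have emp: "{max (fst i) (fst j)<..<min (snd i) (snd j)} = {}" by auto
        have "{fst i..snd i} \<inter> {fst j..snd j} = {max (fst i) (fst j)..min (snd i) (snd j)}" by auto
        also have "\<dots> \<subseteq> {max (fst i) (fst j)}" using emp by auto
        finally show "negligible ({fst i..snd i} \<inter> {fst j..snd j})"
          by (rule negligible_subset[rotated]) simp
      qed
    qed
    then have rU: "r integrable_on (\<Union>i\<in>D. {fst i..snd i})"
       "integral (\<Union>i\<in>D. {fst i..snd i}) r = (\<Sum>i\<in>D. integral {fst i..snd i} r)"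
      by (auto simp: has_integral_iff)
    have "(\<Sum>i\<in>D. integral {fst i..snd i} r) \<le> integral {0..1} r"
      unfolding rU(2)[symmetric]
    proof (rule integral_subset_le[OF _ rU(1) r(1)])
      show "(\<Union>i\<in>D. {fst i..snd i}) \<subseteq> {0..1}" using iv by fastforce
    qed (use r(2) in auto)
    then have rs: "(\<Sum>i\<in>D. integral {fst i..snd i} r) < e / 2" using r(3) by simp
    have each: "\<bar>integral {0..snd i} g - integral {0..fst i} g\<bar> \<le> integral {fst i..snd i} r + real n * (snd i - fst i)"
      if "i \<in> D" for i
    proof -
      have i: "0 \<le> fst i" "fst i \<le> snd i" "snd i \<le> 1" using iv[OF that] by auto
      have gint: "g integrable_on {0..1}" using g by (rule set_lebesgue_integral_eq_integral(1))
      have "g integrable_on {0..snd i}" by (rule integrable_on_subinterval[OF gint]) (use i in auto)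
      from Henstock_Kurzweil_Integration.integral_combine[OF i(1,2) this]
      have "integral {0..snd i} g - integral {0..fst i} g = integral {fst i..snd i} g" by simp
      also have "\<bar>\<dots>\<bar> \<le> integral {fst i..snd i} (\<lambda>x. r x + real n)"
      proof -
        have 1: "g integrable_on {fst i..snd i}" by (rule integrable_on_subinterval[OF gint]) (use i in auto)
        have 2: "r integrable_on {fst i..snd i}" by (rule integrable_on_subinterval[OF r(1)]) (use i in auto)
        have "norm (integral {fst i..snd i} g) \<le> integral {fst i..snd i} (\<lambda>x. r x + real n)"
          by (rule integral_norm_bound_integral[OF 1]) (use 2 r(4) in \<open>auto intro!: integrable_add\<close>)
        then show ?thesis by simp
      qed
      also have "\<dots> = integral {fst i..snd i} r + real n * (snd i - fst i)"
        using ri[OF that] i by (subst integral_add) (auto simp: has_integral_iff)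
      finally show ?thesis .
    qed
    have "(\<Sum>i\<in>D. \<bar>integral {0..snd i} g - integral {0..fst i} g\<bar>) \<le> (\<Sum>i\<in>D. integral {fst i..snd i} r + real n * (snd i - fst i))"
      by (intro sum_mono each)
    also have "\<dots> = (\<Sum>i\<in>D. integral {fst i..snd i} r) + real n * (\<Sum>i\<in>D. snd i - fst i)"
      by (simp add: sum.distrib sum_distrib_left)
    also have "\<dots> < e / 2 + e / 2"
    proof (rule add_less_le_mono[OF rs])
      have "real n * (\<Sum>i\<in>D. snd i - fst i) \<le> real n * d"
        using D(4) by (intro mult_left_mono) (auto simp: case_prod_unfold)
      then show "real n * (\<Sum>i\<in>D. snd i - fst i) \<le> e / 2" using d(2) by simp
    qed
    finally show "(\<Sum>(u, v)\<in>D. \<bar>integral {0..v} g - integral {0..u} g\<bar>) < e"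
      by (simp add: case_prod_unfold)
  qed
qed

text \<open>The integral of \<open>w\<close>, extended by 0, vanishes over all intervals, hence over
  all Borel sets by induction over complements and disjoint unions, and hence over all Lebesgue
  sets, which are Borel up to null sets. A density with this property is 0 almost
  everywhere.\<close>

lemma negligible_nonzero_if_integrals_zero:
  fixes w :: "real \<Rightarrow> real"
  assumes w: "w absolutely_integrable_on {0..1}" and zero: "\<And>x. x \<in> {0..1} \<Longrightarrow> integral {0..x} w = 0"
  obtains N where "negligible N" "\<And>x. x \<in> {0..1} - N \<Longrightarrow> w x = 0"
proof -
  define f where "f x = indicator {0..1} x * w x" for x :: real
  have f: "integrable lebesgue f" using w unfolding set_integrable_def f_def by simp
  have sf: "set_integrable lebesgue A f" if "A \<in> sets lebesgue" for A
    using that f unfolding set_integrable_def by (rule integrable_mult_indicator)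
  have wint: "w integrable_on {0..1}" using w by (rule set_lebesgue_integral_eq_integral(1))
  have wab: "integral {a..b} w = 0" if "0 \<le> a" "a \<le> b" "b \<le> 1" for a b
  proof -
    have "w integrable_on {0..b}" by (rule integrable_on_subinterval[OF wint]) (use that in auto)
    from Henstock_Kurzweil_Integration.integral_combine[OF that(1,2) this] show ?thesis using zero[of a] zero[of b] that by simp
  qed
  have fab: "(LINT x:{a..b}|lebesgue. f x) = 0" for a b
  proof (cases "max 0 a \<le> min 1 b")
    case True
    have "(LINT x:{a..b}|lebesgue. f x) = (LINT x:{max 0 a..min 1 b}|lebesgue. w x)"
      unfolding set_lebesgue_integral_def f_def
      by (intro Bochner_Integration.integral_cong refl) (auto simp: indicator_def)
    also have "\<dots> = integral {max 0 a..min 1 b} w"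
      by (rule set_lebesgue_integral_eq_integral(2), rule set_integrable_subset[OF w]) auto
    also have "\<dots> = 0" using True by (intro wab) auto
    finally show ?thesis .
  next
    case False
    then have "indicator {a..b} x *\<^sub>R f x = 0" for x by (auto simp: f_def indicator_def)
    then show ?thesis unfolding set_lebesgue_integral_def by (simp only: Bochner_Integration.integral_zero)
  qed
  have tot: "integral\<^sup>L lebesgue f = 0"
  proof -
    have "integral\<^sup>L lebesgue f = (LINT x:{0..1}|lebesgue. f x)"
      unfolding set_lebesgue_integral_def f_def
      by (intro Bochner_Integration.integral_cong refl) (auto simp: indicator_def)
    then show ?thesis using fab by simp
  qed
  have bor: "(LINT x:A|lebesgue. f x) = 0" if "A \<in> sets borel" for A
    using that
  proof (induction A rule: borel_set_induct)
    case empty then show ?case by (simp add: set_lebesgue_integral_def)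
  next
    case (interval a b) show ?case by (rule fab)
  next
    case (compl A)
    have A: "A \<in> sets lebesgue" using compl(1) by simp
    have "(LINT x:A \<union> - A|lebesgue. f x) = (LINT x:A|lebesgue. f x) + (LINT x:-A|lebesgue. f x)"
    proof (rule set_integral_Un)
      have "- A \<in> sets lebesgue" using compl(1) by (intro sets_completionI_sets) auto
      then show "set_integrable lebesgue (- A) f" by (rule sf)
    qed (use sf[OF A] in auto)
    moreover have "A \<union> - A = UNIV" by auto
    ultimately show ?case using compl(2) tot by (simp add: set_lebesgue_integral_def)
  next
    case (union A)
    have A: "A i \<in> sets lebesgue" for i using union(2) by simp
    have "(LINT x:(\<Union>i. A i)|lebesgue. f x) = (\<Sum>i. (LINT x:(A i)|lebesgue. f x))"
      by (rule lebesgue_integral_countable_add[OF A])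
        (use union(1) A in \<open>auto simp: disjoint_family_on_def intro!: sf\<close>)
    then show ?case using union(3) by simp
  qed
  have "(LINT x:A|lebesgue. f x) = (LINT x:A|lebesgue. (0::real))" if A: "A \<in> sets lebesgue" for A
  proof -
    obtain S N N' where SN: "A = S \<union> N" "N \<subseteq> N'" "N' \<in> null_sets lborel" "S \<in> sets lborel"
      using A by (rule sets_completionE)
    have "N' \<in> null_sets lebesgue" using SN(3) by (rule null_sets_completionI)
    then have "AE x in lebesgue. x \<notin> N'" by (rule AE_not_in)
    then have "AE x in lebesgue. indicator A x *\<^sub>R f x = indicator S x *\<^sub>R f x"
      by (rule AE_mp) (use SN in \<open>auto simp: indicator_def\<close>)
    then have "(LINT x:A|lebesgue. f x) = (LINT x:S|lebesgue. f x)"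
      unfolding set_lebesgue_integral_def
      by (intro integral_cong_AE) (use SN A sf[OF A] sf[of S] in \<open>auto simp: set_integrable_def\<close>)
    then show ?thesis using bor SN by (simp add: set_lebesgue_integral_def)
  qed
  then have "AE x in lebesgue. f x = 0"
    by (intro density_unique_real f) auto
  then obtain N where N: "{x \<in> space lebesgue. \<not> f x = 0} \<subseteq> N" "N \<in> null_sets lebesgue"
    unfolding eventually_ae_filter by blast
  show thesis
  proof (rule that)
    show "negligible N" using N by (simp add: negligible_iff_null_sets)
    show "w x = 0" if "x \<in> {0..1} - N" for x
    proof -
      have "f x = 0" using N(1) that by auto
      then show ?thesis using that by (simp add: f_def)
    qed
  qed
qed

text \<open>Both \<open>nderiv 1 F\<close> and \<open>g\<close> integrate to the increments of
  \<open>F\<close>, so the indefinite integral of their difference vanishes.\<close>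

lemma indefinite_integral_nderivE:
  fixes g :: "real \<Rightarrow> real"
  assumes g: "g absolutely_integrable_on {0..1}"
    and F: "\<And>x. x \<in> {0..1} \<Longrightarrow> F x = F 0 + integral {0..x} g"
  shows "abs_cont_on {0..1} F"
    and "\<exists>N. negligible N \<and> (\<forall>x\<in>{0..1} - N. nderiv 1 F x = g x)"
proof -
  have "abs_cont_on {0..1} (\<lambda>x. F 0 + integral {0..x} g)"
    using indefinite_integral_abs_cont[OF g] unfolding abs_cont_on_def by simp
  then show ac: "abs_cont_on {0..1} F"
    by (rule abs_cont_on_cong[rotated]) (erule F[symmetric])
  define w where "w x = nderiv 1 F x - g x" for x
  have w: "w absolutely_integrable_on {0..1}" unfolding w_def
    by (intro set_integral_diff abs_cont_nderiv_absolutely_integrable[OF ac] g)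
  have gint: "g integrable_on {0..1}" using g by (rule set_lebesgue_integral_eq_integral(1))
  have "integral {0..x} w = 0" if x: "x \<in> {0..1}" for x
  proof -
    have 1: "(nderiv 1 F has_integral F x - F 0) {0..x}" using x by (intro abs_cont_has_integral[OF ac]) auto
    have 2: "(g has_integral integral {0..x} g) {0..x}"
      by (intro integrable_integral integrable_on_subinterval[OF gint]) (use x in auto)
    from has_integral_diff[OF 1 2] show ?thesis
      unfolding w_def using F[OF x] by (simp add: integral_unique)
  qed
  then obtain N where "negligible N" "\<And>x. x \<in> {0..1} - N \<Longrightarrow> w x = 0"
    using negligible_nonzero_if_integrals_zero[OF w] by blast
  then show "\<exists>N. negligible N \<and> (\<forall>x\<in>{0..1} - N. nderiv 1 F x = g x)"
    by (intro exI[of _ N]) (auto simp: w_def)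
qed

section \<open>Sobolev functions\<close>

text \<open>Square integrability on the unit interval. The first clause supplies the measurability
  of \<open>g\<close>, which integrability of the square alone does not give.\<close>

definition sq_int :: "(real \<Rightarrow> real) \<Rightarrow> bool" where
  "sq_int g \<longleftrightarrow> g absolutely_integrable_on {0..1} \<and> (\<lambda>x. (g x)\<^sup>2) absolutely_integrable_on {0..1}"

lemma absolutely_integrable_imp_set_borel_measurable:
  "g absolutely_integrable_on {0..1} \<Longrightarrow> set_borel_measurable lebesgue {0..1} (g :: real \<Rightarrow> real)"
  unfolding set_integrable_def set_borel_measurable_def by (rule borel_measurable_integrable)

lemma sq_int_mult:
  assumes "sq_int f" "sq_int g"
  shows "(\<lambda>x. f x * g x) absolutely_integrable_on {0..1}"
proof (rule set_integrable_bound)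
  show "(\<lambda>x. (f x)\<^sup>2 + (g x)\<^sup>2) absolutely_integrable_on {0..1}"
    using assms unfolding sq_int_def by (intro set_integral_add) auto
  have "(\<lambda>x. (indicator {0..1} x *\<^sub>R f x) * (indicator {0..1} x *\<^sub>R g x)) \<in> borel_measurable lebesgue"
    using assms[unfolded sq_int_def, THEN conjunct1, THEN absolutely_integrable_imp_set_borel_measurable] unfolding set_borel_measurable_def by (intro borel_measurable_times)
  moreover have "(\<lambda>x. (indicator {0..1} x *\<^sub>R f x) * (indicator {0..1} x *\<^sub>R g x)) = (\<lambda>x. indicator {0..1} x *\<^sub>R (f x * g x))"
    by (rule ext) (simp add: indicator_def)
  ultimately show "set_borel_measurable lebesgue {0..1} (\<lambda>x. f x * g x)"
    unfolding set_borel_measurable_def by metis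
  have "\<bar>f x * g x\<bar> \<le> (f x)\<^sup>2 + (g x)\<^sup>2" for x
  proof -
    have "2 * (\<bar>f x\<bar> * \<bar>g x\<bar>) \<le> \<bar>f x\<bar>\<^sup>2 + \<bar>g x\<bar>\<^sup>2" using sum_squares_bound[of "\<bar>f x\<bar>" "\<bar>g x\<bar>"] by simp
    moreover have "0 \<le> \<bar>f x\<bar> * \<bar>g x\<bar>" by simp
    ultimately have "\<bar>f x\<bar> * \<bar>g x\<bar> \<le> (f x)\<^sup>2 + (g x)\<^sup>2" unfolding power2_abs by linarith
    then show ?thesis by (simp add: abs_mult)
  qed
  then show "AE x in lebesgue. x \<in> {0..1} \<longrightarrow> norm (f x * g x) \<le> norm ((f x)\<^sup>2 + (g x)\<^sup>2)" by simp
qed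

lemma sq_int_const_mult:
  assumes f: "sq_int f" shows "sq_int (\<lambda>x. c * f x)"
proof -
  have "(\<lambda>x. c\<^sup>2 * (f x)\<^sup>2) absolutely_integrable_on {0..1}"
    using f unfolding sq_int_def by (intro set_integrable_mult_right) auto
  then show ?thesis
    using f unfolding sq_int_def by (simp add: power_mult_distrib set_integrable_mult_right)
qed

lemma sq_int_add:
  assumes f: "sq_int f" and g: "sq_int g"
  shows "sq_int (\<lambda>x. f x + g x)"
proof -
  have "(\<lambda>x. (f x)\<^sup>2 + 2 * (f x * g x) + (g x)\<^sup>2) absolutely_integrable_on {0..1}"
    by (intro set_integral_add set_integrable_mult_right sq_int_mult f g)
      (use f g in \<open>auto simp: sq_int_def\<close>)
  moreover have "(f x)\<^sup>2 + 2 * (f x * g x) + (g x)\<^sup>2 = (f x + g x)\<^sup>2" for x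
    by (simp add: power2_eq_square algebra_simps)
  ultimately show ?thesis using f g by (simp add: sq_int_def set_integral_add)
qed

lemma sq_int_diff: "sq_int f \<Longrightarrow> sq_int g \<Longrightarrow> sq_int (\<lambda>x. f x - g x)"
  using sq_int_add[of f "\<lambda>x. (-1) * g x"] sq_int_const_mult[of g "-1"] by simp

lemma sq_int_sum:
  assumes "\<And>i. i \<in> I \<Longrightarrow> sq_int (f i)" shows "sq_int (\<lambda>x. \<Sum>i\<in>I. f i x)"
  using assms
proof (induction I rule: infinite_finite_induct)
  case (insert i I) then show ?case by (simp add: sq_int_add)
qed (auto simp: sq_int_def set_borel_measurable_def)

lemma sq_int_continuous:
  assumes "continuous_on {0..1} f"
  shows "sq_int f"
proof -
  have "f absolutely_integrable_on {0..1}" using assms by (rule absolutely_integrable_continuous_real)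
  moreover have "(\<lambda>x. (f x)\<^sup>2) absolutely_integrable_on {0..1}"
    using assms by (intro absolutely_integrable_continuous_real continuous_intros)
  ultimately show ?thesis using absolutely_integrable_imp_set_borel_measurable by (simp add: sq_int_def)
qed

lemma sq_int_absolutely_integrable:
  assumes "sq_int f" shows "f absolutely_integrable_on {0..1}"
  using sq_int_mult[OF assms sq_int_continuous[of "\<lambda>_. 1"]] by simp

lemma sq_int_integrable: "sq_int f \<Longrightarrow> f integrable_on {0..1}"
  using sq_int_absolutely_integrable set_lebesgue_integral_eq_integral(1) by blast

lemma sq_int_mult_integrable: "sq_int f \<Longrightarrow> sq_int g \<Longrightarrow> (\<lambda>x. f x * g x) integrable_on {0..1}"
  using sq_int_mult set_lebesgue_integral_eq_integral(1) by blast

lemma sq_int_cong_ae: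
  assumes f: "sq_int f" and N: "negligible N" and eq: "\<And>x. x \<in> {0..1} - N \<Longrightarrow> g x = f x"
  shows "sq_int g"
  unfolding sq_int_def
proof
  show "g absolutely_integrable_on {0..1}"
    using f unfolding sq_int_def by (intro absolutely_integrable_spike[OF _ N eq]) auto
  show "(\<lambda>x. (g x)\<^sup>2) absolutely_integrable_on {0..1}"
    by (rule absolutely_integrable_spike[OF _ N, where f="\<lambda>x. (f x)\<^sup>2"]) (use f eq in \<open>auto simp: sq_int_def\<close>)
qed

section \<open>The inner product and chains of derivatives\<close>

lemma inner2_eq_integral:
  "sq_int f \<Longrightarrow> sq_int g \<Longrightarrow> inner2 f g = integral {0..1} (\<lambda>x. f x * g x)"
  unfolding inner2_def by (intro set_lebesgue_integral_eq_integral sq_int_mult)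

lemma inner2_commute: "inner2 f g = inner2 g f"
  by (simp add: inner2_def mult.commute)

lemma inner2_add_left:
  assumes "sq_int f" "sq_int g" "sq_int h"
  shows "inner2 (\<lambda>x. f x + g x) h = inner2 f h + inner2 g h"
  using set_integral_add(2)[OF sq_int_mult[OF assms(1,3)] sq_int_mult[OF assms(2,3)]]
  by (simp add: inner2_def distrib_right)

lemma inner2_mult_left: "inner2 (\<lambda>x. c * f x) h = c * inner2 f h"
  unfolding inner2_def by (simp add: mult.assoc)

lemma inner2_self_nonneg: "inner2 f f \<ge> 0"
  unfolding inner2_def set_lebesgue_integral_def by (rule Bochner_Integration.integral_nonneg) simp

lemma inner2_cong_ae:
  assumes "sq_int f" "sq_int g" and N: "negligible N"
    and f': "\<And>x. x \<in> {0..1} - N \<Longrightarrow> f' x = f x" and g': "\<And>x. x \<in> {0..1} - N \<Longrightarrow> g' x = g x"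
  shows "inner2 f' g' = inner2 f g"
proof -
  have s: "sq_int f'" "sq_int g'"
    using sq_int_cong_ae[OF assms(1) N f'] sq_int_cong_ae[OF assms(2) N g'] by auto
  show ?thesis
    unfolding inner2_eq_integral[OF assms(1,2)] inner2_eq_integral[OF s]
    by (rule integral_spike[OF N]) (use f' g' in auto)
qed

text \<open>A chain of derivatives of \<open>f\<close> linked by integration. Chains can be added
  and scaled pointwise, whereas \<open>nderiv\<close> of a sum is known only where the derivatives
  exist; membership in \<open>sobolev2\<close> is therefore proved by exhibiting a chain.\<close>

definition sobrep :: "nat \<Rightarrow> (real \<Rightarrow> real) \<Rightarrow> (nat \<Rightarrow> real \<Rightarrow> real) \<Rightarrow> bool" where
  "sobrep m f D \<longleftrightarrow> (\<forall>x\<in>{0..1}. D 0 x = f x) \<and>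
     (\<forall>k<m. sq_int (D (Suc k)) \<and> (\<forall>x\<in>{0..1}. D k x = D k 0 + integral {0..x} (D (Suc k))))"

lemma sobrepD:
  assumes "sobrep m f D"
  shows "x \<in> {0..1} \<Longrightarrow> D 0 x = f x" "k < m \<Longrightarrow> sq_int (D (Suc k))"
    "k < m \<Longrightarrow> x \<in> {0..1} \<Longrightarrow> D k x = D k 0 + integral {0..x} (D (Suc k))"
  using assms unfolding sobrep_def by blast+

lemma sobrep_abs_cont:
  assumes "sobrep m f D" "k < m"
  shows "abs_cont_on {0..1} (D k)"
  by (rule indefinite_integral_nderivE(1)[OF sq_int_absolutely_integrable[OF sobrepD(2)[OF assms]] sobrepD(3)[OF assms]])

lemma sobrep_continuous_on:
  assumes "sobrep m f D" "k < m"
  shows "continuous_on {0..1} (D k)"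
  by (rule abs_cont_on_imp_continuous_on[OF sobrep_abs_cont[OF assms]])

lemma sobrep_sq_int:
  assumes "sobrep m f D" "k \<le> m" "m \<ge> 1"
  shows "sq_int (D k)"
proof (cases "k < m")
  case True
  then show ?thesis using sobrep_continuous_on[OF assms(1)] by (intro sq_int_continuous)
next
  case False
  then have "k = Suc (m - 1)" "m - 1 < m" using assms by auto
  then show ?thesis using sobrepD(2)[OF assms(1), of "m - 1"] by simp
qed

lemma sobolev2_abs_cont: "f \<in> sobolev2 r \<Longrightarrow> k < r \<Longrightarrow> abs_cont_on {0..1} (nderiv k f)"
  by (simp add: sobolev2_def)

lemma nderiv_1_nderiv: "nderiv 1 (nderiv k f) = nderiv (Suc k) f"
  by (rule ext) (simp only: nderiv_1 nderiv_Suc)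

lemma sobolev2_imp_sobrep:
  assumes f: "f \<in> sobolev2 m"
  shows "sobrep m f (\<lambda>k. nderiv k f)"
  unfolding sobrep_def
proof (intro conjI ballI allI impI)
  show "nderiv 0 f x = f x" for x by (simp add: nderiv_0)
  fix k assume k: "k < m"
  note ac = sobolev2_abs_cont[OF f k]
  have ai: "nderiv (Suc k) f absolutely_integrable_on {0..1}"
    using abs_cont_nderiv_absolutely_integrable[OF ac] by (simp only: nderiv_1_nderiv)
  show "sq_int (nderiv (Suc k) f)"
  proof (cases "Suc k < m")
    case True
    then show ?thesis by (intro sq_int_continuous abs_cont_on_imp_continuous_on sobolev2_abs_cont[OF f])
  next
    case False
    then have "m = Suc k" using k by simp
    then show ?thesis using f ai by (simp add: sobolev2_def sq_int_def)
  qed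
  fix x :: real assume "x \<in> {0..1}"
  then have "(nderiv 1 (nderiv k f) has_integral nderiv k f x - nderiv k f 0) {0..x}"
    by (intro abs_cont_has_integral[OF ac]) auto
  then show "nderiv k f x = nderiv k f 0 + integral {0..x} (nderiv (Suc k) f)"
    unfolding nderiv_1_nderiv by (simp add: integral_unique)
qed

lemma vector_derivative_within_unit_cong:
  assumes "\<And>y. y \<in> {0..1} \<Longrightarrow> f y = g y" "x \<in> {0..1::real}"
  shows "(f has_vector_derivative d) (at x within {0..1}) \<longleftrightarrow> (g has_vector_derivative d) (at x within {0..1})"
proof
  assume "(f has_vector_derivative d) (at x within {0..1})"
  from has_vector_derivative_transform_within[OF this zero_less_one assms(2)] assms(1)
  show "(g has_vector_derivative d) (at x within {0..1})" by blast
next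
  assume "(g has_vector_derivative d) (at x within {0..1})"
  from has_vector_derivative_transform_within[OF this zero_less_one assms(2)] assms(1)
  show "(f has_vector_derivative d) (at x within {0..1})" by force
qed

text \<open>Below the top order the integrand is itself an indefinite integral, hence continuous,
  and the derivative exists at every point.\<close>

lemma sobrep_has_vector_derivative:
  assumes D: "sobrep m f D" and k: "Suc k < m" and x: "x \<in> {0..1}"
  shows "(D k has_vector_derivative D (Suc k) x) (at x within {0..1})"
proof -
  have "((\<lambda>u. integral {0..u} (D (Suc k))) has_vector_derivative D (Suc k) x) (at x within {0..1})"
    using sobrep_continuous_on[OF D k] x by (rule integral_has_vector_derivative)
  then have "((\<lambda>u. D k 0 + integral {0..u} (D (Suc k))) has_vector_derivative D (Suc k) x) (at x within {0..1})"
    by (auto intro!: derivative_eq_intros)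
  moreover have "D k y = D k 0 + integral {0..y} (D (Suc k))" if "y \<in> {0..1}" for y
    by (rule sobrepD(3)[OF D Suc_lessD[OF k] that])
  ultimately show ?thesis
    by (intro vector_derivative_within_unit_cong[THEN iffD2, OF _ x, of "D k" "\<lambda>u. D k 0 + integral {0..u} (D (Suc k))"])
qed

lemma sobrep_nderiv:
  assumes D: "sobrep m f D"
  shows "k < m \<Longrightarrow> x \<in> {0..1} \<Longrightarrow> nderiv k f x = D k x"
proof (induction k arbitrary: x)
  case 0
  then show ?case using sobrepD(1)[OF D] by (simp add: nderiv_0)
next
  case (Suc k)
  have "(D k has_vector_derivative D (Suc k) x) (at x within {0..1})"
    using sobrep_has_vector_derivative[OF D Suc.prems] .
  then have "(nderiv k f has_vector_derivative D (Suc k) x) (at x within {0..1})"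
    using vector_derivative_within_unit_cong[of "D k" "nderiv k f"] Suc by simp
  then show ?case
    unfolding nderiv_Suc using Suc.prems vector_derivative_within_cbox[of 0 1 x "nderiv k f" "D (Suc k) x"] by simp
qed

lemma sobrep_nderiv_ae:
  assumes D: "sobrep m f D" and m: "m \<ge> 1"
  obtains N where "negligible N" "\<And>k x. k \<le> m \<Longrightarrow> x \<in> {0..1} - N \<Longrightarrow> nderiv k f x = D k x"
proof -
  obtain j where j: "m = Suc j" using m by (cases m) auto
  have sq: "sq_int (D m)" and eq: "\<And>x. x \<in> {0..1} \<Longrightarrow> D j x = D j 0 + integral {0..x} (D m)"
  proof -
    have jm: "j < m" "Suc j = m" using j by auto
    show "sq_int (D m)" using sobrepD(2)[OF D jm(1)] unfolding jm(2) .
    show "D j x = D j 0 + integral {0..x} (D m)" if "x \<in> {0..1}" for x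
      using sobrepD(3)[OF D jm(1) that] unfolding jm(2) .
  qed
  have nd: "nderiv j f x = D j x" if "x \<in> {0..1}" for x
    using sobrep_nderiv[OF D, of j] that j by simp
  have "\<exists>N. negligible N \<and> (\<forall>x\<in>{0..1} - N. nderiv 1 (nderiv j f) x = D m x)"
    proof (rule indefinite_integral_nderivE(2)[OF sq_int_absolutely_integrable[OF sq]])
    fix x :: real assume x: "x \<in> {0..1}"
    show "nderiv j f x = nderiv j f 0 + integral {0..x} (D m)"
      using eq[OF x] nd[OF x] nd[of 0] by simp
  qed
  then obtain N where N: "negligible N" "\<forall>x\<in>{0..1} - N. nderiv 1 (nderiv j f) x = D m x" by blast
  show thesis
  proof (rule that[OF N(1)])
    fix k x assume k: "k \<le> m" and x: "x \<in> {0..1} - N"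
    show "nderiv k f x = D k x"
    proof (cases "k = m")
      case True
      have "nderiv (Suc j) f x = D m x" using N(2) x unfolding nderiv_1_nderiv by blast
      then show ?thesis using True j by simp
    next
      case False
      then have "k < m" using k by simp
      then show ?thesis using sobrep_nderiv[OF D] x by blast
    qed
  qed
qed

lemma sobrep_imp_sobolev2:
  assumes D: "sobrep m f D" and m: "m \<ge> 1"
  shows "f \<in> sobolev2 m"
  unfolding sobolev2_def
proof (intro CollectI conjI allI impI)
  show "abs_cont_on {0..1} (nderiv k f)" if "k < m" for k
    by (rule abs_cont_on_cong[OF _ sobrep_abs_cont[OF D that]]) (simp add: sobrep_nderiv[OF D that])
  show "nderiv k f differentiable_on {0..1}" if k: "Suc k < m" for k
    unfolding differentiable_on_def
  proof
    fix x :: real assume x: "x \<in> {0..1}"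
    have "(D k has_vector_derivative D (Suc k) x) (at x within {0..1})"
      using sobrep_has_vector_derivative[OF D k x] .
    then have "(nderiv k f has_vector_derivative D (Suc k) x) (at x within {0..1})"
      using vector_derivative_within_unit_cong[of "D k" "nderiv k f" x] sobrep_nderiv[OF D, of k] x k by simp
    then show "nderiv k f differentiable at x within {0..1}"
      unfolding has_vector_derivative_def differentiable_def by blast
  qed
  obtain N where "negligible N" "\<And>k x. k \<le> m \<Longrightarrow> x \<in> {0..1} - N \<Longrightarrow> nderiv k f x = D k x"
    using sobrep_nderiv_ae[OF D m] by blast
  then have "sq_int (nderiv m f)"
    using sq_int_cong_ae[OF sobrep_sq_int[OF D order_refl m]] by blast
  then show "set_integrable lebesgue {0..1} (\<lambda>x. \<bar>nderiv m f x\<bar>\<^sup>2)" by (simp add: sq_int_def)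
qed

lemma sobrep_lincomb:
  assumes F: "sobrep m f D" and G: "sobrep m g E"
  shows "sobrep m (\<lambda>x. a * f x + b * g x) (\<lambda>k x. a * D k x + b * E k x)"
  unfolding sobrep_def
proof (intro conjI ballI allI impI)
  show "a * D 0 x + b * E 0 x = a * f x + b * g x" if "x \<in> {0..1}" for x
    using sobrepD(1)[OF F] sobrepD(1)[OF G] that by simp
  fix k assume k: "k < m"
  have sq: "sq_int (D (Suc k))" "sq_int (E (Suc k))" using sobrepD(2)[OF F k] sobrepD(2)[OF G k] by auto
  then show "sq_int (\<lambda>x. a * D (Suc k) x + b * E (Suc k) x)" by (intro sq_int_add sq_int_const_mult)
  fix x :: real assume x: "x \<in> {0..1}"
  have i: "(\<lambda>x. D (Suc k) x) integrable_on {0..x}" "(\<lambda>x. E (Suc k) x) integrable_on {0..x}"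
    by (rule integrable_on_subinterval[OF sq(1)[THEN sq_int_integrable]], use x in simp)
      (rule integrable_on_subinterval[OF sq(2)[THEN sq_int_integrable]], use x in simp)
  have "integral {0..x} (\<lambda>x. a * D (Suc k) x + b * E (Suc k) x) = a * integral {0..x} (D (Suc k)) + b * integral {0..x} (E (Suc k))"
    using integral_add[OF integrable_on_cmult_left[OF i(1), of a] integrable_on_cmult_left[OF i(2), of b]] by simp
  moreover have "D k x = D k 0 + integral {0..x} (D (Suc k))" "E k x = E k 0 + integral {0..x} (E (Suc k))"
    using sobrepD(3)[OF F k x] sobrepD(3)[OF G k x] by blast+
  ultimately show "a * D k x + b * E k x = a * D k 0 + b * E k 0 + integral {0..x} (\<lambda>x. a * D (Suc k) x + b * E (Suc k) x)"
  proof -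
    assume 1: "integral {0..x} (\<lambda>x. a * D (Suc k) x + b * E (Suc k) x) = a * integral {0..x} (D (Suc k)) + b * integral {0..x} (E (Suc k))"
      and 2: "D k x = D k 0 + integral {0..x} (D (Suc k))" and 3: "E k x = E k 0 + integral {0..x} (E (Suc k))"
    show ?thesis unfolding 1 by (subst 2, subst 3) (simp add: algebra_simps)
  qed
qed

lemma sobolev2_lincomb:
  assumes "f \<in> sobolev2 m" "g \<in> sobolev2 m" "m \<ge> 1"
  shows "(\<lambda>x. a * f x + b * g x) \<in> sobolev2 m"
  by (rule sobrep_imp_sobolev2[OF sobrep_lincomb[OF assms(1,2)[THEN sobolev2_imp_sobrep]] assms(3)])

lemma sobolev2_mono:
  assumes "f \<in> sobolev2 r" "m \<le> r" "m \<ge> 1"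
  shows "f \<in> sobolev2 m"
proof (rule sobrep_imp_sobolev2[OF _ assms(3)])
  show "sobrep m f (\<lambda>k. nderiv k f)"
    using sobolev2_imp_sobrep[OF assms(1)] assms(2) unfolding sobrep_def by (meson less_le_trans)
qed

lemma sobolev2_nderiv_sq_int:
  assumes "f \<in> sobolev2 m" "k \<le> m" "m \<ge> 1"
  shows "sq_int (nderiv k f)"
  using sobrep_sq_int[OF sobolev2_imp_sobrep[OF assms(1)] assms(2,3)] .

lemma sobolev2_sq_int:
  assumes "f \<in> sobolev2 m" "m \<ge> 1"
  shows "sq_int f"
  using sobolev2_nderiv_sq_int[OF assms(1) _ assms(2), of 0] by (simp add: nderiv_0)

lemma nderiv_lincomb_ae:
  assumes "f \<in> sobolev2 m" "g \<in> sobolev2 m" "m \<ge> 1"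
  obtains N where "negligible N"
    "\<And>k x. k \<le> m \<Longrightarrow> x \<in> {0..1} - N \<Longrightarrow> nderiv k (\<lambda>x. a * f x + b * g x) x = a * nderiv k f x + b * nderiv k g x"
  using sobrep_nderiv_ae[OF sobrep_lincomb[OF assms(1,2)[THEN sobolev2_imp_sobrep]] assms(3)] by blast

lemma inner2_nderiv_lincomb:
  assumes f: "f \<in> sobolev2 m" and g: "g \<in> sobolev2 m" and h: "sq_int h" and m: "m \<ge> 1" and k: "k \<le> m"
  shows "inner2 (nderiv k (\<lambda>x. a * f x + b * g x)) h = a * inner2 (nderiv k f) h + b * inner2 (nderiv k g) h"
proof -
  obtain N where N: "negligible N"
    "\<And>k x. k \<le> m \<Longrightarrow> x \<in> {0..1} - N \<Longrightarrow> nderiv k (\<lambda>x. a * f x + b * g x) x = a * nderiv k f x + b * nderiv k g x"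
    using nderiv_lincomb_ae[OF f g m, of a b] by blast
  have sq: "sq_int (\<lambda>x. a * nderiv k f x)" "sq_int (\<lambda>x. b * nderiv k g x)"
    using sobolev2_nderiv_sq_int[OF f k m] sobolev2_nderiv_sq_int[OF g k m] by (auto intro: sq_int_const_mult)
  have "inner2 (nderiv k (\<lambda>x. a * f x + b * g x)) h = inner2 (\<lambda>x. a * nderiv k f x + b * nderiv k g x) h"
    by (rule inner2_cong_ae[OF sq_int_add[OF sq] h N(1)]) (use N(2) k in auto)
  then show ?thesis by (simp add: inner2_add_left[OF sq h] inner2_mult_left)
qed

lemma sob_inner_commute: "sob_inner m l f g = sob_inner m l g f"
  by (simp add: sob_inner_def inner2_commute)

lemma sob_inner_lincomb:
  assumes f: "f \<in> sobolev2 m" and g: "g \<in> sobolev2 m" and h: "h \<in> sobolev2 m" and m: "m \<ge> 1"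
  shows "sob_inner m l (\<lambda>x. a * f x + b * g x) h = a * sob_inner m l f h + b * sob_inner m l g h"
  using inner2_nderiv_lincomb[OF f g sobolev2_sq_int[OF h m] m, of 0 a b]
    inner2_nderiv_lincomb[OF f g sobolev2_nderiv_sq_int[OF h order_refl m] m order_refl, of a b]
  by (simp add: sob_inner_def nderiv_0 algebra_simps)

lemma sob_inner_self_nonneg: "l \<ge> 0 \<Longrightarrow> sob_inner m l f f \<ge> 0"
  by (simp add: sob_inner_def inner2_self_nonneg)

section \<open>Sobolev inequalities\<close>

lemma inner2_cauchy_schwarz:
  assumes f: "sq_int f" and g: "sq_int g"
  shows "(inner2 f g)\<^sup>2 \<le> inner2 f f * inner2 g g"
proof -
  define A where "A = inner2 f f"
  define B where "B = inner2 f g"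
  define C where "C = inner2 g g"
  have quad: "0 \<le> s\<^sup>2 * A + 2 * (s * t) * B + t\<^sup>2 * C" for s t
  proof -
    have sf: "sq_int (\<lambda>x. s * f x)" and tg: "sq_int (\<lambda>x. t * g x)" using f g by (auto intro: sq_int_const_mult)
    let ?h = "\<lambda>x. s * f x + t * g x"
    have "inner2 ?h ?h = s * inner2 f ?h + t * inner2 g ?h"
      using inner2_add_left[OF sf tg sq_int_add[OF sf tg]] by (simp only: inner2_mult_left)
    also have "inner2 f ?h = s * A + t * B"
      using inner2_add_left[OF sf tg f] unfolding inner2_commute[of f ?h] inner2_mult_left A_def B_def inner2_commute[of f g] .
    also have "inner2 g ?h = s * B + t * C"
      using inner2_add_left[OF sf tg g] unfolding inner2_commute[of g ?h] inner2_mult_left C_def B_def .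
    finally show ?thesis using inner2_self_nonneg[of ?h] by (simp add: power2_eq_square algebra_simps)
  qed
  have A0: "A \<ge> 0" "C \<ge> 0" by (simp_all add: A_def C_def inner2_self_nonneg)
  show ?thesis
  proof (cases "C = 0")
    case True
    have "B = 0"
    proof (rule ccontr)
      assume "B \<noteq> 0"
      \<comment> \<open>With C = 0 the form is affine in the second multiplier, and this value makes
        it - A - 2.\<close>
      have "0 \<le> 1\<^sup>2 * A + 2 * (1 * (- (A + 1) / B)) * B + (- (A + 1) / B)\<^sup>2 * C" by (rule quad)
      then show False using True \<open>B \<noteq> 0\<close> A0 by simp
    qed
    then show ?thesis using True by (simp add: B_def[symmetric] C_def[symmetric])
  next
    case False
    then have "C > 0" using A0 by simp
    have "0 \<le> C\<^sup>2 * A + 2 * (C * (- B)) * B + (- B)\<^sup>2 * C" by (rule quad)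
    then have "0 \<le> C * (A * C - B\<^sup>2)" by (simp add: power2_eq_square algebra_simps)
    then have "0 \<le> A * C - B\<^sup>2" using \<open>C > 0\<close> by (simp add: zero_le_mult_iff)
    then show ?thesis by (simp add: A_def B_def C_def)
  qed
qed

lemma inner2_amgm:
  assumes f: "sq_int f" and g: "sq_int g" and "t > 0"
  shows "2 * \<bar>inner2 f g\<bar> \<le> t * inner2 f f + inner2 g g / t"
proof -
  let ?A = "inner2 f f" and ?C = "inner2 g g"
  have nn: "?A \<ge> 0" "?C \<ge> 0" by (simp_all add: inner2_self_nonneg)
  have "(2 * \<bar>inner2 f g\<bar>)\<^sup>2 \<le> 4 * ((t * ?A) * (?C / t))"
    using inner2_cauchy_schwarz[OF f g] \<open>t > 0\<close> by (simp add: power_mult_distrib)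
  also have "\<dots> \<le> (t * ?A + ?C / t)\<^sup>2"
  proof -
    have "4 * (p * q) \<le> (p + q)\<^sup>2" for p q :: real
      using zero_le_power2[of "p - q"] by (simp add: power2_eq_square algebra_simps)
    then show ?thesis .
  qed
  finally show ?thesis by (rule power2_le_imp_le) (use nn \<open>t > 0\<close> in simp)
qed

lemma abs_cont_bounded:
  assumes "abs_cont_on {0..1} F"
  obtains B where "B > 0" "\<And>x. x \<in> {0..1} \<Longrightarrow> \<bar>F x\<bar> \<le> B"
proof -
  have "compact (F ` {0..1})"
    using abs_cont_on_imp_continuous_on[OF assms] by (intro compact_continuous_image) auto
  then obtain B where "B > 0" "\<forall>y\<in>F ` {0..1}. norm y \<le> B" using compact_imp_bounded bounded_pos by metis
  then show thesis using that by (metis imageI real_norm_def)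
qed

lemma abs_cont_mult:
  assumes F: "abs_cont_on {0..1} F" and G: "abs_cont_on {0..1} G"
  shows "abs_cont_on {0..1} (\<lambda>x. F x * G x)"
proof -
  obtain B1 where B1: "B1 > 0" "\<And>x. x \<in> {0..1} \<Longrightarrow> \<bar>F x\<bar> \<le> B1" using abs_cont_bounded[OF F] by blast
  obtain B2 where B2: "B2 > 0" "\<And>x. x \<in> {0..1} \<Longrightarrow> \<bar>G x\<bar> \<le> B2" using abs_cont_bounded[OF G] by blast
  show ?thesis
  proof (rule abs_cont_onI)
    fix e :: real assume "e > 0"
    then have e1: "e / (2 * B1) > 0" and e2: "e / (2 * B2) > 0" using B1 B2 by auto
    obtain d1 where d1: "d1 > 0" and D1: "\<forall>D. finite D \<longrightarrow> (\<forall>u v. (u, v) \<in> D \<longrightarrow> u < v \<and> {u..v} \<subseteq> {0..1}) \<longrightarrow>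
        disjoint_family_on (\<lambda>(u, v). {u<..<v}) D \<longrightarrow> (\<Sum>(u, v)\<in>D. v - u) < d1
        \<longrightarrow> (\<Sum>(u, v)\<in>D. \<bar>G v - G u\<bar>) < e / (2 * B1)"
      by (rule abs_cont_onE[OF G e1]) (rule that)
    obtain d2 where d2: "d2 > 0" and D2: "\<forall>D. finite D \<longrightarrow> (\<forall>u v. (u, v) \<in> D \<longrightarrow> u < v \<and> {u..v} \<subseteq> {0..1}) \<longrightarrow>
        disjoint_family_on (\<lambda>(u, v). {u<..<v}) D \<longrightarrow> (\<Sum>(u, v)\<in>D. v - u) < d2
        \<longrightarrow> (\<Sum>(u, v)\<in>D. \<bar>F v - F u\<bar>) < e / (2 * B2)"
      by (rule abs_cont_onE[OF F e2]) (rule that)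
    show "\<exists>d>0. \<forall>D. finite D \<longrightarrow> (\<forall>u v. (u, v) \<in> D \<longrightarrow> u < v \<and> {u..v} \<subseteq> {0..1}) \<longrightarrow>
        disjoint_family_on (\<lambda>(u, v). {u<..<v}) D \<longrightarrow> (\<Sum>(u, v)\<in>D. v - u) < d
        \<longrightarrow> (\<Sum>(u, v)\<in>D. \<bar>F v * G v - F u * G u\<bar>) < e"
    proof (rule exI[of _ "min d1 d2"], intro conjI allI impI)
      show "0 < min d1 d2" using d1 d2 by simp
      fix D assume D: "finite D" "\<forall>u v. (u, v) \<in> D \<longrightarrow> u < v \<and> {u..v} \<subseteq> {0..1}"
        "disjoint_family_on (\<lambda>(u, v). {u<..<v}) D" "(\<Sum>(u, v)\<in>D. v - u) < min d1 d2"
      have 1: "(\<Sum>(u, v)\<in>D. \<bar>G v - G u\<bar>) < e / (2 * B1)"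
        using D1[rule_format, OF D(1) D(2)[rule_format] D(3)] D(4) by simp
      have 2: "(\<Sum>(u, v)\<in>D. \<bar>F v - F u\<bar>) < e / (2 * B2)"
        using D2[rule_format, OF D(1) D(2)[rule_format] D(3)] D(4) by simp
      have "\<bar>F v * G v - F u * G u\<bar> \<le> B1 * \<bar>G v - G u\<bar> + B2 * \<bar>F v - F u\<bar>" if "(u, v) \<in> D" for u v
      proof -
        have uv: "u < v" "{u..v} \<subseteq> {0..1}" using D(2) that by blast+
        then have "u \<in> {0..1}" "v \<in> {0..1}" by auto
        then have "\<bar>F v\<bar> \<le> B1" "\<bar>G u\<bar> \<le> B2" using B1 B2 by auto
        have "F v * G v - F u * G u = F v * (G v - G u) + G u * (F v - F u)" by (simp add: algebra_simps)
        also have "\<bar>\<dots>\<bar> \<le> \<bar>F v\<bar> * \<bar>G v - G u\<bar> + \<bar>G u\<bar> * \<bar>F v - F u\<bar>"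
          by (metis abs_mult abs_triangle_ineq)
        also have "\<dots> \<le> B1 * \<bar>G v - G u\<bar> + B2 * \<bar>F v - F u\<bar>"
          using \<open>\<bar>F v\<bar> \<le> B1\<close> \<open>\<bar>G u\<bar> \<le> B2\<close> by (intro add_mono mult_right_mono) auto
        finally show ?thesis .
      qed
      then have "(\<Sum>(u, v)\<in>D. \<bar>F v * G v - F u * G u\<bar>) \<le> (\<Sum>(u, v)\<in>D. B1 * \<bar>G v - G u\<bar> + B2 * \<bar>F v - F u\<bar>)"
        by (intro sum_mono) auto
      also have "\<dots> = B1 * (\<Sum>(u, v)\<in>D. \<bar>G v - G u\<bar>) + B2 * (\<Sum>(u, v)\<in>D. \<bar>F v - F u\<bar>)"
        by (simp add: case_prod_unfold sum.distrib sum_distrib_left)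
      also have "\<dots> < B1 * (e / (2 * B1)) + B2 * (e / (2 * B2))"
        using 1 2 B1 B2 by (intro add_strict_mono mult_strict_left_mono) auto
      also have "\<dots> = e" using B1 B2 by simp
      finally show "(\<Sum>(u, v)\<in>D. \<bar>F v * G v - F u * G u\<bar>) < e" .
    qed
  qed
qed

lemma abs_cont_mult_deriv:
  assumes F: "abs_cont_on {0..1} F" and G: "abs_cont_on {0..1} G"
  obtains N where "negligible N"
    "\<And>x. x \<in> {0..1} - N \<Longrightarrow> ((\<lambda>x. F x * G x) has_vector_derivative (F x * nderiv 1 G x + nderiv 1 F x * G x)) (at x within {0..1})"
proof -
  obtain N1 where N1: "negligible N1"
    "\<And>x. x \<in> {0..1} - N1 \<Longrightarrow> x \<in> {0<..<1} \<and> (F has_vector_derivative nderiv 1 F x) (at x within {0..1})"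
    using abs_cont_nderivE[OF F] by blast
  obtain N2 where N2: "negligible N2"
    "\<And>x. x \<in> {0..1} - N2 \<Longrightarrow> x \<in> {0<..<1} \<and> (G has_vector_derivative nderiv 1 G x) (at x within {0..1})"
    using abs_cont_nderivE[OF G] by blast
  show thesis
  proof (rule that)
    show "negligible (N1 \<union> N2)" using N1(1) N2(1) by (rule negligible_Un)
    fix x assume "x \<in> {0..1} - (N1 \<union> N2)"
    then show "((\<lambda>x. F x * G x) has_vector_derivative (F x * nderiv 1 G x + nderiv 1 F x * G x)) (at x within {0..1})"
      using N1(2) N2(2) by (intro has_vector_derivative_mult) auto
  qed
qed

lemma abs_cont_mult_has_integral:
  assumes F: "abs_cont_on {0..1} F" and G: "abs_cont_on {0..1} G" and ab: "0 \<le> a" "a \<le> b" "b \<le> 1"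
  shows "((\<lambda>x. F x * nderiv 1 G x + nderiv 1 F x * G x) has_integral F b * G b - F a * G a) {a..b}"
proof -
  obtain N where N: "negligible N"
    "\<And>x. x \<in> {0..1} - N \<Longrightarrow> ((\<lambda>x. F x * G x) has_vector_derivative (F x * nderiv 1 G x + nderiv 1 F x * G x)) (at x within {0..1})"
    using abs_cont_mult_deriv[OF F G] by blast
  have sub: "{a..b} \<subseteq> {0..1}" using ab by auto
  show ?thesis
  proof (rule abs_cont_FTC[OF abs_cont_on_subset[OF abs_cont_mult[OF F G] sub] N(1) ab(2)])
    fix x assume "x \<in> {a..b} - N"
    then show "((\<lambda>x. F x * G x) has_vector_derivative (F x * nderiv 1 G x + nderiv 1 F x * G x)) (at x within {a..b})"
      using N(2)[of x] has_vector_derivative_within_subset[OF _ sub] sub by blast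
  qed
qed

section \<open>Pointwise values and interpolation of derivatives\<close>

text \<open>
  Integrating by parts on a window of length \<open>c\<close> with endpoint \<open>x\<close> represents \<open>F x\<close> as the inner
  product of \<open>F\<close> with \<open>wa c x\<close> plus that of \<open>F'\<close> with \<open>wk c x\<close>. The window lies on the side of \<open>x\<close>
  that keeps it inside the unit interval.
\<close>

definition win :: "real \<Rightarrow> real \<Rightarrow> real set" where
  "win c x = (if x \<le> 1/2 then {x..x + c} else {x - c..x})"

definition wa :: "real \<Rightarrow> real \<Rightarrow> real \<Rightarrow> real" where
  "wa c x s = indicator (win c x) s / c"

definition wk :: "real \<Rightarrow> real \<Rightarrow> real \<Rightarrow> real" where
  "wk c x s = indicator (win c x) s * (if x \<le> 1/2 then (s - x) / c - 1 else (s - x) / c + 1)"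

lemma abs_cont_affine: "abs_cont_on {0..1} (\<lambda>s. p * s + q)"
proof -
  have "abs_cont_on {0..1} (\<lambda>x. integral {0..x} (\<lambda>_. p))"
    by (intro indefinite_integral_abs_cont absolutely_integrable_continuous_real) auto
  moreover have "(\<lambda>s. p * s + q) x = q + integral {0..x} (\<lambda>_. p)" if "x \<in> {0..1}" for x
    using that by simp
  ultimately have "abs_cont_on {0..1} (\<lambda>x. q + integral {0..x} (\<lambda>_. p))"
    unfolding abs_cont_on_def by (simp only: add_diff_cancel_left)
  then show ?thesis by (rule abs_cont_on_cong[rotated]) simp
qed

lemma nderiv_affine: "x \<in> {0..1} \<Longrightarrow> nderiv 1 (\<lambda>s. p * s + q) x = p"
proof -
  assume x: "x \<in> {0..1}"
  have "((\<lambda>s. p * s + q) has_real_derivative p) (at x within {0..1})"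
    by (auto intro!: derivative_eq_intros)
  then have "((\<lambda>s. p * s + q) has_vector_derivative p) (at x within {0..1})"
    by (simp add: has_real_derivative_iff_has_vector_derivative)
  then show ?thesis
    unfolding nderiv_1 using x vector_derivative_within_cbox[of 0 1 x "\<lambda>s. p * s + q" p] by simp
qed

lemma window_formula:
  assumes F: "abs_cont_on {0..1} F" and F': "sq_int (nderiv 1 F)" and c: "0 < c" "c \<le> 1/2" and x: "x \<in> {0..1}"
  shows "F x = integral {0..1} (\<lambda>s. wa c x s * F s) + integral {0..1} (\<lambda>s. wk c x s * nderiv 1 F s)"
    and "sq_int (wa c x)" "sq_int (wk c x)" "inner2 (wa c x) (wa c x) = 1 / c" "inner2 (wk c x) (wk c x) \<le> c"
proof -
  define l where "l = (if x \<le> 1/2 then x else x - c)"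
  define q where "q = (if x \<le> 1/2 then - x / c - 1 else - x / c + 1)"
  have win: "win c x = {l..l + c}" "0 \<le> l" "l + c \<le> 1" "l \<le> l + c" using c x by (auto simp: win_def l_def)
  have wk: "wk c x s = indicator {l..l + c} s * (1 / c * s + q)" for s
    unfolding wk_def win(1) by (simp add: q_def diff_divide_distrib)
  have wa: "wa c x s = indicator {l..l + c} s * (1 / c)" for s
    unfolding wa_def win(1) by simp
  have int_ind: "integral {0..1} (\<lambda>s. indicator {l..l + c} s * g s) = integral {l..l + c} g" for g :: "real \<Rightarrow> real"
  proof -
    have "integral {0..1} (\<lambda>s. indicator {l..l + c} s * g s) = integral {0..1} (\<lambda>s. if s \<in> {l..l + c} then g s else 0)"
      by (rule integral_cong) (simp add: indicator_def)
    also have "\<dots> = integral {l..l + c} g"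
      using integral_restrict_Int[of "{0..1}" "{l..l + c}" g] win by (simp add: Int_absorb1 Int_absorb2)
    finally show ?thesis .
  qed
  have ai: "(\<lambda>s. indicator {l..l + c} s * g s) absolutely_integrable_on {0..1}" if "continuous_on {0..1} g" for g :: "real \<Rightarrow> real"
  proof -
    have "g absolutely_integrable_on {l..l + c}"
      using that win by (intro absolutely_integrable_continuous_real continuous_on_subset[OF that]) auto
    moreover have "(\<lambda>s. indicator {0..1} s *\<^sub>R (indicator {l..l + c} s * g s)) = (\<lambda>s. indicator {l..l + c} s *\<^sub>R g s)"
      using win by (auto simp: fun_eq_iff indicator_def)
    ultimately show ?thesis unfolding set_integrable_def by simp
  qed
  have sq: "sq_int (\<lambda>s. indicator {l..l + c} s * g s)" if "continuous_on {0..1} g" for g :: "real \<Rightarrow> real"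
  proof -
    have "(\<lambda>s. indicator {l..l + c} s * (g s)\<^sup>2) absolutely_integrable_on {0..1}"
      using that by (intro ai continuous_intros)
    moreover have "(indicator {l..l + c} s * g s)\<^sup>2 = indicator {l..l + c} s * (g s)\<^sup>2" for s
      by (simp add: indicator_def)
    ultimately show ?thesis using ai[OF that] unfolding sq_int_def by simp
  qed
  show sqa: "sq_int (wa c x)" using sq[of "\<lambda>_. 1 / c"] unfolding wa[abs_def] by simp
  show sqk: "sq_int (wk c x)" unfolding wk[abs_def] by (intro sq continuous_intros)
  show "inner2 (wa c x) (wa c x) = 1 / c"
  proof -
    have "wa c x s * wa c x s = indicator {l..l + c} s * (1 / c * (1 / c))" for s
      by (simp add: wa indicator_def)
    then show ?thesis using inner2_eq_integral[OF sqa sqa] int_ind[of "\<lambda>_. 1 / c * (1 / c)"] c by simp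
  qed
  show "inner2 (wk c x) (wk c x) \<le> c"
  proof -
    have e: "wk c x s * wk c x s = indicator {l..l + c} s * (1 / c * s + q)\<^sup>2" for s
      by (simp add: wk indicator_def power2_eq_square)
    have "inner2 (wk c x) (wk c x) = integral {l..l + c} (\<lambda>s. (1 / c * s + q)\<^sup>2)"
      using inner2_eq_integral[OF sqk sqk] int_ind[of "\<lambda>s. (1 / c * s + q)\<^sup>2"] unfolding e by simp
    also have "\<dots> \<le> integral {l..l + c} (\<lambda>_. 1)"
    proof (rule integral_le)
      show "(\<lambda>s. (1 / c * s + q)\<^sup>2) integrable_on {l..l + c}" by (intro integrable_continuous_real continuous_intros)
      fix s assume s: "s \<in> {l..l + c}"
      have "\<bar>1 / c * s + q\<bar> \<le> 1"
      proof (cases "x \<le> 1/2")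
        case True
        then have "1 / c * s + q = (s - x) / c - 1" by (simp add: q_def diff_divide_distrib)
        moreover have "0 \<le> (s - x) / c" "(s - x) / c \<le> 1" using s True c by (auto simp: l_def)
        ultimately show ?thesis by linarith
      next
        case False
        then have "1 / c * s + q = (s - x) / c + 1" by (simp add: q_def diff_divide_distrib)
        moreover have "(s - x) / c \<le> 0" "- 1 \<le> (s - x) / c" using s False c by (auto simp: l_def field_simps)
        ultimately show ?thesis by linarith
      qed
      then show "(1 / c * s + q)\<^sup>2 \<le> 1" by (simp add: abs_square_le_1)
    qed auto
    also have "\<dots> = c" using c by simp
    finally show ?thesis .
  qed
  \<comment> \<open>The affine kernel vanishes at the end of the window away from \<open>x\<close>.
    At \<open>x\<close> it equals -1 if \<open>x\<close> is the left end and 1 if it is the right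
    end, so the boundary terms reduce to \<open>F x\<close>.\<close>
  have "((\<lambda>s. (1 / c * s + q) * nderiv 1 F s + nderiv 1 (\<lambda>s. 1 / c * s + q) s * F s) has_integral
      (1 / c * (l + c) + q) * F (l + c) - (1 / c * l + q) * F l) {l..l + c}"
    by (rule abs_cont_mult_has_integral[OF abs_cont_affine F]) (use win in auto)
  moreover have "(1 / c * (l + c) + q) * F (l + c) - (1 / c * l + q) * F l = F x"
    using c by (auto simp: l_def q_def field_simps)
  ultimately have "((\<lambda>s. (1 / c * s + q) * nderiv 1 F s + nderiv 1 (\<lambda>s. 1 / c * s + q) s * F s) has_integral F x) {l..l + c}"
    by simp
  then have h: "((\<lambda>s. (1 / c * s + q) * nderiv 1 F s + 1 / c * F s) has_integral F x) {l..l + c}"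
  proof (rule has_integral_eq[rotated])
    fix s assume "s \<in> {l..l + c}"
    then have "s \<in> {0..1}" using win by auto
    then show "(1 / c * s + q) * nderiv 1 F s + nderiv 1 (\<lambda>s. 1 / c * s + q) s * F s = (1 / c * s + q) * nderiv 1 F s + 1 / c * F s"
      by (simp only: nderiv_affine)
  qed
  have i1: "(\<lambda>s. 1 / c * F s) integrable_on {l..l + c}"
    using abs_cont_on_imp_continuous_on[OF F] win
    by (intro integrable_continuous_real continuous_intros) (auto intro: continuous_on_subset)
  have i2: "(\<lambda>s. (1 / c * s + q) * nderiv 1 F s) integrable_on {l..l + c}"
  proof -
    have "(\<lambda>s. (1 / c * s + q) * nderiv 1 F s) integrable_on {0..1}"
      by (intro sq_int_mult_integrable F' sq_int_continuous continuous_intros)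
    then show ?thesis by (rule integrable_on_subinterval) (use win in auto)
  qed
  have "F x = integral {l..l + c} (\<lambda>s. (1 / c * s + q) * nderiv 1 F s) + integral {l..l + c} (\<lambda>s. 1 / c * F s)"
    using integral_unique[OF h] integral_add[OF i2 i1] by simp
  also have "integral {l..l + c} (\<lambda>s. (1 / c * s + q) * nderiv 1 F s) = integral {0..1} (\<lambda>s. wk c x s * nderiv 1 F s)"
    unfolding wk mult.assoc int_ind ..
  also have "integral {l..l + c} (\<lambda>s. 1 / c * F s) = integral {0..1} (\<lambda>s. wa c x s * F s)"
    unfolding wa mult.assoc int_ind ..
  finally show "F x = integral {0..1} (\<lambda>s. wa c x s * F s) + integral {0..1} (\<lambda>s. wk c x s * nderiv 1 F s)" by simp
qed


text \<open>Cauchy-Schwarz for both terms of the window formula, whose kernels have squared norms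
  1/c and at most c.\<close>

lemma sobolev1_sup_bound:
  assumes F: "abs_cont_on {0..1} F" and F': "sq_int (nderiv 1 F)" and c: "0 < c" "c \<le> 1/2" and x: "x \<in> {0..1}"
  shows "(F x)\<^sup>2 \<le> 2 * (inner2 F F / c + c * inner2 (nderiv 1 F) (nderiv 1 F))"
proof -
  note W = window_formula[OF F F' c x]
  have sF: "sq_int F" using abs_cont_on_imp_continuous_on[OF F] by (rule sq_int_continuous)
  have "F x = inner2 (wa c x) F + inner2 (wk c x) (nderiv 1 F)"
    using W(1) unfolding inner2_eq_integral[OF W(2) sF] inner2_eq_integral[OF W(3) F'] .
  then have "(F x)\<^sup>2 \<le> 2 * ((inner2 (wa c x) F)\<^sup>2 + (inner2 (wk c x) (nderiv 1 F))\<^sup>2)"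
    using zero_le_power2[of "inner2 (wa c x) F - inner2 (wk c x) (nderiv 1 F)"]
    by (simp add: power2_eq_square algebra_simps)
  also have "(inner2 (wa c x) F)\<^sup>2 \<le> inner2 F F / c"
    using inner2_cauchy_schwarz[OF W(2) sF] W(4) by simp
  also have "(inner2 (wk c x) (nderiv 1 F))\<^sup>2 \<le> c * inner2 (nderiv 1 F) (nderiv 1 F)"
    using inner2_cauchy_schwarz[OF W(3) F'] mult_right_mono[OF W(5) inner2_self_nonneg[of "nderiv 1 F"]]
    by linarith
  finally show ?thesis by simp
qed

lemma nderiv_nderiv: "nderiv j (nderiv k f) = nderiv (j + k) f"
  unfolding nderiv_def by (simp add: funpow_add)

lemma sobolev2_nderiv:
  assumes "f \<in> sobolev2 (m + k)"
  shows "nderiv k f \<in> sobolev2 m"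
  using assms unfolding sobolev2_def by (auto simp: nderiv_nderiv add.commute)

text \<open>Integration by parts writes the squared norm of F' as boundary terms minus the inner
  product of F and F''. The supremum bound controls the boundary terms but brings the norm of F'
  back; the weights are such that it returns with total factor 1/2. Absorbing it doubles 2 * 512 +
  1/2, the coefficient of the norm of F, to 2049.\<close>

lemma interpolation_second_order:
  assumes F: "F \<in> sobolev2 2" and b: "0 < b" "b \<le> 1/2"
  shows "b\<^sup>2 * inner2 (nderiv 1 F) (nderiv 1 F) \<le> 2049 * (inner2 F F + b ^ 4 * inner2 (nderiv 2 F) (nderiv 2 F))"
proof -
  define n0 where "n0 = inner2 F F"
  define n1 where "n1 = inner2 (nderiv 1 F) (nderiv 1 F)"
  define n2 where "n2 = inner2 (nderiv 2 F) (nderiv 2 F)"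
  have nn: "n0 \<ge> 0" "n1 \<ge> 0" "n2 \<ge> 0" by (simp_all add: n0_def n1_def n2_def inner2_self_nonneg)
  have ac0: "abs_cont_on {0..1} F" using sobolev2_abs_cont[OF F, of 0] by (simp add: nderiv_0)
  have ac1: "abs_cont_on {0..1} (nderiv 1 F)" using sobolev2_abs_cont[OF F, of 1] by simp
  have sq0: "sq_int F" using sobolev2_sq_int[OF F] by simp
  have sq1: "sq_int (nderiv 1 F)" using sobolev2_nderiv_sq_int[OF F, of 1] by simp
  have sq2: "sq_int (nderiv 2 F)" using sobolev2_nderiv_sq_int[OF F, of 2] by simp
  have nd: "nderiv 1 (nderiv 1 F) = nderiv 2 F" unfolding nderiv_nderiv by (simp only: one_add_one)
  \<comment> \<open>The window for F is 64 times shorter than the one for F', so that each endpoint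
    returns only a quarter of \<open>n1\<close>.\<close>
  define c where "c = b / 64"
  have c: "0 < c" "c \<le> 1/2" using b by (auto simp: c_def)
  have sup: "\<bar>F x * nderiv 1 F x\<bar> \<le> 512 * n0 / b\<^sup>2 + n1 / 4 + b\<^sup>2 * n2 / 8" if x: "x \<in> {0..1}" for x
  proof -
    have 0: "(F x)\<^sup>2 \<le> 2 * (n0 / c + c * n1)"
      unfolding n0_def n1_def by (rule sobolev1_sup_bound[OF ac0 sq1 c x])
    have 1: "(nderiv 1 F x)\<^sup>2 \<le> 2 * (n1 / b + b * n2)"
      using sobolev1_sup_bound[OF ac1 _ b x] sq2 unfolding nd n1_def n2_def by blast
    define u where "u = \<bar>F x\<bar>"
    define v where "v = \<bar>nderiv 1 F x\<bar>"
    have "u\<^sup>2 \<le> 2 * (n0 / c + c * n1)" "v\<^sup>2 \<le> 2 * (n1 / b + b * n2)" using 0 1 by (simp_all add: u_def v_def)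
    have "2 * (u * v) \<le> 8 * u\<^sup>2 / b + b * v\<^sup>2 / 8"
    proof -
      have "0 \<le> (8 * u - b * v)\<^sup>2 / (8 * b)" using b by simp
      also have "\<dots> = 8 * u\<^sup>2 / b + b * v\<^sup>2 / 8 - 2 * (u * v)"
        using b by (simp add: power2_eq_square field_simps)
      finally show ?thesis by simp
    qed
    also have "8 * u\<^sup>2 / b \<le> 8 * (2 * (n0 / c + c * n1)) / b"
      using \<open>u\<^sup>2 \<le> _\<close> b by (intro divide_right_mono mult_left_mono) auto
    also have "b * v\<^sup>2 / 8 \<le> b * (2 * (n1 / b + b * n2)) / 8"
      using \<open>v\<^sup>2 \<le> _\<close> b by (intro divide_right_mono mult_left_mono) auto
    finally have "2 * (u * v) \<le> 8 * (2 * (n0 / c + c * n1)) / b + b * (2 * (n1 / b + b * n2)) / 8" by simp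
    also have "\<dots> = 2 * (512 * n0 / b\<^sup>2 + n1 / 4 + b\<^sup>2 * n2 / 8)"
      using b by (simp add: c_def power2_eq_square field_simps)
    finally have "u * v \<le> 512 * n0 / b\<^sup>2 + n1 / 4 + b\<^sup>2 * n2 / 8"
      by (rule mult_left_le_imp_le) simp
    then show ?thesis unfolding u_def v_def abs_mult .
  qed
  have "((\<lambda>x. F x * nderiv 1 (nderiv 1 F) x + nderiv 1 F x * nderiv 1 F x) has_integral
     F 1 * nderiv 1 F 1 - F 0 * nderiv 1 F 0) {0..1}"
    by (rule abs_cont_mult_has_integral[OF ac0 ac1]) auto
  then have "integral {0..1} (\<lambda>x. F x * nderiv 2 F x + nderiv 1 F x * nderiv 1 F x) = F 1 * nderiv 1 F 1 - F 0 * nderiv 1 F 0"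
    unfolding nd by (rule integral_unique)
  moreover have "integral {0..1} (\<lambda>x. F x * nderiv 2 F x + nderiv 1 F x * nderiv 1 F x) = inner2 F (nderiv 2 F) + n1"
    unfolding n1_def inner2_eq_integral[OF sq0 sq2] inner2_eq_integral[OF sq1 sq1]
    by (rule integral_add) (intro sq_int_mult_integrable sq0 sq1 sq2)+
  ultimately have eq: "n1 = F 1 * nderiv 1 F 1 - F 0 * nderiv 1 F 0 - inner2 F (nderiv 2 F)" by simp
  have am: "2 * \<bar>inner2 F (nderiv 2 F)\<bar> \<le> (1 / b\<^sup>2) * n0 + n2 / (1 / b\<^sup>2)"
    unfolding n0_def n2_def by (rule inner2_amgm[OF sq0 sq2]) (use b in simp)
  have s0: "\<bar>F 0 * nderiv 1 F 0\<bar> \<le> 512 * n0 / b\<^sup>2 + n1 / 4 + b\<^sup>2 * n2 / 8"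
    and s1: "\<bar>F 1 * nderiv 1 F 1\<bar> \<le> 512 * n0 / b\<^sup>2 + n1 / 4 + b\<^sup>2 * n2 / 8"
    using sup[of 0] sup[of 1] by auto
  define P where "P = n0 / b\<^sup>2"
  define Q where "Q = b\<^sup>2 * n2"
  have "n1 \<le> 2049 * P + 2049 * Q"
  proof -
    have "2 * \<bar>inner2 F (nderiv 2 F)\<bar> \<le> P + Q" using am b by (simp add: P_def Q_def mult.commute)
    moreover have "\<bar>F 0 * nderiv 1 F 0\<bar> \<le> 512 * P + n1 / 4 + Q / 8" using s0 by (simp add: P_def Q_def)
    moreover have "\<bar>F 1 * nderiv 1 F 1\<bar> \<le> 512 * P + n1 / 4 + Q / 8" using s1 by (simp add: P_def Q_def)
    moreover have "P \<ge> 0" "Q \<ge> 0" using nn by (auto simp: P_def Q_def)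
    ultimately show ?thesis using eq by linarith
  qed
  then have "b\<^sup>2 * n1 \<le> b\<^sup>2 * (2049 * P + 2049 * Q)" by (rule mult_left_mono) simp
  also have "\<dots> = 2049 * (b\<^sup>2 * P + b\<^sup>2 * Q)" by (simp add: algebra_simps)
  also have "b\<^sup>2 * P = n0" using b by (simp add: P_def)
  also have "b\<^sup>2 * Q = b ^ 4 * n2" by (simp add: Q_def power4_eq_xxxx power2_eq_square)
  finally show ?thesis by (simp add: n0_def n1_def n2_def)
qed

text \<open>The induction hypothesis for F' bounds F'' by F' and the top derivative. Inserted into
  the second-order inequality at a smaller scale \<open>c\<close>, it lets the norm of F' reappear
  with half of its coefficient on the left, where it is absorbed.\<close>

lemma interpolation_inequality:
  assumes "m \<ge> 1"
  shows "\<exists>C\<ge>1. \<forall>F\<in>sobolev2 m. \<forall>b. 0 < b \<longrightarrow> b \<le> 1/2 \<longrightarrow>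
     b\<^sup>2 * inner2 (nderiv 1 F) (nderiv 1 F) \<le> C * (inner2 F F + b ^ (2 * m) * inner2 (nderiv m F) (nderiv m F))"
  using assms
proof (induction m rule: dec_induct)
  case base
  show ?case
  proof (intro exI[of _ 1] conjI ballI allI impI)
    fix F b
    show "b\<^sup>2 * inner2 (nderiv 1 F) (nderiv 1 F) \<le> 1 * (inner2 F F + b ^ (2 * 1) * inner2 (nderiv 1 F) (nderiv 1 F))"
      using inner2_self_nonneg[of F] by (simp only: mult_1 mult_1_right)
  qed simp
next
  case (step m)
  then obtain C where C: "C \<ge> 1" and IH: "\<And>F b. F \<in> sobolev2 m \<Longrightarrow> 0 < b \<Longrightarrow> b \<le> 1/2 \<Longrightarrow>
     b\<^sup>2 * inner2 (nderiv 1 F) (nderiv 1 F) \<le> C * (inner2 F F + b ^ (2 * m) * inner2 (nderiv m F) (nderiv m F))"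
    by blast
  define K where "K = (2049 :: real)"
  \<comment> \<open>Makes \<open>K * C * \<theta>\<close> equal to 1/2, the factor with which
    \<open>n1\<close> comes back; the second-order inequality is used at scale
    \<open>sqrt \<theta> * b\<close>.\<close>
  define \<theta> where "\<theta> = 1 / (2 * K * C)"
  have \<theta>: "\<theta> > 0" "\<theta> \<le> 1" using C by (auto simp: \<theta>_def K_def field_simps)
  show ?case
  proof (intro exI[of _ "2 * K * C / \<theta>"] conjI ballI allI impI)
    show "1 \<le> 2 * K * C / \<theta>" using C \<theta> by (simp add: K_def field_simps)
    fix F and b :: real assume F: "F \<in> sobolev2 (Suc m)" and b: "0 < b" "b \<le> 1/2"
    define n0 where "n0 = inner2 F F"
    define n1 where "n1 = inner2 (nderiv 1 F) (nderiv 1 F)"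
    define n2 where "n2 = inner2 (nderiv 2 F) (nderiv 2 F)"
    define nm where "nm = inner2 (nderiv (Suc m) F) (nderiv (Suc m) F)"
    have nn: "n0 \<ge> 0" "n1 \<ge> 0" "n2 \<ge> 0" "nm \<ge> 0" by (simp_all add: n0_def n1_def n2_def nm_def inner2_self_nonneg)
    have F2: "F \<in> sobolev2 2" using sobolev2_mono[OF F, of 2] step by simp
    have F1: "nderiv 1 F \<in> sobolev2 m" using sobolev2_nderiv[of F m 1] F by simp
    have eqs: "nderiv 1 (nderiv 1 F) = nderiv 2 F" "nderiv m (nderiv 1 F) = nderiv (Suc m) F"
      unfolding nderiv_nderiv by (simp_all only: one_add_one Suc_eq_plus1)
    have i1: "b\<^sup>2 * n2 \<le> C * (n1 + b ^ (2 * m) * nm)"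
      using IH[OF F1 b] unfolding eqs n1_def n2_def nm_def .
    define c where "c = sqrt \<theta> * b"
    have "sqrt \<theta> \<le> 1" "0 < sqrt \<theta>" using \<theta> by auto
    then have "sqrt \<theta> * b \<le> 1 * b" using b by (intro mult_right_mono) auto
    then have c: "c \<le> 1/2" using b unfolding c_def by linarith
    have c': "0 < c" using \<theta> b by (simp add: c_def)
    have c2: "c\<^sup>2 = \<theta> * b\<^sup>2" using \<theta> by (simp add: c_def power_mult_distrib)
    have c4: "c ^ 4 = \<theta>\<^sup>2 * b\<^sup>2 * b\<^sup>2"
    proof -
      have "c ^ 4 = c\<^sup>2 * c\<^sup>2" by (simp add: power4_eq_xxxx power2_eq_square)
      then show ?thesis unfolding c2 by (simp add: power2_eq_square)
    qed
    have "\<theta> * b\<^sup>2 * n1 \<le> K * (n0 + c ^ 4 * n2)"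
      using interpolation_second_order[OF F2 c' c] unfolding c2 K_def n0_def n1_def n2_def .
    also have "\<dots> = K * n0 + K * \<theta>\<^sup>2 * b\<^sup>2 * (b\<^sup>2 * n2)" unfolding c4 by (simp add: algebra_simps)
    also have "\<dots> \<le> K * n0 + K * \<theta>\<^sup>2 * b\<^sup>2 * (C * (n1 + b ^ (2 * m) * nm))"
      by (intro add_left_mono mult_left_mono i1) (simp add: K_def)
    also have "\<dots> = K * n0 + (K * C * \<theta>) * \<theta> * (b\<^sup>2 * n1 + b ^ (2 * Suc m) * nm)"
      by (simp add: power2_eq_square algebra_simps)
    also have "K * C * \<theta> = 1 / 2" using C by (simp add: \<theta>_def K_def)
    finally have "\<theta> * (b\<^sup>2 * n1) \<le> 2 * (K * n0) + \<theta> * (b ^ (2 * Suc m) * nm)" by (simp add: algebra_simps)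
    also have "2 * (K * n0) \<le> 2 * K * C * n0" using C nn by (simp add: K_def mult_left_mono mult_right_mono)
    also have "\<theta> * (b ^ (2 * Suc m) * nm) \<le> 2 * K * C * (b ^ (2 * Suc m) * nm)"
      using \<theta> C nn b by (intro mult_right_mono) (auto simp: K_def)
    finally have "\<theta> * (b\<^sup>2 * n1) \<le> 2 * K * C * (n0 + b ^ (2 * Suc m) * nm)" by (simp add: algebra_simps)
    then have "b\<^sup>2 * n1 \<le> 2 * K * C * (n0 + b ^ (2 * Suc m) * nm) / \<theta>" using \<theta> by (simp add: field_simps)
    then show "b\<^sup>2 * inner2 (nderiv 1 F) (nderiv 1 F) \<le> 2 * K * C / \<theta> * (inner2 F F + b ^ (2 * Suc m) * inner2 (nderiv (Suc m) F) (nderiv (Suc m) F))"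
      by (simp add: n0_def n1_def nm_def)
  qed
qed

lemma inner2_by_parts:
  assumes F: "abs_cont_on {0..1} F" "sq_int (nderiv 1 F)" and G: "abs_cont_on {0..1} G" "sq_int (nderiv 1 G)"
    and bd: "F 0 = 0" "F 1 = 0"
  shows "inner2 F (nderiv 1 G) = - inner2 (nderiv 1 F) G"
proof -
  have s: "sq_int F" "sq_int G" using F(1) G(1) by (auto intro: sq_int_continuous abs_cont_on_imp_continuous_on)
  have "((\<lambda>x. F x * nderiv 1 G x + nderiv 1 F x * G x) has_integral F 1 * G 1 - F 0 * G 0) {0..1}"
    by (rule abs_cont_mult_has_integral[OF F(1) G(1)]) auto
  then have "integral {0..1} (\<lambda>x. F x * nderiv 1 G x + nderiv 1 F x * G x) = 0"
    using bd by (simp add: integral_unique)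
  moreover have "integral {0..1} (\<lambda>x. F x * nderiv 1 G x + nderiv 1 F x * G x) = inner2 F (nderiv 1 G) + inner2 (nderiv 1 F) G"
    unfolding inner2_eq_integral[OF s(1) G(2)] inner2_eq_integral[OF F(2) s(2)]
    by (rule integral_add) (intro sq_int_mult_integrable s F G)+
  ultimately show ?thesis by simp
qed

text \<open>Each integration by parts moves one derivative from \<open>h\<close> to
  \<open>f\<close>. The boundary terms vanish through \<open>f\<close> alone, whose derivatives of
  orders m to 2m - 1 are 0 at both ends; the absolute values hide the sign.\<close>

lemma inner2_nderiv_by_parts:
  assumes f: "f \<in> sobolev2 (2 * m)" and h: "h \<in> sobolev2 m" and m: "m \<ge> 1"
    and bd: "\<And>s. m \<le> s \<Longrightarrow> s \<le> 2 * m - 1 \<Longrightarrow> nderiv s f 0 = 0 \<and> nderiv s f 1 = 0"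
  shows "\<bar>inner2 (nderiv m f) (nderiv m h)\<bar> = \<bar>inner2 (nderiv (2 * m) f) h\<bar>"
proof -
  have "j \<le> m \<Longrightarrow> \<bar>inner2 (nderiv m f) (nderiv m h)\<bar> = \<bar>inner2 (nderiv (m + j) f) (nderiv (m - j) h)\<bar>" for j
  proof (induction j)
    case (Suc j)
    have j: "j < m" using Suc.prems by simp
    define k where "k = m - Suc j"
    have k: "m - j = Suc k" "k < m" using j by (auto simp: k_def)
    have "inner2 (nderiv (m + j) f) (nderiv 1 (nderiv k h)) = - inner2 (nderiv 1 (nderiv (m + j) f)) (nderiv k h)"
    proof (rule inner2_by_parts)
      show "abs_cont_on {0..1} (nderiv (m + j) f)" using sobolev2_abs_cont[OF f] j by simp
      show "abs_cont_on {0..1} (nderiv k h)" using sobolev2_abs_cont[OF h] k by simp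
      show "sq_int (nderiv 1 (nderiv (m + j) f))" unfolding nderiv_1_nderiv
        using sobolev2_nderiv_sq_int[OF f] j m by simp
      show "sq_int (nderiv 1 (nderiv k h))" unfolding nderiv_1_nderiv
        using sobolev2_nderiv_sq_int[OF h] k m by simp
      show "nderiv (m + j) f 0 = 0" "nderiv (m + j) f 1 = 0" using bd[of "m + j"] j by auto
    qed
    then show ?case using Suc.IH j k unfolding nderiv_1_nderiv by (simp add: k_def)
  qed simp
  from this[of m] show ?thesis by (simp add: nderiv_0 mult_2)
qed

text \<open>Prepares \<open>h^2\<close> for the design condition. The derivative 2 h h' is split by
  the arithmetic-geometric mean inequality with weight \<open>b\<close>, so that the bound is the
  first-order norm at scale \<open>b\<close>.\<close>

lemma square_sobolev11:
  assumes h: "abs_cont_on {0..1} h" "sq_int (nderiv 1 h)" and b: "b > 0"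
  shows "(\<lambda>x. (h x)\<^sup>2) \<in> sobolev11"
    and "(LINT x:{0..1}|lebesgue. (h x)\<^sup>2) = inner2 h h"
    and "(LINT x:{0..1}|lebesgue. \<bar>nderiv 1 (\<lambda>x. (h x)\<^sup>2) x\<bar>) \<le> (inner2 h h + b\<^sup>2 * inner2 (nderiv 1 h) (nderiv 1 h)) / b"
proof -
  have sh: "sq_int h" using h(1) by (intro sq_int_continuous abs_cont_on_imp_continuous_on)
  have ac: "abs_cont_on {0..1} (\<lambda>x. (h x)\<^sup>2)" using abs_cont_mult[OF h(1) h(1)] by (simp add: power2_eq_square)
  have ai: "nderiv 1 (\<lambda>x. (h x)\<^sup>2) absolutely_integrable_on {0..1}"
    by (rule abs_cont_nderiv_absolutely_integrable[OF ac])
  show "(\<lambda>x. (h x)\<^sup>2) \<in> sobolev11" using ac ai unfolding sobolev11_def by simp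
  show "(LINT x:{0..1}|lebesgue. (h x)\<^sup>2) = inner2 h h" by (simp add: inner2_def power2_eq_square)
  obtain N where N: "negligible N"
    "\<And>x. x \<in> {0..1} - N \<Longrightarrow> ((\<lambda>x. h x * h x) has_vector_derivative (h x * nderiv 1 h x + nderiv 1 h x * h x)) (at x within {0..1})"
    using abs_cont_mult_deriv[OF h(1) h(1)] by blast
  have nd: "nderiv 1 (\<lambda>x. (h x)\<^sup>2) x = 2 * (h x * nderiv 1 h x)" if "x \<in> {0..1} - N" for x
  proof -
    have "vector_derivative (\<lambda>x. h x * h x) (at x within {0..1}) = h x * nderiv 1 h x + nderiv 1 h x * h x"
      using vector_derivative_within_cbox[of 0 1 x, OF _ _ N(2)[OF that, folded box_real(2)]] that by simp
    then show ?thesis unfolding nderiv_1[of "\<lambda>x. (h x)\<^sup>2"] by (simp add: power2_eq_square)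
  qed
  have ai': "(\<lambda>x. \<bar>nderiv 1 (\<lambda>x. (h x)\<^sup>2) x\<bar>) absolutely_integrable_on {0..1}"
    using absolutely_integrable_norm[OF ai] by (simp add: o_def)
  have "(LINT x:{0..1}|lebesgue. \<bar>nderiv 1 (\<lambda>x. (h x)\<^sup>2) x\<bar>) = integral {0..1} (\<lambda>x. \<bar>nderiv 1 (\<lambda>x. (h x)\<^sup>2) x\<bar>)"
    by (rule set_lebesgue_integral_eq_integral(2)[OF ai'])
  also have "\<dots> = integral {0..1} (\<lambda>x. \<bar>2 * (h x * nderiv 1 h x)\<bar>)"
    by (rule integral_spike[OF N(1)]) (simp only: nd)
  also have "\<dots> \<le> integral {0..1} (\<lambda>x. (1 / b) * (h x * h x) + b * (nderiv 1 h x * nderiv 1 h x))"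
  proof (rule integral_le)
    show "(\<lambda>x. \<bar>2 * (h x * nderiv 1 h x)\<bar>) integrable_on {0..1}"
      by (rule integrable_spike[OF set_lebesgue_integral_eq_integral(1)[OF ai'] N(1)]) (simp only: nd)
    show "(\<lambda>x. (1 / b) * (h x * h x) + b * (nderiv 1 h x * nderiv 1 h x)) integrable_on {0..1}"
      using integrable_add[OF integrable_on_cmult_left[OF sq_int_mult_integrable[OF sh sh], of "1 / b"]
            integrable_on_cmult_left[OF sq_int_mult_integrable[OF h(2) h(2)], of b]] by simp
    fix x
    define u where "u = \<bar>h x\<bar>"
    define v where "v = \<bar>nderiv 1 h x\<bar>"
    have "0 \<le> (u - b * v)\<^sup>2 / b" using b by simp
    also have "\<dots> = (1 / b) * (u * u) + b * (v * v) - 2 * (u * v)"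
      using b by (simp add: power2_eq_square field_simps)
    finally show "\<bar>2 * (h x * nderiv 1 h x)\<bar> \<le> (1 / b) * (h x * h x) + b * (nderiv 1 h x * nderiv 1 h x)"
      by (simp add: u_def v_def abs_mult)
  qed
  also have "\<dots> = (1 / b) * inner2 h h + b * inner2 (nderiv 1 h) (nderiv 1 h)"
    unfolding inner2_eq_integral[OF sh sh] inner2_eq_integral[OF h(2) h(2)]
    using integral_add[OF integrable_on_cmult_left[OF sq_int_mult_integrable[OF sh sh], of "1 / b"]
        integrable_on_cmult_left[OF sq_int_mult_integrable[OF h(2) h(2)], of b]] by simp
  also have "\<dots> = (inner2 h h + b\<^sup>2 * inner2 (nderiv 1 h) (nderiv 1 h)) / b"
    using b by (simp add: field_simps power2_eq_square)
  finally show "(LINT x:{0..1}|lebesgue. \<bar>nderiv 1 (\<lambda>x. (h x)\<^sup>2) x\<bar>) \<le> (inner2 h h + b\<^sup>2 * inner2 (nderiv 1 h) (nderiv 1 h)) / b" .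
qed

section \<open>Existence and measurable selection of splines\<close>

definition Iop :: "(real \<Rightarrow> real) \<Rightarrow> real \<Rightarrow> real" where
  "Iop g x = integral {0..x} g"

lemma Iop_continuous:
  assumes "sq_int g" shows "continuous_on {0..1} (Iop g)"
  unfolding Iop_def[abs_def]
  by (rule abs_cont_on_imp_continuous_on[OF indefinite_integral_abs_cont[OF sq_int_absolutely_integrable[OF assms]]])

lemma Iop_sq_int: "sq_int g \<Longrightarrow> sq_int (Iop g)"
  by (rule sq_int_continuous[OF Iop_continuous])

lemma Iop_pow_sq_int: "sq_int g \<Longrightarrow> sq_int ((Iop ^^ k) g)"
  by (induction k) (auto intro: Iop_sq_int)

lemma Iop_cong: "(\<And>x. x \<in> {0..1} \<Longrightarrow> f x = g x) \<Longrightarrow> x \<in> {0..1} \<Longrightarrow> Iop f x = Iop g x"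
  unfolding Iop_def by (intro integral_cong) auto

lemma Iop_pow_cong: "(\<And>x. x \<in> {0..1} \<Longrightarrow> f x = g x) \<Longrightarrow> x \<in> {0..1} \<Longrightarrow> (Iop ^^ k) f x = (Iop ^^ k) g x"
proof (induction k arbitrary: x)
  case (Suc k)
  have "Iop ((Iop ^^ k) f) x = Iop ((Iop ^^ k) g) x"
    by (rule Iop_cong) (use Suc in auto)
  then show ?case by simp
qed simp

lemma Iop_lincomb:
  assumes "sq_int f" "sq_int g" "x \<in> {0..1}"
  shows "Iop (\<lambda>x. a * f x + b * g x) x = a * Iop f x + b * Iop g x"
proof -
  have i: "f integrable_on {0..x}" "g integrable_on {0..x}"
    by (rule integrable_on_subinterval[OF sq_int_integrable[OF assms(1)]], use assms(3) in simp)
      (rule integrable_on_subinterval[OF sq_int_integrable[OF assms(2)]], use assms(3) in simp)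
  show ?thesis unfolding Iop_def
    using integral_add[OF integrable_on_cmult_left[OF i(1), of a] integrable_on_cmult_left[OF i(2), of b]] by simp
qed

lemma Iop_pow_lincomb:
  assumes "sq_int f" "sq_int g" "x \<in> {0..1}"
  shows "(Iop ^^ k) (\<lambda>x. a * f x + b * g x) x = a * (Iop ^^ k) f x + b * (Iop ^^ k) g x"
  using assms(3)
proof (induction k arbitrary: x)
  case (Suc k)
  have "(Iop ^^ Suc k) (\<lambda>x. a * f x + b * g x) x = Iop (\<lambda>x. a * (Iop ^^ k) f x + b * (Iop ^^ k) g x) x"
    unfolding funpow.simps o_def by (rule Iop_cong) (use Suc in auto)
  also have "\<dots> = a * Iop ((Iop ^^ k) f) x + b * Iop ((Iop ^^ k) g) x"
    by (rule Iop_lincomb) (use assms Suc in \<open>auto intro: Iop_pow_sq_int\<close>)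
  finally show ?case by simp
qed simp

lemma sobrep_Iop_pow:
  assumes "sq_int g"
  shows "sobrep m ((Iop ^^ m) g) (\<lambda>k. (Iop ^^ (m - k)) g)"
  unfolding sobrep_def
proof (intro conjI ballI allI impI)
  fix k assume "k < m"
  then have k: "m - k = Suc (m - Suc k)" by simp
  show "sq_int ((Iop ^^ (m - Suc k)) g)" using assms by (rule Iop_pow_sq_int)
  fix x :: real
  show "(Iop ^^ (m - k)) g x = (Iop ^^ (m - k)) g 0 + integral {0..x} ((Iop ^^ (m - Suc k)) g)"
    unfolding k by (simp add: Iop_def)
qed simp

text \<open>\<open>(Iop ^^ k) (\<lambda>_. 1)\<close> is the monomial x^k / k! on the unit interval.
  Its chain of derivatives descends to the constant 1 at order k and is 0 from there on.\<close>

lemma sobrep_Iop_pow_one: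
  assumes "k < m"
  shows "sobrep m ((Iop ^^ k) (\<lambda>_. 1)) (\<lambda>j. if j \<le> k then (Iop ^^ (k - j)) (\<lambda>_. 1) else (\<lambda>_. 0))"
  unfolding sobrep_def
proof (intro conjI ballI allI impI)
  have c: "sq_int (\<lambda>_. c)" for c by (intro sq_int_continuous continuous_intros)
  fix j assume "j < m"
  show "sq_int (if Suc j \<le> k then (Iop ^^ (k - Suc j)) (\<lambda>_. 1) else (\<lambda>_. 0))"
    using c by (auto intro: Iop_pow_sq_int)
  fix x :: real
  consider "j < k" | "j = k" | "j > k" by linarith
  then show "(if j \<le> k then (Iop ^^ (k - j)) (\<lambda>_. 1) else (\<lambda>_. 0)) x = (if j \<le> k then (Iop ^^ (k - j)) (\<lambda>_. 1) else (\<lambda>_. 0)) 0 +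
     integral {0..x} (if Suc j \<le> k then (Iop ^^ (k - Suc j)) (\<lambda>_. 1) else (\<lambda>_. 0))"
  proof cases
    case 1
    then have k: "k - j = Suc (k - Suc j)" by simp
    show ?thesis using 1 unfolding k by (simp add: Iop_def)
  qed auto
qed simp

text \<open>Taylor's formula at 0 with the integral remainder left as an iterated integral, the form
  in which the remainder has a representer.\<close>

lemma taylor_Iop:
  assumes f: "f \<in> sobolev2 m" and x: "x \<in> {0..1}"
  shows "j \<le> m \<Longrightarrow> f x = (\<Sum>k<j. nderiv k f 0 * (Iop ^^ k) (\<lambda>_. 1) x) + (Iop ^^ j) (nderiv j f) x"
proof (induction j)
  case (Suc j)
  note rep = sobolev2_imp_sobrep[OF f]
  have c: "sq_int (\<lambda>_. 1)" by (intro sq_int_continuous continuous_intros)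
  have sq: "sq_int (nderiv (Suc j) f)" using sobrepD(2)[OF rep] Suc.prems by simp
  have "(Iop ^^ j) (nderiv j f) x = (Iop ^^ j) (\<lambda>y. nderiv j f 0 * 1 + 1 * Iop (nderiv (Suc j) f) y) x"
  proof (rule Iop_pow_cong[OF _ x])
    fix y :: real assume y: "y \<in> {0..1}"
    have "nderiv j f y = nderiv j f 0 + integral {0..y} (nderiv (Suc j) f)"
      by (rule sobrepD(3)[OF rep _ y]) (use Suc.prems in simp)
    then show "nderiv j f y = nderiv j f 0 * 1 + 1 * Iop (nderiv (Suc j) f) y" by (simp only: Iop_def mult_1 mult_1_right)
  qed
  also have "\<dots> = nderiv j f 0 * (Iop ^^ j) (\<lambda>_. 1) x + 1 * (Iop ^^ j) (Iop (nderiv (Suc j) f)) x"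
    by (rule Iop_pow_lincomb[OF c Iop_sq_int[OF sq] x])
  also have "(Iop ^^ j) (Iop (nderiv (Suc j) f)) = (Iop ^^ Suc j) (nderiv (Suc j) f)"
    by (simp only: funpow_Suc_right o_apply)
  finally show ?case using Suc.IH Suc.prems by (simp del: funpow.simps)
qed (simp add: nderiv_0)

text \<open>Integration by parts with the antiderivative of \<open>K\<close> that vanishes at 1; as
  \<open>Iop g\<close> vanishes at 0, no boundary term survives.\<close>

lemma Iop_adjoint:
  assumes K: "sq_int K" and g: "sq_int g"
  shows "inner2 K (Iop g) = inner2 (\<lambda>s. Iop K 1 - Iop K s) g"
proof -
  define \<kappa> where "\<kappa> s = Iop K s - Iop K 1" for s
  have acI: "abs_cont_on {0..1} (Iop h)" if "sq_int h" for h
    unfolding Iop_def[abs_def] by (rule indefinite_integral_abs_cont[OF sq_int_absolutely_integrable[OF that]])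
  have "abs_cont_on {0..1} (\<lambda>s. Iop K s - Iop K 1)" using acI[OF K] unfolding abs_cont_on_def by simp
  then have ac\<kappa>: "abs_cont_on {0..1} \<kappa>" unfolding \<kappa>_def[abs_def] .
  have "\<exists>N. negligible N \<and> (\<forall>x\<in>{0..1} - N. nderiv 1 \<kappa> x = K x)"
    by (rule indefinite_integral_nderivE(2)[OF sq_int_absolutely_integrable[OF K]]) (simp add: \<kappa>_def Iop_def)
  then obtain N1 where N1: "negligible N1" "\<And>x. x \<in> {0..1} - N1 \<Longrightarrow> nderiv 1 \<kappa> x = K x" by blast
  have "\<exists>N. negligible N \<and> (\<forall>x\<in>{0..1} - N. nderiv 1 (Iop g) x = g x)"
    by (rule indefinite_integral_nderivE(2)[OF sq_int_absolutely_integrable[OF g]]) (simp add: Iop_def)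
  then obtain N2 where N2: "negligible N2" "\<And>x. x \<in> {0..1} - N2 \<Longrightarrow> nderiv 1 (Iop g) x = g x" by blast
  have s: "sq_int \<kappa>" "sq_int (Iop g)" using ac\<kappa> abs_cont_on_imp_continuous_on sq_int_continuous Iop_sq_int[OF g] by auto
  have sd: "sq_int (nderiv 1 \<kappa>)" "sq_int (nderiv 1 (Iop g))"
    using sq_int_cong_ae[OF K N1] sq_int_cong_ae[OF g N2] by auto
  have "((\<lambda>x. \<kappa> x * nderiv 1 (Iop g) x + nderiv 1 \<kappa> x * Iop g x) has_integral \<kappa> 1 * Iop g 1 - \<kappa> 0 * Iop g 0) {0..1}"
    by (rule abs_cont_mult_has_integral[OF ac\<kappa> acI[OF g]]) auto
  then have "integral {0..1} (\<lambda>x. \<kappa> x * nderiv 1 (Iop g) x + nderiv 1 \<kappa> x * Iop g x) = 0"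
    by (simp add: integral_unique \<kappa>_def Iop_def)
  moreover have "integral {0..1} (\<lambda>x. \<kappa> x * nderiv 1 (Iop g) x + nderiv 1 \<kappa> x * Iop g x) =
     inner2 \<kappa> (nderiv 1 (Iop g)) + inner2 (nderiv 1 \<kappa>) (Iop g)"
    unfolding inner2_eq_integral[OF s(1) sd(2)] inner2_eq_integral[OF sd(1) s(2)]
    by (rule integral_add[OF sq_int_mult_integrable[OF s(1) sd(2)] sq_int_mult_integrable[OF sd(1) s(2)]])
  moreover have "inner2 \<kappa> (nderiv 1 (Iop g)) = inner2 \<kappa> g"
    by (rule inner2_cong_ae[OF s(1) g N2(1) _ N2(2)]) simp
  moreover have "inner2 (nderiv 1 \<kappa>) (Iop g) = inner2 K (Iop g)"
    by (rule inner2_cong_ae[OF K s(2) N1(1) N1(2)]) simp_all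
  moreover have "(\<lambda>s. Iop K 1 - Iop K s) = (\<lambda>s. (-1) * \<kappa> s)" by (simp add: \<kappa>_def fun_eq_iff)
  ultimately show ?thesis by (simp only: inner2_mult_left) 
qed

text \<open>Representers of point evaluation, built explicitly: the indicator of
  \<open>{0..t}\<close> for a single integration, and one application of the adjoint for each
  further one.\<close>

lemma Iop_pow_kernel:
  assumes t: "t \<in> {0..1}"
  shows "\<exists>K. sq_int K \<and> (\<forall>g. sq_int g \<longrightarrow> (Iop ^^ Suc k) g t = inner2 K g)"
proof (induction k)
  case 0
  define K :: "real \<Rightarrow> real" where "K = indicator {0..t}"
  have KK: "(K s)\<^sup>2 = K s" for s by (simp add: K_def indicator_def)
  have "K absolutely_integrable_on {0..1}"
  proof -
    have "(\<lambda>x. 1 :: real) absolutely_integrable_on {0..t}" by (intro absolutely_integrable_continuous_real continuous_intros)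
    moreover have "(\<lambda>s. indicator {0..1} s *\<^sub>R K s) = (\<lambda>s. indicator {0..t} s *\<^sub>R 1)"
      using t by (auto simp: K_def fun_eq_iff indicator_def)
    ultimately show ?thesis unfolding set_integrable_def by simp
  qed
  then have K: "sq_int K" unfolding sq_int_def KK by simp
  show ?case
  proof (intro exI[of _ K] conjI allI impI K)
    fix g assume g: "sq_int g"
    have "inner2 K g = integral {0..1} (\<lambda>s. if s \<in> {0..t} then g s else 0)"
      unfolding inner2_eq_integral[OF K g] by (rule integral_cong) (simp add: K_def indicator_def)
    also have "\<dots> = integral {0..t} g"
      using integral_restrict_Int[of "{0..1}" "{0..t}" g] t by (simp add: Int_absorb1 Int_absorb2)
    finally show "(Iop ^^ Suc 0) g t = inner2 K g" by (simp add: Iop_def)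
  qed
next
  case (Suc k)
  then obtain K where K: "sq_int K" "\<And>g. sq_int g \<Longrightarrow> (Iop ^^ Suc k) g t = inner2 K g" by blast
  show ?case
  proof (intro exI[of _ "\<lambda>s. Iop K 1 - Iop K s"] conjI allI impI)
    show "sq_int (\<lambda>s. Iop K 1 - Iop K s)"
      by (intro sq_int_diff Iop_sq_int K sq_int_continuous continuous_intros)
    fix g assume g: "sq_int g"
    have "(Iop ^^ Suc (Suc k)) g t = (Iop ^^ Suc k) (Iop g) t" by (simp only: funpow_Suc_right o_apply)
    also have "\<dots> = inner2 K (Iop g)" by (rule K(2)[OF Iop_sq_int[OF g]])
    also have "\<dots> = inner2 (\<lambda>s. Iop K 1 - Iop K s) g" by (rule Iop_adjoint[OF K(1) g])
    finally show "(Iop ^^ Suc (Suc k)) g t = inner2 (\<lambda>s. Iop K 1 - Iop K s) g" .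
  qed
qed

text \<open>An abstract setting shared by the penalty, the Sobolev form and the design form. Only
  semidefiniteness is required: the penalty vanishes on polynomials of degree below m, and functions
  that agree on the unit interval are not identified.\<close>

locale semi_inner =
  fixes H :: "(real \<Rightarrow> real) set" and B :: "(real \<Rightarrow> real) \<Rightarrow> (real \<Rightarrow> real) \<Rightarrow> real"
  assumes zero: "(\<lambda>_. 0) \<in> H"
    and closed: "f \<in> H \<Longrightarrow> g \<in> H \<Longrightarrow> (\<lambda>x. a * f x + b * g x) \<in> H"
    and sym: "f \<in> H \<Longrightarrow> g \<in> H \<Longrightarrow> B f g = B g f"
    and lin: "f \<in> H \<Longrightarrow> g \<in> H \<Longrightarrow> h \<in> H \<Longrightarrow> B (\<lambda>x. a * f x + b * g x) h = a * B f h + b * B g h"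
    and nonneg: "f \<in> H \<Longrightarrow> B f f \<ge> 0"
begin

lemma sum_mem: "(\<And>k. k < (K::nat) \<Longrightarrow> v k \<in> H) \<Longrightarrow> (\<lambda>x. \<Sum>k<K. c k * v k x) \<in> H"
proof (induction K)
  case (Suc K)
  then have "(\<lambda>x. 1 * (\<Sum>k<K. c k * v k x) + c K * v K x) \<in> H" by (intro closed) auto
  then show ?case by simp
qed (simp add: zero)

lemma B_zero: "h \<in> H \<Longrightarrow> B (\<lambda>_. 0) h = 0"
  using lin[OF zero zero, of h 0 0] by simp

lemma B_sum: "(\<And>k. k < (K::nat) \<Longrightarrow> v k \<in> H) \<Longrightarrow> h \<in> H \<Longrightarrow> B (\<lambda>x. \<Sum>k<K. c k * v k x) h = (\<Sum>k<K. c k * B (v k) h)"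
proof (induction K)
  case (Suc K)
  have "B (\<lambda>x. 1 * (\<Sum>k<K. c k * v k x) + c K * v K x) h = 1 * B (\<lambda>x. \<Sum>k<K. c k * v k x) h + c K * B (v K) h"
    by (intro lin sum_mem) (use Suc in auto)
  then show ?case using Suc by simp
qed (simp add: B_zero)

lemma null:
  assumes z: "z \<in> H" "B z z = 0" and f: "f \<in> H"
  shows "B z f = 0"
proof (rule ccontr)
  assume nz: "B z f \<noteq> 0"
  \<comment> \<open>Since \<open>B z z = 0\<close>, the form at \<open>c z + f\<close> is
    \<open>2 c B z f + B f f\<close>, which this \<open>c\<close> makes -1.\<close>
  define c where "c = - (B f f + 1) / (2 * B z f)"
  let ?g = "\<lambda>x. c * z x + 1 * f x"
  have g: "?g \<in> H" by (intro closed z f)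
  have "B ?g ?g = c * B z ?g + 1 * B f ?g" by (rule lin[OF z(1) f g])
  also have "B z ?g = c * B z z + 1 * B f z" unfolding sym[OF z(1) g] by (rule lin[OF z(1) f z(1)])
  also have "B f ?g = c * B z f + 1 * B f f" unfolding sym[OF f g] by (rule lin[OF z(1) f f])
  also have "B f z = B z f" by (rule sym[OF f z(1)])
  finally have "B ?g ?g = c * (2 * B z f) + B f f" using z(2) by (simp add: algebra_simps)
  also have "c * (2 * B z f) = - (B f f + 1)" using nz by (simp add: c_def)
  finally show False using nonneg[OF g] by simp
qed

text \<open>Once the \<open>v k\<close> are orthonormal, this is \<open>f\<close> minus its
  orthogonal projection onto their span.\<close>

definition resid :: "nat \<Rightarrow> (nat \<Rightarrow> real \<Rightarrow> real) \<Rightarrow> (real \<Rightarrow> real) \<Rightarrow> real \<Rightarrow> real" where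
  "resid K v f x = f x - (\<Sum>k<K. B f (v k) * v k x)"

lemma resid_mem:
  assumes "\<And>k. k < K \<Longrightarrow> v k \<in> H" "f \<in> H" shows "resid K v f \<in> H"
proof -
  have "(\<lambda>x. 1 * f x + (-1) * (\<Sum>k<K. B f (v k) * v k x)) \<in> H"
    by (intro closed assms sum_mem)
  then show ?thesis by (simp add: resid_def[abs_def])
qed

lemma B_resid:
  assumes "\<And>k. k < K \<Longrightarrow> v k \<in> H" "f \<in> H" "h \<in> H"
  shows "B (resid K v f) h = B f h - (\<Sum>k<K. B f (v k) * B (v k) h)"
proof -
  have "B (\<lambda>x. 1 * f x + (-1) * (\<Sum>k<K. B f (v k) * v k x)) h = 1 * B f h + (-1) * B (\<lambda>x. \<Sum>k<K. B f (v k) * v k x) h"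
    by (intro lin assms sum_mem)
  then show ?thesis using B_sum[OF assms(1,3)] by (simp add: resid_def[abs_def])
qed

lemma resid_orth:
  assumes v: "\<And>k. k < K \<Longrightarrow> v k \<in> H"
    and on: "\<And>i j. i < K \<Longrightarrow> j < K \<Longrightarrow> B (v i) (v j) = (if i = j then 1 else 0)"
    and f: "f \<in> H" and j: "j < K"
  shows "B (resid K v f) (v j) = 0"
proof -
  have "B (resid K v f) (v j) = B f (v j) - (\<Sum>k<K. B f (v k) * B (v k) (v j))"
    by (rule B_resid[OF v f v[OF j]])
  also have "(\<Sum>k<K. B f (v k) * B (v k) (v j)) = (\<Sum>k<K. if k = j then B f (v j) else 0)"
    by (intro sum.cong refl) (use on j in auto)
  also have "\<dots> = B f (v j)" using j by simp
  finally show ?thesis by simp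
qed

text \<open>As the form is only semidefinite, a list entry whose residual has length 0 cannot be
  normalised; it is skipped, since such a residual is orthogonal to everything. Orthogonality of all
  residuals to the list replaces a statement about spans.\<close>

lemma gram_schmidt:
  assumes "set es \<subseteq> H"
  shows "\<exists>K v. (\<forall>k<K. v k \<in> H) \<and> (\<forall>i<K. \<forall>j<K. B (v i) (v j) = (if i = j then 1 else 0)) \<and>
     (\<forall>e\<in>set es. \<forall>f\<in>H. B (resid K v f) e = 0)"
  using assms
proof (induction es)
  case Nil
  then show ?case by (intro exI[of _ 0]) simp
next
  case (Cons e es)
  then have "\<exists>K v. (\<forall>k<K. v k \<in> H) \<and> (\<forall>i<K. \<forall>j<K. B (v i) (v j) = (if i = j then 1 else 0)) \<and>
     (\<forall>e\<in>set es. \<forall>f\<in>H. B (resid K v f) e = 0)" by simp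
  then obtain K v where Kv: "\<forall>k<K. v k \<in> H" "\<forall>i<K. \<forall>j<K. B (v i) (v j) = (if i = j then 1 else 0)"
     "\<forall>e\<in>set es. \<forall>f\<in>H. B (resid K v f) e = 0" by (elim exE conjE) (rule that)
  have v: "\<And>k. k < K \<Longrightarrow> v k \<in> H"
    and on: "\<And>i j. i < K \<Longrightarrow> j < K \<Longrightarrow> B (v i) (v j) = (if i = j then 1 else 0)"
    and es: "\<And>e f. e \<in> set es \<Longrightarrow> f \<in> H \<Longrightarrow> B (resid K v f) e = 0" using Kv by blast+
  have e: "e \<in> H" and esH: "set es \<subseteq> H" using Cons.prems by auto
  have orth: "B (resid K v f) (v j) = 0" if "f \<in> H" "j < K" for f j
    by (rule resid_orth[OF v on that])
  define z where "z = resid K v e"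
  have z: "z \<in> H" unfolding z_def by (rule resid_mem[OF v e])
  have Bfz: "B f z = B f e" if f: "f \<in> H" "\<And>k. k < K \<Longrightarrow> B f (v k) = 0" for f
  proof -
    have "B f z = B z f" by (rule sym[OF f(1) z])
    also have "\<dots> = B e f - (\<Sum>k<K. B e (v k) * B (v k) f)" unfolding z_def by (rule B_resid[OF v e f(1)])
    also have "(\<Sum>k<K. B e (v k) * B (v k) f) = 0"
      by (intro sum.neutral) (use f v sym in auto)
    finally show ?thesis using sym[OF f(1) e] by simp
  qed
  show ?case
  proof (cases "B z z = 0")
    case True
    have "B (resid K v f) e = 0" if f: "f \<in> H" for f
    proof -
      have r: "resid K v f \<in> H" by (rule resid_mem[OF v f])
      have "B (resid K v f) e = B (resid K v f) z" by (rule Bfz[OF r orth[OF f], symmetric])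
      also have "\<dots> = B z (resid K v f)" by (rule sym[OF r z])
      also have "\<dots> = 0" by (rule null[OF z True r])
      finally show ?thesis .
    qed
    then show ?thesis using v on es by (intro exI[of _ K] exI[of _ v]) auto
  next
    case False
    define s where "s = sqrt (B z z)"
    have s: "s > 0" "s\<^sup>2 = B z z" using False nonneg[OF z] by (auto simp: s_def)
    define w where "w x = 1 / s * z x" for x
    define v' where "v' k = (if k = K then w else v k)" for k
    have w: "w \<in> H" using closed[OF z z, of "1 / s" 0] by (simp add: w_def[abs_def])
    have Bw: "B w f = B z f / s" if "f \<in> H" for f
      using lin[OF z z that, of "1 / s" 0] by (simp add: w_def[abs_def])
    have wv: "B w (v j) = 0" if "j < K" for j
      using Bw[OF v[OF that]] orth[OF e that] by (simp add: z_def)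
    have ww: "B w w = 1"
    proof -
      have "B w w = B z w / s" by (rule Bw[OF w])
      also have "B z w = B w z" by (rule sym[OF z w])
      also have "B w z = B z z / s" by (rule Bw[OF z])
      finally show ?thesis using s(1) by (simp add: s(2)[symmetric] power2_eq_square)
    qed
    have v': "v' k \<in> H" if "k < Suc K" for k using that v w by (auto simp: v'_def less_Suc_eq)
    have on': "B (v' i) (v' j) = (if i = j then 1 else 0)" if "i < Suc K" "j < Suc K" for i j
      using that on wv ww sym[OF w v] by (auto simp: v'_def less_Suc_eq)
    have res: "resid (Suc K) v' f x = resid K v f x - B f w * w x" for f x
      by (simp add: resid_def v'_def)
    have Bres: "B (resid (Suc K) v' f) h = B (resid K v f) h - B f w * B w h" if "f \<in> H" "h \<in> H" for f h
      using B_resid[of "Suc K" v' f h, OF v' that] B_resid[OF v that] by (simp add: v'_def)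
    have "B (resid (Suc K) v' f) e' = 0" if "e' \<in> set (e # es)" "f \<in> H" for e' f
    proof (cases "e' \<in> set es")
      case True
      have "e' \<in> H" using True esH by auto
      have "B w e' = 0" using Bw[OF \<open>e' \<in> H\<close>] es[OF True e] by (simp add: z_def)
      then show ?thesis using Bres[OF that(2) \<open>e' \<in> H\<close>] es[OF True that(2)] by simp
    next
      case False
      then have e': "e' = e" using that(1) by simp
      have r: "resid (Suc K) v' f \<in> H" by (rule resid_mem[OF v' that(2)])
      have rv: "B (resid (Suc K) v' f) (v k) = 0" if "k < K" for k
        using Bres[OF \<open>f \<in> H\<close> v[OF that]] orth[OF \<open>f \<in> H\<close> that] wv[OF that] by simp
      have "B (resid (Suc K) v' f) e = B (resid (Suc K) v' f) z" by (rule Bfz[OF r rv, symmetric])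
      also have "\<dots> = B (resid K v f) z - B f w * B w z" by (rule Bres[OF that(2) z])
      also have "B (resid K v f) z = B f z"
        using B_resid[OF v that(2) z] orth[OF e] sym[OF v z] by (simp add: z_def)
      also have "B w z = s" using Bw[OF z] s(1) by (simp add: s(2)[symmetric] power2_eq_square)
      also have "B f w = B f z / s" using sym[OF that(2) w] Bw[OF that(2)] sym[OF z that(2)] by simp
      finally show ?thesis using s e' by simp
    qed
    then show ?thesis using v' on' by (intro exI[of _ "Suc K"] exI[of _ v']) blast
  qed
qed

end

section \<open>Semi-inner products on the Sobolev space and the finite-dimensional reduction\<close>

lemma Iop_pow_mem: "m \<ge> 1 \<Longrightarrow> sq_int g \<Longrightarrow> (Iop ^^ m) g \<in> sobolev2 m"
  by (rule sobrep_imp_sobolev2[OF sobrep_Iop_pow])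

lemma Iop_pow_one_mem: "k < m \<Longrightarrow> (Iop ^^ k) (\<lambda>_. 1) \<in> sobolev2 m"
  by (rule sobrep_imp_sobolev2[OF sobrep_Iop_pow_one]) auto

lemma sobolev2_zero:
  assumes "m \<ge> 1" shows "(\<lambda>_. 0) \<in> sobolev2 m"
  using sobolev2_lincomb[OF Iop_pow_one_mem[of 0 m] Iop_pow_one_mem[of 0 m] assms, of 0 0] assms by simp

lemma semi_inner_nderiv:
  assumes m: "m \<ge> 1"
  shows "semi_inner (sobolev2 m) (\<lambda>f g. inner2 (nderiv m f) (nderiv m g))"
proof
  show "(\<lambda>_. 0) \<in> sobolev2 m" by (rule sobolev2_zero[OF m])
  fix f g h a b assume f: "f \<in> sobolev2 m" and g: "g \<in> sobolev2 m"
  show "(\<lambda>x. a * f x + b * g x) \<in> sobolev2 m" by (rule sobolev2_lincomb[OF f g m])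
  show "inner2 (nderiv m f) (nderiv m g) = inner2 (nderiv m g) (nderiv m f)" by (rule inner2_commute)
  show "0 \<le> inner2 (nderiv m f) (nderiv m f)" by (rule inner2_self_nonneg)
  assume h: "h \<in> sobolev2 m"
  show "inner2 (nderiv m (\<lambda>x. a * f x + b * g x)) (nderiv m h) = a * inner2 (nderiv m f) (nderiv m h) + b * inner2 (nderiv m g) (nderiv m h)"
    by (rule inner2_nderiv_lincomb[OF f g sobolev2_nderiv_sq_int[OF h order_refl m] m order_refl])
qed

lemma semi_inner_sob:
  assumes m: "m \<ge> 1" and l: "l \<ge> 0"
  shows "semi_inner (sobolev2 m) (sob_inner m l)"
proof
  show "(\<lambda>_. 0) \<in> sobolev2 m" by (rule sobolev2_zero[OF m])
  fix f g h a b assume f: "f \<in> sobolev2 m" and g: "g \<in> sobolev2 m"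
  show "(\<lambda>x. a * f x + b * g x) \<in> sobolev2 m" by (rule sobolev2_lincomb[OF f g m])
  show "sob_inner m l f g = sob_inner m l g f" by (rule sob_inner_commute)
  show "0 \<le> sob_inner m l f f" by (rule sob_inner_self_nonneg[OF l])
  assume h: "h \<in> sobolev2 m"
  show "sob_inner m l (\<lambda>x. a * f x + b * g x) h = a * sob_inner m l f h + b * sob_inner m l g h"
    by (rule sob_inner_lincomb[OF f g h m])
qed

text \<open>Built from exactly the quantities that the spline objective controls, the design values
  and the penalty. In an orthonormal system for this form they bound the coefficients.\<close>

definition design_form :: "nat \<Rightarrow> nat \<Rightarrow> (nat \<Rightarrow> real) \<Rightarrow> (real \<Rightarrow> real) \<Rightarrow> (real \<Rightarrow> real) \<Rightarrow> real" where
  "design_form m n t f g = (\<Sum>i=1..n. f (t i) * g (t i)) + inner2 (nderiv m f) (nderiv m g)"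

lemma semi_inner_design:
  assumes m: "m \<ge> 1"
  shows "semi_inner (sobolev2 m) (design_form m n t)"
proof -
  interpret J: semi_inner "sobolev2 m" "\<lambda>f g. inner2 (nderiv m f) (nderiv m g)"
    by (rule semi_inner_nderiv[OF m])
  show ?thesis
  proof
    show "(\<lambda>_. 0) \<in> sobolev2 m" by (rule J.zero)
    fix f g h a b assume f: "f \<in> sobolev2 m" and g: "g \<in> sobolev2 m"
    show "(\<lambda>x. a * f x + b * g x) \<in> sobolev2 m" by (rule J.closed[OF f g])
    show "design_form m n t f g = design_form m n t g f"
      unfolding design_form_def using J.sym[OF f g] by (simp add: mult.commute)
    show "0 \<le> design_form m n t f f"
      unfolding design_form_def using J.nonneg[OF f] by (intro add_nonneg_nonneg sum_nonneg) auto
    assume h: "h \<in> sobolev2 m"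
    show "design_form m n t (\<lambda>x. a * f x + b * g x) h = a * design_form m n t f h + b * design_form m n t g h"
      unfolding design_form_def J.lin[OF f g h]
      by (simp add: algebra_simps sum.distrib sum_distrib_left)
  qed
qed

text \<open>
  The residual \<open>d\<close> is orthogonal to the Taylor monomials and to the \<open>m\<close>-fold integrals of the
  representers of the evaluations \<open>d (t j)\<close>; pairing with \<open>d (t j)\<close> gives
  \<open>0 = \<parallel>\<Sum>j. d (t j) K\<^sub>j\<parallel>\<^sup>2 + (\<Sum>j. d (t j)\<^sup>2)\<close>.
\<close>

lemma spline_space:
  assumes m: "m \<ge> 1" and t: "\<And>i. i \<in> {1..n} \<Longrightarrow> t i \<in> {0..1}"
  obtains K :: nat and v where "\<And>k. k < K \<Longrightarrow> v k \<in> sobolev2 m"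
    "\<And>i j. i < K \<Longrightarrow> j < K \<Longrightarrow> design_form m n t (v i) (v j) = (if i = j then 1 else 0)"
    "\<And>f. f \<in> sobolev2 m \<Longrightarrow> \<exists>\<theta>. (\<forall>i\<in>{1..n}. (\<Sum>k<K. \<theta> k * v k (t i)) = f (t i)) \<and>
       inner2 (nderiv m (\<lambda>x. \<Sum>k<K. \<theta> k * v k x)) (nderiv m (\<lambda>x. \<Sum>k<K. \<theta> k * v k x)) \<le> inner2 (nderiv m f) (nderiv m f)"
proof -
  interpret D: semi_inner "sobolev2 m" "design_form m n t" by (rule semi_inner_design[OF m])
  interpret J: semi_inner "sobolev2 m" "\<lambda>f g. inner2 (nderiv m f) (nderiv m g)" by (rule semi_inner_nderiv[OF m])
  obtain m' where m': "m = Suc m'" using m by (cases m) auto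
  have "\<forall>i\<in>{1..n}. \<exists>K. sq_int K \<and> (\<forall>g. sq_int g \<longrightarrow> (Iop ^^ m) g (t i) = inner2 K g)"
    unfolding m' using Iop_pow_kernel t by blast
  from bchoice[OF this] obtain Ker where Ker: "\<forall>i\<in>{1..n}. sq_int (Ker i) \<and> (\<forall>g. sq_int g \<longrightarrow> (Iop ^^ m) g (t i) = inner2 (Ker i) g)" ..
  define e where "e k = (Iop ^^ k) (\<lambda>_. 1)" for k :: nat
  define E where "E i = (Iop ^^ m) (Ker i)" for i
  have eH: "e k \<in> sobolev2 m" if "k < m" for k unfolding e_def by (rule Iop_pow_one_mem[OF that])
  have EH: "E i \<in> sobolev2 m" if "i \<in> {1..n}" for i unfolding E_def using Ker that by (intro Iop_pow_mem[OF m]) auto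
  define es where "es = map e [0..<m] @ map E [1..<Suc n]"
  have es: "set es \<subseteq> sobolev2 m" using eH EH by (auto simp: es_def simp del: upt_Suc)
  from D.gram_schmidt[OF es] obtain K v where Kv: "\<forall>k<K. v k \<in> sobolev2 m"
     "\<forall>i<K. \<forall>j<K. design_form m n t (v i) (v j) = (if i = j then 1 else 0)"
     "\<forall>e\<in>set es. \<forall>f\<in>sobolev2 m. design_form m n t (D.resid K v f) e = 0" by (elim exE conjE) (rule that)
  have v: "\<And>k. k < K \<Longrightarrow> v k \<in> sobolev2 m"
    and on: "\<And>i j. i < K \<Longrightarrow> j < K \<Longrightarrow> design_form m n t (v i) (v j) = (if i = j then 1 else 0)"
    and orth: "\<And>e f. e \<in> set es \<Longrightarrow> f \<in> sobolev2 m \<Longrightarrow> design_form m n t (D.resid K v f) e = 0" using Kv by blast+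
  show thesis
  proof (rule that[OF v on])
    fix f assume f: "f \<in> sobolev2 m"
    define d where "d = D.resid K v f"
    have d: "d \<in> sobolev2 m" unfolding d_def by (rule D.resid_mem[OF v f])
    have sqd: "sq_int (nderiv m d)" by (rule sobolev2_nderiv_sq_int[OF d order_refl m])
    \<comment> \<open>The m-th derivative of a monomial of degree below m vanishes almost
      everywhere, so orthogonality to it concerns the design values alone.\<close>
    have e0: "(\<Sum>i=1..n. d (t i) * e k (t i)) = 0" if k: "k < m" for k
    proof -
      have "e k \<in> set es" using k by (auto simp: es_def)
      then have "design_form m n t d (e k) = 0" unfolding d_def by (rule orth[OF _ f])
      moreover have "inner2 (nderiv m d) (nderiv m (e k)) = 0"
      proof -
        obtain N where N: "negligible N" "\<And>j x. j \<le> m \<Longrightarrow> x \<in> {0..1} - N \<Longrightarrow>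
            nderiv j (e k) x = (if j \<le> k then (Iop ^^ (k - j)) (\<lambda>_. 1) else (\<lambda>_. 0)) x"
          using sobrep_nderiv_ae[OF sobrep_Iop_pow_one[OF k] m] unfolding e_def by blast
        have "inner2 (nderiv m d) (nderiv m (e k)) = inner2 (nderiv m d) (\<lambda>_. 0)"
          by (rule inner2_cong_ae[OF sqd _ N(1)]) (use N(2)[of m] k in \<open>auto intro: sq_int_continuous\<close>)
        then show ?thesis by (simp add: inner2_def)
      qed
      ultimately show ?thesis by (simp add: design_form_def)
    qed
    \<comment> \<open>The m-th derivative of \<open>E j\<close> is the representer
      \<open>Ker j\<close>. Pairing it with that of \<open>d\<close> yields the Taylor remainder of
      \<open>d\<close> at \<open>t j\<close>.\<close>
    have KE: "inner2 (nderiv m d) (nderiv m (E j)) = d (t j) - (\<Sum>k<m. nderiv k d 0 * e k (t j))" if j: "j \<in> {1..n}" for j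
    proof -
      have K: "sq_int (Ker j)" using Ker j by blast
      obtain N where N: "negligible N" "\<And>i x. i \<le> m \<Longrightarrow> x \<in> {0..1} - N \<Longrightarrow> nderiv i (E j) x = (Iop ^^ (m - i)) (Ker j) x"
        using sobrep_nderiv_ae[OF sobrep_Iop_pow[OF K] m] unfolding E_def by blast
      have "inner2 (nderiv m d) (nderiv m (E j)) = inner2 (nderiv m d) (Ker j)"
        by (rule inner2_cong_ae[OF sqd K N(1)]) (use N(2)[of m] in auto)
      also have "\<dots> = inner2 (Ker j) (nderiv m d)" by (rule inner2_commute)
      also have "\<dots> = (Iop ^^ m) (nderiv m d) (t j)" using Ker j sqd by simp
      also have "\<dots> = d (t j) - (\<Sum>k<m. nderiv k d 0 * e k (t j))"
        using taylor_Iop[OF d t[OF j] order_refl] by (simp add: e_def)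
      finally show ?thesis .
    qed
    have eqj: "(\<Sum>i=1..n. d (t i) * inner2 (Ker i) (Ker j)) + d (t j) - (\<Sum>k<m. nderiv k d 0 * e k (t j)) = 0" if j: "j \<in> {1..n}" for j
    proof -
      have "E j \<in> set es" using j by (auto simp: es_def simp del: upt_Suc)
      then have "design_form m n t d (E j) = 0" unfolding d_def by (rule orth[OF _ f])
      moreover have "E j (t i) = inner2 (Ker i) (Ker j)" if "i \<in> {1..n}" for i
        using Ker that j unfolding E_def by blast
      ultimately show ?thesis unfolding design_form_def KE[OF j] by simp
    qed
    have "0 = (\<Sum>j=1..n. d (t j) * ((\<Sum>i=1..n. d (t i) * inner2 (Ker i) (Ker j)) + d (t j) - (\<Sum>k<m. nderiv k d 0 * e k (t j))))"
      by (rule sum.neutral[symmetric]) (use eqj in auto)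
    also have "\<dots> = (\<Sum>j=1..n. d (t j) * (\<Sum>i=1..n. d (t i) * inner2 (Ker i) (Ker j))) + (\<Sum>j=1..n. (d (t j))\<^sup>2)
        - (\<Sum>j=1..n. \<Sum>k<m. d (t j) * (nderiv k d 0 * e k (t j)))"
      by (simp add: algebra_simps sum.distrib sum_subtractf sum_distrib_left power2_eq_square)
    also have "(\<Sum>j=1..n. \<Sum>k<m. d (t j) * (nderiv k d 0 * e k (t j))) = (\<Sum>k<m. nderiv k d 0 * (\<Sum>j=1..n. d (t j) * e k (t j)))"
      by (subst sum.swap) (simp add: sum_distrib_left mult.left_commute)
    also have "\<dots> = 0" by (rule sum.neutral) (use e0 in auto)
    finally have sum0: "(\<Sum>j=1..n. d (t j) * (\<Sum>i=1..n. d (t i) * inner2 (Ker i) (Ker j))) + (\<Sum>j=1..n. (d (t j))\<^sup>2) = 0" by simp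
    have "(\<Sum>j=1..n. d (t j) * (\<Sum>i=1..n. d (t i) * inner2 (Ker i) (Ker j))) \<ge> 0"
    proof -
      let ?g = "\<lambda>x. \<Sum>i=1..n. d (t i) * Ker i x"
      have g: "sq_int ?g" by (intro sq_int_sum sq_int_const_mult) (use Ker in auto)
      have sum_left: "inner2 (\<lambda>x. \<Sum>i\<in>I. d (t i) * Ker i x) h = (\<Sum>i\<in>I. d (t i) * inner2 (Ker i) h)"
        if "I \<subseteq> {1..n}" "sq_int h" "finite I" for I h
        using that(3,1)
      proof (induction I rule: finite_induct)
        case (insert i I)
        have "sq_int (\<lambda>x. d (t i) * Ker i x)" using Ker insert by (intro sq_int_const_mult) auto
        moreover have "sq_int (\<lambda>x. \<Sum>i\<in>I. d (t i) * Ker i x)"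
          by (intro sq_int_sum sq_int_const_mult) (use Ker insert in auto)
        ultimately show ?case using insert that(2) by (simp add: inner2_add_left inner2_mult_left)
      qed (simp add: inner2_def)
      have "inner2 ?g ?g = (\<Sum>j=1..n. d (t j) * inner2 (Ker j) ?g)" by (rule sum_left[OF _ g]) auto
      also have "\<dots> = (\<Sum>j=1..n. d (t j) * (\<Sum>i=1..n. d (t i) * inner2 (Ker i) (Ker j)))"
      proof (intro sum.cong refl)
        fix j assume "j \<in> {1..n}"
        then have "inner2 ?g (Ker j) = (\<Sum>i=1..n. d (t i) * inner2 (Ker i) (Ker j))"
          by (intro sum_left) (use Ker in auto)
        then show "d (t j) * inner2 (Ker j) ?g = d (t j) * (\<Sum>i=1..n. d (t i) * inner2 (Ker i) (Ker j))"
          by (simp only: inner2_commute[of "Ker j" ?g])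
      qed
      finally show ?thesis using inner2_self_nonneg[of ?g] by simp
    qed
    then have "(\<Sum>j=1..n. (d (t j))\<^sup>2) = 0" using sum0 by (smt (verit) sum_nonneg zero_le_power2)
    then have d0: "d (t j) = 0" if "j \<in> {1..n}" for j
      using that by (subst (asm) sum_nonneg_eq_0_iff) auto
    define \<theta> where "\<theta> k = design_form m n t f (v k)" for k
    define p where "p x = (\<Sum>k<K. \<theta> k * v k x)" for x
    have p: "p \<in> sobolev2 m" unfolding p_def[abs_def] by (rule D.sum_mem[OF v])
    have fpd: "f x = p x + d x" for x by (simp add: d_def D.resid_def p_def \<theta>_def)
    have pt: "p (t i) = f (t i)" if "i \<in> {1..n}" for i using fpd d0[OF that] by simp
    \<comment> \<open>\<open>d\<close> vanishes at the design points, so orthogonality in the design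
      form becomes orthogonality for the penalty. Pythagoras then shows that the projection
      \<open>p\<close> interpolates \<open>f\<close> without increasing the penalty.\<close>
    have "design_form m n t p d = 0"
    proof -
      have "design_form m n t p d = (\<Sum>k<K. \<theta> k * design_form m n t (v k) d)"
        unfolding p_def[abs_def] by (rule D.B_sum[OF v d])
      also have "\<dots> = 0"
      proof (intro sum.neutral ballI)
        fix k assume "k \<in> {..<K}"
        then have "design_form m n t d (v k) = 0" unfolding d_def by (intro D.resid_orth v on f) auto
        then show "\<theta> k * design_form m n t (v k) d = 0" using D.sym[OF v d] \<open>k \<in> {..<K}\<close> by simp
      qed
      finally show ?thesis .
    qed
    then have Jpd: "inner2 (nderiv m p) (nderiv m d) = 0" using d0 by (simp add: design_form_def)
    have Jf: "inner2 (nderiv m f) (nderiv m f) = inner2 (nderiv m p) (nderiv m p) + inner2 (nderiv m d) (nderiv m d)"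
    proof -
      have feq: "f = (\<lambda>x. 1 * p x + 1 * d x)" using fpd by (simp add: fun_eq_iff)
      have lin: "inner2 (nderiv m f) (nderiv m h) = inner2 (nderiv m p) (nderiv m h) + inner2 (nderiv m d) (nderiv m h)" if "h \<in> sobolev2 m" for h
        by (subst feq, subst J.lin[OF p d that]) simp
      show ?thesis
        unfolding lin[OF f] J.sym[OF p f] J.sym[OF d f] unfolding lin[OF p] lin[OF d] J.sym[OF d p] Jpd by simp
    qed
    show "\<exists>\<theta>. (\<forall>i\<in>{1..n}. (\<Sum>k<K. \<theta> k * v k (t i)) = f (t i)) \<and>
       inner2 (nderiv m (\<lambda>x. \<Sum>k<K. \<theta> k * v k x)) (nderiv m (\<lambda>x. \<Sum>k<K. \<theta> k * v k x)) \<le> inner2 (nderiv m f) (nderiv m f)"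
    proof (intro exI[of _ \<theta>] conjI ballI)
      show "(\<Sum>k<K. \<theta> k * v k (t i)) = f (t i)" if "i \<in> {1..n}" for i
        using pt[OF that] by (simp add: p_def)
      show "inner2 (nderiv m (\<lambda>x. \<Sum>k<K. \<theta> k * v k x)) (nderiv m (\<lambda>x. \<Sum>k<K. \<theta> k * v k x)) \<le> inner2 (nderiv m f) (nderiv m f)"
        using Jf inner2_self_nonneg[of "nderiv m d"] by (simp add: p_def[abs_def])
    qed
  qed
qed

section \<open>Minimisers that depend measurably on the data\<close>

lemma compact_coordinate_box: "compact {\<theta> :: nat \<Rightarrow> real. \<forall>k. \<bar>\<theta> k\<bar> \<le> r k}"
proof -
  have "compactin (product_topology (\<lambda>_. euclidean) UNIV) (PiE UNIV (\<lambda>k. {- r k..r k}))"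
    by (subst compactin_PiE) auto
  then have "compact (PiE UNIV (\<lambda>k. {- r k..r k}))"
    by (simp only: euclidean_product_topology compactin_euclidean_iff)
  moreover have "PiE UNIV (\<lambda>k. {- r k..r k}) = {\<theta>. \<forall>k. \<bar>\<theta> k\<bar> \<le> r k}"
    by (auto simp: PiE_def Pi_def abs_le_iff minus_le_iff)
  ultimately show ?thesis by simp
qed

text \<open>Witnesses chosen in the compact set have a convergent subsequence. Sequences suffice
  because data and coefficients, both functions on \<open>nat\<close>, form a metric space.\<close>

lemma closed_projection_of_compact:
  fixes T :: "('b::metric_space \<times> 'c::metric_space) set"
  assumes "compact S" "closed T"
  shows "closed {y. \<exists>x\<in>S. (y, x) \<in> T}"
  unfolding closed_sequential_limits
proof (intro allI impI, elim conjE)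
  fix y l assume y: "\<forall>n. y n \<in> {y. \<exists>x\<in>S. (y, x) \<in> T}" and l: "y \<longlonglongrightarrow> l"
  then have "\<forall>n. \<exists>x. x \<in> S \<and> (y n, x) \<in> T" by blast
  from choice[OF this] obtain x where x: "\<forall>n. x n \<in> S \<and> (y n, x n) \<in> T" ..
  obtain a r where a: "a \<in> S" "strict_mono r" "(x \<circ> r) \<longlonglongrightarrow> a"
    using assms(1) x unfolding compact_def by meson
  have "(y \<circ> r) \<longlonglongrightarrow> l" using l a(2) by (rule LIMSEQ_subseq_LIMSEQ)
  then have "(\<lambda>n. (y (r n), x (r n))) \<longlonglongrightarrow> (l, a)" using a(3) by (intro tendsto_Pair) (simp_all add: o_def)
  then have "(l, a) \<in> T" using assms(2) x by (meson closed_sequentially)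
  then show "l \<in> {y. \<exists>x\<in>S. (y, x) \<in> T}" using a(1) by blast
qed

text \<open>
  Minimising a second criterion over the set of minimisers makes the attained value a lower
  semicontinuous function of the data: its sublevel sets are projections of closed sets along a compact set.
\<close>

lemma argmin_selection:
  fixes F :: "(nat \<Rightarrow> real) \<Rightarrow> (nat \<Rightarrow> real) \<Rightarrow> real" and G :: "(nat \<Rightarrow> real) \<Rightarrow> real" and \<Theta> :: "(nat \<Rightarrow> real) set"
  assumes F: "continuous_on UNIV (\<lambda>p. F (fst p) (snd p))" and G: "continuous_on UNIV G" and \<Theta>: "closed \<Theta>" "\<theta>0 \<in> \<Theta>"
    and Y: "\<And>N::nat. closed (Y N)" "(\<Union>N. Y N) = UNIV"
    and bound: "\<And>N. \<exists>r. \<forall>y\<in>Y N. \<forall>\<theta>\<in>\<Theta>. F y \<theta> \<le> F y \<theta>0 \<longrightarrow> (\<forall>k. \<bar>\<theta> k\<bar> \<le> r k)"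
  shows "\<exists>sel. (\<forall>y. sel y \<in> \<Theta>) \<and> (\<forall>y. \<forall>\<theta>\<in>\<Theta>. F y (sel y) \<le> F y \<theta>) \<and> (\<lambda>y. G (sel y)) \<in> borel_measurable borel"
proof -
  obtain r where r: "\<And>N y \<theta>. y \<in> Y N \<Longrightarrow> \<theta> \<in> \<Theta> \<Longrightarrow> F y \<theta> \<le> F y \<theta>0 \<Longrightarrow> \<forall>k. \<bar>\<theta> k\<bar> \<le> r N k"
  proof -
    have "\<forall>N. \<exists>r. \<forall>y\<in>Y N. \<forall>\<theta>\<in>\<Theta>. F y \<theta> \<le> F y \<theta>0 \<longrightarrow> (\<forall>k. \<bar>\<theta> k\<bar> \<le> r k)" using bound by blast
    from choice[OF this] obtain r where "\<forall>N. \<forall>y\<in>Y N. \<forall>\<theta>\<in>\<Theta>. F y \<theta> \<le> F y \<theta>0 \<longrightarrow> (\<forall>k. \<bar>\<theta> k\<bar> \<le> r N k)" ..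
    then show thesis using that by blast
  qed
  \<comment> \<open>For data in \<open>Y N\<close> every minimiser lies in this fixed compact set;
    \<open>Y N\<close> exhausts the data space because no single compact set serves all
    data.\<close>
  define box where "box N = \<Theta> \<inter> {\<theta>. \<forall>k. \<bar>\<theta> k\<bar> \<le> r N k}" for N
  have box: "compact (box N)" for N
    unfolding box_def using \<Theta>(1) compact_coordinate_box by (rule closed_Int_compact)
  define A where "A y = {\<theta>\<in>\<Theta>. \<forall>\<theta>'\<in>\<Theta>. F y \<theta> \<le> F y \<theta>'}" for y
  have Abox: "A y \<subseteq> box N" if "y \<in> Y N" for y N
    using r[OF that] \<Theta>(2) by (auto simp: A_def box_def)
  have Fy: "continuous_on UNIV (F y)" for y
    using continuous_on_compose2[OF F, of UNIV "\<lambda>\<theta>. (y, \<theta>)"] by (simp add: continuous_intros)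
  have Fpair: "continuous_on UNIV (\<lambda>p. F (fst p) \<theta>')" for \<theta>'
    using continuous_on_compose2[OF F, of UNIV "\<lambda>p. (fst p, \<theta>')"] by (simp add: continuous_intros)
  have ex: "\<exists>\<theta>\<in>A y. \<forall>\<theta>'\<in>A y. G \<theta> \<le> G \<theta>'" for y
  proof -
    obtain N where N: "y \<in> Y N" using Y(2) by blast
    have "\<theta>0 \<in> box N" using r[OF N \<Theta>(2)] \<Theta>(2) by (simp add: box_def)
    then obtain \<theta>1 where \<theta>1: "\<theta>1 \<in> box N" "\<forall>\<theta>\<in>box N. F y \<theta>1 \<le> F y \<theta>"
      using continuous_attains_inf[OF box, of N "F y"] continuous_on_subset[OF Fy] by auto
    have "\<theta>1 \<in> A y"
      unfolding A_def
    proof (intro CollectI conjI ballI)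
      show "\<theta>1 \<in> \<Theta>" using \<theta>1 by (simp add: box_def)
      fix \<theta>' assume t': "\<theta>' \<in> \<Theta>"
      show "F y \<theta>1 \<le> F y \<theta>'"
      proof (cases "F y \<theta>' \<le> F y \<theta>0")
        case True
        then have "\<theta>' \<in> box N" using r[OF N t'] t' by (simp add: box_def)
        then show ?thesis using \<theta>1 by blast
      next
        case False
        then show ?thesis using \<theta>1(2) \<open>\<theta>0 \<in> box N\<close> by fastforce
      qed
    qed
    moreover have "compact (A y)"
    proof -
      have "A y = \<Theta> \<inter> (\<Inter>\<theta>'\<in>\<Theta>. {\<theta>. F y \<theta> \<le> F y \<theta>'})" by (auto simp: A_def)
      then have "closed (A y)"
        using \<Theta>(1) Fy by (auto intro!: closed_Int closed_INT closed_Collect_le continuous_on_const)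
      then have "compact (A y \<inter> box N)" using box by (rule closed_Int_compact)
      then show ?thesis using Abox[OF N] by (simp add: Int_absorb2)
    qed
    ultimately show ?thesis
      using continuous_attains_inf[of "A y" G] continuous_on_subset[OF G] by auto
  qed
  define sel where "sel y = (SOME \<theta>. \<theta> \<in> A y \<and> (\<forall>\<theta>'\<in>A y. G \<theta> \<le> G \<theta>'))" for y
  have sel: "sel y \<in> A y" "\<And>\<theta>'. \<theta>' \<in> A y \<Longrightarrow> G (sel y) \<le> G \<theta>'" for y
    using someI_ex[of "\<lambda>\<theta>. \<theta> \<in> A y \<and> (\<forall>\<theta>'\<in>A y. G \<theta> \<le> G \<theta>')"] ex[of y] unfolding sel_def by blast+
  have "(\<lambda>y. G (sel y)) \<in> borel_measurable borel"
  proof (subst borel_measurable_iff_le, intro allI)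
    fix c
    \<comment> \<open>The pairs of data and a minimiser with criterion at most \<open>c\<close>.
      Written as an intersection over all competitors, the minimising property is closed jointly in
      both components.\<close>
    define T where "T = {p :: (nat \<Rightarrow> real) \<times> (nat \<Rightarrow> real). G (snd p) \<le> c} \<inter> (\<Inter>\<theta>'\<in>\<Theta>. {p. F (fst p) (snd p) \<le> F (fst p) \<theta>'})"
    have "closed T" unfolding T_def
      by (intro closed_Int closed_INT ballI closed_Collect_le F Fpair continuous_on_const
          continuous_on_compose2[OF G] continuous_on_snd continuous_on_id) auto
    then have cl: "closed (Y N \<inter> {y. \<exists>\<theta>\<in>box N. (y, \<theta>) \<in> T})" for N
      by (intro closed_Int Y(1) closed_projection_of_compact box)
    have "{y \<in> space borel. G (sel y) \<le> c} = (\<Union>N. Y N \<inter> {y. \<exists>\<theta>\<in>box N. (y, \<theta>) \<in> T})"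
    proof (intro equalityI subsetI)
      fix y assume "y \<in> {y \<in> space borel. G (sel y) \<le> c}"
      then have y: "G (sel y) \<le> c" by simp
      obtain N where N: "y \<in> Y N" using Y(2) by blast
      have "sel y \<in> box N" using sel(1) Abox[OF N] by blast
      moreover have "(y, sel y) \<in> T" using y sel(1)[of y] by (simp add: T_def A_def)
      ultimately show "y \<in> (\<Union>N. Y N \<inter> {y. \<exists>\<theta>\<in>box N. (y, \<theta>) \<in> T})" using N by blast
    next
      fix y assume "y \<in> (\<Union>N. Y N \<inter> {y. \<exists>\<theta>\<in>box N. (y, \<theta>) \<in> T})"
      then obtain N \<theta> where \<theta>: "\<theta> \<in> box N" "(y, \<theta>) \<in> T" by blast
      then have "\<theta> \<in> A y" "G \<theta> \<le> c" by (auto simp: T_def A_def box_def)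
      then show "y \<in> {y \<in> space borel. G (sel y) \<le> c}" using sel(2) by fastforce
    qed
    also have "\<dots> \<in> sets borel" using cl by (intro sets.countable_UN) auto
    finally show "{y \<in> space borel. G (sel y) \<le> c} \<in> sets borel" .
  qed
  then show ?thesis using sel(1) unfolding A_def by (intro exI[of _ sel]) blast
qed

text \<open>On a sublevel set of the objective, coercivity of \<open>\<rho>\<close> bounds the
  design values of a spline and the second term bounds its penalty. Together these bound the sum of
  squared coefficients, which is the design form at the spline. The bound is uniform over bounded
  data, as the selection argument requires.\<close>

lemma spline_selection:
  fixes \<rho> :: "real \<Rightarrow> real"
  assumes m: "m \<ge> 1" and n: "n \<ge> 1" and lam: "lam > 0" and t: "\<And>i. i \<in> {1..n} \<Longrightarrow> t i \<in> {0..1}"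
    and \<rho>: "continuous_on UNIV \<rho>" "\<And>x. \<rho> x \<ge> 0" "a > 0" "\<And>x. \<rho> x \<ge> a * \<bar>x\<bar> - c"
    and f0: "f0 \<in> sobolev2 m"
  obtains fhat where "\<And>y. m_smoothing_spline m n lam \<rho> t y (fhat y)"
    "(\<lambda>y. sob_inner m lam (\<lambda>x. fhat y x - f0 x) (\<lambda>x. fhat y x - f0 x)) \<in> borel_measurable borel"
proof -
  interpret D: semi_inner "sobolev2 m" "design_form m n t" by (rule semi_inner_design[OF m])
  interpret J: semi_inner "sobolev2 m" "\<lambda>f g. inner2 (nderiv m f) (nderiv m g)" by (rule semi_inner_nderiv[OF m])
  interpret S: semi_inner "sobolev2 m" "sob_inner m lam" by (rule semi_inner_sob[OF m]) (use lam in simp)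
  obtain K :: nat and v where v: "\<And>k. k < K \<Longrightarrow> v k \<in> sobolev2 m"
    and on: "\<And>i j. i < K \<Longrightarrow> j < K \<Longrightarrow> design_form m n t (v i) (v j) = (if i = j then 1 else 0)"
    and best: "\<And>f. f \<in> sobolev2 m \<Longrightarrow> \<exists>\<theta>. (\<forall>i\<in>{1..n}. (\<Sum>k<K. \<theta> k * v k (t i)) = f (t i)) \<and>
       inner2 (nderiv m (\<lambda>x. \<Sum>k<K. \<theta> k * v k x)) (nderiv m (\<lambda>x. \<Sum>k<K. \<theta> k * v k x)) \<le> inner2 (nderiv m f) (nderiv m f)"
    using spline_space[where t=t and n=n, OF m t] by blast
  define f where "f \<theta> x = (\<Sum>k<K. \<theta> k * v k x)" for \<theta> x
  have fH: "f \<theta> \<in> sobolev2 m" for \<theta> unfolding f_def[abs_def] by (rule D.sum_mem[OF v])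
  have obj: "spline_objective m n lam \<rho> t y g = 1 / real n * (\<Sum>i=1..n. \<rho> (y i - g (t i))) + lam * inner2 (nderiv m g) (nderiv m g)" for y g
    by (simp add: spline_objective_def inner2_def power2_eq_square)
  define F where "F y \<theta> = spline_objective m n lam \<rho> t y (f \<theta>)" for y \<theta>
  define G where "G \<theta> = sob_inner m lam (\<lambda>x. f \<theta> x - f0 x) (\<lambda>x. f \<theta> x - f0 x)" for \<theta>
  \<comment> \<open>The objective sees only the first \<open>K\<close> coefficients. Fixing the
    others at 0 is what makes its sublevel sets bounded.\<close>
  define \<Theta> where "\<Theta> = {\<theta> :: nat \<Rightarrow> real. \<forall>k\<in>{K..}. \<theta> k = 0}"
  have Jf: "inner2 (nderiv m (f \<theta>)) (nderiv m (f \<theta>)) = (\<Sum>j<K. \<theta> j * (\<Sum>k<K. \<theta> k * inner2 (nderiv m (v k)) (nderiv m (v j))))" for \<theta>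
  proof -
    have "inner2 (nderiv m (f \<theta>)) (nderiv m (f \<theta>)) = (\<Sum>j<K. \<theta> j * inner2 (nderiv m (v j)) (nderiv m (f \<theta>)))"
      unfolding f_def[abs_def] by (rule J.B_sum[OF v D.sum_mem[OF v]])
    also have "\<dots> = (\<Sum>j<K. \<theta> j * (\<Sum>k<K. \<theta> k * inner2 (nderiv m (v k)) (nderiv m (v j))))"
    proof (intro sum.cong refl)
      fix j assume "j \<in> {..<K}"
      then have "inner2 (nderiv m (v j)) (nderiv m (f \<theta>)) = inner2 (nderiv m (f \<theta>)) (nderiv m (v j))" by (intro J.sym v fH) auto
      also have "\<dots> = (\<Sum>k<K. \<theta> k * inner2 (nderiv m (v k)) (nderiv m (v j)))"
        unfolding f_def[abs_def] by (rule J.B_sum[OF v v]) (use \<open>j \<in> _\<close> in auto)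
      finally show "\<theta> j * inner2 (nderiv m (v j)) (nderiv m (f \<theta>)) = \<theta> j * (\<Sum>k<K. \<theta> k * inner2 (nderiv m (v k)) (nderiv m (v j)))" by simp
    qed
    finally show ?thesis .
  qed
  have cont_coord: "continuous_on UNIV (\<lambda>p :: (nat \<Rightarrow> real) \<times> (nat \<Rightarrow> real). fst p i)" "continuous_on UNIV (\<lambda>p :: (nat \<Rightarrow> real) \<times> (nat \<Rightarrow> real). snd p i)" for i
    by (rule continuous_on_product_then_coordinatewise, intro continuous_intros)+
  have cF: "continuous_on UNIV (\<lambda>p. F (fst p) (snd p))"
    unfolding F_def obj Jf unfolding f_def
    by (intro continuous_intros cont_coord continuous_on_compose2[OF \<rho>(1)]) auto
  have Geq: "G \<theta> = (\<Sum>j<K. \<theta> j * (\<Sum>k<K. \<theta> k * sob_inner m lam (v k) (v j))) - 2 * (\<Sum>k<K. \<theta> k * sob_inner m lam (v k) f0) + sob_inner m lam f0 f0" for \<theta>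
  proof -
    have d: "(\<lambda>x. 1 * f \<theta> x + (-1) * f0 x) \<in> sobolev2 m" by (rule S.closed[OF fH f0])
    have lin: "sob_inner m lam (\<lambda>x. 1 * f \<theta> x + (-1) * f0 x) h = 1 * sob_inner m lam (f \<theta>) h + (-1) * sob_inner m lam f0 h" if "h \<in> sobolev2 m" for h
      by (rule S.lin[OF fH f0 that])
    have "G \<theta> = sob_inner m lam (\<lambda>x. 1 * f \<theta> x + (-1) * f0 x) (\<lambda>x. 1 * f \<theta> x + (-1) * f0 x)" by (simp add: G_def)
    also have "\<dots> = sob_inner m lam (\<lambda>x. 1 * f \<theta> x + (-1) * f0 x) (f \<theta>) - sob_inner m lam (\<lambda>x. 1 * f \<theta> x + (-1) * f0 x) f0"
      using lin[OF d] S.sym[OF fH d] S.sym[OF f0 d] by simp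
    also have "\<dots> = sob_inner m lam (f \<theta>) (f \<theta>) - 2 * sob_inner m lam (f \<theta>) f0 + sob_inner m lam f0 f0"
      unfolding lin[OF fH] lin[OF f0] S.sym[OF f0 fH] by simp
    also have "sob_inner m lam (f \<theta>) f0 = (\<Sum>k<K. \<theta> k * sob_inner m lam (v k) f0)"
      unfolding f_def[abs_def] by (rule S.B_sum[OF v f0])
    also have "sob_inner m lam (f \<theta>) (f \<theta>) = (\<Sum>j<K. \<theta> j * sob_inner m lam (v j) (f \<theta>))"
      unfolding f_def[abs_def] by (rule S.B_sum[OF v D.sum_mem[OF v]])
    also have "\<dots> = (\<Sum>j<K. \<theta> j * (\<Sum>k<K. \<theta> k * sob_inner m lam (v k) (v j)))"
    proof (intro sum.cong refl)
      fix j assume "j \<in> {..<K}"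
      then have "sob_inner m lam (v j) (f \<theta>) = sob_inner m lam (f \<theta>) (v j)" by (intro S.sym v fH) auto
      also have "\<dots> = (\<Sum>k<K. \<theta> k * sob_inner m lam (v k) (v j))"
        unfolding f_def[abs_def] by (rule S.B_sum[OF v v]) (use \<open>j \<in> _\<close> in auto)
      finally show "\<theta> j * sob_inner m lam (v j) (f \<theta>) = \<theta> j * (\<Sum>k<K. \<theta> k * sob_inner m lam (v k) (v j))" by simp
    qed
    finally show ?thesis .
  qed
  have cG: "continuous_on UNIV G"
    unfolding Geq[abs_def] by (intro continuous_intros continuous_on_product_coordinates)
  have DF: "design_form m n t (f \<theta>) (f \<theta>) = (\<Sum>k<K. (\<theta> k)\<^sup>2)" for \<theta>
  proof -
    have "design_form m n t (f \<theta>) (f \<theta>) = (\<Sum>j<K. \<theta> j * design_form m n t (v j) (f \<theta>))"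
      unfolding f_def[abs_def] by (rule D.B_sum[OF v D.sum_mem[OF v]])
    also have "\<dots> = (\<Sum>j<K. \<theta> j * \<theta> j)"
    proof (intro sum.cong refl)
      fix j assume j: "j \<in> {..<K}"
      then have "design_form m n t (v j) (f \<theta>) = design_form m n t (f \<theta>) (v j)" by (intro D.sym v fH) auto
      also have "\<dots> = (\<Sum>k<K. \<theta> k * design_form m n t (v k) (v j))"
        unfolding f_def[abs_def] by (rule D.B_sum[OF v v]) (use j in auto)
      also have "\<dots> = (\<Sum>k<K. if k = j then \<theta> j else 0)"
        by (intro sum.cong refl) (use on j in auto)
      also have "\<dots> = \<theta> j" using j by simp
      finally show "\<theta> j * design_form m n t (v j) (f \<theta>) = \<theta> j * \<theta> j" by simp
    qed
    finally show ?thesis by (simp add: power2_eq_square)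
  qed
  have J0: "inner2 (nderiv m (f (\<lambda>_. 0))) (nderiv m (f (\<lambda>_. 0))) = 0" unfolding Jf by simp
  have "\<exists>sel. (\<forall>y. sel y \<in> \<Theta>) \<and> (\<forall>y. \<forall>\<theta>\<in>\<Theta>. F y (sel y) \<le> F y \<theta>) \<and> (\<lambda>y. G (sel y)) \<in> borel_measurable borel"
  proof (rule argmin_selection[OF cF cG, where \<Theta>=\<Theta> and ?\<theta>0.0="\<lambda>_. 0" and Y="\<lambda>N. {y. \<forall>i\<in>{1..n}. \<bar>y i\<bar> \<le> real N}"])
    show "closed \<Theta>"
    proof -
      have "\<Theta> = (\<Inter>k\<in>{K..}. {\<theta>. \<theta> k = 0})" by (auto simp: \<Theta>_def)
      then show ?thesis by (auto intro!: closed_INT closed_Collect_eq continuous_on_product_coordinates continuous_on_const)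
    qed
    show "(\<lambda>_. 0) \<in> \<Theta>" by (simp add: \<Theta>_def)
    show "closed {y :: nat \<Rightarrow> real. \<forall>i\<in>{1..n}. \<bar>y i\<bar> \<le> real N}" for N
    proof -
      have "{y :: nat \<Rightarrow> real. \<forall>i\<in>{1..n}. \<bar>y i\<bar> \<le> real N} = (\<Inter>i\<in>{1..n}. {y. \<bar>y i\<bar> \<le> real N})" by auto
      moreover have "closed (\<Inter>i\<in>{1..n}. {y :: nat \<Rightarrow> real. \<bar>y i\<bar> \<le> real N})"
        by (intro closed_INT ballI closed_Collect_le continuous_on_rabs continuous_on_product_coordinates continuous_on_const)
      ultimately show ?thesis by simp
    qed
    show "(\<Union>N::nat. {y :: nat \<Rightarrow> real. \<forall>i\<in>{1..n}. \<bar>y i\<bar> \<le> real N}) = UNIV"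
    proof (intro equalityI subsetI UNIV_I)
      fix y :: "nat \<Rightarrow> real"
      obtain N :: nat where "(\<Sum>i=1..n. \<bar>y i\<bar>) \<le> real N" using real_arch_simple by blast
      moreover have "\<bar>y i\<bar> \<le> (\<Sum>i=1..n. \<bar>y i\<bar>)" if "i \<in> {1..n}" for i
        by (rule member_le_sum[OF that]) auto
      ultimately have "\<forall>i\<in>{1..n}. \<bar>y i\<bar> \<le> real N" by fastforce
      then show "y \<in> (\<Union>N::nat. {y. \<forall>i\<in>{1..n}. \<bar>y i\<bar> \<le> real N})" by blast
    qed
    fix N :: nat
    have "bounded (\<rho> ` {- real N..real N})"
      using continuous_on_subset[OF \<rho>(1)] by (intro compact_imp_bounded compact_continuous_image) auto
    then obtain S where S: "S > 0" "\<And>x. \<bar>x\<bar> \<le> real N \<Longrightarrow> \<rho> x \<le> S"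
      unfolding bounded_pos by (force simp: abs_le_iff)
    \<comment> \<open>Comparison with the zero function bounds the objective by \<open>S\<close>.
      Hence each loss term is at most \<open>n S\<close>, which coercivity turns into the bound
      \<open>Q\<close> on the design values, and the penalty is at most \<open>S / lam\<close>. The
      1 in \<open>R\<close> comes from passing from a square to an absolute value.\<close>
    define Q where "Q = real N + (real n * S + \<bar>c\<bar>) / a"
    define R where "R = real n * Q\<^sup>2 + S / lam + 1"
    have R: "\<bar>\<theta> k\<bar> \<le> R" if y: "\<forall>i\<in>{1..n}. \<bar>y i\<bar> \<le> real N" and \<theta>: "\<theta> \<in> \<Theta>" "F y \<theta> \<le> F y (\<lambda>_. 0)" for y \<theta> k
    proof -
      have "F y (\<lambda>_. 0) = 1 / real n * (\<Sum>i=1..n. \<rho> (y i))"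
        unfolding F_def obj J0 by (simp add: f_def)
      also have "\<dots> \<le> 1 / real n * (\<Sum>i=1..n. S)"
        using y S(2) by (intro mult_left_mono sum_mono) auto
      also have "\<dots> = S" using n by simp
      finally have FS: "1 / real n * (\<Sum>i=1..n. \<rho> (y i - f \<theta> (t i))) + lam * inner2 (nderiv m (f \<theta>)) (nderiv m (f \<theta>)) \<le> S"
        using \<theta>(2) unfolding F_def obj by linarith
      have nnr: "0 \<le> 1 / real n * (\<Sum>i=1..n. \<rho> (y i - f \<theta> (t i)))" using \<rho>(2) by (intro mult_nonneg_nonneg sum_nonneg) auto
      have nnJ: "0 \<le> lam * inner2 (nderiv m (f \<theta>)) (nderiv m (f \<theta>))" using lam inner2_self_nonneg by simp
      have JS: "inner2 (nderiv m (f \<theta>)) (nderiv m (f \<theta>)) \<le> S / lam"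
        using FS nnr lam by (simp add: field_simps)
      have sumS: "(\<Sum>i=1..n. \<rho> (y i - f \<theta> (t i))) \<le> real n * S"
      proof -
        have "1 / real n * (\<Sum>i=1..n. \<rho> (y i - f \<theta> (t i))) \<le> S" using FS nnJ by linarith
        then have "real n * (1 / real n * (\<Sum>i=1..n. \<rho> (y i - f \<theta> (t i)))) \<le> real n * S" by (rule mult_left_mono) simp
        then show ?thesis using n by simp
      qed
      have fQ: "\<bar>f \<theta> (t i)\<bar> \<le> Q" if i: "i \<in> {1..n}" for i
      proof -
        have "a * \<bar>y i - f \<theta> (t i)\<bar> - c \<le> \<rho> (y i - f \<theta> (t i))" by (rule \<rho>(4))
        also have "\<dots> \<le> (\<Sum>i=1..n. \<rho> (y i - f \<theta> (t i)))" by (rule member_le_sum[OF i]) (use \<rho>(2) in auto)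
        finally have "a * \<bar>y i - f \<theta> (t i)\<bar> \<le> real n * S + \<bar>c\<bar>" using sumS by linarith
        then have "\<bar>y i - f \<theta> (t i)\<bar> \<le> (real n * S + \<bar>c\<bar>) / a" using \<rho>(3) by (simp add: field_simps)
        moreover have "\<bar>y i\<bar> \<le> real N" using y i by blast
        ultimately show ?thesis unfolding Q_def by linarith
      qed
      have "(\<Sum>k<K. (\<theta> k)\<^sup>2) \<le> real n * Q\<^sup>2 + S / lam"
      proof -
        have "f \<theta> (t i) * f \<theta> (t i) \<le> Q\<^sup>2" if "i \<in> {1..n}" for i
          using power_mono[OF fQ[OF that], of 2] by (simp add: power2_eq_square)
        then have "(\<Sum>i=1..n. f \<theta> (t i) * f \<theta> (t i)) \<le> (\<Sum>i=1..n. Q\<^sup>2)" by (rule sum_mono)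
        then show ?thesis using JS unfolding DF[symmetric] design_form_def by simp
      qed
      moreover have "(\<theta> k)\<^sup>2 \<le> (\<Sum>k<K. (\<theta> k)\<^sup>2)" if "k < K"
        by (rule member_le_sum) (use that in auto)
      moreover have "(\<theta> k)\<^sup>2 = 0" if "\<not> k < K" using \<theta>(1) that by (simp add: \<Theta>_def)
      moreover have "0 \<le> real n * Q\<^sup>2 + S / lam" using S lam by simp
      ultimately have "(\<theta> k)\<^sup>2 \<le> real n * Q\<^sup>2 + S / lam" by (cases "k < K") auto
      moreover have "\<bar>\<theta> k\<bar> \<le> (\<theta> k)\<^sup>2 + 1"
        using zero_le_power2[of "\<bar>\<theta> k\<bar> - 1"] zero_le_power2[of "\<theta> k"] by (simp add: power2_diff)
      ultimately show ?thesis unfolding R_def by linarith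
    qed
    then show "\<exists>r. \<forall>y\<in>{y. \<forall>i\<in>{1..n}. \<bar>y i\<bar> \<le> real N}. \<forall>\<theta>\<in>\<Theta>. F y \<theta> \<le> F y (\<lambda>_. 0) \<longrightarrow> (\<forall>k. \<bar>\<theta> k\<bar> \<le> r k)"
      by (intro exI[of _ "\<lambda>_. R"]) blast
  qed
  then obtain sel where sel: "\<And>y. sel y \<in> \<Theta>" "\<And>y \<theta>. \<theta> \<in> \<Theta> \<Longrightarrow> F y (sel y) \<le> F y \<theta>"
    "(\<lambda>y. G (sel y)) \<in> borel_measurable borel" by blast
  show thesis
  proof (rule that[of "\<lambda>y. f (sel y)"])
    show "(\<lambda>y. sob_inner m lam (\<lambda>x. f (sel y) x - f0 x) (\<lambda>x. f (sel y) x - f0 x)) \<in> borel_measurable borel"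
      using sel(3) unfolding G_def .
    fix y
    show "m_smoothing_spline m n lam \<rho> t y (f (sel y))"
      unfolding m_smoothing_spline_def is_arg_min_def
    proof (intro conjI notI fH)
      assume "\<exists>g. g \<in> sobolev2 m \<and> spline_objective m n lam \<rho> t y g < spline_objective m n lam \<rho> t y (f (sel y))"
      then obtain g where g: "g \<in> sobolev2 m" "spline_objective m n lam \<rho> t y g < spline_objective m n lam \<rho> t y (f (sel y))" by blast
      obtain \<theta> where \<theta>: "\<forall>i\<in>{1..n}. (\<Sum>k<K. \<theta> k * v k (t i)) = g (t i)"
        "inner2 (nderiv m (\<lambda>x. \<Sum>k<K. \<theta> k * v k x)) (nderiv m (\<lambda>x. \<Sum>k<K. \<theta> k * v k x)) \<le> inner2 (nderiv m g) (nderiv m g)"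
        using best[OF g(1)] by blast
      \<comment> \<open>The entries of \<open>\<theta>\<close> from \<open>K\<close> on are
        arbitrary; cutting them off brings the competitor into \<open>\<Theta>\<close> without
        changing the function.\<close>
      define \<theta>' where "\<theta>' k = (if k < K then \<theta> k else 0)" for k
      have f': "f \<theta>' = (\<lambda>x. \<Sum>k<K. \<theta> k * v k x)" by (auto simp: f_def \<theta>'_def fun_eq_iff intro!: sum.cong)
      have "F y \<theta>' \<le> spline_objective m n lam \<rho> t y g"
        unfolding F_def obj f' using \<theta> lam by (intro add_mono mult_left_mono) auto
      moreover have "F y (sel y) \<le> F y \<theta>'" by (rule sel(2)) (simp add: \<Theta>_def \<theta>'_def)
      ultimately show False using g(2) unfolding F_def by linarith
    qed
  qed
qed

section \<open>Empirical processes\<close>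

lemma SUP_ennreal_add_le:
  fixes f g :: "'i \<Rightarrow> ennreal"
  assumes "H \<noteq> {}" "\<And>h h'. h \<in> H \<Longrightarrow> h' \<in> H \<Longrightarrow> f h + g h' \<le> B"
  shows "(\<Squnion>h\<in>H. f h) + (\<Squnion>h\<in>H. g h) \<le> B"
proof -
  have "f h + (\<Squnion>h\<in>H. g h) \<le> B" if "h \<in> H" for h
  proof -
    have "(\<Squnion>h'\<in>H. g h' + f h) \<le> B"
      by (rule SUP_least) (use assms(2)[OF that] in \<open>simp add: add.commute\<close>)
    then show ?thesis using ennreal_SUP_add_left[OF assms(1), of g "f h"] by (simp add: add.commute)
  qed
  then have "(\<Squnion>h\<in>H. f h + (\<Squnion>h\<in>H. g h)) \<le> B" by (rule SUP_least)
  then show ?thesis using ennreal_SUP_add_left[OF assms(1), of f] by simp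
qed

text \<open>\<open>ennreal\<close> sends negative numbers to 0, so on sums it is only
  subadditive.\<close>

lemma ennreal_add_le_add: "ennreal (p + q) \<le> ennreal p + ennreal q"
proof (cases "p \<ge> 0")
  case True
  then show ?thesis
  proof (cases "q \<ge> 0")
    case False
    then have "ennreal (p + q) \<le> ennreal p" by (intro ennreal_leI) simp
    moreover have "ennreal q = 0" using False by (intro ennreal_neg) simp
    ultimately show ?thesis by simp
  qed simp
next
  case False
  then have "ennreal (p + q) \<le> ennreal q" by (intro ennreal_leI) simp
  moreover have "ennreal p = 0" using False by (intro ennreal_neg) simp
  ultimately show ?thesis by simp
qed

text \<open>A random function of \<open>u\<close> on \<bar>u\<bar> \<le> \<delta> with random
  Lipschitz constant \<open>L\<close>. \<Lambda> bounds the second moment of the sum of two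
  independent copies of \<open>L\<close>, because symmetrisation replaces an observation by an
  independent pair.\<close>

locale lip_process = prob_space N for N :: "real measure" +
  fixes \<phi> :: "real \<Rightarrow> real \<Rightarrow> real" and L :: "real \<Rightarrow> real" and \<delta> \<Lambda> :: real
  assumes sets_N [measurable_cong]: "sets N = sets borel"
    and \<phi>_meas [measurable]: "\<And>u. (\<lambda>e. \<phi> e u) \<in> borel_measurable borel"
    and \<phi>_int: "\<And>u. \<bar>u\<bar> \<le> \<delta> \<Longrightarrow> integrable N (\<lambda>e. \<phi> e u)"
    and \<phi>_0: "\<And>e. \<phi> e 0 = 0"
    and L_meas [measurable]: "L \<in> borel_measurable borel"
    and L_nonneg: "\<And>e. L e \<ge> 0"
    and lip: "\<And>e u u'. \<bar>u\<bar> \<le> \<delta> \<Longrightarrow> \<bar>u'\<bar> \<le> \<delta> \<Longrightarrow> \<bar>\<phi> e u - \<phi> e u'\<bar> \<le> L e * \<bar>u - u'\<bar>"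
    and \<Lambda>_nonneg: "\<Lambda> \<ge> 0"
    and \<Lambda>: "(\<integral>\<^sup>+p. ennreal ((L (fst p) + L (snd p))\<^sup>2) \<partial>(N \<Otimes>\<^sub>M N)) \<le> ennreal \<Lambda>"
begin

definition mu :: "real \<Rightarrow> real" where
  "mu u = (\<integral>e. \<phi> e u \<partial>N)"

lemma mu_0: "mu 0 = 0"
  by (simp add: mu_def \<phi>_0)

sublocale NN: pair_sigma_finite N N ..

text \<open>
  Symmetrisation and contraction for a single coordinate: Jensen replaces the mean \<open>mu\<close> by an
  independent copy, exchanging the two copies produces a random sign, and the Lipschitz bound
  replaces the increments of \<open>\<phi>\<close> by linear ones.
\<close>

lemma symmetrize_coordinate:
  assumes H: "countable H" "\<And>h. h \<in> H \<Longrightarrow> \<bar>u h\<bar> \<le> \<delta>" and h0: "h0 \<in> H" "u h0 = 0" "a h0 \<ge> 0"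
  shows "2 * (\<integral>\<^sup>+y. (\<Squnion>h\<in>H. ennreal (a h + (mu (u h) - \<phi> y (u h)))) \<partial>N) \<le>
     (\<integral>\<^sup>+p. ((\<Squnion>h\<in>H. ennreal (a h + (L (fst p) + L (snd p)) * u h)) + (\<Squnion>h\<in>H. ennreal (a h - (L (fst p) + L (snd p)) * u h))) \<partial>(N \<Otimes>\<^sub>M N))"
proof -
  define D where "D y y' = (\<Squnion>h\<in>H. ennreal (a h + (\<phi> y' (u h) - \<phi> y (u h))))" for y y'
  have Dm: "(\<lambda>p. D (fst p) (snd p)) \<in> borel_measurable (N \<Otimes>\<^sub>M N)"
    unfolding D_def using H(1) by measurable
  have Dm': "(\<lambda>p. D (snd p) (fst p)) \<in> borel_measurable (N \<Otimes>\<^sub>M N)"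
    unfolding D_def using H(1) by measurable
  have "(\<integral>\<^sup>+y. (\<Squnion>h\<in>H. ennreal (a h + (mu (u h) - \<phi> y (u h)))) \<partial>N) \<le> (\<integral>\<^sup>+y. \<integral>\<^sup>+y'. D y y' \<partial>N \<partial>N)"
  proof (intro nn_integral_mono SUP_least)
    fix y h assume h: "h \<in> H"
    define g where "g y' = a h + (\<phi> y' (u h) - \<phi> y (u h))" for y'
    have gi: "integrable N g" unfolding g_def using \<phi>_int[OF H(2)[OF h]] by simp
    have "a h + (mu (u h) - \<phi> y (u h)) = (\<integral>y'. g y' \<partial>N)"
      unfolding g_def mu_def using \<phi>_int[OF H(2)[OF h]] by (simp add: prob_space)
    \<comment> \<open>Jensen's inequality for the positive part, which is what
      \<open>ennreal\<close> applies to a real number.\<close>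
    also have "\<dots> \<le> (\<integral>y'. max 0 (g y') \<partial>N)" by (rule integral_mono[OF gi]) (use gi in auto)
    finally have "ennreal (a h + (mu (u h) - \<phi> y (u h))) \<le> ennreal (\<integral>y'. max 0 (g y') \<partial>N)" by (rule ennreal_leI)
    also have "\<dots> = (\<integral>\<^sup>+y'. ennreal (max 0 (g y')) \<partial>N)"
      by (rule nn_integral_eq_integral[symmetric]) (use gi in auto)
    also have "\<dots> = (\<integral>\<^sup>+y'. ennreal (g y') \<partial>N)" by (simp add: ennreal_max_0)
    also have "\<dots> \<le> (\<integral>\<^sup>+y'. D y y' \<partial>N)"
      unfolding g_def D_def using h by (intro nn_integral_mono SUP_upper)
    finally show "ennreal (a h + (mu (u h) - \<phi> y (u h))) \<le> (\<integral>\<^sup>+y'. D y y' \<partial>N)" .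
  qed
  then have "2 * (\<integral>\<^sup>+y. (\<Squnion>h\<in>H. ennreal (a h + (mu (u h) - \<phi> y (u h)))) \<partial>N) \<le>
     (\<integral>\<^sup>+y. \<integral>\<^sup>+y'. D y y' \<partial>N \<partial>N) + (\<integral>\<^sup>+y. \<integral>\<^sup>+y'. D y y' \<partial>N \<partial>N)"
    unfolding mult_2 by (intro add_mono)
  also have "(\<integral>\<^sup>+y. \<integral>\<^sup>+y'. D y y' \<partial>N \<partial>N) = (\<integral>\<^sup>+p. D (fst p) (snd p) \<partial>(N \<Otimes>\<^sub>M N))"
    using nn_integral_fst[OF Dm] by simp
  also have "(\<integral>\<^sup>+p. D (fst p) (snd p) \<partial>(N \<Otimes>\<^sub>M N)) + (\<integral>\<^sup>+p. D (fst p) (snd p) \<partial>(N \<Otimes>\<^sub>M N)) =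
     (\<integral>\<^sup>+p. D (fst p) (snd p) \<partial>(N \<Otimes>\<^sub>M N)) + (\<integral>\<^sup>+p. D (snd p) (fst p) \<partial>(N \<Otimes>\<^sub>M N))"
  proof -
    have "(\<integral>\<^sup>+p. D (fst p) (snd p) \<partial>(N \<Otimes>\<^sub>M N)) = (\<integral>\<^sup>+y. \<integral>\<^sup>+x. D y x \<partial>N \<partial>N)"
      using nn_integral_fst[OF Dm] by simp
    also have "\<dots> = (\<integral>\<^sup>+p. D (snd p) (fst p) \<partial>(N \<Otimes>\<^sub>M N))"
      using NN.nn_integral_snd[OF Dm'[unfolded case_prod_beta'[symmetric]]] by (simp add: case_prod_beta')
    finally show ?thesis by simp
  qed
  also have "\<dots> = (\<integral>\<^sup>+p. D (fst p) (snd p) + D (snd p) (fst p) \<partial>(N \<Otimes>\<^sub>M N))"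
    by (rule nn_integral_add[OF Dm Dm', symmetric])
  also have "\<dots> \<le> (\<integral>\<^sup>+p. ((\<Squnion>h\<in>H. ennreal (a h + (L (fst p) + L (snd p)) * u h)) + (\<Squnion>h\<in>H. ennreal (a h - (L (fst p) + L (snd p)) * u h))) \<partial>(N \<Otimes>\<^sub>M N))"
  proof (rule nn_integral_mono)
    fix p :: "real \<times> real"
    define y where "y = fst p"
    define y' where "y' = snd p"
    define l where "l = L y + L y'"
    define X where "X h = a h + (\<phi> y' (u h) - \<phi> y (u h))" for h
    define X' where "X' h = a h + (\<phi> y (u h) - \<phi> y' (u h))" for h
    define B where "B = (\<Squnion>h\<in>H. ennreal (a h + l * u h)) + (\<Squnion>h\<in>H. ennreal (a h - l * u h))"
    \<comment> \<open>The increments of \<open>\<phi>\<close> cost at most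
      \<open>l * \<bar>u h - u h'\<bar>\<close>. The index with the larger value of \<open>u\<close>
      takes the plus sign and the other the minus sign, so the absolute value is dominated by the
      two linear suprema.\<close>
    have main: "ennreal (X h) + ennreal (X' h') \<le> B" if h: "h \<in> H" "h' \<in> H" "X h \<ge> 0" "X' h' \<ge> 0" for h h'
    proof -
      have "(\<phi> y' (u h) - \<phi> y' (u h')) + (\<phi> y (u h') - \<phi> y (u h)) \<le> L y' * \<bar>u h - u h'\<bar> + L y * \<bar>u h' - u h\<bar>"
        using lip[OF H(2)[OF h(1)] H(2)[OF h(2)], of y'] lip[OF H(2)[OF h(2)] H(2)[OF h(1)], of y] by linarith
      also have "\<dots> = l * \<bar>u h - u h'\<bar>" by (simp add: l_def abs_minus_commute distrib_right)
      finally have le: "X h + X' h' \<le> a h + a h' + l * \<bar>u h - u h'\<bar>" by (simp add: X_def X'_def)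
      have up: "ennreal (a k + l * u k) + ennreal (a k' - l * u k') \<le> B" if "k \<in> H" "k' \<in> H" for k k'
        unfolding B_def using that by (intro add_mono SUP_upper)
      have "ennreal (X h) + ennreal (X' h') = ennreal (X h + X' h')" using h by simp
      also have "\<dots> \<le> B"
      proof (cases "u h \<ge> u h'")
        case True
        then have "X h + X' h' \<le> (a h + l * u h) + (a h' - l * u h')" using le by (simp add: algebra_simps)
        then have "ennreal (X h + X' h') \<le> ennreal ((a h + l * u h) + (a h' - l * u h'))" by (rule ennreal_leI)
        also have "\<dots> \<le> ennreal (a h + l * u h) + ennreal (a h' - l * u h')" by (rule ennreal_add_le_add)
        also have "\<dots> \<le> B" by (rule up[OF h(1,2)])
        finally show ?thesis .
      next
        case False
        then have "X h + X' h' \<le> (a h' + l * u h') + (a h - l * u h)" using le by (simp add: algebra_simps)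
        then have "ennreal (X h + X' h') \<le> ennreal ((a h' + l * u h') + (a h - l * u h))" by (rule ennreal_leI)
        also have "\<dots> \<le> ennreal (a h' + l * u h') + ennreal (a h - l * u h)" by (rule ennreal_add_le_add)
        also have "\<dots> \<le> B" by (rule up[OF h(2,1)])
        finally show ?thesis .
      qed
      finally show ?thesis .
    qed
    have X0: "X h0 \<ge> 0" "X' h0 \<ge> 0" using h0 by (simp_all add: X_def X'_def \<phi>_0)
    have "ennreal (X h) + ennreal (X' h') \<le> B" if h: "h \<in> H" "h' \<in> H" for h h'
    proof -
      \<comment> \<open>An index with a negative value, which \<open>ennreal\<close> cuts to 0, is
        traded for \<open>h0\<close>, where \<open>X\<close> and \<open>X'\<close> both equal
        \<open>a h0 >= 0\<close>. The truncation then plays no part any more.\<close>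
      define k where "k = (if X h \<ge> 0 then h else h0)"
      define k' where "k' = (if X' h' \<ge> 0 then h' else h0)"
      have k: "k \<in> H" "X k \<ge> 0" "X h \<le> X k" "k' \<in> H" "X' k' \<ge> 0" "X' h' \<le> X' k'"
        using h h0 X0 by (auto simp: k_def k'_def)
      then have "ennreal (X h) + ennreal (X' h') \<le> ennreal (X k) + ennreal (X' k')" by (intro add_mono ennreal_leI)
      also have "\<dots> \<le> B" using k by (intro main)
      finally show ?thesis .
    qed
    then have "(\<Squnion>h\<in>H. ennreal (X h)) + (\<Squnion>h\<in>H. ennreal (X' h)) \<le> B"
      using h0 by (intro SUP_ennreal_add_le) auto
    then show "D (fst p) (snd p) + D (snd p) (fst p) \<le> ((\<Squnion>h\<in>H. ennreal (a h + (L (fst p) + L (snd p)) * u h)) + (\<Squnion>h\<in>H. ennreal (a h - (L (fst p) + L (snd p)) * u h)))"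
      unfolding D_def B_def X_def X'_def l_def y_def y'_def .
  qed
  finally show ?thesis .
qed

text \<open>
  The coordinates are exchanged one at a time for linear weights. The parallelogram law for \<open>q\<close>
  makes the average over a random sign cost only \<open>\<kappa> i\<close>, so no chaining is needed.
\<close>

lemma expected_sup_bound:
  fixes H :: "(nat \<Rightarrow> real) set" and q :: "(nat \<Rightarrow> real) \<Rightarrow> real" and \<kappa> :: "nat \<Rightarrow> real"
  assumes I: "finite I" "I \<subseteq> J" and J: "finite J"
    and H: "countable H" "\<And>h i. h \<in> H \<Longrightarrow> i \<in> J \<Longrightarrow> \<bar>h i\<bar> \<le> \<delta>" "(\<lambda>_. 0) \<in> H"
    and base: "\<And>w h. h \<in> H \<Longrightarrow> (\<Sum>i\<in>J. w i * h i) \<le> A0 + q w" and nn: "A0 \<ge> 0" "\<And>w. q w \<ge> 0" "\<And>i. \<kappa> i \<ge> 0"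
    and par: "\<And>w i l. i \<in> J \<Longrightarrow> q (w(i := w i + l)) + q (w(i := w i - l)) = 2 * q w + 2 * l\<^sup>2 * \<kappa> i"
  shows "(\<integral>\<^sup>+x. (\<Squnion>h\<in>H. ennreal ((\<Sum>i\<in>J. w i * h i) + (\<Sum>i\<in>I. mu (h i) - \<phi> (x i) (h i)))) \<partial>(PiM I (\<lambda>_. N)))
     \<le> ennreal (A0 + q w + \<Lambda> * (\<Sum>i\<in>I. \<kappa> i))"
  using I
proof (induction I arbitrary: w rule: finite_induct)
  case empty
  interpret E: prob_space "PiM {} (\<lambda>_::nat. N)" by (intro prob_space_PiM prob_space_axioms)
  have "(\<integral>\<^sup>+x. (\<Squnion>h\<in>H. ennreal ((\<Sum>i\<in>J. w i * h i) + (\<Sum>i\<in>{}. mu (h i) - \<phi> (x i) (h i)))) \<partial>(PiM {} (\<lambda>_::nat. N)))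
     \<le> (\<integral>\<^sup>+x. ennreal (A0 + q w) \<partial>(PiM {} (\<lambda>_::nat. N)))"
  proof (rule nn_integral_mono)
    fix x :: "nat \<Rightarrow> real"
    show "(\<Squnion>h\<in>H. ennreal ((\<Sum>i\<in>J. w i * h i) + (\<Sum>i\<in>{}. mu (h i) - \<phi> (x i) (h i)))) \<le> ennreal (A0 + q w)"
      by (rule SUP_least) (use base in \<open>auto intro: ennreal_leI\<close>)
  qed
  then show ?case by (simp add: E.emeasure_space_1)
next
  case (insert i I)
  have iJ: "i \<in> J" and IJ: "I \<subseteq> J" using insert.prems by auto
  interpret P: product_prob_space "\<lambda>_. N" I by unfold_locales
  interpret PP: pair_sigma_finite "PiM I (\<lambda>_. N)" "N \<Otimes>\<^sub>M N"
    by (intro pair_sigma_finite.intro prob_space_imp_sigma_finite prob_space_PiM prob_space_pair prob_space_axioms)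
  define a where "a x h = (\<Sum>j\<in>J. w j * h j) + (\<Sum>j\<in>I. mu (h j) - \<phi> (x j) (h j))" for x h :: "nat \<Rightarrow> real"
  define l where "l p = L (fst p) + L (snd p)" for p :: "real \<times> real"
  have l_meas [measurable]: "l \<in> borel_measurable (N \<Otimes>\<^sub>M N)" unfolding l_def by measurable
  define Pp where "Pp x p = (\<Squnion>h\<in>H. ennreal (a x h + l p * h i))" for x p
  define Pm where "Pm x p = (\<Squnion>h\<in>H. ennreal (a x h - l p * h i))" for x p
  have [measurable]: "(\<lambda>x. x j) \<in> borel_measurable (PiM I (\<lambda>_. N))" if "j \<in> I" for j
    using measurable_component_singleton[OF that, of "\<lambda>_. N"] by (simp add: measurable_def cong: measurable_cong_sets) 
  have a_meas [measurable]: "(\<lambda>x. a x h) \<in> borel_measurable (PiM I (\<lambda>_. N))" for h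
    unfolding a_def by measurable
  have Pp_meas [measurable]: "(\<lambda>(x, p). Pp x p) \<in> borel_measurable (PiM I (\<lambda>_. N) \<Otimes>\<^sub>M (N \<Otimes>\<^sub>M N))"
    unfolding Pp_def using H(1) by measurable
  have Pm_meas [measurable]: "(\<lambda>(x, p). Pm x p) \<in> borel_measurable (PiM I (\<lambda>_. N) \<Otimes>\<^sub>M (N \<Otimes>\<^sub>M N))"
    unfolding Pm_def using H(1) by measurable
  let ?F = "\<lambda>x. (\<Squnion>h\<in>H. ennreal ((\<Sum>j\<in>J. w j * h j) + (\<Sum>j\<in>insert i I. mu (h j) - \<phi> (x j) (h j))))"
  have comp: "(\<lambda>x. x j) \<in> borel_measurable (PiM (insert i I) (\<lambda>_. N))" if "j \<in> insert i I" for j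
    using measurable_component_singleton[OF that, of "\<lambda>_. N"] by (simp add: measurable_def cong: measurable_cong_sets)
  have "?F \<in> borel_measurable (PiM (insert i I) (\<lambda>_. N))"
    using H(1) comp by measurable
  then have "(\<integral>\<^sup>+x. ?F x \<partial>(PiM (insert i I) (\<lambda>_. N))) = (\<integral>\<^sup>+x. (\<integral>\<^sup>+y. ?F (x(i := y)) \<partial>N) \<partial>(PiM I (\<lambda>_. N)))"
    by (rule P.product_nn_integral_insert[OF insert.hyps(1,2)])
  also have "\<dots> = (\<integral>\<^sup>+x. (\<integral>\<^sup>+y. (\<Squnion>h\<in>H. ennreal (a x h + (mu (h i) - \<phi> y (h i)))) \<partial>N) \<partial>(PiM I (\<lambda>_. N)))"
  proof -
    have "(\<Sum>j\<in>insert i I. mu (h j) - \<phi> ((x(i := y)) j) (h j)) = (mu (h i) - \<phi> y (h i)) + (\<Sum>j\<in>I. mu (h j) - \<phi> (x j) (h j))" for x y h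
    proof -
      have "(\<Sum>j\<in>I. mu (h j) - \<phi> ((x(i := y)) j) (h j)) = (\<Sum>j\<in>I. mu (h j) - \<phi> (x j) (h j))"
        using insert.hyps(2) by (intro sum.cong refl) auto
      then show ?thesis using insert.hyps by simp
    qed
    then show ?thesis by (simp add: a_def add_ac)
  qed
  finally have eq: "(\<integral>\<^sup>+x. ?F x \<partial>(PiM (insert i I) (\<lambda>_. N))) = (\<integral>\<^sup>+x. (\<integral>\<^sup>+y. (\<Squnion>h\<in>H. ennreal (a x h + (mu (h i) - \<phi> y (h i)))) \<partial>N) \<partial>(PiM I (\<lambda>_. N)))" .
  have "2 * (\<integral>\<^sup>+x. ?F x \<partial>(PiM (insert i I) (\<lambda>_. N))) = (\<integral>\<^sup>+x. 2 * (\<integral>\<^sup>+y. (\<Squnion>h\<in>H. ennreal (a x h + (mu (h i) - \<phi> y (h i)))) \<partial>N) \<partial>(PiM I (\<lambda>_. N)))"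
    unfolding eq by (rule nn_integral_cmult[symmetric]) (use H(1) in measurable)
  also have "\<dots> \<le> (\<integral>\<^sup>+x. (\<integral>\<^sup>+p. Pp x p + Pm x p \<partial>(N \<Otimes>\<^sub>M N)) \<partial>(PiM I (\<lambda>_. N)))"
    unfolding Pp_def Pm_def l_def
    by (intro nn_integral_mono symmetrize_coordinate[where ?h0.0="\<lambda>_. 0"] H(1))
      (use H(2)[OF _ iJ] H(3) in \<open>auto simp: a_def mu_0 \<phi>_0\<close>)
  also have "\<dots> = (\<integral>\<^sup>+p. (\<integral>\<^sup>+x. Pp x p + Pm x p \<partial>(PiM I (\<lambda>_. N))) \<partial>(N \<Otimes>\<^sub>M N))"
    by (rule PP.Fubini'[symmetric]) measurable
  also have "\<dots> \<le> (\<integral>\<^sup>+p. ennreal (2 * (A0 + q w + \<Lambda> * (\<Sum>j\<in>I. \<kappa> j))) + ennreal (2 * \<kappa> i) * ennreal ((L (fst p) + L (snd p))\<^sup>2) \<partial>(N \<Otimes>\<^sub>M N))"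
  proof (rule nn_integral_mono)
    fix p :: "real \<times> real"
    have [measurable]: "(\<lambda>x. Pp x p) \<in> borel_measurable (PiM I (\<lambda>_. N))" "(\<lambda>x. Pm x p) \<in> borel_measurable (PiM I (\<lambda>_. N))"
      unfolding Pp_def Pm_def using H(1) by measurable
    have sumw: "(\<Sum>j\<in>J. (w(i := w i + s)) j * h j) = (\<Sum>j\<in>J. w j * h j) + s * h i" for s h
    proof -
      have "(\<Sum>j\<in>J. (w(i := w i + s)) j * h j) = (\<Sum>j\<in>J. w j * h j + (if j = i then s * h i else 0))"
        by (intro sum.cong refl) (auto simp: algebra_simps)
      also have "\<dots> = (\<Sum>j\<in>J. w j * h j) + s * h i" using iJ J by (simp add: sum.distrib)
      finally show ?thesis .
    qed
    \<comment> \<open>A linear increment in coordinate \<open>i\<close> is a shift of the weight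
      \<open>w i\<close>. The induction hypothesis holds for all weights and so covers both
      signs.\<close>
    have aw: "(\<Sum>j\<in>J. (w(i := w i + s)) j * h j) + (\<Sum>j\<in>I. mu (h j) - \<phi> (x j) (h j)) = a x h + s * h i" for s h x
      unfolding sumw a_def by simp
    have pp: "(\<integral>\<^sup>+x. Pp x p \<partial>(PiM I (\<lambda>_. N))) \<le> ennreal (A0 + q (w(i := w i + l p)) + \<Lambda> * (\<Sum>j\<in>I. \<kappa> j))"
      using insert.IH[OF IJ, of "w(i := w i + l p)"] unfolding aw Pp_def .
    have pm: "(\<integral>\<^sup>+x. Pm x p \<partial>(PiM I (\<lambda>_. N))) \<le> ennreal (A0 + q (w(i := w i - l p)) + \<Lambda> * (\<Sum>j\<in>I. \<kappa> j))"
      using insert.IH[OF IJ, of "w(i := w i + (- l p))"] unfolding aw Pm_def by (simp only: mult_minus_left add_uminus_conv_diff)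
    have K: "0 \<le> \<Lambda> * (\<Sum>j\<in>I. \<kappa> j)" using \<Lambda>_nonneg nn by (intro mult_nonneg_nonneg sum_nonneg)
    have "(\<integral>\<^sup>+x. Pp x p + Pm x p \<partial>(PiM I (\<lambda>_. N))) = (\<integral>\<^sup>+x. Pp x p \<partial>(PiM I (\<lambda>_. N))) + (\<integral>\<^sup>+x. Pm x p \<partial>(PiM I (\<lambda>_. N)))"
      by (rule nn_integral_add) measurable
    also have "\<dots> \<le> ennreal (A0 + q (w(i := w i + l p)) + \<Lambda> * (\<Sum>j\<in>I. \<kappa> j)) + ennreal (A0 + q (w(i := w i - l p)) + \<Lambda> * (\<Sum>j\<in>I. \<kappa> j))"
      by (rule add_mono[OF pp pm])
    also have "\<dots> = ennreal (2 * A0 + (q (w(i := w i + l p)) + q (w(i := w i - l p))) + 2 * (\<Lambda> * (\<Sum>j\<in>I. \<kappa> j)))"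
      using nn K by (subst ennreal_plus[symmetric]) (auto simp: algebra_simps)
    also have "\<dots> = ennreal (2 * (A0 + q w + \<Lambda> * (\<Sum>j\<in>I. \<kappa> j)) + 2 * \<kappa> i * (l p)\<^sup>2)"
      unfolding par[OF iJ] by (simp add: algebra_simps)
    also have "\<dots> = ennreal (2 * (A0 + q w + \<Lambda> * (\<Sum>j\<in>I. \<kappa> j))) + ennreal (2 * \<kappa> i) * ennreal ((L (fst p) + L (snd p))\<^sup>2)"
      using nn K unfolding l_def by (subst ennreal_plus) (auto simp: ennreal_mult)
    finally show "(\<integral>\<^sup>+x. Pp x p + Pm x p \<partial>(PiM I (\<lambda>_. N))) \<le> ennreal (2 * (A0 + q w + \<Lambda> * (\<Sum>j\<in>I. \<kappa> j))) + ennreal (2 * \<kappa> i) * ennreal ((L (fst p) + L (snd p))\<^sup>2)" .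
  qed
  also have "\<dots> = ennreal (2 * (A0 + q w + \<Lambda> * (\<Sum>j\<in>I. \<kappa> j))) * emeasure (N \<Otimes>\<^sub>M N) (space (N \<Otimes>\<^sub>M N)) + ennreal (2 * \<kappa> i) * (\<integral>\<^sup>+p. ennreal ((L (fst p) + L (snd p))\<^sup>2) \<partial>(N \<Otimes>\<^sub>M N))"
    by (subst nn_integral_add) (simp_all add: nn_integral_cmult)
  also have "emeasure (N \<Otimes>\<^sub>M N) (space (N \<Otimes>\<^sub>M N)) = 1"
  proof -
    interpret NP: pair_prob_space N N ..
    show ?thesis by (rule NP.emeasure_space_1)
  qed
  also have "ennreal (2 * (A0 + q w + \<Lambda> * (\<Sum>j\<in>I. \<kappa> j))) * 1 + ennreal (2 * \<kappa> i) * (\<integral>\<^sup>+p. ennreal ((L (fst p) + L (snd p))\<^sup>2) \<partial>(N \<Otimes>\<^sub>M N))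
     \<le> ennreal (2 * (A0 + q w + \<Lambda> * (\<Sum>j\<in>I. \<kappa> j))) * 1 + ennreal (2 * \<kappa> i) * ennreal \<Lambda>"
    by (intro add_left_mono mult_left_mono \<Lambda>) simp
  also have "\<dots> = 2 * ennreal (A0 + q w + \<Lambda> * (\<Sum>j\<in>insert i I. \<kappa> j))"
  proof -
    have K: "0 \<le> \<Lambda> * (\<Sum>j\<in>I. \<kappa> j)" using \<Lambda>_nonneg nn by (intro mult_nonneg_nonneg sum_nonneg)
    have "ennreal (2 * (A0 + q w + \<Lambda> * (\<Sum>j\<in>I. \<kappa> j))) * 1 + ennreal (2 * \<kappa> i) * ennreal \<Lambda> =
       ennreal (2 * (A0 + q w + \<Lambda> * (\<Sum>j\<in>I. \<kappa> j)) + 2 * \<kappa> i * \<Lambda>)"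
      using nn K \<Lambda>_nonneg by (subst ennreal_plus) (auto simp: ennreal_mult)
    also have "\<dots> = ennreal (2 * (A0 + q w + \<Lambda> * (\<Sum>j\<in>insert i I. \<kappa> j)))"
      using insert.hyps by (simp add: algebra_simps)
    also have "\<dots> = 2 * ennreal (A0 + q w + \<Lambda> * (\<Sum>j\<in>insert i I. \<kappa> j))"
      using nn \<Lambda>_nonneg by (subst ennreal_mult) (auto intro!: add_nonneg_nonneg mult_nonneg_nonneg sum_nonneg)
    finally show ?thesis .
  qed
  finally show ?case by (subst (asm) ennreal_mult_le_mult_iff) auto
qed


text \<open>The class is uncountable. By continuity of the loss in the observation, each event
  \<open>Z x h > s\<close> is open, so Lindelof's theorem reduces the union to countably many
  \<open>h\<close>. This gives measurability, and the expected supremum over a countable class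
  together with Markov's inequality gives the bound.\<close>

lemma tail_bound:
  fixes T :: "(nat \<Rightarrow> real) set" and q :: "(nat \<Rightarrow> real) \<Rightarrow> real" and \<kappa> :: "nat \<Rightarrow> real"
  assumes J: "finite J" and s: "s > 0"
    and \<phi>_cont: "\<And>u. continuous_on UNIV (\<lambda>e. \<phi> e u)"
    and T: "\<And>h i. h \<in> T \<Longrightarrow> i \<in> J \<Longrightarrow> \<bar>h i\<bar> \<le> \<delta>" "(\<lambda>_. 0) \<in> T"
    and base: "\<And>w h. h \<in> T \<Longrightarrow> (\<Sum>i\<in>J. w i * h i) \<le> A0 + q w" and nn: "A0 \<ge> 0" "\<And>w. q w \<ge> 0" "\<And>i. \<kappa> i \<ge> 0"
    and par: "\<And>w i l. i \<in> J \<Longrightarrow> q (w(i := w i + l)) + q (w(i := w i - l)) = 2 * q w + 2 * l\<^sup>2 * \<kappa> i"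
  shows "{x \<in> space (PiM J (\<lambda>_. N)). \<exists>h\<in>T. (\<Sum>i\<in>J. mu (h i) - \<phi> (x i) (h i)) > s} \<in> sets (PiM J (\<lambda>_. N))"
    and "emeasure (PiM J (\<lambda>_. N)) {x \<in> space (PiM J (\<lambda>_. N)). \<exists>h\<in>T. (\<Sum>i\<in>J. mu (h i) - \<phi> (x i) (h i)) > s}
       \<le> ennreal ((A0 + q (\<lambda>_. 0) + \<Lambda> * (\<Sum>i\<in>J. \<kappa> i)) / s)"
proof -
  let ?P = "PiM J (\<lambda>_. N)"
  define Z where "Z x h = (\<Sum>i\<in>J. mu (h i) - \<phi> (x i) (h i))" for x h :: "nat \<Rightarrow> real"
  have Zcont: "continuous_on UNIV (\<lambda>x. Z x h)" for h
    unfolding Z_def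
    by (intro continuous_intros continuous_on_compose2[OF \<phi>_cont] continuous_on_product_coordinates) auto
  define \<F> where "\<F> = (\<lambda>h. {x. Z x h > s}) ` T"
  have "open S" if "S \<in> \<F>" for S
    using that Zcont unfolding \<F>_def by (auto intro!: open_Collect_less continuous_on_const)
  then obtain \<F>' where \<F>': "\<F>' \<subseteq> \<F>" "countable \<F>'" "\<Union>\<F>' = \<Union>\<F>"
    using Lindelof[of \<F>] by blast
  obtain C where C: "countable C" "C \<subseteq> T" "\<F>' = (\<lambda>h. {x. Z x h > s}) ` C"
    using \<F>'(1,2) unfolding \<F>_def using countable_subset_image by metis
  have ex: "(\<exists>h\<in>T. Z x h > s) \<longleftrightarrow> (\<exists>h\<in>C. Z x h > s)" for x
  proof -
    have "(\<exists>h\<in>T. Z x h > s) \<longleftrightarrow> x \<in> \<Union>\<F>" by (auto simp: \<F>_def)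
    also have "\<dots> \<longleftrightarrow> x \<in> \<Union>\<F>'" using \<F>'(3) by simp
    also have "\<dots> \<longleftrightarrow> (\<exists>h\<in>C. Z x h > s)" by (auto simp: C(3))
    finally show ?thesis .
  qed
  have comp [measurable]: "(\<lambda>x. x j) \<in> borel_measurable ?P" if "j \<in> J" for j
    using measurable_component_singleton[OF that, of "\<lambda>_. N"] by (simp add: measurable_def cong: measurable_cong_sets)
  have Zm [measurable]: "(\<lambda>x. Z x h) \<in> borel_measurable ?P" for h unfolding Z_def by measurable
  define A where "A = {x \<in> space ?P. \<exists>h\<in>T. Z x h > s}"
  have A: "A = (\<Union>h\<in>C. {x \<in> space ?P. Z x h > s})" unfolding A_def ex by auto
  have "{x \<in> space ?P. Z x h > s} \<in> sets ?P" for h by measurable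
  then have Am: "A \<in> sets ?P" unfolding A using C(1) by (intro sets.countable_UN') auto
  then show "{x \<in> space ?P. \<exists>h\<in>T. (\<Sum>i\<in>J. mu (h i) - \<phi> (x i) (h i)) > s} \<in> sets ?P"
    unfolding A_def Z_def .
  \<comment> \<open>The zero vector supplies the index of nonnegative value that symmetrisation
    relies on.\<close>
  define H where "H = insert (\<lambda>_. 0) C"
  have H: "countable H" "H \<subseteq> T" "(\<lambda>_. 0) \<in> H" using C T(2) by (auto simp: H_def)
  define u where "u x = (\<Squnion>h\<in>H. ennreal (Z x h))" for x
  have um: "u \<in> borel_measurable ?P" unfolding u_def using H(1) by measurable
  have E: "(\<integral>\<^sup>+x. u x \<partial>?P) \<le> ennreal (A0 + q (\<lambda>_. 0) + \<Lambda> * (\<Sum>i\<in>J. \<kappa> i))"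
    using expected_sup_bound[OF J subset_refl J H(1) _ H(3) _ nn par, of "\<lambda>_. 0"] T(1) H(2) base
    unfolding u_def Z_def by (simp add: subset_iff)
  have "A \<subseteq> {x \<in> space ?P. 1 \<le> ennreal (1 / s) * u x}"
  proof
    fix x assume x: "x \<in> A"
    then obtain h where h: "h \<in> C" "Z x h > s" unfolding A by blast
    have "1 = ennreal (1 / s) * ennreal s" using s by (simp add: ennreal_mult[symmetric])
    also have "ennreal s \<le> u x"
      unfolding u_def using h H_def by (intro SUP_upper2[of h]) (auto intro: ennreal_leI)
    finally show "x \<in> {x \<in> space ?P. 1 \<le> ennreal (1 / s) * u x}" using x by (simp add: A_def mult_left_mono)
  qed
  then have "emeasure ?P A \<le> emeasure ?P {x \<in> space ?P. 1 \<le> ennreal (1 / s) * u x}"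
    by (intro emeasure_mono borel_measurable_le borel_measurable_const borel_measurable_times_ennreal um)
  also have "\<dots> \<le> ennreal (1 / s) * (\<integral>\<^sup>+x. u x * indicator (space ?P) x \<partial>?P)"
    by (rule nn_integral_Markov_inequality) (intro borel_measurable_times_ennreal um borel_measurable_indicator, auto)
  also have "(\<integral>\<^sup>+x. u x * indicator (space ?P) x \<partial>?P) = (\<integral>\<^sup>+x. u x \<partial>?P)"
    by (intro nn_integral_cong) simp
  also have "ennreal (1 / s) * (\<integral>\<^sup>+x. u x \<partial>?P) \<le> ennreal (1 / s) * ennreal (A0 + q (\<lambda>_. 0) + \<Lambda> * (\<Sum>i\<in>J. \<kappa> i))"
    by (intro mult_left_mono E) simp
  also have "\<dots> = ennreal ((A0 + q (\<lambda>_. 0) + \<Lambda> * (\<Sum>i\<in>J. \<kappa> i)) / s)"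
    using s nn \<Lambda>_nonneg by (subst ennreal_mult[symmetric]) (auto intro!: add_nonneg_nonneg mult_nonneg_nonneg sum_nonneg)
  finally show "emeasure ?P {x \<in> space ?P. \<exists>h\<in>T. (\<Sum>i\<in>J. mu (h i) - \<phi> (x i) (h i)) > s}
       \<le> ennreal ((A0 + q (\<lambda>_. 0) + \<Lambda> * (\<Sum>i\<in>J. \<kappa> i)) / s)"
    unfolding A_def Z_def .
qed

end

section \<open>Functionals of the design values on a Sobolev ball\<close>

lemma inner2_parallelogram:
  assumes f: "sq_int f" and g: "sq_int g"
  shows "inner2 (\<lambda>x. f x + l * g x) (\<lambda>x. f x + l * g x) + inner2 (\<lambda>x. f x - l * g x) (\<lambda>x. f x - l * g x) = 2 * inner2 f f + 2 * l\<^sup>2 * inner2 g g"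
proof -
  have exp: "inner2 (\<lambda>x. f x + s * g x) (\<lambda>x. f x + s * g x) = inner2 f f + 2 * s * inner2 f g + s\<^sup>2 * inner2 g g" for s
  proof -
    have sg: "sq_int (\<lambda>x. s * g x)" using g by (rule sq_int_const_mult)
    let ?h = "\<lambda>x. f x + s * g x"
    have h: "sq_int ?h" using f sg by (rule sq_int_add)
    have "inner2 ?h ?h = inner2 f ?h + s * inner2 g ?h"
      using inner2_add_left[OF f sg h] by (simp only: inner2_mult_left)
    also have "inner2 f ?h = inner2 f f + s * inner2 g f"
      using inner2_add_left[OF f sg f] unfolding inner2_commute[of f ?h] inner2_mult_left .
    also have "inner2 g ?h = inner2 f g + s * inner2 g g"
      using inner2_add_left[OF f sg g] unfolding inner2_commute[of g ?h] inner2_mult_left .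
    also have "inner2 g f = inner2 f g" by (rule inner2_commute)
    finally show ?thesis by (simp add: power2_eq_square algebra_simps)
  qed
  show ?thesis using exp[of l] exp[of "- l"] by simp
qed

text \<open>The element that represents the functional \<open>\<Sum>i\<in>J. w i * h (t i)\<close>
  through the window formula: with \<open>k = wa\<close> it is paired with \<open>h\<close>, with
  \<open>k = wk\<close> with the derivative of \<open>h\<close>.\<close>

definition "wsum b J t w k = (\<lambda>x::real. \<Sum>i\<in>J. w i * k b (t i :: real) x)" for b :: real and w :: "nat \<Rightarrow> real"

text \<open>The choice \<open>b ^ (2 * m) = lam\<close> turns the right side of the interpolation
  inequality into a multiple of the squared Sobolev norm. The second bound follows from the supremum
  estimate on windows of length \<open>b\<close>, and is where the factor 1/b comes from.\<close>

lemma sobolev_design_bounds: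
  assumes m: "m \<ge> 1" and C: "\<And>F b. F \<in> sobolev2 m \<Longrightarrow> 0 < b \<Longrightarrow> b \<le> 1/2 \<Longrightarrow>
     b\<^sup>2 * inner2 (nderiv 1 F) (nderiv 1 F) \<le> C * (inner2 F F + b ^ (2 * m) * inner2 (nderiv m F) (nderiv m F))"
    and b: "0 < b" "b \<le> 1/2" "b ^ (2 * m) = lam" and h: "h \<in> sobolev2 m"
  shows "inner2 h h + b\<^sup>2 * inner2 (nderiv 1 h) (nderiv 1 h) \<le> (1 + C) * sob_inner m lam h h"
    and "x \<in> {0..1} \<Longrightarrow> (h x)\<^sup>2 \<le> 2 * (1 + C) * sob_inner m lam h h / b"
proof -
  have S: "sob_inner m lam h h = inner2 h h + b ^ (2 * m) * inner2 (nderiv m h) (nderiv m h)"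
    using b by (simp add: sob_inner_def)
  have "inner2 h h \<le> sob_inner m lam h h" proof -
    have "0 \<le> b ^ (2 * m) * inner2 (nderiv m h) (nderiv m h)"
      by (intro mult_nonneg_nonneg inner2_self_nonneg zero_le_power less_imp_le b(1))
    then show ?thesis unfolding S by linarith
  qed
  moreover have "b\<^sup>2 * inner2 (nderiv 1 h) (nderiv 1 h) \<le> C * sob_inner m lam h h" unfolding S by (rule C[OF h b(1,2)])
  ultimately show 1: "inner2 h h + b\<^sup>2 * inner2 (nderiv 1 h) (nderiv 1 h) \<le> (1 + C) * sob_inner m lam h h"
    by (simp only: distrib_right)
  assume x: "x \<in> {0..1}"
  have ac: "abs_cont_on {0..1} h" using sobolev2_abs_cont[OF h, of 0] m by (simp add: nderiv_0)
  have sq: "sq_int (nderiv 1 h)" by (rule sobolev2_nderiv_sq_int[OF h m m])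
  have "(h x)\<^sup>2 \<le> 2 * (inner2 h h / b + b * inner2 (nderiv 1 h) (nderiv 1 h))"
    by (rule sobolev1_sup_bound[OF ac sq b(1,2) x])
  also have "\<dots> = 2 * (inner2 h h + b\<^sup>2 * inner2 (nderiv 1 h) (nderiv 1 h)) / b"
    using b by (simp add: power2_eq_square field_simps)
  also have "\<dots> \<le> 2 * ((1 + C) * sob_inner m lam h h) / b"
    using 1 b by (intro divide_right_mono mult_left_mono) auto
  finally show "(h x)\<^sup>2 \<le> 2 * (1 + C) * sob_inner m lam h h / b" by (simp only: mult.assoc)
qed

text \<open>Young's inequality with a free weight \<open>c\<close> separates \<open>h\<close> from
  the weights \<open>w\<close>; the powers of \<open>b\<close> match the derivative of
  \<open>h\<close> to the first-order norm at scale \<open>b\<close>.\<close>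

lemma window_duality:
  assumes J: "finite J" and t: "\<And>i. i \<in> J \<Longrightarrow> t i \<in> {0..1}" and b: "0 < b" "b \<le> 1/2" and c: "c > 0"
    and h: "abs_cont_on {0..1} h" "sq_int (nderiv 1 h)"
  shows "(\<Sum>i\<in>J. w i * h (t i)) \<le> c / 2 * (inner2 h h + b\<^sup>2 * inner2 (nderiv 1 h) (nderiv 1 h)) +
     (inner2 (wsum b J t w wa) (wsum b J t w wa) + inner2 (wsum b J t w wk) (wsum b J t w wk) / b\<^sup>2) / (2 * c)"
proof -
  have sh: "sq_int h" using h(1) by (intro sq_int_continuous abs_cont_on_imp_continuous_on)
  have a: "sq_int (wa b (t i))" and k: "sq_int (wk b (t i))"
    and eq: "h (t i) = inner2 (wa b (t i)) h + inner2 (wk b (t i)) (nderiv 1 h)" if i: "i \<in> J" for i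
  proof -
    note W = window_formula[OF h b t[OF i]]
    show "sq_int (wa b (t i))" "sq_int (wk b (t i))" by (rule W(2), rule W(3))
    show "h (t i) = inner2 (wa b (t i)) h + inner2 (wk b (t i)) (nderiv 1 h)"
      using W(1) unfolding inner2_eq_integral[OF W(2) sh] inner2_eq_integral[OF W(3) h(2)] .
  qed
  have sum_left: "inner2 (\<lambda>x. \<Sum>i\<in>I. w i * k (t i) x) g = (\<Sum>i\<in>I. w i * inner2 (k (t i)) g)"
    if I: "finite I" and k: "\<And>i. i \<in> I \<Longrightarrow> sq_int (k (t i))" and g: "sq_int g" for I :: "nat set" and k :: "real \<Rightarrow> real \<Rightarrow> real" and g
    using I k
  proof (induction I rule: finite_induct)
    case (insert i I)
    have "sq_int (\<lambda>x. w i * k (t i) x)" using insert by (intro sq_int_const_mult) auto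
    moreover have "sq_int (\<lambda>x. \<Sum>i\<in>I. w i * k (t i) x)" using insert by (intro sq_int_sum sq_int_const_mult) auto
    ultimately show ?case using insert g by (simp add: inner2_add_left inner2_mult_left)
  qed (simp add: inner2_def)
  have sA: "sq_int (wsum b J t w wa)" "sq_int (wsum b J t w wk)"
    unfolding wsum_def using a k by (auto intro!: sq_int_sum sq_int_const_mult)
  have "(\<Sum>i\<in>J. w i * h (t i)) = (\<Sum>i\<in>J. w i * inner2 (wa b (t i)) h) + (\<Sum>i\<in>J. w i * inner2 (wk b (t i)) (nderiv 1 h))"
    unfolding sum.distrib[symmetric] by (intro sum.cong refl) (use eq in \<open>simp only: distrib_left\<close>)
  also have "(\<Sum>i\<in>J. w i * inner2 (wa b (t i)) h) = inner2 (wsum b J t w wa) h"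
    unfolding wsum_def by (rule sum_left[where k="wa b" and g=h, OF J a sh, symmetric])
  also have "(\<Sum>i\<in>J. w i * inner2 (wk b (t i)) (nderiv 1 h)) = inner2 (wsum b J t w wk) (nderiv 1 h)"
    unfolding wsum_def by (rule sum_left[where k="wk b" and g="nderiv 1 h", OF J k h(2), symmetric])
  finally have main: "(\<Sum>i\<in>J. w i * h (t i)) = inner2 (wsum b J t w wa) h + inner2 (wsum b J t w wk) (nderiv 1 h)" .
  have "2 * \<bar>inner2 h (wsum b J t w wa)\<bar> \<le> c * inner2 h h + inner2 (wsum b J t w wa) (wsum b J t w wa) / c"
    by (rule inner2_amgm[OF sh sA(1) c])
  moreover have "2 * \<bar>inner2 (nderiv 1 h) (wsum b J t w wk)\<bar> \<le> (c * b\<^sup>2) * inner2 (nderiv 1 h) (nderiv 1 h) + inner2 (wsum b J t w wk) (wsum b J t w wk) / (c * b\<^sup>2)"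
    by (rule inner2_amgm[OF h(2) sA(2)]) (use c b in simp)
  moreover have add: "2 * (x + y) \<le> P + Q" if "2 * \<bar>x\<bar> \<le> P" "2 * \<bar>y\<bar> \<le> Q" for x y P Q :: real
  proof -
    have "2 * x \<le> P" using that(1) abs_ge_self[of x] by (meson mult_left_mono order_trans zero_le_numeral)
    moreover have "2 * y \<le> Q" using that(2) abs_ge_self[of y] by (meson mult_left_mono order_trans zero_le_numeral)
    ultimately show ?thesis unfolding distrib_left by (rule add_mono)
  qed
  ultimately have "2 * (\<Sum>i\<in>J. w i * h (t i)) \<le> c * inner2 h h + inner2 (wsum b J t w wa) (wsum b J t w wa) / c +
      ((c * b\<^sup>2) * inner2 (nderiv 1 h) (nderiv 1 h) + inner2 (wsum b J t w wk) (wsum b J t w wk) / (c * b\<^sup>2))"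
    unfolding main inner2_commute[of "wsum b J t w wa" h] inner2_commute[of "wsum b J t w wk" "nderiv 1 h"]
    by (intro add)
  also have "\<dots> = 2 * (c / 2 * (inner2 h h + b\<^sup>2 * inner2 (nderiv 1 h) (nderiv 1 h)) +
     (inner2 (wsum b J t w wa) (wsum b J t w wa) + inner2 (wsum b J t w wk) (wsum b J t w wk) / b\<^sup>2) / (2 * c))"
    using c by (simp add: field_simps)
  finally show ?thesis by (rule mult_left_le_imp_le) simp
qed

context lip_process
begin

text \<open>
  Window duality bounds every linear functional \<open>\<Sum>i. w i * h (t i)\<close> on the Sobolev ball by a
  quadratic form in \<open>w\<close>, which serves as \<open>q\<close> in the tail bound.
\<close>

lemma sobolev_tail_bound:
  fixes h :: "real \<Rightarrow> real"
  assumes m: "m \<ge> 1" and n: "n \<ge> 1" and C: "C \<ge> 1" "\<And>F b. F \<in> sobolev2 m \<Longrightarrow> 0 < b \<Longrightarrow> b \<le> 1/2 \<Longrightarrow>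
     b\<^sup>2 * inner2 (nderiv 1 F) (nderiv 1 F) \<le> C * (inner2 F F + b ^ (2 * m) * inner2 (nderiv m F) (nderiv m F))"
    and b: "0 < b" "b \<le> 1/2" "b ^ (2 * m) = lam" and t: "\<And>i. i \<in> {1..n} \<Longrightarrow> t i \<in> {0..1}"
    and \<phi>_cont: "\<And>u. continuous_on UNIV (\<lambda>e. \<phi> e u)"
    and r: "r > 0" "2 * (1 + C) * r\<^sup>2 / b \<le> \<delta>\<^sup>2" "\<delta> \<ge> 0" and s: "s > 0"
  defines "A \<equiv> {x \<in> space (PiM {1..n} (\<lambda>_. N)). \<exists>h\<in>sobolev2 m. sob_inner m lam h h \<le> r\<^sup>2 \<and>
      (\<Sum>i=1..n. mu (h (t i)) - \<phi> (x i) (h (t i))) > s}"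
  shows "A \<in> sets (PiM {1..n} (\<lambda>_. N))"
    "emeasure (PiM {1..n} (\<lambda>_. N)) A \<le> ennreal (r * sqrt (real n / b) * ((1 + C) / 2 + \<Lambda>) / s)"
proof -
  \<comment> \<open>Balances the two costs: \<open>A0\<close> is proportional to c r^2 and the sum
    of the \<open>\<kappa> i\<close> is at most n / (b c). With this \<open>c\<close> both are
    multiples of r (n/b)^(1/2).\<close>
  define c where "c = sqrt (real n / b) / r"
  have c: "c > 0" using n b r by (simp add: c_def)
  have lam: "lam > 0" using b by auto
  \<comment> \<open>Only the design values of a function matter. The value 0 outside
    \<open>{1..n}\<close> makes the zero function correspond to the zero vector required in
    \<open>T\<close>.\<close>
  define vec where "vec h i = (if i \<in> {1..n} then h (t i) else 0)" for h :: "real \<Rightarrow> real" and i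
  define T where "T = vec ` {h \<in> sobolev2 m. sob_inner m lam h h \<le> r\<^sup>2}"
  define Qa where "Qa w = inner2 (wsum b {1..n} t w wa) (wsum b {1..n} t w wa)" for w
  define Qk where "Qk w = inner2 (wsum b {1..n} t w wk) (wsum b {1..n} t w wk)" for w
  define q where "q w = (Qa w + Qk w / b\<^sup>2) / (2 * c)" for w
  define \<kappa> where "\<kappa> i = (inner2 (wa b (t i)) (wa b (t i)) + inner2 (wk b (t i)) (wk b (t i)) / b\<^sup>2) / (2 * c)" for i
  define A0 where "A0 = c / 2 * ((1 + C) * r\<^sup>2)"
  have bound: "\<bar>h i\<bar> \<le> \<delta>" if hT: "h \<in> T" and i: "i \<in> {1..n}" for h i
  proof -
    obtain g where g: "g \<in> sobolev2 m" "sob_inner m lam g g \<le> r\<^sup>2" "h = vec g" using hT unfolding T_def by blast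
    have "(g (t i))\<^sup>2 \<le> 2 * (1 + C) * sob_inner m lam g g / b"
      by (rule sobolev_design_bounds(2)[OF m C(2) b g(1) t[OF i]])
    also have "\<dots> \<le> 2 * (1 + C) * r\<^sup>2 / b" using g(2) C b by (intro divide_right_mono mult_left_mono) auto
    also have "\<dots> \<le> \<delta>\<^sup>2" by (rule r(2))
    finally have "(h i)\<^sup>2 \<le> \<delta>\<^sup>2" using i g(3) by (simp add: vec_def)
    then show ?thesis using r(3) by (metis abs_le_square_iff abs_of_nonneg)
  qed
  have zero: "(\<lambda>_. 0) \<in> T"
  proof -
    have "sob_inner m lam (\<lambda>_. 0) (\<lambda>_. 0) = 0"
      using semi_inner.B_zero[OF semi_inner_sob[OF m], of lam "\<lambda>_. 0"] sobolev2_zero[OF m] lam by simp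
    moreover have "vec (\<lambda>_. 0) = (\<lambda>_. 0)" by (auto simp: vec_def)
    ultimately show ?thesis unfolding T_def using sobolev2_zero[OF m] by (intro image_eqI[of _ _ "\<lambda>_. 0"]) auto
  qed
  have base: "(\<Sum>i\<in>{1..n}. w i * h i) \<le> A0 + q w" if hT: "h \<in> T" for w h
  proof -
    obtain g where g: "g \<in> sobolev2 m" "sob_inner m lam g g \<le> r\<^sup>2" "h = vec g" using hT unfolding T_def by blast
    have ac: "abs_cont_on {0..1} g" using sobolev2_abs_cont[OF g(1), of 0] m by (simp add: nderiv_0)
    have sq: "sq_int (nderiv 1 g)" by (rule sobolev2_nderiv_sq_int[OF g(1) m m])
    have "(\<Sum>i\<in>{1..n}. w i * h i) = (\<Sum>i\<in>{1..n}. w i * g (t i))"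
      by (intro sum.cong refl) (simp add: g(3) vec_def)
    also have "\<dots> \<le> c / 2 * (inner2 g g + b\<^sup>2 * inner2 (nderiv 1 g) (nderiv 1 g)) + q w"
      unfolding q_def Qa_def Qk_def by (rule window_duality[OF _ t b(1,2) c ac sq]) auto
    also have "inner2 g g + b\<^sup>2 * inner2 (nderiv 1 g) (nderiv 1 g) \<le> (1 + C) * sob_inner m lam g g"
      by (rule sobolev_design_bounds(1)[OF m C(2) b g(1)])
    also have "(1 + C) * sob_inner m lam g g \<le> (1 + C) * r\<^sup>2" using g(2) C by (intro mult_left_mono) auto
    finally show ?thesis using c by (simp add: A0_def mult_left_mono)
  qed
  have sqw: "sq_int (wa b (t i))" "sq_int (wk b (t i))" "inner2 (wa b (t i)) (wa b (t i)) = 1 / b" "inner2 (wk b (t i)) (wk b (t i)) \<le> b"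
    if "i \<in> {1..n}" for i
  proof -
    \<comment> \<open>The kernels do not depend on the function represented, so the zero function
      serves to extract their norms from the window formula.\<close>
    have c0: "abs_cont_on {0..1} (\<lambda>s. 0 * s + 0)" by (rule abs_cont_affine)
    have "sq_int (nderiv 1 (\<lambda>s. 0 * s + 0))"
      by (rule sq_int_cong_ae[OF sq_int_continuous[of "\<lambda>_. 0"], of "{}"]) (simp_all only: nderiv_affine continuous_on_const negligible_empty Diff_empty)
    from window_formula[OF c0 this b(1,2) t[OF that]]
    show "sq_int (wa b (t i))" "sq_int (wk b (t i))" "inner2 (wa b (t i)) (wa b (t i)) = 1 / b" "inner2 (wk b (t i)) (wk b (t i)) \<le> b" by blast+
  qed
  have upd: "wsum b {1..n} t (w(i := w i + l)) k = (\<lambda>x. wsum b {1..n} t w k x + l * k b (t i) x)" if "i \<in> {1..n}" for w i l k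
  proof
    fix x
    have "wsum b {1..n} t (w(i := w i + l)) k x = (\<Sum>j\<in>{1..n}. w j * k b (t j) x + (if j = i then l * k b (t i) x else 0))"
      unfolding wsum_def by (intro sum.cong refl) (auto simp: algebra_simps)
    also have "\<dots> = wsum b {1..n} t w k x + l * k b (t i) x" using that by (simp add: sum.distrib wsum_def)
    finally show "wsum b {1..n} t (w(i := w i + l)) k x = wsum b {1..n} t w k x + l * k b (t i) x" .
  qed
  have par: "q (w(i := w i + l)) + q (w(i := w i - l)) = 2 * q w + 2 * l\<^sup>2 * \<kappa> i" if i: "i \<in> {1..n}" for w i l
  proof -
    have updm: "wsum b {1..n} t (w(i := w i - l)) k = (\<lambda>x. wsum b {1..n} t w k x - l * k b (t i) x)" for k
      using upd[OF i, of w "- l" k] by (simp only: add_uminus_conv_diff mult_minus_left)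
    have sA: "sq_int (wsum b {1..n} t w wa)" "sq_int (wsum b {1..n} t w wk)"
      unfolding wsum_def using sqw by (auto intro!: sq_int_sum sq_int_const_mult)
    have a: "Qa (w(i := w i + l)) + Qa (w(i := w i - l)) = 2 * Qa w + 2 * l\<^sup>2 * inner2 (wa b (t i)) (wa b (t i))"
      unfolding Qa_def upd[OF i] updm by (rule inner2_parallelogram[OF sA(1) sqw(1)[OF i]])
    have k: "Qk (w(i := w i + l)) + Qk (w(i := w i - l)) = 2 * Qk w + 2 * l\<^sup>2 * inner2 (wk b (t i)) (wk b (t i))"
      unfolding Qk_def upd[OF i] updm by (rule inner2_parallelogram[OF sA(2) sqw(2)[OF i]])
    have "q (w(i := w i + l)) + q (w(i := w i - l)) =
       ((Qa (w(i := w i + l)) + Qa (w(i := w i - l))) + (Qk (w(i := w i + l)) + Qk (w(i := w i - l))) / b\<^sup>2) / (2 * c)"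
      unfolding q_def by (simp add: add_divide_distrib)
    also have "\<dots> = 2 * q w + 2 * l\<^sup>2 * \<kappa> i"
      unfolding a k q_def \<kappa>_def by (simp add: add_divide_distrib distrib_left)
    finally show ?thesis .
  qed
  have nn: "A0 \<ge> 0" "\<And>w. q w \<ge> 0" "\<And>i. \<kappa> i \<ge> 0"
    using c C b by (auto simp: A0_def q_def Qa_def Qk_def \<kappa>_def intro!: divide_nonneg_nonneg add_nonneg_nonneg inner2_self_nonneg mult_nonneg_nonneg)
  have A_eq: "A = {x \<in> space (PiM {1..n} (\<lambda>_. N)). \<exists>h\<in>T. (\<Sum>i\<in>{1..n}. mu (h i) - \<phi> (x i) (h i)) > s}"
  proof -
    have "(\<Sum>i\<in>{1..n}. mu (vec h i) - \<phi> (x i) (vec h i)) = (\<Sum>i\<in>{1..n}. mu (h (t i)) - \<phi> (x i) (h (t i)))" for x h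
      by (intro sum.cong refl) (simp add: vec_def)
    then show ?thesis unfolding A_def T_def by auto
  qed
  show "A \<in> sets (PiM {1..n} (\<lambda>_. N))"
    unfolding A_eq by (rule tail_bound(1)[where T=T and q=q and \<kappa>=\<kappa> and ?A0.0=A0])
      (simp, rule s, rule \<phi>_cont, erule (1) bound, rule zero, erule base, rule nn, rule nn, rule nn, erule par)
  have "emeasure (PiM {1..n} (\<lambda>_. N)) A \<le> ennreal ((A0 + q (\<lambda>_. 0) + \<Lambda> * (\<Sum>i\<in>{1..n}. \<kappa> i)) / s)"
    unfolding A_eq by (rule tail_bound(2)[where T=T and q=q and \<kappa>=\<kappa> and ?A0.0=A0])
      (simp, rule s, rule \<phi>_cont, erule (1) bound, rule zero, erule base, rule nn, rule nn, rule nn, erule par)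
  also have "\<dots> \<le> ennreal (r * sqrt (real n / b) * ((1 + C) / 2 + \<Lambda>) / s)"
  proof (intro ennreal_leI divide_right_mono)
    have q0: "q (\<lambda>_. 0) = 0" by (simp add: q_def Qa_def Qk_def wsum_def inner2_def)
    have "\<kappa> i \<le> 1 / (c * b)" if "i \<in> {1..n}" for i
    proof -
      have "inner2 (wk b (t i)) (wk b (t i)) / b\<^sup>2 \<le> b / b\<^sup>2" using sqw(4)[OF that] by (intro divide_right_mono) auto
      also have "\<dots> = 1 / b" using b by (simp add: power2_eq_square)
      finally have "\<kappa> i \<le> (1 / b + 1 / b) / (2 * c)"
        unfolding \<kappa>_def sqw(3)[OF that] using c by (intro divide_right_mono) auto
      also have "\<dots> = 1 / (c * b)" using c b by (simp add: field_simps)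
      finally show ?thesis .
    qed
    then have "(\<Sum>i\<in>{1..n}. \<kappa> i) \<le> (\<Sum>i\<in>{1..n}. 1 / (c * b))" by (rule sum_mono)
    also have "\<dots> = (real n / b) / c" using c b by (simp add: field_simps)
    also have "\<dots> = sqrt (real n / b) * r"
    proof -
      define sq where "sq = sqrt (real n / b)"
      have "sq > 0" using n b by (simp add: sq_def)
      then have "(sq * sq) / (sq / r) = sq * r" using r by simp
      moreover have "sq * sq = real n / b" using b by (simp add: sq_def)
      ultimately show ?thesis unfolding c_def sq_def[symmetric] by simp
    qed
    finally have k: "\<Lambda> * (\<Sum>i\<in>{1..n}. \<kappa> i) \<le> \<Lambda> * (sqrt (real n / b) * r)" using \<Lambda>_nonneg by (rule mult_left_mono)
    have "A0 = r * sqrt (real n / b) * ((1 + C) / 2)"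
      using r by (simp add: A0_def c_def power2_eq_square)
    then have "A0 + q (\<lambda>_. 0) + \<Lambda> * (\<Sum>i\<in>{1..n}. \<kappa> i) \<le> r * sqrt (real n / b) * ((1 + C) / 2) + \<Lambda> * (sqrt (real n / b) * r)"
      using k unfolding q0 by (simp only: add_0_right add_left_mono)
    also have "\<dots> = r * sqrt (real n / b) * ((1 + C) / 2 + \<Lambda>)"
      by (simp only: distrib_left mult.commute mult.left_commute)
    finally show "A0 + q (\<lambda>_. 0) + \<Lambda> * (\<Sum>i\<in>{1..n}. \<kappa> i) \<le> r * sqrt (real n / b) * ((1 + C) / 2 + \<Lambda>)" .
  qed (use s in simp)
  finally show "emeasure (PiM {1..n} (\<lambda>_. N)) A \<le> ennreal (r * sqrt (real n / b) * ((1 + C) / 2 + \<Lambda>) / s)" .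
qed

end

section \<open>Convergence rate of the spline\<close>

lemma abs_cont_on_all_imp_continuous:
  assumes "\<And>a b. abs_cont_on {a..b} \<rho>"
  shows "continuous_on UNIV \<rho>"
proof (rule continuous_at_imp_continuous_on, rule ballI)
  fix x :: real
  have "continuous_on {x - 1..x + 1} \<rho>" using assms by (rule abs_cont_on_imp_continuous_on)
  then show "isCont \<rho> x" by (rule continuous_on_interior) simp
qed

lemma subgradient_mono:
  assumes sub: "\<And>x y. \<rho> y \<ge> \<rho> x + \<psi> x * (y - x)"
  shows "mono (\<psi> :: real \<Rightarrow> real)"
proof (rule monoI)
  fix x y :: real assume "x \<le> y"
  show "\<psi> x \<le> \<psi> y"
  proof (cases "x = y")
    case False
    have "\<rho> x + \<psi> x * (y - x) \<le> \<rho> y" "\<rho> y + \<psi> y * (x - y) \<le> \<rho> x" using sub[of x y] sub[of y x] by auto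
    then have "0 \<le> (\<psi> y - \<psi> x) * (y - x)" by (simp add: algebra_simps)
    then show ?thesis using False \<open>x \<le> y\<close> by (simp add: zero_le_mult_iff)
  qed simp
qed

text \<open>The supporting lines at \<open>x1\<close> and \<open>x2\<close> have slopes of opposite
  sign and force linear growth on both sides. This growth is what the existence of a minimiser rests
  on.\<close>

lemma subgradient_coercive:
  fixes \<rho> \<psi> :: "real \<Rightarrow> real"
  assumes sub: "\<And>x y. \<rho> y \<ge> \<rho> x + \<psi> x * (y - x)" and x1: "\<psi> x1 > 0" and x2: "\<psi> x2 < 0"
  shows "\<exists>a>0. \<exists>c. \<forall>x. \<rho> x \<ge> a * \<bar>x\<bar> - c"
proof -
  define a where "a = min (\<psi> x1) (- \<psi> x2)"
  define c where "c = \<bar>\<rho> x1 - \<psi> x1 * x1\<bar> + \<bar>\<rho> x2 - \<psi> x2 * x2\<bar>"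
  have "\<rho> x \<ge> a * \<bar>x\<bar> - c" for x
  proof (cases "x \<ge> 0")
    case True
    have "a * \<bar>x\<bar> \<le> \<psi> x1 * x" using True by (simp add: a_def mult_right_mono)
    moreover have "\<rho> x \<ge> \<rho> x1 + \<psi> x1 * x - \<psi> x1 * x1" using sub[of x1 x] by (simp add: algebra_simps)
    ultimately show ?thesis unfolding c_def by linarith
  next
    case False
    have "a * \<bar>x\<bar> \<le> (- \<psi> x2) * \<bar>x\<bar>" by (intro mult_right_mono) (auto simp: a_def)
    also have "\<dots> = \<psi> x2 * x" using False by simp
    finally have "a * \<bar>x\<bar> \<le> \<psi> x2 * x" .
    moreover have "\<rho> x \<ge> \<rho> x2 + \<psi> x2 * x - \<psi> x2 * x2" using sub[of x2 x] by (simp add: algebra_simps)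
    ultimately show ?thesis unfolding c_def by linarith
  qed
  moreover have "a > 0" using x1 x2 by (simp add: a_def)
  ultimately show ?thesis by blast
qed

text \<open>Subgradients at nearby points differ from \<open>\<psi> e\<close> by at most
  \<open>M1\<close>, so the loss increment has Lipschitz constant \<bar>\<psi> e\<bar> + M1 near 0,
  with finite second moment. The quadratic growth of its mean comes from the linear expansion of the
  mean of \<open>\<psi>\<close>, through subgradient inequalities instead of integrating
  \<open>\<psi>\<close>.\<close>

lemma convex_loss_lip_process:
  fixes N :: "real measure" and \<rho> \<psi> :: "real \<Rightarrow> real"
  assumes N: "prob_space N" "sets N = sets borel"
    and \<rho>: "continuous_on UNIV \<rho>" and sub: "\<And>x y. \<rho> y \<ge> \<rho> x + \<psi> x * (y - x)"
    and \<kappa>: "\<kappa> > 0" "\<And>x y. \<bar>y\<bar> < \<kappa> \<Longrightarrow> \<bar>\<psi> (x + y) - \<psi> x\<bar> \<le> M1"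
    and moment: "(\<integral>\<^sup>+e. ennreal (\<bar>\<psi> e\<bar>\<^sup>2) \<partial>N) \<le> ennreal (\<tau>\<^sup>2)"
    and mean: "(\<integral>e. \<psi> e \<partial>N) = 0"
    and \<xi>: "\<xi> > 0" "(\<lambda>s. (\<integral>e. \<psi> (e + s) \<partial>N) - \<xi> * s) \<in> o[at 0](\<lambda>s. s)"
  shows "\<exists>\<delta>>0. lip_process N (\<lambda>e u. \<rho> (e - u) - \<rho> e) (\<lambda>e. \<bar>\<psi> e\<bar> + M1) \<delta> (8 * \<tau>\<^sup>2 + 8 * M1\<^sup>2) \<and>
     (\<forall>u. \<bar>u\<bar> \<le> \<delta> \<longrightarrow> \<xi> / 8 * u\<^sup>2 \<le> (\<integral>e. \<rho> (e - u) - \<rho> e \<partial>N))"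
proof -
  interpret prob_space N by fact
  note [measurable_cong] = N(2)
  have M1: "M1 \<ge> 0" using \<kappa>(2)[of 0 0] \<kappa>(1) by simp
  have \<rho>m [measurable]: "\<rho> \<in> borel_measurable borel" by (rule borel_measurable_continuous_onI[OF \<rho>])
  have \<psi>m [measurable]: "\<psi> \<in> borel_measurable borel" by (rule borel_measurable_mono[OF subgradient_mono[OF sub]])
  have sq: "integrable N (\<lambda>e. (\<psi> e)\<^sup>2)"
  proof (rule integrableI_nonneg)
    show "(\<lambda>e. (\<psi> e)\<^sup>2) \<in> borel_measurable N" by measurable
    show "(\<integral>\<^sup>+e. ennreal ((\<psi> e)\<^sup>2) \<partial>N) < \<infinity>" using moment by (simp add: le_less_trans[OF _ ennreal_less_top])
  qed simp
  have \<psi>i: "integrable N \<psi>"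
  proof (rule Bochner_Integration.integrable_bound)
    show "integrable N (\<lambda>e. (\<psi> e)\<^sup>2 + 1)" using sq by simp
    have "\<bar>\<psi> e\<bar> \<le> (\<psi> e)\<^sup>2 + 1" for e
      using zero_le_power2[of "\<bar>\<psi> e\<bar> - 1"] zero_le_power2[of "\<psi> e"] by (simp add: power2_diff)
    then show "AE e in N. norm (\<psi> e) \<le> norm ((\<psi> e)\<^sup>2 + 1)" by simp
  qed measurable
  have \<psi>si: "integrable N (\<lambda>e. \<psi> (e + s))" if "\<bar>s\<bar> < \<kappa>" for s
  proof (rule Bochner_Integration.integrable_bound)
    show "integrable N (\<lambda>e. \<bar>\<psi> e\<bar> + M1)" using \<psi>i by simp
    have "\<bar>\<psi> (e + s)\<bar> \<le> \<bar>\<psi> e\<bar> + M1" for e using \<kappa>(2)[OF that, of e] by linarith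
    then show "AE e in N. norm (\<psi> (e + s)) \<le> norm (\<bar>\<psi> e\<bar> + M1)" using M1 by simp
  qed measurable
  have "\<forall>\<^sub>F s in at 0. norm ((\<integral>e. \<psi> (e + s) \<partial>N) - \<xi> * s) \<le> \<xi> / 2 * norm s"
    by (rule landau_o.smallD[OF \<xi>(2)]) (use \<xi>(1) in simp)
  then obtain d where d: "d > 0" "\<And>s. s \<noteq> 0 \<Longrightarrow> \<bar>s\<bar> < d \<Longrightarrow> \<bar>(\<integral>e. \<psi> (e + s) \<partial>N) - \<xi> * s\<bar> \<le> \<xi> / 2 * \<bar>s\<bar>"
    unfolding eventually_at by (auto simp: dist_real_def)
  \<comment> \<open>\<open>\<kappa> / 2\<close> keeps \<bar>u\<bar> \<le> \<delta> strictly inside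
    the range where the increments of \<open>\<psi>\<close> are bounded; within \<open>d\<close> the
    error of the expansion is at most half of its main term.\<close>
  define \<delta> where "\<delta> = min (\<kappa> / 2) d"
  have \<delta>: "\<delta> > 0" "\<delta> < \<kappa>" "\<delta> \<le> d" using \<kappa>(1) d by (auto simp: \<delta>_def)
  have bound: "\<rho> (e - u) - \<rho> (e - u') \<le> (\<bar>\<psi> e\<bar> + M1) * \<bar>u - u'\<bar>" if "\<bar>u\<bar> \<le> \<delta>" for e u u'
  proof -
    have "\<rho> (e - u) + \<psi> (e - u) * (u - u') \<le> \<rho> (e - u')" using sub[of "e - u" "e - u'"] by (simp add: algebra_simps)
    then have "\<rho> (e - u) - \<rho> (e - u') \<le> - (\<psi> (e - u) * (u - u'))" by linarith
    also have "\<dots> \<le> \<bar>\<psi> (e - u)\<bar> * \<bar>u - u'\<bar>" by (metis abs_ge_minus_self abs_mult)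
    also have "\<bar>\<psi> (e - u)\<bar> \<le> \<bar>\<psi> e\<bar> + M1" using \<kappa>(2)[of "- u" e] that \<delta> by simp
    finally show ?thesis by (simp add: mult_right_mono)
  qed
  have lip: "\<bar>(\<rho> (e - u) - \<rho> e) - (\<rho> (e - u') - \<rho> e)\<bar> \<le> (\<bar>\<psi> e\<bar> + M1) * \<bar>u - u'\<bar>" if "\<bar>u\<bar> \<le> \<delta>" "\<bar>u'\<bar> \<le> \<delta>" for e u u'
    using bound[OF that(1), of e u'] bound[OF that(2), of e u] by (simp add: abs_minus_commute abs_le_iff)
  have \<phi>i: "integrable N (\<lambda>e. \<rho> (e - u) - \<rho> e)" if "\<bar>u\<bar> \<le> \<delta>" for u
  proof (rule Bochner_Integration.integrable_bound)
    show "integrable N (\<lambda>e. (\<bar>\<psi> e\<bar> + M1) * \<bar>u\<bar>)" using \<psi>i by simp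
    have "\<bar>\<rho> (e - u) - \<rho> e\<bar> \<le> (\<bar>\<psi> e\<bar> + M1) * \<bar>u\<bar>" for e using lip[OF that, of 0 e] \<delta> by simp
    then show "AE e in N. norm (\<rho> (e - u) - \<rho> e) \<le> norm ((\<bar>\<psi> e\<bar> + M1) * \<bar>u\<bar>)" using M1 by (simp add: abs_mult)
  qed measurable
  have LL: "(\<integral>\<^sup>+p. ennreal (((\<bar>\<psi> (fst p)\<bar> + M1) + (\<bar>\<psi> (snd p)\<bar> + M1))\<^sup>2) \<partial>(N \<Otimes>\<^sub>M N)) \<le> ennreal (8 * \<tau>\<^sup>2 + 8 * M1\<^sup>2)"
  proof -
    interpret NN: pair_sigma_finite N N ..
    let ?g = "\<lambda>e. ennreal (4 * (\<psi> e)\<^sup>2 + 4 * M1\<^sup>2)"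
    have g: "(\<integral>\<^sup>+e. ?g e \<partial>N) \<le> ennreal (4 * \<tau>\<^sup>2 + 4 * M1\<^sup>2)"
    proof -
      have "(\<integral>\<^sup>+e. ?g e \<partial>N) = (\<integral>\<^sup>+e. ennreal 4 * ennreal (\<bar>\<psi> e\<bar>\<^sup>2) + ennreal (4 * M1\<^sup>2) \<partial>N)"
        by (intro nn_integral_cong, subst ennreal_mult[symmetric], simp, simp, subst ennreal_plus[symmetric]) auto
      also have "\<dots> = ennreal 4 * (\<integral>\<^sup>+e. ennreal (\<bar>\<psi> e\<bar>\<^sup>2) \<partial>N) + ennreal (4 * M1\<^sup>2)"
        by (subst nn_integral_add) (auto simp: nn_integral_cmult emeasure_space_1)
      also have "\<dots> \<le> ennreal 4 * ennreal (\<tau>\<^sup>2) + ennreal (4 * M1\<^sup>2)"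
        by (intro add_right_mono mult_left_mono moment) simp
      also have "\<dots> = ennreal (4 * \<tau>\<^sup>2 + 4 * M1\<^sup>2)"
        by (subst ennreal_mult[symmetric], simp, simp, subst ennreal_plus[symmetric]) auto
      finally show ?thesis .
    qed
    \<comment> \<open>The inequality (p + q)^2 <= 2 p^2 + 2 q^2 is used twice, which gives 4 for
      each copy and 8 in total.\<close>
    have "((\<bar>\<psi> x\<bar> + M1) + (\<bar>\<psi> y\<bar> + M1))\<^sup>2 \<le> (4 * (\<psi> x)\<^sup>2 + 4 * M1\<^sup>2) + (4 * (\<psi> y)\<^sup>2 + 4 * M1\<^sup>2)" for x y
    proof -
      have "(p + q)\<^sup>2 \<le> 2 * p\<^sup>2 + 2 * q\<^sup>2" for p q :: real
        using zero_le_power2[of "p - q"] by (simp add: power2_eq_square algebra_simps)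
      from this[of "\<bar>\<psi> x\<bar> + M1" "\<bar>\<psi> y\<bar> + M1"] this[of "\<bar>\<psi> x\<bar>" M1] this[of "\<bar>\<psi> y\<bar>" M1]
      show ?thesis by simp
    qed
    then have "(\<integral>\<^sup>+p. ennreal (((\<bar>\<psi> (fst p)\<bar> + M1) + (\<bar>\<psi> (snd p)\<bar> + M1))\<^sup>2) \<partial>(N \<Otimes>\<^sub>M N)) \<le> (\<integral>\<^sup>+p. ?g (fst p) + ?g (snd p) \<partial>(N \<Otimes>\<^sub>M N))"
      by (intro nn_integral_mono) (simp add: ennreal_plus[symmetric] del: ennreal_plus)
    also have "\<dots> = (\<integral>\<^sup>+x. \<integral>\<^sup>+y. ?g x + ?g y \<partial>N \<partial>N)"
      by (subst nn_integral_fst[symmetric]) (simp_all add: case_prod_beta')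
    also have "\<dots> = (\<integral>\<^sup>+x. ?g x + (\<integral>\<^sup>+y. ?g y \<partial>N) \<partial>N)"
      by (intro nn_integral_cong, subst nn_integral_add) (auto simp: emeasure_space_1)
    also have "\<dots> = (\<integral>\<^sup>+x. ?g x \<partial>N) + (\<integral>\<^sup>+y. ?g y \<partial>N)"
      by (subst nn_integral_add) (auto simp: emeasure_space_1)
    also have "\<dots> \<le> ennreal (4 * \<tau>\<^sup>2 + 4 * M1\<^sup>2) + ennreal (4 * \<tau>\<^sup>2 + 4 * M1\<^sup>2)" by (rule add_mono[OF g g])
    also have "\<dots> = ennreal (8 * \<tau>\<^sup>2 + 8 * M1\<^sup>2)" by (subst ennreal_plus[symmetric]) auto
    finally show ?thesis .
  qed
  have "lip_process N (\<lambda>e u. \<rho> (e - u) - \<rho> e) (\<lambda>e. \<bar>\<psi> e\<bar> + M1) \<delta> (8 * \<tau>\<^sup>2 + 8 * M1\<^sup>2)"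
    using N(2) \<phi>i lip LL M1 by unfold_locales simp_all
  moreover have "\<xi> / 8 * u\<^sup>2 \<le> (\<integral>e. \<rho> (e - u) - \<rho> e \<partial>N)" if u: "\<bar>u\<bar> \<le> \<delta>" for u
  proof (cases "u = 0")
    case False
    define s where "s = - u / 2"
    have s: "s \<noteq> 0" "\<bar>s\<bar> < d" "\<bar>s\<bar> < \<kappa>" using False u \<delta> by (auto simp: s_def)
    (* Two half steps: only the mean of psi at the midpoint e + s is needed. *)
    have pt: "s * \<psi> (e + s) + s * \<psi> e \<le> \<rho> (e - u) - \<rho> e" for e
    proof -
      have "\<rho> (e + s) + \<psi> (e + s) * s \<le> \<rho> (e - u)" using sub[of "e + s" "e - u"] by (simp add: s_def)
      moreover have "\<rho> e + \<psi> e * s \<le> \<rho> (e + s)" using sub[of e "e + s"] by simp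
      ultimately show ?thesis by (simp add: mult.commute)
    qed
    \<comment> \<open>With \<open>s = - u / 2\<close> the main term is \<xi> u^2 / 4, and the error
      of the expansion costs at most half of it.\<close>
    have "\<xi> / 8 * u\<^sup>2 = s * (\<xi> * s) - \<xi> / 2 * \<bar>s\<bar> * \<bar>s\<bar>" by (simp add: s_def power2_eq_square abs_mult_self_eq)
    also have "\<dots> \<le> s * (\<integral>e. \<psi> (e + s) \<partial>N)"
    proof -
      define R where "R = (\<integral>e. \<psi> (e + s) \<partial>N) - \<xi> * s"
      have "\<bar>R\<bar> \<le> \<xi> / 2 * \<bar>s\<bar>" unfolding R_def by (rule d(2)[OF s(1,2)])
      then have "\<bar>s * R\<bar> \<le> \<xi> / 2 * \<bar>s\<bar> * \<bar>s\<bar>" unfolding abs_mult using mult_right_mono[of "\<bar>R\<bar>" "\<xi> / 2 * \<bar>s\<bar>" "\<bar>s\<bar>"] by (simp add: mult.commute)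
      moreover have "s * (\<integral>e. \<psi> (e + s) \<partial>N) = s * (\<xi> * s) + s * R" by (simp add: R_def algebra_simps)
      ultimately show ?thesis by linarith
    qed
    also have "\<dots> = (\<integral>e. s * \<psi> (e + s) + s * \<psi> e \<partial>N)"
      using \<psi>si[OF s(3)] \<psi>i mean by simp
    also have "\<dots> \<le> (\<integral>e. \<rho> (e - u) - \<rho> e \<partial>N)"
      by (rule integral_mono) (use \<psi>si[OF s(3)] \<psi>i \<phi>i[OF u] pt in auto)
    finally show ?thesis .
  qed simp
  ultimately show ?thesis using \<delta>(1) by blast
qed

text \<open>Near 0 the mean of \<open>\<psi> (e + s)\<close> has the sign of \<open>s\<close>, which
  is impossible for a \<open>\<psi>\<close> of one sign. Both signs are needed for
  coercivity.\<close>

lemma expansion_sign_change: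
  fixes N :: "real measure" and \<psi> :: "real \<Rightarrow> real"
  assumes \<xi>: "\<xi> > 0" "(\<lambda>s. (\<integral>e. \<psi> (e + s) \<partial>N) - \<xi> * s) \<in> o[at 0](\<lambda>s. s)"
  shows "\<exists>x. \<psi> x > 0" "\<exists>x. \<psi> x < 0"
proof -
  have "\<forall>\<^sub>F s in at 0. norm ((\<integral>e. \<psi> (e + s) \<partial>N) - \<xi> * s) \<le> \<xi> / 2 * norm s"
    by (rule landau_o.smallD[OF \<xi>(2)]) (use \<xi>(1) in simp)
  then obtain d where d: "d > 0" "\<And>s. s \<noteq> 0 \<Longrightarrow> \<bar>s\<bar> < d \<Longrightarrow> \<bar>(\<integral>e. \<psi> (e + s) \<partial>N) - \<xi> * s\<bar> \<le> \<xi> / 2 * \<bar>s\<bar>"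
    unfolding eventually_at by (auto simp: dist_real_def)
  define s where "s = d / 2"
  have s: "s > 0" "s < d" using d by (auto simp: s_def)
  have pos: "\<xi> * s > 0" using s \<xi> by simp
  have p: "(\<integral>e. \<psi> (e + s) \<partial>N) > 0" 
  proof -
    have "\<bar>(\<integral>e. \<psi> (e + s) \<partial>N) - \<xi> * s\<bar> \<le> \<xi> * s / 2" using d(2)[of s] s by simp
    then show ?thesis using pos unfolding abs_le_iff by linarith
  qed
  have n: "(\<integral>e. \<psi> (e + - s) \<partial>N) < 0" 
  proof -
    have "\<bar>(\<integral>e. \<psi> (e + - s) \<partial>N) + \<xi> * s\<bar> \<le> \<xi> * s / 2" using d(2)[of "- s"] s by simp
    then show ?thesis using pos unfolding abs_le_iff by linarith
  qed
  show "\<exists>x. \<psi> x > 0"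
  proof (rule ccontr)
    assume "\<nexists>x. \<psi> x > 0"
    then have "0 \<le> (\<integral>e. - \<psi> (e + s) \<partial>N)" by (intro Bochner_Integration.integral_nonneg) (simp add: not_less)
    then show False using p by simp
  qed
  show "\<exists>x. \<psi> x < 0"
  proof (rule ccontr)
    assume "\<nexists>x. \<psi> x < 0"
    then have "0 \<le> (\<integral>e. \<psi> (e + - s) \<partial>N)" by (intro Bochner_Integration.integral_nonneg) (simp add: not_less)
    then show False using n by simp
  qed
qed

text \<open>
  On the sphere \<open>sob_inner m lam h h = r\<^sup>2\<close> around \<open>fo\<close> the objective exceeds its value at \<open>fo\<close>,
  so by convexity no minimiser lies outside the ball.
\<close>

lemma spline_deviation_bound:
  fixes \<rho> mu :: "real \<Rightarrow> real" and t x y :: "nat \<Rightarrow> real"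
  assumes m: "m \<ge> 1" and n: "n \<ge> 1" and C: "C \<ge> 1" "\<And>F b. F \<in> sobolev2 m \<Longrightarrow> 0 < b \<Longrightarrow> b \<le> 1/2 \<Longrightarrow>
     b\<^sup>2 * inner2 (nderiv 1 F) (nderiv 1 F) \<le> C * (inner2 F F + b ^ (2 * m) * inner2 (nderiv m F) (nderiv m F))"
    and b: "0 < b" "b \<le> 1/2" "b ^ (2 * m) = lam" and t: "\<And>i. i \<in> {1..n} \<Longrightarrow> t i \<in> {0..1}"
    and convex: "convex_on UNIV \<rho>"
    and y: "\<And>i. i \<in> {1..n} \<Longrightarrow> y i = fo (t i) + x i"
    and design: "\<And>f. f \<in> sobolev11 \<Longrightarrow> \<bar>1 / real n * (\<Sum>i=1..n. f (t i)) - (LINT x:{0..1}|lebesgue. f x)\<bar>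
                 \<le> M3 / real n * (LINT x:{0..1}|lebesgue. \<bar>nderiv 1 f x\<bar>)"
    and fo: "fo \<in> sobolev2 (2 * m)" "\<And>s. m \<le> s \<Longrightarrow> s \<le> 2 * m - 1 \<Longrightarrow> nderiv s fo 0 = 0 \<and> nderiv s fo 1 = 0"
    and mu: "\<And>u. \<bar>u\<bar> \<le> \<delta> \<Longrightarrow> c0 * u\<^sup>2 \<le> mu u" and c0: "c0 > 0"
    and r: "r > 0" "2 * (1 + C) * r\<^sup>2 / b \<le> \<delta>\<^sup>2" "\<delta> \<ge> 0"
    and c1: "c1 = min c0 1"
    and small1: "c0 * (\<bar>M3\<bar> * (1 + C) / (real n * b)) \<le> c1 / 8"
    and small2: "2 * lam * sqrt (inner2 (nderiv (2 * m) fo) (nderiv (2 * m) fo)) \<le> c1 * r / 8"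
    and event: "\<And>h. h \<in> sobolev2 m \<Longrightarrow> sob_inner m lam h h \<le> r\<^sup>2 \<Longrightarrow>
       (\<Sum>i=1..n. mu (h (t i)) - (\<rho> (x i - h (t i)) - \<rho> (x i))) \<le> real n * c1 * r\<^sup>2 / 2"
    and spline: "m_smoothing_spline m n lam \<rho> t y fhat"
  shows "sob_inner m lam (\<lambda>x. fhat x - fo x) (\<lambda>x. fhat x - fo x) \<le> r\<^sup>2"
proof (rule ccontr)
  define d where "d x = fhat x - fo x" for x
  assume "\<not> sob_inner m lam (\<lambda>x. fhat x - fo x) (\<lambda>x. fhat x - fo x) \<le> r\<^sup>2"
  then have Sd: "sob_inner m lam d d > r\<^sup>2" by (simp add: d_def[abs_def])
  have lam: "lam > 0" using b by auto
  interpret J: semi_inner "sobolev2 m" "\<lambda>f g. inner2 (nderiv m f) (nderiv m g)" by (rule semi_inner_nderiv[OF m])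
  interpret S: semi_inner "sobolev2 m" "sob_inner m lam" by (rule semi_inner_sob[OF m]) (use lam in simp)
  have foH: "fo \<in> sobolev2 m" by (rule sobolev2_mono[OF fo(1) _ m]) simp
  have fhH: "fhat \<in> sobolev2 m" using spline by (simp add: m_smoothing_spline_def is_arg_min_def)
  have d: "d \<in> sobolev2 m" using S.closed[OF fhH foH, of 1 "-1"] by (simp add: d_def[abs_def])
  define obj where "obj = spline_objective m n lam \<rho> t y"
  have obj: "obj g = 1 / real n * (\<Sum>i=1..n. \<rho> (y i - g (t i))) + lam * inner2 (nderiv m g) (nderiv m g)" for g
    by (simp add: obj_def spline_objective_def inner2_def power2_eq_square)
  have min: "obj fhat \<le> obj fo" using spline foH unfolding obj_def m_smoothing_spline_def is_arg_min_def by force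
  \<comment> \<open>Shrinks the deviation \<open>d\<close> of the spline to a multiple
    \<open>h\<close> on the sphere of radius \<open>r\<close>.\<close>
  define \<alpha> where "\<alpha> = r / sqrt (sob_inner m lam d d)"
  have sqd: "sqrt (sob_inner m lam d d) > r" using Sd r(1) by (metis real_less_rsqrt)
  have sqd0: "sqrt (sob_inner m lam d d) > 0" using sqd r(1) by linarith
  have \<alpha>: "0 < \<alpha>" "\<alpha> < 1"
    unfolding \<alpha>_def using sqd sqd0 r(1) by (simp_all only: divide_pos_pos divide_less_eq_1_pos)
  define h where "h x = \<alpha> * d x" for x
  have h: "h \<in> sobolev2 m" using S.closed[OF d d, of \<alpha> 0] by (simp add: h_def[abs_def])
  have hlin: "sob_inner m lam h g = \<alpha> * sob_inner m lam d g" if "g \<in> sobolev2 m" for g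
    using S.lin[OF d d that, of \<alpha> 0] by (simp add: h_def[abs_def])
  have Sh: "sob_inner m lam h h = r\<^sup>2"
  proof -
    have "sob_inner m lam h h = \<alpha> * (\<alpha> * sob_inner m lam d d)"
      unfolding hlin[OF h] S.sym[OF d h] hlin[OF d] ..
    also have "\<dots> = \<alpha>\<^sup>2 * (sqrt (sob_inner m lam d d))\<^sup>2" using S.nonneg[OF d] by (simp add: power2_eq_square)
    also have "\<dots> = r\<^sup>2" using sqd0 by (simp add: \<alpha>_def power_divide)
    finally show ?thesis .
  qed
  have Jsum: "inner2 (nderiv m (\<lambda>x. fo x + s * d x)) (nderiv m (\<lambda>x. fo x + s * d x)) =
     inner2 (nderiv m fo) (nderiv m fo) + 2 * s * inner2 (nderiv m fo) (nderiv m d) + s\<^sup>2 * inner2 (nderiv m d) (nderiv m d)" for s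
  proof -
    have g: "(\<lambda>x. fo x + s * d x) \<in> sobolev2 m" using S.closed[OF foH d, of 1 s] by simp
    have lin: "inner2 (nderiv m (\<lambda>x. fo x + s * d x)) (nderiv m k) = inner2 (nderiv m fo) (nderiv m k) + s * inner2 (nderiv m d) (nderiv m k)"
      if "k \<in> sobolev2 m" for k using J.lin[OF foH d that, of 1 s] by simp
    have "inner2 (nderiv m (\<lambda>x. fo x + s * d x)) (nderiv m (\<lambda>x. fo x + s * d x)) =
       inner2 (nderiv m (\<lambda>x. fo x + s * d x)) (nderiv m fo) + s * inner2 (nderiv m (\<lambda>x. fo x + s * d x)) (nderiv m d)"
      unfolding lin[OF g] J.sym[OF foH g] J.sym[OF d g] ..
    then show ?thesis unfolding lin[OF foH] lin[OF d] J.sym[OF d foH] by (simp add: power2_eq_square algebra_simps)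
  qed
  define Jo where "Jo = inner2 (nderiv m fo) (nderiv m fo)"
  define Jx where "Jx = inner2 (nderiv m fo) (nderiv m d)"
  define Jd where "Jd = inner2 (nderiv m d) (nderiv m d)"
  have Jd0: "Jd \<ge> 0" by (simp add: Jd_def inner2_self_nonneg)
  have J\<alpha>: "inner2 (nderiv m (\<lambda>x. fo x + h x)) (nderiv m (\<lambda>x. fo x + h x)) = Jo + 2 * \<alpha> * Jx + \<alpha>\<^sup>2 * Jd"
    using Jsum[of \<alpha>] by (simp add: h_def Jo_def Jx_def Jd_def)
  have J1: "inner2 (nderiv m fhat) (nderiv m fhat) = Jo + 2 * Jx + Jd"
    using Jsum[of 1] by (simp add: d_def[abs_def] Jo_def Jx_def Jd_def)
  have "obj (\<lambda>x. fo x + h x) \<le> (1 - \<alpha>) * obj fo + \<alpha> * obj fhat"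
  proof -
    have "(\<Sum>i=1..n. \<rho> (y i - (fo (t i) + h (t i)))) \<le> (\<Sum>i=1..n. (1 - \<alpha>) * \<rho> (y i - fo (t i)) + \<alpha> * \<rho> (y i - fhat (t i)))"
    proof (rule sum_mono)
      fix i
      have "y i - (fo (t i) + h (t i)) = (1 - \<alpha>) * (y i - fo (t i)) + \<alpha> * (y i - fhat (t i))"
        by (simp add: h_def d_def algebra_simps)
      then show "\<rho> (y i - (fo (t i) + h (t i))) \<le> (1 - \<alpha>) * \<rho> (y i - fo (t i)) + \<alpha> * \<rho> (y i - fhat (t i))"
        using convex_onD[OF convex, of \<alpha> "y i - fo (t i)" "y i - fhat (t i)"] \<alpha> by simp
    qed
    then have "1 / real n * (\<Sum>i=1..n. \<rho> (y i - (fo (t i) + h (t i)))) \<le>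
        1 / real n * ((1 - \<alpha>) * (\<Sum>i=1..n. \<rho> (y i - fo (t i))) + \<alpha> * (\<Sum>i=1..n. \<rho> (y i - fhat (t i))))"
      by (intro mult_left_mono) (simp_all add: sum.distrib sum_distrib_left)
    moreover have "lam * (Jo + 2 * \<alpha> * Jx + \<alpha>\<^sup>2 * Jd) \<le> lam * ((1 - \<alpha>) * Jo + \<alpha> * (Jo + 2 * Jx + Jd))"
    proof (rule mult_left_mono)
      have "\<alpha>\<^sup>2 * Jd \<le> \<alpha> * Jd" using \<alpha> Jd0 by (intro mult_right_mono) (auto simp: power2_eq_square mult_left_le_one_le)
      then show "Jo + 2 * \<alpha> * Jx + \<alpha>\<^sup>2 * Jd \<le> (1 - \<alpha>) * Jo + \<alpha> * (Jo + 2 * Jx + Jd)" by (simp add: algebra_simps)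
    qed (use lam in simp)
    ultimately show ?thesis unfolding obj J\<alpha> J1 Jo_def[symmetric] by (simp add: algebra_simps diff_divide_distrib)
  qed
  also have "\<dots> \<le> (1 - \<alpha>) * obj fo + \<alpha> * obj fo" using min \<alpha> by (intro add_left_mono mult_left_mono) auto
  finally have up: "obj (\<lambda>x. fo x + h x) \<le> obj fo" by (simp add: algebra_simps)
  have Jh: "inner2 (nderiv m h) (nderiv m h) = \<alpha>\<^sup>2 * Jd" "inner2 (nderiv m fo) (nderiv m h) = \<alpha> * Jx"
  proof -
    have lin: "inner2 (nderiv m h) (nderiv m k) = \<alpha> * inner2 (nderiv m d) (nderiv m k)" if "k \<in> sobolev2 m" for k
      using J.lin[OF d d that, of \<alpha> 0] by (simp add: h_def[abs_def])
    show "inner2 (nderiv m fo) (nderiv m h) = \<alpha> * Jx" unfolding J.sym[OF foH h] lin[OF foH] J.sym[OF d foH] Jx_def ..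
    show "inner2 (nderiv m h) (nderiv m h) = \<alpha>\<^sup>2 * Jd"
      unfolding lin[OF h] J.sym[OF d h] lin[OF d] Jd_def by (simp add: power2_eq_square)
  qed
  define n0 where "n0 = inner2 h h"
  have n0: "n0 \<ge> 0" by (simp add: n0_def inner2_self_nonneg)
  have Sh': "n0 + lam * (\<alpha>\<^sup>2 * Jd) = r\<^sup>2" using Sh by (simp add: sob_inner_def n0_def Jh)
  have n0r: "n0 \<le> r\<^sup>2" using Sh' lam Jd0 by (smt (verit) mult_nonneg_nonneg zero_le_power2)
  have ach: "abs_cont_on {0..1} h" using sobolev2_abs_cont[OF h, of 0] m by (simp add: nderiv_0)
  have sqh: "sq_int (nderiv 1 h)" by (rule sobolev2_nderiv_sq_int[OF h m m])
  \<comment> \<open>The design condition, applied to \<open>h^2\<close>, replaces the mean over the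
    design points by the integral with an error of relative order 1/(n b).\<close>
  have mean_sq: "1 / real n * (\<Sum>i=1..n. (h (t i))\<^sup>2) \<ge> n0 - \<bar>M3\<bar> * (1 + C) / (real n * b) * r\<^sup>2"
  proof -
    have "\<bar>1 / real n * (\<Sum>i=1..n. (h (t i))\<^sup>2) - (LINT x:{0..1}|lebesgue. (h x)\<^sup>2)\<bar>
        \<le> M3 / real n * (LINT x:{0..1}|lebesgue. \<bar>nderiv 1 (\<lambda>x. (h x)\<^sup>2) x\<bar>)"
      by (rule design[OF square_sobolev11(1)[OF ach sqh b(1)]])
    also have "\<dots> \<le> \<bar>M3\<bar> / real n * ((1 + C) * r\<^sup>2 / b)"
    proof -
      have "(LINT x:{0..1}|lebesgue. \<bar>nderiv 1 (\<lambda>x. (h x)\<^sup>2) x\<bar>) \<le> (inner2 h h + b\<^sup>2 * inner2 (nderiv 1 h) (nderiv 1 h)) / b"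
        by (rule square_sobolev11(3)[OF ach sqh b(1)])
      also have "\<dots> \<le> (1 + C) * r\<^sup>2 / b"
        using sobolev_design_bounds(1)[OF m C(2) b h] Sh b by (intro divide_right_mono) auto
      finally have le: "(LINT x:{0..1}|lebesgue. \<bar>nderiv 1 (\<lambda>x. (h x)\<^sup>2) x\<bar>) \<le> (1 + C) * r\<^sup>2 / b" .
      have nn: "0 \<le> (LINT x:{0..1}|lebesgue. \<bar>nderiv 1 (\<lambda>x. (h x)\<^sup>2) x\<bar>)"
        unfolding set_lebesgue_integral_def by (rule Bochner_Integration.integral_nonneg) simp
      have "M3 / real n * (LINT x:{0..1}|lebesgue. \<bar>nderiv 1 (\<lambda>x. (h x)\<^sup>2) x\<bar>) \<le> \<bar>M3\<bar> / real n * (LINT x:{0..1}|lebesgue. \<bar>nderiv 1 (\<lambda>x. (h x)\<^sup>2) x\<bar>)"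
        using nn by (intro mult_right_mono divide_right_mono) auto
      also have "\<dots> \<le> \<bar>M3\<bar> / real n * ((1 + C) * r\<^sup>2 / b)" using le by (intro mult_left_mono) auto
      finally show ?thesis .
    qed
    also have "\<dots> = \<bar>M3\<bar> * (1 + C) / (real n * b) * r\<^sup>2" by simp
    finally show ?thesis unfolding square_sobolev11(2)[OF ach sqh b(1)] n0_def by linarith
  qed
  have hb: "\<bar>h (t i)\<bar> \<le> \<delta>" if "i \<in> {1..n}" for i
  proof -
    have "(h (t i))\<^sup>2 \<le> 2 * (1 + C) * sob_inner m lam h h / b" by (rule sobolev_design_bounds(2)[OF m C(2) b h t[OF that]])
    then have "(h (t i))\<^sup>2 \<le> \<delta>\<^sup>2" using r(2) Sh by simp
    then show ?thesis using r(3) by (metis abs_le_square_iff abs_of_nonneg)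
  qed
  have "c0 * (\<Sum>i=1..n. (h (t i))\<^sup>2) \<le> (\<Sum>i=1..n. mu (h (t i)))"
    unfolding sum_distrib_left using mu hb by (intro sum_mono) auto
  also have "\<dots> = (\<Sum>i=1..n. mu (h (t i)) - (\<rho> (x i - h (t i)) - \<rho> (x i))) + (\<Sum>i=1..n. \<rho> (x i - h (t i)) - \<rho> (x i))"
    by (simp add: sum.distrib[symmetric])
  also have "\<dots> \<le> real n * c1 * r\<^sup>2 / 2 + (\<Sum>i=1..n. \<rho> (x i - h (t i)) - \<rho> (x i))"
    using event[OF h] Sh by simp
  finally have low: "1 / real n * (c0 * (\<Sum>i=1..n. (h (t i))\<^sup>2)) \<le> 1 / real n * (real n * c1 * r\<^sup>2 / 2 + (\<Sum>i=1..n. \<rho> (x i - h (t i)) - \<rho> (x i)))"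
    by (rule mult_left_mono) simp
  define \<Phi> where "\<Phi> = 1 / real n * (\<Sum>i=1..n. \<rho> (x i - h (t i)) - \<rho> (x i))"
  have low': "c0 * (n0 - \<bar>M3\<bar> * (1 + C) / (real n * b) * r\<^sup>2) \<le> c1 * r\<^sup>2 / 2 + \<Phi>"
  proof -
    have "c0 * (n0 - \<bar>M3\<bar> * (1 + C) / (real n * b) * r\<^sup>2) \<le> c0 * (1 / real n * (\<Sum>i=1..n. (h (t i))\<^sup>2))"
      using mean_sq c0 by (intro mult_left_mono) auto
    also have "\<dots> = 1 / real n * (c0 * (\<Sum>i=1..n. (h (t i))\<^sup>2))" by simp
    also have "\<dots> \<le> c1 * r\<^sup>2 / 2 + \<Phi>" using low n by (simp add: \<Phi>_def add_divide_distrib)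
    finally show ?thesis .
  qed
  have diff: "obj (\<lambda>x. fo x + h x) - obj fo = \<Phi> + lam * (2 * (\<alpha> * Jx) + \<alpha>\<^sup>2 * Jd)"
  proof -
    have "(\<Sum>i=1..n. \<rho> (y i - (fo (t i) + h (t i)))) - (\<Sum>i=1..n. \<rho> (y i - fo (t i))) = (\<Sum>i=1..n. \<rho> (x i - h (t i)) - \<rho> (x i))"
      unfolding sum_subtractf[symmetric] by (intro sum.cong refl) (simp add: y)
    then show ?thesis unfolding obj J\<alpha> Jo_def[symmetric] \<Phi>_def by (simp add: algebra_simps diff_divide_distrib)
  qed
  define A where "A = sqrt (inner2 (nderiv (2 * m) fo) (nderiv (2 * m) fo))"
  have bias: "\<bar>\<alpha> * Jx\<bar> \<le> A * r"
  proof -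
    have "\<bar>\<alpha> * Jx\<bar> = \<bar>inner2 (nderiv (2 * m) fo) h\<bar>"
      unfolding Jh(2)[symmetric] by (rule inner2_nderiv_by_parts[OF fo(1) h m fo(2)])
    moreover have "(inner2 (nderiv (2 * m) fo) h)\<^sup>2 \<le> A\<^sup>2 * r\<^sup>2"
    proof -
      have "(inner2 (nderiv (2 * m) fo) h)\<^sup>2 \<le> inner2 (nderiv (2 * m) fo) (nderiv (2 * m) fo) * inner2 h h"
        by (rule inner2_cauchy_schwarz[OF sobolev2_nderiv_sq_int[OF fo(1) order_refl] sobolev2_sq_int[OF h m]]) (use m in simp)
      also have "\<dots> \<le> A\<^sup>2 * r\<^sup>2"
        using n0r inner2_self_nonneg[of "nderiv (2 * m) fo"] by (simp add: A_def n0_def mult_left_mono)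
      finally show ?thesis .
    qed
    then have sq: "\<bar>inner2 (nderiv (2 * m) fo) h\<bar>\<^sup>2 \<le> (A * r)\<^sup>2" by (simp only: power2_abs power_mult_distrib)
    have "A \<ge> 0" by (simp add: A_def inner2_self_nonneg)
    then have "0 \<le> A * r" using r(1) by simp
    with sq have "\<bar>inner2 (nderiv (2 * m) fo) h\<bar> \<le> A * r" by (rule power2_le_imp_le)
    ultimately show ?thesis by simp
  qed
  have bias2: "2 * lam * \<bar>\<alpha> * Jx\<bar> \<le> c1 * r\<^sup>2 / 8"
  proof -
    have "2 * lam * \<bar>\<alpha> * Jx\<bar> \<le> 2 * lam * (A * r)" using bias lam by (intro mult_left_mono) auto
    also have "\<dots> = (2 * lam * A) * r" by simp
    also have "\<dots> \<le> (c1 * r / 8) * r" using small2 r(1) unfolding A_def by (intro mult_right_mono) auto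
    finally show ?thesis by (simp add: power2_eq_square)
  qed
  have s1: "c0 * (\<bar>M3\<bar> * (1 + C) / (real n * b) * r\<^sup>2) \<le> c1 / 8 * r\<^sup>2"
    using mult_right_mono[OF small1, of "r\<^sup>2"] by (simp add: mult.assoc)
  have c1p: "c1 > 0" "c1 \<le> c0" "c1 \<le> 1" using c1 c0 by auto
  \<comment> \<open>The loss gains \<open>c0\<close> times the first part of the squared norm, the
    penalty gains the second part with factor 1; \<open>c1 = min c0 1\<close> serves both.\<close>
  have "c1 * r\<^sup>2 = c1 * n0 + c1 * (lam * (\<alpha>\<^sup>2 * Jd))" unfolding Sh'[symmetric] by (simp add: distrib_left)
  also have "c1 * n0 \<le> c0 * n0" using c1p n0 by (intro mult_right_mono)
  also have "c1 * (lam * (\<alpha>\<^sup>2 * Jd)) \<le> 1 * (lam * (\<alpha>\<^sup>2 * Jd))" using c1p lam Jd0 by (intro mult_right_mono) auto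
  finally have main: "c1 * r\<^sup>2 \<le> c0 * n0 + lam * (\<alpha>\<^sup>2 * Jd)" by simp
  \<comment> \<open>The budget: of the gain \<open>R\<close>, the stochastic term takes at most R/2,
    the design error R/8 and the bias R/8, so R/4 remains.\<close>
  define R where "R = c1 * r\<^sup>2"
  have R: "R > 0" using c1p r(1) by (simp add: R_def)
  have e1: "c0 * n0 - c0 * (\<bar>M3\<bar> * (1 + C) / (real n * b) * r\<^sup>2) \<le> R / 2 + \<Phi>"
    using low' by (simp only: R_def right_diff_distrib)
  have e2: "c0 * (\<bar>M3\<bar> * (1 + C) / (real n * b) * r\<^sup>2) \<le> R / 8" using s1 by (simp add: R_def)
  have e3: "- (R / 8) \<le> lam * (2 * (\<alpha> * Jx))"
  proof -
    have "\<bar>lam * (2 * (\<alpha> * Jx))\<bar> = 2 * lam * \<bar>\<alpha> * Jx\<bar>" using lam by (simp add: abs_mult)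
    then show ?thesis using bias2 unfolding R_def by linarith
  qed
  have e4: "R \<le> c0 * n0 + lam * (\<alpha>\<^sup>2 * Jd)" using main by (simp only: R_def)
  have e5: "\<Phi> + (lam * (2 * (\<alpha> * Jx)) + lam * (\<alpha>\<^sup>2 * Jd)) \<le> 0" using diff up by (simp only: distrib_left[symmetric])
  show False using R e1 e2 e3 e4 e5 by linarith
qed

section \<open>The law of the sample and the asymptotic rates\<close>

lemma distr_iid_sample:
  fixes X :: "nat \<Rightarrow> 'a \<Rightarrow> real"
  assumes M: "prob_space M" and indep: "prob_space.indep_vars M (\<lambda>_. borel) X {1..}"
    and ident: "\<And>i. i \<ge> 1 \<Longrightarrow> distr M borel (X i) = N" and n: "n \<ge> 1"
  shows "(\<lambda>\<omega>. \<lambda>i\<in>{1..n}. X i \<omega>) \<in> M \<rightarrow>\<^sub>M PiM {1..n} (\<lambda>_. N)"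
    "distr M (PiM {1..n} (\<lambda>_. N)) (\<lambda>\<omega>. \<lambda>i\<in>{1..n}. X i \<omega>) = PiM {1..n} (\<lambda>_. N)"
proof -
  interpret prob_space M by fact
  have ind: "indep_vars (\<lambda>_. borel) X {1..n}" by (rule indep_vars_subset[OF indep]) auto
  have N: "sets N = sets borel" using ident[of 1] by auto
  have rv: "random_variable borel (X i)" if "i \<in> {1..n}" for i
    using indep that unfolding indep_vars_def by auto
  have S: "sets (PiM {1..n} (\<lambda>_. N)) = sets (PiM {1..n} (\<lambda>_. borel))" by (rule sets_PiM_cong) (auto simp: N)
  have "(\<lambda>\<omega>. \<lambda>i\<in>{1..n}. X i \<omega>) \<in> M \<rightarrow>\<^sub>M PiM {1..n} (\<lambda>_. borel)" by (rule measurable_restrict) (rule rv)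
  then show "(\<lambda>\<omega>. \<lambda>i\<in>{1..n}. X i \<omega>) \<in> M \<rightarrow>\<^sub>M PiM {1..n} (\<lambda>_. N)"
    unfolding measurable_cong_sets[OF refl S] .
  have "distr M (PiM {1..n} (\<lambda>_. N)) (\<lambda>\<omega>. \<lambda>i\<in>{1..n}. X i \<omega>) = distr M (PiM {1..n} (\<lambda>_. borel)) (\<lambda>\<omega>. \<lambda>i\<in>{1..n}. X i \<omega>)"
    by (rule distr_cong[OF refl S refl])
  also have "\<dots> = PiM {1..n} (\<lambda>i. distr M borel (X i))"
    using indep_vars_iff_distr_eq_PiM'[where I = "{1..n}" and M' = "\<lambda>_. borel" and X = X] rv ind n by auto
  also have "\<dots> = PiM {1..n} (\<lambda>_. N)" by (rule PiM_cong) (auto simp: ident)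
  finally show "distr M (PiM {1..n} (\<lambda>_. N)) (\<lambda>\<omega>. \<lambda>i\<in>{1..n}. X i \<omega>) = PiM {1..n} (\<lambda>_. N)" .
qed

text \<open>For lam < 1 a larger exponent gives a smaller power, so the rate condition carries over
  to the exponent 1/m, that is, to n b^2. Moreover b <= 1/2 gives lam = b^(2m) <= b. The last
  quotient is therefore at most lam + 1/(n b^2).\<close>

lemma smoothing_rate:
  fixes lam b :: "nat \<Rightarrow> real"
  assumes m: "m \<ge> 1" and lam: "\<And>n. lam n > 0" "lam \<longlonglongrightarrow> 0"
    and rate: "filterlim (\<lambda>n. real n * lam n powr (3 / (2 * real m) - 1 / (4 * (real m)\<^sup>2))) at_top sequentially"
    and b: "\<And>n. b n = lam n powr (1 / (2 * real m))"
  shows "\<And>n. b n > 0" "\<And>n. b n ^ (2 * m) = lam n" "\<forall>\<^sub>F n in sequentially. b n \<le> 1/2"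
    "(\<lambda>n. ((lam n)\<^sup>2 + inverse (real n * b n)) / b n) \<longlonglongrightarrow> 0"
proof -
  show b0: "b n > 0" for n using lam(1)[of n] by (simp add: b)
  show bm: "b n ^ (2 * m) = lam n" for n
  proof -
    have "b n ^ (2 * m) = b n powr (real (2 * m))" by (rule powr_realpow[symmetric, OF b0])
    also have "\<dots> = lam n" using m lam(1)[of n] by (simp add: b powr_powr)
    finally show ?thesis .
  qed
  have "b \<longlonglongrightarrow> 0"
  proof -
    have "(\<lambda>n. lam n powr (1 / (2 * real m))) \<longlonglongrightarrow> 0"
      by (rule tendsto_zero_powrI[OF lam(2) tendsto_const]) (use m lam(1) in \<open>auto intro!: always_eventually less_imp_le\<close>)
    then show ?thesis by (simp add: b[abs_def])
  qed
  then have "\<forall>\<^sub>F n in sequentially. b n < 1/2" by (rule order_tendstoD) simp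
  then show bh: "\<forall>\<^sub>F n in sequentially. b n \<le> 1/2" by eventually_elim simp
  have lam1: "\<forall>\<^sub>F n in sequentially. lam n < 1" by (rule order_tendstoD(2)[OF lam(2)]) simp
  have b2: "(b n)\<^sup>2 = lam n powr (1 / real m)" for n
    using m lam(1)[of n] by (simp add: b power2_eq_square powr_add[symmetric])
  have "filterlim (\<lambda>n. real n * (b n)\<^sup>2) at_top sequentially"
  proof (rule filterlim_at_top_mono[OF rate])
    have "1 / (4 * (real m)\<^sup>2) \<le> 1 / (2 * real m)"
    proof (rule divide_left_mono)
      have "real m * 1 \<le> real m * real m" using m by (intro mult_left_mono) auto
      then show "2 * real m \<le> 4 * (real m)\<^sup>2" by (simp add: power2_eq_square)
    qed (use m in auto)
    moreover have "3 / (2 * real m) = 1 / real m + 1 / (2 * real m)" using m by (simp add: field_simps)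
    ultimately have e: "1 / real m \<le> 3 / (2 * real m) - 1 / (4 * (real m)\<^sup>2)" by linarith
    show "\<forall>\<^sub>F n in sequentially. real n * lam n powr (3 / (2 * real m) - 1 / (4 * (real m)\<^sup>2)) \<le> real n * (b n)\<^sup>2"
      using lam1
    proof eventually_elim
      case (elim n)
      show ?case unfolding b2 using e elim lam(1)[of n] by (intro mult_left_mono powr_mono') auto
    qed
  qed
  then have inv: "(\<lambda>n. inverse (real n * (b n)\<^sup>2)) \<longlonglongrightarrow> 0" by (rule tendsto_inverse_0_at_top)
  have lim: "(\<lambda>n. lam n + inverse (real n * (b n)\<^sup>2)) \<longlonglongrightarrow> 0" using tendsto_add[OF lam(2) inv] by simp
  show "(\<lambda>n. ((lam n)\<^sup>2 + inverse (real n * b n)) / b n) \<longlonglongrightarrow> 0"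
  proof (rule tendsto_sandwich[OF _ _ tendsto_const lim])
    show "\<forall>\<^sub>F n in sequentially. 0 \<le> ((lam n)\<^sup>2 + inverse (real n * b n)) / b n"
      using b0 by (intro always_eventually allI) (simp add: less_imp_le)
    show "\<forall>\<^sub>F n in sequentially. ((lam n)\<^sup>2 + inverse (real n * b n)) / b n \<le> lam n + inverse (real n * (b n)\<^sup>2)"
      using bh
    proof eventually_elim
      case (elim n)
      have "b n ^ (2 * m) \<le> b n ^ 1" using elim b0[of n] m by (intro power_decreasing) auto
      then have "lam n / b n \<le> 1" using b0[of n] by (simp add: bm)
      then have "lam n * (lam n / b n) \<le> lam n * 1" using lam(1)[of n] by (intro mult_left_mono) auto
      then show ?case by (simp add: power2_eq_square divide_inverse mult.assoc distrib_right)
    qed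
  qed
qed

text \<open>With q = sqrt (x b) the ratio equals 2 K / (c r q), and the assumption on
  \<open>r\<close> says r q >= D. A large \<open>D\<close> thus makes the tail small uniformly in
  the sample size.\<close>

lemma tail_ratio_le:
  fixes x b r D c K :: real
  assumes "x > 0" "b > 0" "D > 0" "c > 0" "K \<ge> 0" and r: "r \<ge> D / sqrt (x * b)"
  shows "r * sqrt (x / b) * K / (x * c * r\<^sup>2 / 2) \<le> 2 * K / (c * D)"
proof -
  define q where "q = sqrt (x * b)"
  have q: "q > 0" "q\<^sup>2 = x * b" using assms by (auto simp: q_def)
  have r0: "r > 0" 
  proof -
    have "D / sqrt (x * b) > 0" using assms by simp
    with r show ?thesis by linarith
  qed
  have "sqrt (x / b) = x / q"
  proof (rule real_sqrt_unique)
    show "(x / q)\<^sup>2 = x / b" using assms by (simp add: power_divide q) (simp add: power2_eq_square)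
  qed (use assms q in simp)
  then have "r * sqrt (x / b) * K / (x * c * r\<^sup>2 / 2) = 2 * K / (c * (r * q))"
    using assms r0 q(1) by (simp add: field_simps power2_eq_square)
  also have "\<dots> \<le> 2 * K / (c * D)"
  proof (rule divide_left_mono)
    have "D \<le> r * q" using r q(1) by (simp add: q_def[symmetric] pos_divide_le_eq)
    then show "c * D \<le> c * (r * q)" using assms by simp
  qed (use assms r0 q in auto)
  finally show ?thesis .
qed

text \<open>Outside the event of the tail bound at level \<open>s\<close> the deterministic
  deviation bound applies to every sample. So the failures lie in the preimage of that event, whose
  probability is computed under the product law.\<close>

lemma spline_deviation_prob:
  fixes \<rho> :: "real \<Rightarrow> real" and t :: "nat \<Rightarrow> real" and \<epsilon> y :: "'a \<Rightarrow> nat \<Rightarrow> real"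
  assumes M: "prob_space M" and lip: "lip_process N (\<lambda>e u. \<rho> (e - u) - \<rho> e) L \<delta> \<Lambda>"
    and sample: "\<epsilon> \<in> M \<rightarrow>\<^sub>M PiM {1..n} (\<lambda>_. N)" "distr M (PiM {1..n} (\<lambda>_. N)) \<epsilon> = PiM {1..n} (\<lambda>_. N)"
    and m: "m \<ge> 1" and n: "n \<ge> 1" and C: "C \<ge> 1" "\<And>F b. F \<in> sobolev2 m \<Longrightarrow> 0 < b \<Longrightarrow> b \<le> 1/2 \<Longrightarrow>
     b\<^sup>2 * inner2 (nderiv 1 F) (nderiv 1 F) \<le> C * (inner2 F F + b ^ (2 * m) * inner2 (nderiv m F) (nderiv m F))"
    and b: "0 < b" "b \<le> 1/2" "b ^ (2 * m) = lam" and t: "\<And>i. i \<in> {1..n} \<Longrightarrow> t i \<in> {0..1}"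
    and \<rho>: "continuous_on UNIV \<rho>" "convex_on UNIV \<rho>"
    and y: "\<And>\<omega> i. \<omega> \<in> space M \<Longrightarrow> i \<in> {1..n} \<Longrightarrow> y \<omega> i = fo (t i) + \<epsilon> \<omega> i"
    and design: "\<And>f. f \<in> sobolev11 \<Longrightarrow> \<bar>1 / real n * (\<Sum>i=1..n. f (t i)) - (LINT x:{0..1}|lebesgue. f x)\<bar>
                 \<le> M3 / real n * (LINT x:{0..1}|lebesgue. \<bar>nderiv 1 f x\<bar>)"
    and fo: "fo \<in> sobolev2 (2 * m)" "\<And>s. m \<le> s \<Longrightarrow> s \<le> 2 * m - 1 \<Longrightarrow> nderiv s fo 0 = 0 \<and> nderiv s fo 1 = 0"
    and mu: "\<And>u. \<bar>u\<bar> \<le> \<delta> \<Longrightarrow> c0 * u\<^sup>2 \<le> (\<integral>e. \<rho> (e - u) - \<rho> e \<partial>N)" and c0: "c0 > 0"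
    and r: "r > 0" "2 * (1 + C) * r\<^sup>2 / b \<le> \<delta>\<^sup>2" "\<delta> \<ge> 0"
    and c1: "c1 = min c0 1"
    and small: "c0 * (\<bar>M3\<bar> * (1 + C) / (real n * b)) \<le> c1 / 8"
      "2 * lam * sqrt (inner2 (nderiv (2 * m) fo) (nderiv (2 * m) fo)) \<le> c1 * r / 8"
    and spline: "\<And>\<omega>. \<omega> \<in> space M \<Longrightarrow> m_smoothing_spline m n lam \<rho> t (y \<omega>) (fhat \<omega>)"
  shows "measure M {\<omega> \<in> space M. sob_inner m lam (\<lambda>x. fhat \<omega> x - fo x) (\<lambda>x. fhat \<omega> x - fo x) > r\<^sup>2}
     \<le> r * sqrt (real n / b) * ((1 + C) / 2 + \<Lambda>) / (real n * c1 * r\<^sup>2 / 2)"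
proof -
  interpret prob_space M by fact
  interpret L: lip_process N "\<lambda>e u. \<rho> (e - u) - \<rho> e" L \<delta> \<Lambda> by fact
  define s where "s = real n * c1 * r\<^sup>2 / 2"
  have c1p: "c1 > 0" using c0 c1 by simp
  have s: "s > 0" using n c1p r(1) by (simp add: s_def)
  have cont: "continuous_on UNIV (\<lambda>e. \<rho> (e - u) - \<rho> e)" for u
  proof -
    have "continuous_on UNIV (\<lambda>e. \<rho> (e - u))"
      by (rule continuous_on_compose2[OF \<rho>(1)]) (auto intro!: continuous_intros)
    then show ?thesis using \<rho>(1) by (rule continuous_on_diff)
  qed
  define A where "A = {x \<in> space (PiM {1..n} (\<lambda>_. N)). \<exists>h\<in>sobolev2 m. sob_inner m lam h h \<le> r\<^sup>2 \<and>
      (\<Sum>i=1..n. L.mu (h (t i)) - (\<rho> (x i - h (t i)) - \<rho> (x i))) > s}"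
  have A: "A \<in> sets (PiM {1..n} (\<lambda>_. N))"
    "emeasure (PiM {1..n} (\<lambda>_. N)) A \<le> ennreal (r * sqrt (real n / b) * ((1 + C) / 2 + \<Lambda>) / s)"
    unfolding A_def by (rule L.sobolev_tail_bound[OF m n C b t cont r s]; assumption)+
  have pre: "\<epsilon> -` A \<inter> space M \<in> sets M" by (rule measurable_sets[OF sample(1) A(1)])
  have sub: "{\<omega> \<in> space M. sob_inner m lam (\<lambda>x. fhat \<omega> x - fo x) (\<lambda>x. fhat \<omega> x - fo x) > r\<^sup>2} \<subseteq> \<epsilon> -` A \<inter> space M"
  proof (rule subsetI)
    fix \<omega> assume "\<omega> \<in> {\<omega> \<in> space M. sob_inner m lam (\<lambda>x. fhat \<omega> x - fo x) (\<lambda>x. fhat \<omega> x - fo x) > r\<^sup>2}"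
    then have \<omega>: "\<omega> \<in> space M" and big: "\<not> sob_inner m lam (\<lambda>x. fhat \<omega> x - fo x) (\<lambda>x. fhat \<omega> x - fo x) \<le> r\<^sup>2" by auto
    have "\<epsilon> \<omega> \<in> A"
    proof (rule ccontr)
      assume nA: "\<epsilon> \<omega> \<notin> A"
      have ev: "(\<Sum>i=1..n. L.mu (h (t i)) - (\<rho> (\<epsilon> \<omega> i - h (t i)) - \<rho> (\<epsilon> \<omega> i))) \<le> real n * c1 * r\<^sup>2 / 2"
        if "h \<in> sobolev2 m" "sob_inner m lam h h \<le> r\<^sup>2" for h
      proof (rule ccontr)
        assume "\<not> (\<Sum>i=1..n. L.mu (h (t i)) - (\<rho> (\<epsilon> \<omega> i - h (t i)) - \<rho> (\<epsilon> \<omega> i))) \<le> real n * c1 * r\<^sup>2 / 2"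
        then have "(\<Sum>i=1..n. L.mu (h (t i)) - (\<rho> (\<epsilon> \<omega> i - h (t i)) - \<rho> (\<epsilon> \<omega> i))) > s" unfolding s_def by (rule not_le_imp_less)
        then have "\<epsilon> \<omega> \<in> A" unfolding A_def
          by (intro CollectI conjI bexI[of _ h] measurable_space[OF sample(1) \<omega>] that)
        with nA show False ..
      qed
      have mu': "c0 * u\<^sup>2 \<le> L.mu u" if "\<bar>u\<bar> \<le> \<delta>" for u using mu[OF that] by (simp add: L.mu_def)
      have "sob_inner m lam (\<lambda>x. fhat \<omega> x - fo x) (\<lambda>x. fhat \<omega> x - fo x) \<le> r\<^sup>2"
        by (rule spline_deviation_bound[OF m n C b t \<rho>(2) y[OF \<omega>] design fo mu' c0 r c1 small ev spline[OF \<omega>]])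
      with big show False by simp
    qed
    with \<omega> show "\<omega> \<in> \<epsilon> -` A \<inter> space M" by simp
  qed
  have "measure M {\<omega> \<in> space M. sob_inner m lam (\<lambda>x. fhat \<omega> x - fo x) (\<lambda>x. fhat \<omega> x - fo x) > r\<^sup>2} \<le> measure M (\<epsilon> -` A \<inter> space M)"
    by (rule finite_measure_mono[OF sub pre])
  also have "\<dots> = measure (PiM {1..n} (\<lambda>_. N)) A"
    using measure_distr[OF sample(1) A(1)] unfolding sample(2) by simp
  also have "\<dots> \<le> r * sqrt (real n / b) * ((1 + C) / 2 + \<Lambda>) / s"
    unfolding measure_def
  proof (rule enn2real_leI[OF _ A(2)])
    show "0 \<le> r * sqrt (real n / b) * ((1 + C) / 2 + \<Lambda>) / s"
      using r(1) b(1) C(1) s L.\<Lambda>_nonneg by (intro divide_nonneg_nonneg mult_nonneg_nonneg) auto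
  qed
  finally show ?thesis by (simp only: s_def)
qed

theorem corollary2:
  fixes M :: "'a measure"
    and m :: nat
    and \<epsilon> :: "nat \<Rightarrow> 'a \<Rightarrow> real"
    and t :: "nat \<Rightarrow> nat \<Rightarrow> real"
    and Y :: "nat \<Rightarrow> nat \<Rightarrow> 'a \<Rightarrow> real"
    and f\<^sub>o \<rho> \<psi> :: "real \<Rightarrow> real"
    and lam :: "nat \<Rightarrow> real"
    and \<tau> :: real
  assumes m: "m \<ge> 1"
    and prob: "prob_space M"
    and indep: "prob_space.indep_vars M (\<lambda>_. borel) \<epsilon> {1..}"
    and ident: "\<And>i. i \<ge> 1 \<Longrightarrow> distr M borel (\<epsilon> i) = distr M borel (\<epsilon> 1)"
    and design: "\<And>n i. i \<in> {1..n} \<Longrightarrow> t n i \<in> {0..1}"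
    and model: "\<And>n i \<omega>. i \<in> {1..n} \<Longrightarrow> \<omega> \<in> space M \<Longrightarrow> Y n i \<omega> = f\<^sub>o (t n i) + \<epsilon> i \<omega>"
    and rho_nonneg: "\<And>x. \<rho> x \<ge> 0"
    and rho_zero: "\<rho> 0 = 0"
    and A1_ac: "\<And>a b. abs_cont_on {a..b} \<rho>"
    and A1_convex: "convex_on UNIV \<rho>"
    and A1_subgradient: "\<And>x y. \<rho> y \<ge> \<rho> x + \<psi> x * (y - x)"
    and A2: "\<exists>\<kappa>>0. \<exists>M\<^sub>1::real. \<forall>x y. \<bar>y\<bar> < \<kappa> \<longrightarrow> \<bar>\<psi> (x + y) - \<psi> x\<bar> \<le> M\<^sub>1"
    and A3: "\<exists>M\<^sub>2::real. \<forall>\<^sub>F h in at_right 0.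
               (SUP s\<in>{-h..h}. \<integral>\<^sup>+\<omega>. ennreal (\<bar>\<psi> (\<epsilon> 1 \<omega> + s) - \<psi> (\<epsilon> 1 \<omega>)\<bar>\<^sup>2) \<partial>M)
                 \<le> ennreal (M\<^sub>2 * \<bar>h\<bar>)"
    and A4_moment: "(\<integral>\<^sup>+\<omega>. ennreal (\<bar>\<psi> (\<epsilon> 1 \<omega>)\<bar>\<^sup>2) \<partial>M) \<le> ennreal (\<tau>\<^sup>2)"
    and A4_mean: "(LINT \<omega>|M. \<psi> (\<epsilon> 1 \<omega>)) = 0"
    and A4_expansion: "\<exists>\<xi>>0. (\<lambda>s. (LINT \<omega>|M. \<psi> (\<epsilon> 1 \<omega> + s)) - \<xi> * s) \<in> o[at 0](\<lambda>s. s)"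
    and A5: "\<exists>M\<^sub>3::real. \<forall>n\<ge>2. \<forall>f\<in>sobolev11.
               \<bar>1 / real n * (\<Sum>i=1..n. f (t n i)) - (LINT x:{0..1}|lebesgue. f x)\<bar>
                 \<le> M\<^sub>3 / real n * (LINT x:{0..1}|lebesgue. \<bar>nderiv 1 f x\<bar>)"
    and lam_pos: "\<And>n. lam n > 0"
    and lam_tendsto: "lam \<longlonglongrightarrow> 0"
    and lam_rate: "filterlim (\<lambda>n. real n * lam n powr (3 / (2 * real m) - 1 / (4 * (real m)\<^sup>2)))
                     at_top sequentially"
    and fo_smooth: "f\<^sub>o \<in> sobolev2 (2 * m)"
    and fo_boundary: "\<And>s. m \<le> s \<Longrightarrow> s \<le> 2 * m - 1 \<Longrightarrow> nderiv s f\<^sub>o 0 = 0 \<and> nderiv s f\<^sub>o 1 = 0"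
  shows "\<exists>fhat :: nat \<Rightarrow> 'a \<Rightarrow> real \<Rightarrow> real.
           (\<forall>n\<ge>1. \<forall>\<omega>\<in>space M.
              m_smoothing_spline m n (lam n) \<rho> (t n) (\<lambda>i. Y n i \<omega>) (fhat n \<omega>)) \<and>
           big_O_prob M (\<lambda>n \<omega>. (sob_norm m (lam n) (\<lambda>x. fhat n \<omega> x - f\<^sub>o x))\<^sup>2)
             (\<lambda>n. (lam n)\<^sup>2 + inverse (real n * lam n powr (1 / (2 * real m))))"
proof -
  interpret prob_space M by (rule prob)
  define N where "N = distr M borel (\<epsilon> 1)"
  have rv: "random_variable borel (\<epsilon> i)" if "i \<ge> 1" for i
    using indep that unfolding indep_vars_def by auto
  have rv1: "\<epsilon> 1 \<in> borel_measurable M" by (rule rv) simp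
  have N: "prob_space N" "sets N = sets borel" unfolding N_def by (rule prob_space_distr[OF rv1]) simp
  have \<rho>c: "continuous_on UNIV \<rho>" by (rule abs_cont_on_all_imp_continuous) (rule A1_ac)
  have \<psi>m [measurable]: "\<psi> \<in> borel_measurable borel"
    by (rule borel_measurable_mono[OF subgradient_mono[OF A1_subgradient]])
  obtain \<kappa> M\<^sub>1 where \<kappa>: "\<kappa> > 0" "\<And>x y. \<bar>y\<bar> < \<kappa> \<Longrightarrow> \<bar>\<psi> (x + y) - \<psi> x\<bar> \<le> M\<^sub>1" using A2 by blast
  obtain \<xi> where \<xi>: "\<xi> > 0" "(\<lambda>s. (LINT \<omega>|M. \<psi> (\<epsilon> 1 \<omega> + s)) - \<xi> * s) \<in> o[at 0](\<lambda>s. s)"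
    using A4_expansion by blast
  obtain M\<^sub>3 where M3: "\<And>n f. n \<ge> 2 \<Longrightarrow> f \<in> sobolev11 \<Longrightarrow>
      \<bar>1 / real n * (\<Sum>i=1..n. f (t n i)) - (LINT x:{0..1}|lebesgue. f x)\<bar>
        \<le> M\<^sub>3 / real n * (LINT x:{0..1}|lebesgue. \<bar>nderiv 1 f x\<bar>)" using A5 by blast
  have moment: "(\<integral>\<^sup>+e. ennreal (\<bar>\<psi> e\<bar>\<^sup>2) \<partial>N) \<le> ennreal (\<tau>\<^sup>2)"
    using A4_moment unfolding N_def by (subst nn_integral_distr[OF rv1]) auto
  have mean: "(\<integral>e. \<psi> e \<partial>N) = 0"
    using A4_mean unfolding N_def by (subst integral_distr[OF rv1]) auto
  have shift: "(\<integral>e. \<psi> (e + s) \<partial>N) = (LINT \<omega>|M. \<psi> (\<epsilon> 1 \<omega> + s))" for s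
    unfolding N_def by (subst integral_distr[OF rv1]) auto
  have \<xi>N: "(\<lambda>s. (\<integral>e. \<psi> (e + s) \<partial>N) - \<xi> * s) \<in> o[at 0](\<lambda>s. s)" unfolding shift by (rule \<xi>(2))
  obtain \<delta> where \<delta>: "\<delta> > 0"
    and lip: "lip_process N (\<lambda>e u. \<rho> (e - u) - \<rho> e) (\<lambda>e. \<bar>\<psi> e\<bar> + M\<^sub>1) \<delta> (8 * \<tau>\<^sup>2 + 8 * M\<^sub>1\<^sup>2)"
    and mu: "\<And>u. \<bar>u\<bar> \<le> \<delta> \<Longrightarrow> \<xi> / 8 * u\<^sup>2 \<le> (\<integral>e. \<rho> (e - u) - \<rho> e \<partial>N)"
    using convex_loss_lip_process[OF N \<rho>c A1_subgradient \<kappa> moment mean \<xi>(1) \<xi>N] by blast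
  obtain x1 x2 where "\<psi> x1 > 0" "\<psi> x2 < 0" using expansion_sign_change[OF \<xi>(1) \<xi>N] by blast
  then obtain a c where ac: "a > 0" "\<And>x. \<rho> x \<ge> a * \<bar>x\<bar> - c"
    using subgradient_coercive[OF A1_subgradient] by blast
  obtain C where C: "C \<ge> 1" "\<And>F b. F \<in> sobolev2 m \<Longrightarrow> 0 < b \<Longrightarrow> b \<le> 1/2 \<Longrightarrow>
     b\<^sup>2 * inner2 (nderiv 1 F) (nderiv 1 F) \<le> C * (inner2 F F + b ^ (2 * m) * inner2 (nderiv m F) (nderiv m F))"
    using interpolation_inequality[OF m] by blast
  have foH: "f\<^sub>o \<in> sobolev2 m" by (rule sobolev2_mono[OF fo_smooth _ m]) simp

  define good where "good n fh \<longleftrightarrow> (\<forall>y. m_smoothing_spline m n (lam n) \<rho> (t n) y (fh y)) \<and>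
      (\<lambda>y. sob_inner m (lam n) (\<lambda>x. fh y x - f\<^sub>o x) (\<lambda>x. fh y x - f\<^sub>o x)) \<in> borel_measurable borel" for n fh
  have ex: "\<exists>fh. good n fh" if n1: "n \<ge> 1" for n
  proof (rule spline_selection[where n = n and lam = "lam n" and t = "t n",
        OF m n1 lam_pos design \<rho>c rho_nonneg ac foH])
    fix i assume "i \<in> {1..n}" then show "i \<in> {1..n}" .
  next
    fix fh assume "\<And>y. m_smoothing_spline m n (lam n) \<rho> (t n) y (fh y)"
      "(\<lambda>y. sob_inner m (lam n) (\<lambda>x. fh y x - f\<^sub>o x) (\<lambda>x. fh y x - f\<^sub>o x)) \<in> borel_measurable borel"
    then have "good n fh" by (simp add: good_def)
    then show "\<exists>fh. good n fh" by (rule exI[of "good n"])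
  qed
  define fh where "fh n = (SOME f. good n f)" for n
  have good: "good n (fh n)" if "n \<ge> 1" for n unfolding fh_def by (rule someI_ex[OF ex[OF that]])
  have fh: "m_smoothing_spline m n (lam n) \<rho> (t n) y (fh n y)" if "n \<ge> 1" for n y
    using good[OF that] by (simp add: good_def)
  have fhm: "(\<lambda>y. sob_inner m (lam n) (\<lambda>x. fh n y x - f\<^sub>o x) (\<lambda>x. fh n y x - f\<^sub>o x)) \<in> borel_measurable borel" if "n \<ge> 1" for n
    using good[OF that] by (simp add: good_def)
  \<comment> \<open>The value 0 outside \<open>{1..n}\<close> makes every coordinate measurable; the
    objective reads only the indices from 1 to \<open>n\<close>.\<close>
  define y where "y n \<omega> i = (if i \<in> {1..n} then f\<^sub>o (t n i) + \<epsilon> i \<omega> else 0)" for n \<omega> i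
  \<comment> \<open>\<open>big_O_prob\<close> demands measurability for every \<open>n\<close>,
    including 0, where there are no observations; the default \<open>f\<^sub>o\<close> makes the
    error constant there.\<close>
  define fhat where "fhat n \<omega> = (if n = 0 then f\<^sub>o else fh n (y n \<omega>))" for n \<omega>
  define X where "X n \<omega> = sob_inner m (lam n) (\<lambda>x. fhat n \<omega> x - f\<^sub>o x) (\<lambda>x. fhat n \<omega> x - f\<^sub>o x)" for n \<omega>
  have X0: "X n \<omega> \<ge> 0" for n \<omega> unfolding X_def by (rule sob_inner_self_nonneg) (simp add: lam_pos less_imp_le)
  have norm_X: "(sob_norm m (lam n) (\<lambda>x. fhat n \<omega> x - f\<^sub>o x))\<^sup>2 = X n \<omega>" for n \<omega>
    using X0[of n \<omega>] by (simp add: sob_norm_def X_def)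
  have spl: "m_smoothing_spline m n (lam n) \<rho> (t n) (y n \<omega>) (fhat n \<omega>)" if "n \<ge> 1" for n \<omega>
    using fh[OF that] that by (simp add: fhat_def)
  have spline: "m_smoothing_spline m n (lam n) \<rho> (t n) (\<lambda>i. Y n i \<omega>) (fhat n \<omega>)" if "n \<ge> 1" "\<omega> \<in> space M" for n \<omega>
  proof -
    have "spline_objective m n (lam n) \<rho> (t n) (\<lambda>i. Y n i \<omega>) = spline_objective m n (lam n) \<rho> (t n) (y n \<omega>)"
      unfolding spline_objective_def fun_eq_iff
      by (intro allI arg_cong2[of _ _ _ _ "(+)"] arg_cong2[of _ _ _ _ "(*)"] sum.cong refl) (simp add: model[OF _ that(2)] y_def)
    then show ?thesis using spl[OF that(1)] by (simp add: m_smoothing_spline_def)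
  qed
  have meas: "X n \<in> borel_measurable M" for n
  proof (cases "n = 0")
    case True
    then show ?thesis by (simp add: X_def[abs_def] fhat_def)
  next
    case False
    have yn: "(\<lambda>\<omega>. y n \<omega>) \<in> borel_measurable M"
    proof (rule measurable_coordinatewise_then_product)
      fix i show "(\<lambda>\<omega>. y n \<omega> i) \<in> borel_measurable M"
      proof (cases "i \<in> {1..n}")
        case True
        then show ?thesis using borel_measurable_add[OF borel_measurable_const rv[of i]] by (simp add: y_def)
      qed (auto simp: y_def)
    qed
    have "(\<lambda>\<omega>. sob_inner m (lam n) (\<lambda>x. fh n (y n \<omega>) x - f\<^sub>o x) (\<lambda>x. fh n (y n \<omega>) x - f\<^sub>o x)) \<in> borel_measurable M"
      by (rule measurable_compose[OF yn fhm]) (use False in simp)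
    then show ?thesis using False by (simp add: X_def[abs_def] fhat_def)
  qed

  define b where "b n = lam n powr (1 / (2 * real m))" for n
  note rate = smoothing_rate[OF m lam_pos lam_tendsto lam_rate b_def]
  define q where "q n = (lam n)\<^sup>2 + inverse (real n * b n)" for n
  have qb: "(\<lambda>n. q n / b n) \<longlonglongrightarrow> 0" using rate(4) by (simp add: q_def)
  define c1 where "c1 = min (\<xi> / 8) 1"
  have c1: "c1 > 0" using \<xi>(1) by (simp add: c1_def)
  define A where "A = sqrt (inner2 (nderiv (2 * m) f\<^sub>o) (nderiv (2 * m) f\<^sub>o))"
  have A: "A \<ge> 0" by (simp add: A_def inner2_self_nonneg)
  define K where "K = (1 + C) / 2 + (8 * \<tau>\<^sup>2 + 8 * M\<^sub>1\<^sup>2)"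
  have K: "K > 0" using C(1) by (simp add: K_def add_pos_nonneg)

  have tail: "\<exists>D>0. \<forall>\<^sub>F n in sequentially. measure M {\<omega> \<in> space M. \<bar>X n \<omega>\<bar> > D * \<bar>q n\<bar>} < \<eta>" if \<eta>: "\<eta> > 0" for \<eta>
  proof -
    \<comment> \<open>The first term gives \<open>2 * lam n * A \<le> c1 * r / 8\<close> through
      \<open>r \<ge> D * lam n\<close>; the second makes the tail bound
      \<open>2 * K / (c1 * D)\<close> at most half of \<open>\<eta>\<close>.\<close>
    define D where "D = 16 * A / c1 + 4 * K / (c1 * \<eta>)"
    have t1: "16 * A / c1 \<ge> 0" using A c1 by simp
    have t2: "4 * K / (c1 * \<eta>) > 0" using K c1 \<eta> by simp
    have D: "D > 0" "16 * A / c1 \<le> D" "4 * K / (c1 * \<eta>) \<le> D" using t1 t2 unfolding D_def by linarith+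
    have D16: "16 * A \<le> c1 * D" using D(2) c1 by (simp add: pos_divide_le_eq mult.commute)
    have "4 * K \<le> D * (c1 * \<eta>)" using D(3) c1 \<eta> by (simp add: pos_divide_le_eq)
    then have "4 * K / (c1 * D) \<le> \<eta>" using c1 D(1) by (simp add: pos_divide_le_eq ac_simps)
    moreover have "2 * K / (c1 * D) < 4 * K / (c1 * D)" using K c1 D(1) by (intro divide_strict_right_mono) auto
    ultimately have K\<eta>: "2 * K / (c1 * D) < \<eta>" by linarith
    define e where "e = min (\<delta>\<^sup>2 / (2 * (1 + C) * D\<^sup>2)) (c1 / (8 * (\<xi> / 8) * ((\<bar>M\<^sub>3\<bar> + 1) * (1 + C))))"
    have e: "e > 0" using \<delta> C(1) D(1) c1 \<xi>(1) by (simp add: e_def)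
    have "\<forall>\<^sub>F n in sequentially. q n / b n < e" by (rule order_tendstoD(2)[OF qb e])
    with rate(3) eventually_ge_at_top[of 2]
    have "\<forall>\<^sub>F n in sequentially. measure M {\<omega> \<in> space M. \<bar>X n \<omega>\<bar> > D\<^sup>2 * \<bar>q n\<bar>} < \<eta>"
    proof eventually_elim
      case (elim n)
      have n1: "n \<ge> 1" using elim by simp
      have b0: "b n > 0" by (rule rate(1))
      have nb: "real n * b n > 0" using b0 n1 by simp
      have q: "q n > 0" unfolding q_def
        using lam_pos[of n] nb by (intro add_pos_pos zero_less_power positive_imp_inverse_positive)
      \<comment> \<open>Both terms of \<open>q n\<close> then bound \<open>r\<close> from below, by
        \<open>D * lam n\<close> for the bias and by \<open>D / sqrt (real n * b n)\<close> for the
        noise; the constant in the rate is \<open>D^2\<close>.\<close>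
      define r where "r = D * sqrt (q n)"
      have r: "r > 0" "r\<^sup>2 = D\<^sup>2 * q n" using D(1) q by (simp_all add: r_def power_mult_distrib)
      have r_lam: "D * lam n \<le> r" unfolding r_def
        by (intro mult_left_mono real_le_rsqrt) (use D(1) b0 in \<open>auto simp: q_def less_imp_le\<close>)
      have r_nb: "D / sqrt (real n * b n) \<le> r"
      proof -
        have "1 / sqrt (real n * b n) = sqrt (inverse (real n * b n))" by (simp only: real_sqrt_inverse[symmetric] inverse_eq_divide real_sqrt_divide real_sqrt_one)
        also have "\<dots> \<le> sqrt (q n)" by (intro real_sqrt_le_mono) (simp add: q_def)
        finally have "D * (1 / sqrt (real n * b n)) \<le> r" unfolding r_def using D(1) by (intro mult_left_mono) auto
        then show ?thesis by simp
      qed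
      have r\<delta>: "2 * (1 + C) * r\<^sup>2 / b n \<le> \<delta>\<^sup>2"
      proof -
        have P: "2 * (1 + C) * D\<^sup>2 > 0" using C(1) D(1) by simp
        have "q n / b n \<le> \<delta>\<^sup>2 / (2 * (1 + C) * D\<^sup>2)" using elim unfolding e_def by linarith
        then have "q n / b n * (2 * (1 + C) * D\<^sup>2) \<le> \<delta>\<^sup>2" by (simp only: pos_le_divide_eq[OF P])
        moreover have "2 * (1 + C) * r\<^sup>2 / b n = q n / b n * (2 * (1 + C) * D\<^sup>2)" by (simp add: r(2))
        ultimately show ?thesis by (simp only:)
      qed
      have small1: "\<xi> / 8 * (\<bar>M\<^sub>3\<bar> * (1 + C) / (real n * b n)) \<le> c1 / 8"
      proof -
        have P: "8 * (\<xi> / 8) * ((\<bar>M\<^sub>3\<bar> + 1) * (1 + C)) > 0" using C(1) \<xi>(1) by (intro mult_pos_pos) auto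
        have "inverse (real n * b n) \<le> q n" by (simp add: q_def)
        also have "\<dots> \<le> q n / b n" using q b0 elim by (simp add: pos_le_divide_eq mult_left_le)
        also have "\<dots> \<le> c1 / (8 * (\<xi> / 8) * ((\<bar>M\<^sub>3\<bar> + 1) * (1 + C)))" using elim unfolding e_def by linarith
        finally have i: "inverse (real n * b n) * (8 * (\<xi> / 8) * ((\<bar>M\<^sub>3\<bar> + 1) * (1 + C))) \<le> c1" by (simp only: pos_le_divide_eq[OF P])
        have "\<xi> / 8 * (\<bar>M\<^sub>3\<bar> * (1 + C) / (real n * b n)) = (\<xi> / 8 * inverse (real n * b n)) * (\<bar>M\<^sub>3\<bar> * (1 + C))"
          by (simp only: divide_inverse ac_simps)
        also have "\<dots> \<le> (\<xi> / 8 * inverse (real n * b n)) * ((\<bar>M\<^sub>3\<bar> + 1) * (1 + C))"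
        proof (rule mult_left_mono)
          show "\<bar>M\<^sub>3\<bar> * (1 + C) \<le> (\<bar>M\<^sub>3\<bar> + 1) * (1 + C)" using C(1) by (intro mult_right_mono) auto
          show "0 \<le> \<xi> / 8 * inverse (real n * b n)"
            using \<xi>(1) positive_imp_inverse_positive[OF nb] by (intro mult_nonneg_nonneg) linarith+
        qed
        also have "\<dots> = inverse (real n * b n) * (8 * (\<xi> / 8) * ((\<bar>M\<^sub>3\<bar> + 1) * (1 + C))) / 8"
          by (simp only: times_divide_eq_left times_divide_eq_right ac_simps)
        also have "\<dots> \<le> c1 / 8" using i by (rule divide_right_mono) simp
        finally show ?thesis .
      qed
      have small2: "2 * lam n * A \<le> c1 * r / 8"
      proof -
        have "lam n * (16 * A) \<le> lam n * (c1 * D)" using D16 lam_pos[of n] by (intro mult_left_mono) auto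
        moreover have "c1 * (D * lam n) \<le> c1 * r" using r_lam c1 by (intro mult_left_mono) auto
        ultimately show ?thesis by (simp add: ac_simps)
      qed
      have ident': "distr M borel (\<epsilon> i) = N" if "i \<ge> 1" for i using ident[OF that] by (simp add: N_def)
      have y': "y n \<omega> i = f\<^sub>o (t n i) + (\<lambda>i\<in>{1..n}. \<epsilon> i \<omega>) i" if "\<omega> \<in> space M" "i \<in> {1..n}" for \<omega> i
        using that(2) by (simp add: y_def)
      have "measure M {\<omega> \<in> space M. X n \<omega> > r\<^sup>2} \<le> r * sqrt (real n / b n) * K / (real n * c1 * r\<^sup>2 / 2)"
        unfolding X_def K_def
        by (rule spline_deviation_prob[OF prob lip distr_iid_sample[OF prob indep ident' n1] m n1 C
              b0 elim(1) rate(2) design \<rho>c A1_convex y' M3[OF elim(2)] fo_smooth fo_boundary mu _ r(1) r\<delta>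
              less_imp_le[OF \<delta>] c1_def small1 small2[unfolded A_def] spl[OF n1]]) (use \<xi>(1) in auto)
      also have "\<dots> \<le> 2 * K / (c1 * D)"
        by (rule tail_ratio_le) (use n1 b0 D(1) c1 K r_nb in auto)
      also have "\<dots> < \<eta>" by (rule K\<eta>)
      finally show ?case using X0[of n] q by (simp add: r(2))
    qed
    then show ?thesis using D(1) by (intro exI[of _ "D\<^sup>2"]) simp
  qed
  have "big_O_prob M (\<lambda>n \<omega>. (sob_norm m (lam n) (\<lambda>x. fhat n \<omega> x - f\<^sub>o x))\<^sup>2)
      (\<lambda>n. (lam n)\<^sup>2 + inverse (real n * lam n powr (1 / (2 * real m))))"
    using meas tail unfolding big_O_prob_def norm_X q_def b_def by simp
  with spline show ?thesis by blast
qed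

end
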